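(* Let $X\in\mathbb R^{n\times p}$, $\beta_0\in\mathbb R^p$, $\mu_0=X\beta_0$, $\sigma>0$, let $h:\mathbb R^n\to\mathbb R^n$ be smooth and Lipschitz continuous, and let $Y\sim\mathcal N(h(\mu_0),\sigma^2\mathrm{Id}_n)$. Let $J:\mathbb R^p\to\mathbb R\cup\{+\infty\}$ be proper, lower semicontinuous, convex and partly smooth with a finite set $\mathscr M$ of partial smoothness manifolds, let $F(\beta,y)=F_0(X\beta,y)$ with $F_0(\cdot,y)$ convex for every $y$, and let $\hat\mu(y)=X\hat\beta(y)$, where $\hat\beta(y)$ is any solution of $(P(y)):\ \min_{\beta\in\mathbb R^p}F_0(X\beta,y)+J(\beta)$. Let the conditions $(C_{\mathcal O})$, $(C_{\mathrm{sconv}})$, $(C_L)$, $(C_F)$, the sets $\mathcal H$, $\mathcal G$ and the matrix $\Delta$ be as in the context. Then: (i) Under $(C_{\mathcal O})$, $\mathcal H$ is of Lebesgue measure zero. (ii) Under $(C_{\mathrm{sconv}})$ and $(C_L)$, $h\circ\hat\mu$ is Lipschitz continuous, hence weakly differentiable, with an essentially bounded gradient. (iii) If $(C_{\mathcal O})$, $(C_{\mathrm{sconv}})$, $(C_F)$ and $(C_L)$ hold, and $\mathcal G$ is of zero Lebesgue measure, then: (a) $\widehat{\mathrm{df}}=\mathrm{tr}\big(\mathrm Dh(\hat\mu(Y))\,\Delta(Y)\big)$ is an unbiased estimate of $\mathrm{df}=\mathbb E\big(\mathrm{div}(h\circ\hat\mu)(Y)\big)$; (b) $$\mathrm{SURE}(h\circ\hat\mu)(Y)=\|Y-h(\hat\mu(Y))\|^2+2\sigma^2\,\widehat{\mathrm{df}}-n\sigma^2$$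 is an unbiased estimator of the risk $\mathbb E\big(\|h(\hat\mu(Y))-h(\mu_0)\|^2\big)$.
   Context: Notation. $\nabla F,\nabla F_0,\nabla^2F,\nabla^2F_0$ are derivatives in the first variable; $\mathrm D(\nabla F_0)(\mu,y)$ is the Jacobian of $\nabla F_0(\mu,\cdot)$ in the second variable at $y$. $\mathrm P_E$ is the orthogonal projector on $E$; $X_T=X\mathrm P_T$, $X_S=X\mathrm P_S$; $A^+$ is the Moore–Penrose pseudo-inverse; $\mathrm{rbd}$, $\mathrm{bd}$ denote relative boundary and boundary; $\mathrm{Lin}(C)=\mathbb R(C-C)$. For $\beta$ with $\partial J(\beta)\neq\emptyset$, $S_\beta=\mathrm{Lin}(\partial J(\beta))$, $T_\beta=S_\beta^\perp$. $\mathrm{div}(g)=\mathrm{tr}(\mathrm Dg)$, where derivatives are understood in the weak sense (identities hold Lebesgue-a.e.). Partial smoothness. $J$ is partly smooth at $\beta$ (with $\partial J(\beta)\ne\emptyset$) relative to $\mathcal M\ni\beta$ if: (1) $\mathcal M$ is a $C^2$ embedded submanifold of $\mathbb R^p$ around $\beta$ and $J|_{\mathcal M}$ is $C^2$ around $\beta$; (2) the tangent space of $\mathcal M$ at $\beta$ is $T_\beta$; (3) the set-valued map $\partial J$ is continuous at $\beta$ relative to $\mathcal M$. $\mathcal M_\beta$ denotes the partial smoothness manifold associated to $J$ at $\beta$ (one for each $\beta$, fixed once and for all). $\mathscr M=\{\mathcal M_\beta\}_{\beta\in\mathbb R^p}$ (assumed finite), and $\widetilde{\mathcal M}=\{\beta'\in\mathbb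 R^p:\mathcal M_{\beta'}=\mathcal M\}$ for $\mathcal M\in\mathscr M$. Riemannian Hessians. The Weingarten map of $\mathcal M$ at $\beta$ is $\mathfrak A_\beta(\xi,v)=-\mathrm P_{T_\beta}\mathrm DV[\xi]$ for $\xi\in T_\beta$, $v\in T_\beta^\perp$, with $V$ any local extension of $v$ to a normal vector field on $\mathcal M$. For $f$ that is $C^2$ on $\mathcal M$ near $\beta$ and $\tilde f$ any smooth ($C^2$) function on $\mathbb R^p$ agreeing with $f$ on $\mathcal M$ near $\beta$, $\nabla^2_{\mathcal M}f(\beta)\xi=\mathrm P_{T_\beta}\nabla^2\tilde f(\beta)\mathrm P_{T_\beta}\xi+\mathfrak A_\beta(\xi,\mathrm P_{T_\beta^\perp}\nabla\tilde f(\beta))$ for $\xi\in T_\beta$. $\nabla^2_{\mathcal M}F(\beta,y)$ is the Riemannian Hessian of $F(\cdot,y)$. Operators on $T_\beta$ are extended by $0$ on $T_\beta^\perp$. Condition $(\mathcal C_{\beta,y})$: $\langle(\nabla^2_{\mathcal M_\beta}F(\beta,y)+\nabla^2_{\mathcal M_\beta}J(\beta))\xi,\xi\rangle>0$ for all $0\neq\xi\in T_\beta$. Transition space: $\mathcal H=\bigcup_{\mathcal M\in\mathscr M}\mathrm{bd}(\Pi(\mathcal A_{\mathcal M}))$, $\Pi(y,\beta)=y$, $\mathcal A_{\mathcal M}=\{(y,\beta)\in\mathbb R^n\times\widetilde{\mathcal M}:-\nabla F(\beta,y)\in\mathrm{rbd}\,\partial J(\beta)\}$. Non-injectivity set: $\mathcal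 G=\{y\notin\mathcal H:(\mathcal C_{\hat\beta(y),y})$ does not hold for any minimizer $\hat\beta(y)$ of $(P(y))\}$. Matrix $\Delta$. For $y\notin\mathcal H\cup\mathcal G$, with $\hat\beta(y)$ any solution of $(P(y))$ satisfying $(\mathcal C_{\hat\beta(y),y})$, $\mathcal M=\mathcal M_{\hat\beta(y)}$, $T=S^\perp=T_{\hat\beta(y)}$: $\Delta(y)=-X_T\big(X_T^\top\nabla^2F_0(\hat\mu(y),y)X_T+\mathfrak A_{\hat\beta(y)}(\cdot,X_S^\top\nabla F_0(\hat\mu(y),y))+\nabla^2_{\mathcal M}J(\hat\beta(y))\big)^{+}X_T^\top\,\mathrm D(\nabla F_0)(\hat\mu(y),y)$. Conditions. $(C_{\mathcal O})$: there is an o-minimal structure $\mathcal O$ expanding $\mathbb R$ (containing all semi-algebraic sets) in which $F$, $J$ and every $\mathcal M\in\mathscr M$ are definable. $(C_{\mathrm{sconv}})$: for all $y\in\mathbb R^n$, $F_0(\cdot,y)$ is strongly convex with modulus $\tau$ (with $\tau>0$ independent of $y$). $(C_L)$: there is $L>0$ with $\sup_{(\mu,y)\in\mathbb R^n\times\mathbb R^n}\|\mathrm D(\nabla F_0)(\mu,y)\|\le L$. $(C_F)$: for all $y\in\mathbb R^n$, $F(\cdot,y)\in C^2(\mathbb R^p)$, and for all $\beta\in\mathbb R^p$, $F(\beta,\cdot)\in C^2(\mathbb R^n)$. When $F_0(\cdot,y)$ is strictly convex (in particular under $(C_{\mathrm{sconv}})$), all solutions of $(P(y))$ have the same image under $X$,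 so $\hat\mu$ is single-valued.
   Formalization: Condition (C_O) here also requires each set {β : M_β = M} to be definable, not only F, J and the manifolds M; with an arbitrary choice of M_β, claim (i) is false (e.g. l1 norm, choosing between two manifolds by rationality of a coordinate). *)

theory Defs
  imports "HOL-Probability.Probability"
begin

section \<open>Calculus\<close>

text \<open>Functions of class \<open>C\<^sup>k\<close> on an open set, through iterated directional derivatives.\<close>

primrec Ck_on ::
  "nat \<Rightarrow> 'a::euclidean_space set \<Rightarrow> ('a \<Rightarrow> 'b::real_normed_vector) \<Rightarrow> bool" where
  "Ck_on 0 U f = continuous_on U f"
| "Ck_on (Suc k) U f =
     ((\<forall>x\<in>U. f differentiable (at x)) \<and> (\<forall>v. Ck_on k U (\<lambda>x. frechet_derivative f (at x) v)))"

definition grad :: "('a::real_inner \<Rightarrow> real) \<Rightarrow> 'a \<Rightarrow> 'a" where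
  "grad f x = (THE D. GDERIV f x :> D)"

definition jacobian :: "(real^'m \<Rightarrow> real^'k) \<Rightarrow> real^'m \<Rightarrow> real^'m^'k" where
  "jacobian g x = matrix (frechet_derivative g (at x))"

definition dir_deriv :: "('a::real_vector \<Rightarrow> real) \<Rightarrow> 'a \<Rightarrow> 'a \<Rightarrow> real" where
  "dir_deriv f x v = deriv (\<lambda>t. f (x + t *\<^sub>R v)) 0"

text \<open>\<open>hess_form f x u v\<close> is the Hessian as a bilinear form, \<open>u \<bullet> (\<nabla>\<^sup>2f(x) v)\<close>.
  \<open>hess_pullback A f x\<close> is the matrix \<open>A\<^sup>T \<nabla>\<^sup>2f(x) A\<close>. It only differentiates \<open>f\<close> twice along the
  range of \<open>A\<close>. This matters for \<open>A = X P\<^sub>T\<close> and \<open>f = F\<^sub>0(\<cdot>,y)\<close>, since only the composition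
  \<open>F(\<cdot>,y) = F\<^sub>0(X\<cdot>,y)\<close> is required to be \<open>C\<^sup>2\<close>.\<close>

definition hess_form :: "('a::real_vector \<Rightarrow> real) \<Rightarrow> 'a \<Rightarrow> 'a \<Rightarrow> 'a \<Rightarrow> real" where
  "hess_form f x u v = dir_deriv (\<lambda>z. dir_deriv f z v) x u"

definition hess :: "(real^'m \<Rightarrow> real) \<Rightarrow> real^'m \<Rightarrow> real^'m^'m" where
  "hess f x = (\<chi> i j. hess_form f x (axis i 1) (axis j 1))"

definition hess_pullback :: "real^'k^'m \<Rightarrow> (real^'m \<Rightarrow> real) \<Rightarrow> real^'m \<Rightarrow> real^'k^'k" where
  "hess_pullback A f x = (\<chi> i j. hess_form f x (column i A) (column j A))"


section \<open>Linear algebra and convex analysis\<close>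

definition proj_mat :: "(real^'m) set \<Rightarrow> real^'m^'m" where
  "proj_mat E = matrix (closest_point E)"

text \<open>The Moore--Penrose pseudo-inverse, characterised by the four Penrose equations.\<close>

definition pinv :: "real^'m^'k \<Rightarrow> real^'k^'m" where
  "pinv A = (THE B. A ** B ** A = A \<and> B ** A ** B = B \<and>
                    transpose (A ** B) = A ** B \<and> transpose (B ** A) = B ** A)"

definition strongly_convex :: "real \<Rightarrow> ('a::real_normed_vector \<Rightarrow> real) \<Rightarrow> bool" where
  "strongly_convex \<tau> f \<longleftrightarrow>
     (\<forall>x y. \<forall>t\<in>{0..1}. f (t *\<^sub>R x + (1 - t) *\<^sub>R y)
        \<le> t * f x + (1 - t) * f y - \<tau> / 2 * t * (1 - t) * (norm (x - y))\<^sup>2)"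

definition proper_ext :: "('a \<Rightarrow> ereal) \<Rightarrow> bool" where
  "proper_ext J \<longleftrightarrow> (\<forall>x. J x \<noteq> -\<infinity>) \<and> (\<exists>x. J x \<noteq> \<infinity>)"

definition lsc_ext :: "('a::topological_space \<Rightarrow> ereal) \<Rightarrow> bool" where
  "lsc_ext J \<longleftrightarrow> (\<forall>x. J x \<le> Liminf (at x) J)"

definition convex_ext :: "('a::real_vector \<Rightarrow> ereal) \<Rightarrow> bool" where
  "convex_ext J \<longleftrightarrow> convex {(x, r::real). J x \<le> ereal r}"

definition subdiff :: "('a::real_inner \<Rightarrow> ereal) \<Rightarrow> 'a \<Rightarrow> 'a set" where
  "subdiff J x = {v. \<forall>z. J x + ereal (v \<bullet> (z - x)) \<le> J z}"

definition Lin :: "'a::real_vector set \<Rightarrow> 'a set" where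
  "Lin C = {t *\<^sub>R (a - b) | t a b. a \<in> C \<and> b \<in> C}"

definition S_sp :: "('a::real_inner \<Rightarrow> ereal) \<Rightarrow> 'a \<Rightarrow> 'a set" where
  "S_sp J \<beta> = Lin (subdiff J \<beta>)"

definition T_sp :: "('a::euclidean_space \<Rightarrow> ereal) \<Rightarrow> 'a \<Rightarrow> 'a set" where
  "T_sp J \<beta> = (S_sp J \<beta>)\<^sup>\<bottom>"


section \<open>Submanifolds and partial smoothness\<close>

definition C2_submanifold_around :: "'a::euclidean_space set \<Rightarrow> 'a \<Rightarrow> bool" where
  "C2_submanifold_around M x \<longleftrightarrow>
     (\<exists>U V \<phi> \<psi> (E :: 'a set). open U \<and> x \<in> U \<and> open V \<and> subspace E \<and>
        homeomorphism U V \<phi> \<psi> \<and> Ck_on 2 U \<phi> \<and> Ck_on 2 V \<psi> \<and> \<phi> ` (M \<inter> U) = E \<inter> V)"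

definition tangent_space :: "'a::real_normed_vector set \<Rightarrow> 'a \<Rightarrow> 'a set" where
  "tangent_space M x =
     {v. \<exists>\<gamma>. \<gamma> (0::real) = x \<and> (\<forall>\<^sub>F t in nhds 0. \<gamma> t \<in> M) \<and> (\<gamma> has_vector_derivative v) (at 0)}"

definition partly_smooth :: "('a::euclidean_space \<Rightarrow> ereal) \<Rightarrow> 'a \<Rightarrow> 'a set \<Rightarrow> bool" where
  "partly_smooth J \<beta> M \<longleftrightarrow>
     subdiff J \<beta> \<noteq> {} \<and> \<beta> \<in> M \<and>
     C2_submanifold_around M \<beta> \<and>
     (\<exists>U g. open U \<and> \<beta> \<in> U \<and> Ck_on 2 U g \<and> (\<forall>z\<in>M \<inter> U. J z = ereal (g z))) \<and>
     tangent_space M \<beta> = T_sp J \<beta> \<and>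
     \<comment> \<open>continuity of the subdifferential relative to \<open>M\<close> (Painleve--Kuratowski): outer \<dots>\<close>
     (\<forall>z v w. (\<forall>k::nat. z k \<in> M \<and> v k \<in> subdiff J (z k)) \<and> z \<longlonglongrightarrow> \<beta> \<and> v \<longlonglongrightarrow> w
          \<longrightarrow> w \<in> subdiff J \<beta>) \<and>
     \<comment> \<open>\<dots> and inner semicontinuity\<close>
     (\<forall>z. (\<forall>k::nat. z k \<in> M) \<and> z \<longlonglongrightarrow> \<beta>
          \<longrightarrow> (\<forall>w\<in>subdiff J \<beta>. \<exists>v. v \<longlonglongrightarrow> w \<and> (\<forall>\<^sub>F k in sequentially. v k \<in> subdiff J (z k))))"

definition normal_extension ::
  "'a::euclidean_space set \<Rightarrow> 'a \<Rightarrow> 'a \<Rightarrow> ('a \<Rightarrow> 'a) \<Rightarrow> bool" where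
  "normal_extension M x v V \<longleftrightarrow>
     V x = v \<and> (\<exists>U. open U \<and> x \<in> U \<and> Ck_on 1 U V \<and> (\<forall>z\<in>M \<inter> U. V z \<in> (tangent_space M z)\<^sup>\<bottom>))"

text \<open>The values of \<open>weingarten M x \<xi> v\<close> and \<open>riem_hess M f x\<close> do not depend on the
  extension that is chosen when \<open>\<xi>\<close> is tangent, \<open>v\<close> is normal and \<open>f\<close> is \<open>C\<^sup>2\<close> on \<open>M\<close> near \<open>x\<close>.
  \<open>riem_hess\<close> is the Riemannian Hessian extended by 0 on the normal space.\<close>

definition weingarten :: "(real^'p) set \<Rightarrow> real^'p \<Rightarrow> real^'p \<Rightarrow> real^'p \<Rightarrow> real^'p" where
  "weingarten M x \<xi> v =
     - (proj_mat (tangent_space M x) *v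
          frechet_derivative (SOME V. normal_extension M x v V) (at x) \<xi>)"

definition C2_extension ::
  "'a::euclidean_space set \<Rightarrow> 'a \<Rightarrow> ('a \<Rightarrow> real) \<Rightarrow> ('a \<Rightarrow> real) \<Rightarrow> bool" where
  "C2_extension M x f g \<longleftrightarrow> (\<exists>U. open U \<and> x \<in> U \<and> Ck_on 2 U g \<and> (\<forall>z\<in>M \<inter> U. g z = f z))"

definition riem_hess ::
  "(real^'p) set \<Rightarrow> (real^'p \<Rightarrow> real) \<Rightarrow> real^'p \<Rightarrow> real^'p \<Rightarrow> real^'p" where
  "riem_hess M f x \<xi> =
     (let g = (SOME g. C2_extension M x f g);
          PT = proj_mat (tangent_space M x);
          PN = proj_mat ((tangent_space M x)\<^sup>\<bottom>)
      in PT *v (hess g x *v (PT *v \<xi>)) + weingarten M x (PT *v \<xi>) (PN *v grad g x))"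


section \<open>The variational problem\<close>

definition loss ::
  "real^'p^'n \<Rightarrow> (real^'n \<Rightarrow> real^'n \<Rightarrow> real) \<Rightarrow> real^'p \<Rightarrow> real^'n \<Rightarrow> real" where
  "loss X F0 \<beta> y = F0 (X *v \<beta>) y"

definition solutions ::
  "real^'p^'n \<Rightarrow> (real^'n \<Rightarrow> real^'n \<Rightarrow> real) \<Rightarrow> (real^'p \<Rightarrow> ereal) \<Rightarrow> real^'n \<Rightarrow> (real^'p) set" where
  "solutions X F0 J y =
     {\<beta>. is_arg_min (\<lambda>b. ereal (loss X F0 b y) + J b) (\<lambda>_. True) \<beta>}"

text \<open>\<open>Mf \<beta>\<close> is the partial smoothness manifold chosen at \<open>\<beta>\<close>. It is meaningful only where
  the subdifferential is nonempty; elsewhere the relative boundary of the subdifferential is empty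
  as well, so these points do not contribute to the transition space.\<close>

definition manifolds :: "(real^'p \<Rightarrow> ereal) \<Rightarrow> (real^'p \<Rightarrow> (real^'p) set) \<Rightarrow> (real^'p) set set" where
  "manifolds J Mf = Mf ` {\<beta>. subdiff J \<beta> \<noteq> {}}"

definition tilde_manifold ::
  "(real^'p \<Rightarrow> ereal) \<Rightarrow> (real^'p \<Rightarrow> (real^'p) set) \<Rightarrow> (real^'p) set \<Rightarrow> (real^'p) set" where
  "tilde_manifold J Mf M = {\<beta>. subdiff J \<beta> \<noteq> {} \<and> Mf \<beta> = M}"

definition transition_space ::
  "real^'p^'n \<Rightarrow> (real^'n \<Rightarrow> real^'n \<Rightarrow> real) \<Rightarrow> (real^'p \<Rightarrow> ereal) \<Rightarrow>
   (real^'p \<Rightarrow> (real^'p) set) \<Rightarrow> (real^'n) set" where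
  "transition_space X F0 J Mf =
     (\<Union>M\<in>manifolds J Mf. frontier (fst `
        {(y, \<beta>). \<beta> \<in> tilde_manifold J Mf M \<and>
                 - grad (\<lambda>b. loss X F0 b y) \<beta> \<in> rel_frontier (subdiff J \<beta>)}))"

definition cond_C ::
  "real^'p^'n \<Rightarrow> (real^'n \<Rightarrow> real^'n \<Rightarrow> real) \<Rightarrow> (real^'p \<Rightarrow> ereal) \<Rightarrow>
   (real^'p \<Rightarrow> (real^'p) set) \<Rightarrow> real^'p \<Rightarrow> real^'n \<Rightarrow> bool" where
  "cond_C X F0 J Mf \<beta> y \<longleftrightarrow>
     (\<forall>\<xi>\<in>T_sp J \<beta>. \<xi> \<noteq> 0 \<longrightarrow>
        (riem_hess (Mf \<beta>) (\<lambda>b. loss X F0 b y) \<beta> \<xi>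
         + riem_hess (Mf \<beta>) (\<lambda>b. real_of_ereal (J b)) \<beta> \<xi>) \<bullet> \<xi> > 0)"

definition non_injectivity_set ::
  "real^'p^'n \<Rightarrow> (real^'n \<Rightarrow> real^'n \<Rightarrow> real) \<Rightarrow> (real^'p \<Rightarrow> ereal) \<Rightarrow>
   (real^'p \<Rightarrow> (real^'p) set) \<Rightarrow> (real^'n) set" where
  "non_injectivity_set X F0 J Mf =
     {y. y \<notin> transition_space X F0 J Mf \<and> (\<forall>\<beta>\<in>solutions X F0 J y. \<not> cond_C X F0 J Mf \<beta> y)}"

text \<open>\<open>D_grad F0 \<mu> y\<close> is the Jacobian at \<open>y\<close> of \<open>\<nabla>F\<^sub>0(\<mu>,\<cdot>)\<close>, the gradient being taken in the first
  variable.\<close>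

definition D_grad :: "(real^'n \<Rightarrow> real^'n \<Rightarrow> real) \<Rightarrow> real^'n \<Rightarrow> real^'n \<Rightarrow> real^'n^'n" where
  "D_grad F0 \<mu> y = jacobian (\<lambda>y'. grad (\<lambda>m. F0 m y') \<mu>) y"

text \<open>The matrix \<open>\<Delta>\<close> at \<open>y\<close>, given \<open>\<mu> = X \<beta>\<close> and a solution \<open>\<beta>\<close>.\<close>

definition Delta ::
  "real^'p^'n \<Rightarrow> (real^'n \<Rightarrow> real^'n \<Rightarrow> real) \<Rightarrow> (real^'p \<Rightarrow> ereal) \<Rightarrow>
   (real^'p \<Rightarrow> (real^'p) set) \<Rightarrow> real^'n \<Rightarrow> real^'p \<Rightarrow> real^'n \<Rightarrow> real^'n^'n" where
  "Delta X F0 J Mf \<mu> \<beta> y =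
     (let M = Mf \<beta>;
          PT = proj_mat (T_sp J \<beta>);
          XT = X ** PT;
          XS = X ** proj_mat (S_sp J \<beta>);
          v = transpose XS *v grad (\<lambda>m. F0 m y) \<mu>;
          Q = hess_pullback XT (\<lambda>m. F0 m y) \<mu>
              + matrix (\<lambda>\<xi>. weingarten M \<beta> (PT *v \<xi>) v)
              + matrix (riem_hess M (\<lambda>b. real_of_ereal (J b)) \<beta>)
      in - (XT ** pinv Q ** transpose XT ** D_grad F0 \<mu> y))"


section \<open>o-minimal structures\<close>

text \<open>Points of \<open>\<real>\<^sup>k\<close> are represented as real lists of length \<open>k\<close>.\<close>

inductive poly_fun :: "nat \<Rightarrow> (real list \<Rightarrow> real) \<Rightarrow> bool" for k where
  poly_const: "poly_fun k (\<lambda>_. c)"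
| poly_coord: "i < k \<Longrightarrow> poly_fun k (\<lambda>x. x ! i)"
| poly_add: "poly_fun k f \<Longrightarrow> poly_fun k g \<Longrightarrow> poly_fun k (\<lambda>x. f x + g x)"
| poly_mult: "poly_fun k f \<Longrightarrow> poly_fun k g \<Longrightarrow> poly_fun k (\<lambda>x. f x * g x)"

inductive semialgebraic :: "nat \<Rightarrow> real list set \<Rightarrow> bool" for k where
  semialg_pos: "poly_fun k f \<Longrightarrow> semialgebraic k {x. length x = k \<and> f x > 0}"
| semialg_compl: "semialgebraic k A \<Longrightarrow> semialgebraic k ({x. length x = k} - A)"
| semialg_union: "semialgebraic k A \<Longrightarrow> semialgebraic k B \<Longrightarrow> semialgebraic k (A \<union> B)"

definition o_minimal :: "(nat \<Rightarrow> real list set set) \<Rightarrow> bool" where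
  "o_minimal \<O> \<longleftrightarrow>
     (\<forall>k. \<forall>A\<in>\<O> k. A \<subseteq> {x. length x = k}) \<and>
     (\<forall>k. \<forall>A\<in>\<O> k. {x. length x = k} - A \<in> \<O> k) \<and>
     (\<forall>k. \<forall>A\<in>\<O> k. \<forall>B\<in>\<O> k. A \<union> B \<in> \<O> k) \<and>
     (\<forall>k A. semialgebraic k A \<longrightarrow> A \<in> \<O> k) \<and>
     (\<forall>k l. \<forall>A\<in>\<O> k. \<forall>B\<in>\<O> l. {a @ b | a b. a \<in> A \<and> b \<in> B} \<in> \<O> (k + l)) \<and>
     (\<forall>k. \<forall>A\<in>\<O> (Suc k). butlast ` A \<in> \<O> k) \<and>
     \<comment> \<open>tameness; points are degenerate intervals, and the converse inclusion holds because
        finite unions of intervals are semialgebraic\<close>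
     (\<forall>A\<in>\<O> 1. \<exists>\<I>. finite \<I> \<and> (\<forall>I\<in>\<I>. is_interval (I :: real set)) \<and> {r. [r] \<in> A} = \<Union>\<I>)"

text \<open>The enumeration of the index type is arbitrary, but definability is invariant under
  permutations of the coordinates.\<close>

definition list_of_vec :: "real^'m \<Rightarrow> real list" where
  "list_of_vec x = map (\<lambda>i. x $ from_nat_into UNIV i) [0..<CARD('m)]"

definition definable_set :: "(nat \<Rightarrow> real list set set) \<Rightarrow> (real^'m) set \<Rightarrow> bool" where
  "definable_set \<O> A \<longleftrightarrow> list_of_vec ` A \<in> \<O> CARD('m)"

definition definable_loss ::
  "(nat \<Rightarrow> real list set set) \<Rightarrow> (real^'p \<Rightarrow> real^'n \<Rightarrow> real) \<Rightarrow> bool" where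
  "definable_loss \<O> F \<longleftrightarrow>
     {list_of_vec \<beta> @ list_of_vec y @ [F \<beta> y] | \<beta> y. True} \<in> \<O> (CARD('p) + CARD('n) + 1)"

definition definable_ext :: "(nat \<Rightarrow> real list set set) \<Rightarrow> (real^'m \<Rightarrow> ereal) \<Rightarrow> bool" where
  "definable_ext \<O> J \<longleftrightarrow>
     {list_of_vec \<beta> @ [r] | \<beta> r. J \<beta> = ereal r} \<in> \<O> (CARD('m) + 1)"


section \<open>Conditions on the data\<close>

text \<open>Besides the manifolds themselves, the (finite) choice \<open>\<beta> \<mapsto> Mf \<beta>\<close> is understood to be made
  definably, i.e. its level sets are definable. Without this, a wild choice between two
  definable manifolds with the same germ can make the transition space of positive measure.\<close>

definition cond_O ::
  "real^'p^'n \<Rightarrow> (real^'n \<Rightarrow> real^'n \<Rightarrow> real) \<Rightarrow> (real^'p \<Rightarrow> ereal) \<Rightarrow>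
   (real^'p \<Rightarrow> (real^'p) set) \<Rightarrow> bool" where
  "cond_O X F0 J Mf \<longleftrightarrow>
     (\<exists>\<O>. o_minimal \<O> \<and> definable_loss \<O> (loss X F0) \<and> definable_ext \<O> J \<and>
          (\<forall>M\<in>manifolds J Mf. definable_set \<O> M \<and> definable_set \<O> (tilde_manifold J Mf M)))"

definition cond_sconv :: "(real^'n \<Rightarrow> real^'n \<Rightarrow> real) \<Rightarrow> bool" where
  "cond_sconv F0 \<longleftrightarrow> (\<exists>\<tau>>0. \<forall>y. strongly_convex \<tau> (\<lambda>m. F0 m y))"

text \<open>The existence of the derivatives whose norm is bounded is made explicit.\<close>

definition cond_L :: "(real^'n \<Rightarrow> real^'n \<Rightarrow> real) \<Rightarrow> bool" where
  "cond_L F0 \<longleftrightarrow>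
     (\<forall>\<mu> y. (\<lambda>m. F0 m y) differentiable (at \<mu>)) \<and>
     (\<forall>\<mu> y. (\<lambda>y'. grad (\<lambda>m. F0 m y') \<mu>) differentiable (at y)) \<and>
     (\<exists>L>0. \<forall>\<mu> y. onorm ((*v) (D_grad F0 \<mu> y)) \<le> L)"

definition cond_F :: "real^'p^'n \<Rightarrow> (real^'n \<Rightarrow> real^'n \<Rightarrow> real) \<Rightarrow> bool" where
  "cond_F X F0 \<longleftrightarrow>
     (\<forall>y. Ck_on 2 UNIV (\<lambda>\<beta>. loss X F0 \<beta> y)) \<and> (\<forall>\<beta>. Ck_on 2 UNIV (\<lambda>y. loss X F0 \<beta> y))"


section \<open>Weak derivatives and estimation\<close>

definition locally_integrable :: "('a::euclidean_space \<Rightarrow> 'b::euclidean_space) \<Rightarrow> bool" where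
  "locally_integrable g \<longleftrightarrow> (\<forall>K. compact K \<longrightarrow> set_integrable lebesgue K g)"

definition test_function :: "(real^'n \<Rightarrow> real) \<Rightarrow> bool" where
  "test_function \<phi> \<longleftrightarrow> (\<forall>k. Ck_on k UNIV \<phi>) \<and> compact (closure {y. \<phi> y \<noteq> 0})"

definition weak_jacobian :: "(real^'n \<Rightarrow> real^'m) \<Rightarrow> (real^'n \<Rightarrow> real^'n^'m) \<Rightarrow> bool" where
  "weak_jacobian g G \<longleftrightarrow>
     locally_integrable g \<and> locally_integrable G \<and>
     (\<forall>\<phi> i j. test_function \<phi> \<longrightarrow>
        (LINT y|lebesgue. g y $ i * frechet_derivative \<phi> (at y) (axis j 1))
        = - (LINT y|lebesgue. G y $ i $ j * \<phi> y))"

definition gaussian_density :: "real^'n \<Rightarrow> real \<Rightarrow> real^'n \<Rightarrow> ennreal" where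
  "gaussian_density m \<sigma> y = ennreal (\<Prod>i\<in>UNIV. normal_density (m $ i) \<sigma> (y $ i))"

text \<open>Expectations are taken in the completed probability space: estimators such as the divergence
  of a weakly differentiable map are determined only up to Lebesgue-null sets, hence need not be
  Borel measurable.\<close>

definition unbiased_estimate :: "'w measure \<Rightarrow> ('w \<Rightarrow> real) \<Rightarrow> real \<Rightarrow> bool" where
  "unbiased_estimate P Z \<theta> \<longleftrightarrow>
     integrable (completion P) Z \<and> integral\<^sup>L (completion P) Z = \<theta>"

end

theory Submission
  imports Defs
begin

text \<open>
  The three parts rest on different arguments.

  \<^bold>\<open>Genericity.\<close> In an o-minimal structure, the frontier of a definable set is Lebesgue null (\<open>null_frontier\<close>). This
  is proved by induction on the dimension from Fubini's theorem and the tameness of the line.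
  The transition space is a finite union of frontiers of definable sets, hence null (\<open>transition_space_null\<close>). The
  same fact has a second use: for countably many definable sets, almost every point is interior to each of the
  sets that contain it (\<open>generic_interior\<close>).

  \<^bold>\<open>Lipschitz continuity.\<close> Solutions are critical points, \<open>- \<nabla>F(\<beta>,y) \<in> \<partial>J(\<beta>)\<close>. Strong convexity of the loss in the
  prediction, monotonicity of the subdifferential and the bound on the mixed derivative make the
  prediction \<open>muhat\<close> Lipschitz (\<open>critical_image_lipschitz\<close>). A Lipschitz map has a bounded weak Jacobian, a weak limit of difference
  quotients (\<open>lipschitz_weak_jacobian\<close>). It coincides with the classical derivative if the latter exists almost
  everywhere (\<open>weak_jacobian_eq_derivative\<close>).

  \<^bold>\<open>The derivative is \<Delta>.\<close> Let \<open>\<beta>0\<close> be the chosen solution at generic data \<open>y0\<close> and \<open>M\<close> its manifold. That there are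
  critical points near \<open>\<beta>0\<close> with manifold \<open>M\<close> is, for each member of a countable family of balls, a definable condition on
  the data, so it persists near \<open>y0\<close>. This yields a path of critical points in \<open>M\<close> that is continuous at \<open>y0\<close> and has
  the prediction \<open>muhat\<close> (\<open>stable_stratum\<close>). Along \<open>M\<close> subgradients act on tangent vectors like the derivative of a \<open>C\<^sup>2\<close> function, so
  the critical equation can be expanded in a chart. The linear term is the operator inside the pseudo-inverse of \<open>\<Delta>\<close>
  (\<open>Delta_matrix\<close>), which is injective by the condition \<open>cond_C\<close>, and solving for the step differentiates the path
  (\<open>critical_path_derivative\<close>). A second application of genericity controls the mixed derivative along the path
  (\<open>diagonal_derivative\<close>). Hence \<open>muhat\<close> has the derivative \<open>\<Delta>(y)\<close> at almost every \<open>y\<close> (\<open>image_derivative_AE\<close>).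

  \<^bold>\<open>Unbiasedness.\<close> By the chain rule the trace of \<open>Dh(\<mu>) \<Delta>\<close> is almost everywhere the divergence of \<open>h \<circ> muhat\<close>, which is the
  claim about the degrees of freedom. Stein's identity for Lipschitz maps (\<open>stein_component\<close>) turns the mixed term in the expansion
  of the residual into the expected divergence, which is the claim about the risk (\<open>stein_risk_identity\<close>).
\<close>

section \<open>Definable sets of lists\<close>

lemma poly_fun_mono: "poly_fun k f \<Longrightarrow> k \<le> m \<Longrightarrow> poly_fun m f"
  by (induction rule: poly_fun.induct) (auto intro: poly_fun.intros)

lemma poly_fun_append:
  "poly_fun k f \<Longrightarrow> length xs = k \<Longrightarrow> f (xs @ ys) = f xs"
  by (induction rule: poly_fun.induct) (auto simp: nth_append)

lemma poly_fun_uminus: "poly_fun k f \<Longrightarrow> poly_fun k (\<lambda>x. - f x)"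
  using poly_mult[OF poly_const[of k "-1"]] by simp

lemma poly_fun_diff: "poly_fun k f \<Longrightarrow> poly_fun k g \<Longrightarrow> poly_fun k (\<lambda>x. f x - g x)"
  using poly_add[OF _ poly_fun_uminus] by simp

lemma poly_fun_sum: "(\<And>i. i \<in> I \<Longrightarrow> poly_fun k (f i)) \<Longrightarrow> poly_fun k (\<lambda>x. \<Sum>i\<in>I. f i x)"
  by (induction I rule: infinite_finite_induct) (auto intro: poly_fun.intros)

locale tame_structure =
  fixes \<O> :: "nat \<Rightarrow> real list set set"
  assumes o_minimal: "o_minimal \<O>"
begin

lemma tame_length: "A \<in> \<O> k \<Longrightarrow> x \<in> A \<Longrightarrow> length x = k"
  using o_minimal[unfolded o_minimal_def, THEN conjunct1] by blast

lemma tame_compl: "A \<in> \<O> k \<Longrightarrow> {x. length x = k} - A \<in> \<O> k"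
  using o_minimal[unfolded o_minimal_def, THEN conjunct2, THEN conjunct1] by blast

lemma tame_Un: "A \<in> \<O> k \<Longrightarrow> B \<in> \<O> k \<Longrightarrow> A \<union> B \<in> \<O> k"
  using o_minimal[unfolded o_minimal_def, THEN conjunct2, THEN conjunct2, THEN conjunct1] by blast

lemma tame_semialgebraic: "semialgebraic k A \<Longrightarrow> A \<in> \<O> k"
  using o_minimal[unfolded o_minimal_def, THEN conjunct2, THEN conjunct2, THEN conjunct2, THEN conjunct1] by blast

lemma tame_append: "A \<in> \<O> k \<Longrightarrow> B \<in> \<O> l \<Longrightarrow> {a @ b | a b. a \<in> A \<and> b \<in> B} \<in> \<O> (k + l)"
  using o_minimal[unfolded o_minimal_def, THEN conjunct2, THEN conjunct2, THEN conjunct2, THEN conjunct2, THEN conjunct1] by blast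

lemma tame_butlast: "A \<in> \<O> (Suc k) \<Longrightarrow> butlast ` A \<in> \<O> k"
  using o_minimal[unfolded o_minimal_def, THEN conjunct2, THEN conjunct2, THEN conjunct2, THEN conjunct2, THEN conjunct2, THEN conjunct1] by blast

lemma tame_line:
  "A \<in> \<O> 1 \<Longrightarrow> \<exists>\<I>. finite \<I> \<and> (\<forall>I\<in>\<I>. is_interval (I :: real set)) \<and> {r. [r] \<in> A} = \<Union>\<I>"
  using o_minimal[unfolded o_minimal_def, THEN conjunct2, THEN conjunct2, THEN conjunct2, THEN conjunct2, THEN conjunct2, THEN conjunct2] by blast

lemma tame_Int: assumes "A \<in> \<O> k" "B \<in> \<O> k" shows "A \<inter> B \<in> \<O> k"
proof -
  have "A \<inter> B = {x. length x = k} - (({x. length x = k} - A) \<union> ({x. length x = k} - B))"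
    using tame_length assms by auto
  then show ?thesis using assms by (simp add: tame_compl tame_Un)
qed

lemma tame_Diff: assumes "A \<in> \<O> k" "B \<in> \<O> k" shows "A - B \<in> \<O> k"
proof -
  have "A - B = A \<inter> ({x. length x = k} - B)"
    using tame_length assms by auto
  then show ?thesis using assms by (simp add: tame_compl tame_Int)
qed

lemma tame_poly_pos: "poly_fun k f \<Longrightarrow> {x. length x = k \<and> f x > 0} \<in> \<O> k"
  by (intro tame_semialgebraic semialg_pos)

lemma tame_poly_less:
  "poly_fun k f \<Longrightarrow> poly_fun k g \<Longrightarrow> {x. length x = k \<and> f x < g x} \<in> \<O> k"
  using tame_poly_pos[OF poly_fun_diff, of k g f] by simp

lemma tame_space: "{x. length x = k} \<in> \<O> k"
  using tame_poly_pos[OF poly_const[of k 1]] by simp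

lemma tame_poly_eq:
  assumes "poly_fun k f" "poly_fun k g" shows "{x. length x = k \<and> f x = g x} \<in> \<O> k"
proof -
  have "{x. length x = k \<and> f x = g x} =
    {x. length x = k} - ({x. length x = k \<and> f x < g x} \<union> {x. length x = k \<and> g x < f x})"
    by auto
  then show ?thesis using assms by (simp add: tame_compl tame_Un tame_poly_less)
qed

lemma tame_Ball:
  "(\<And>j. j < (m::nat) \<Longrightarrow> {x. length x = k \<and> P j x} \<in> \<O> k) \<Longrightarrow> {x. length x = k \<and> (\<forall>j<m. P j x)} \<in> \<O> k"
proof (induction m)
  case 0 show ?case using tame_space by simp
next
  case (Suc m)
  have "{x. length x = k \<and> (\<forall>j<Suc m. P j x)} =
     {x. length x = k \<and> (\<forall>j<m. P j x)} \<inter> {x. length x = k \<and> P m x}"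
    by (auto simp: less_Suc_eq)
  then show ?case using Suc by (simp add: tame_Int)
qed

lemma tame_take: "A \<in> \<O> (k + m) \<Longrightarrow> take k ` A \<in> \<O> k"
proof (induction m arbitrary: A)
  case 0
  then have "take k ` A = A" using tame_length by (force simp: image_iff)
  with 0 show ?case by simp
next
  case (Suc m)
  have "take k ` A = take k ` butlast ` A"
    using tame_length[OF Suc.prems] by (simp add: image_image butlast_conv_take take_take min_def cong: image_cong_simp)
  then show ?case using Suc tame_butlast by simp
qed

text \<open>Preimages are projections of graphs: an o-minimal structure is closed under products, intersections with
  semialgebraic sets and dropping the last coordinate, and the graph of a polynomial map is semialgebraic.\<close>

lemma tame_vimage_poly:
  assumes A: "A \<in> \<O> m" and qs: "length qs = m" "\<And>q. q \<in> set qs \<Longrightarrow> poly_fun k q"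
  shows "{x. length x = k \<and> map (\<lambda>q. q x) qs \<in> A} \<in> \<O> k"
proof -
  let ?W = "{x @ y | x y. x \<in> {x. length x = k} \<and> y \<in> A}"
  let ?E = "{z. length z = k + m \<and> (\<forall>j<m. z ! (k + j) = (qs ! j) z)}"
  have pq: "poly_fun k (qs ! j)" if "j < m" for j using that qs by simp
  have qa: "(qs ! j) (x @ y) = (qs ! j) x" if "j < m" "length x = k" for j x y
    using poly_fun_append[OF pq] that by blast
  have "?W \<inter> ?E \<in> \<O> (k + m)"
  proof (rule tame_Int[OF tame_append[OF tame_space A] tame_Ball], rule tame_poly_eq)
    fix j assume "j < m"
    then show "poly_fun (k + m) (\<lambda>z. z ! (k + j))" "poly_fun (k + m) (qs ! j)"
      using pq by (auto intro: poly_coord poly_fun_mono[where k=k])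
  qed
  then have "take k ` (?W \<inter> ?E) \<in> \<O> k" by (rule tame_take)
  moreover have "take k ` (?W \<inter> ?E) = {x. length x = k \<and> map (\<lambda>q. q x) qs \<in> A}" (is "?L = ?R")
  proof
    show "?L \<subseteq> ?R"
    proof
      fix z assume "z \<in> ?L"
      then obtain w where w: "w \<in> ?W" "w \<in> ?E" "z = take k w" by blast
      then obtain x y where xy: "length x = k" "y \<in> A" "w = x @ y" by blast
      with w have *: "length x = k" "y \<in> A" "x @ y \<in> ?E" "z = x" by simp_all
      then have "y = map (\<lambda>q. q x) qs"
        using qs(1) qa by (intro nth_equalityI) auto
      then show "z \<in> ?R" using * by simp
    qed
    show "?R \<subseteq> ?L"
    proof
      fix x assume *: "x \<in> ?R"
      then show "x \<in> ?L"
        using qs(1) qa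
        by (intro image_eqI[of _ _ "x @ map (\<lambda>q. q x) qs"]) auto
    qed
  qed
  ultimately show ?thesis by simp
qed

text \<open>Fixing all coordinates but the last is a polynomial preimage in \<open>\<real>\<close>, so tameness of the line applies to
  every fibre. This is the only form in which tameness is used.\<close>

lemma tame_section:
  assumes A: "A \<in> \<O> (Suc k)" and x: "length x = k"
  shows "\<exists>\<I>. finite \<I> \<and> (\<forall>I\<in>\<I>. is_interval (I :: real set)) \<and> {r. x @ [r] \<in> A} = \<Union>\<I>"
proof -
  let ?qs = "map (\<lambda>i z. x ! i) [0..<k] @ [\<lambda>z. z ! 0]"
  have "{z. length z = 1 \<and> map (\<lambda>q. q z) ?qs \<in> A} \<in> \<O> 1"
    by (rule tame_vimage_poly[OF A]) (auto intro: poly_const poly_coord)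
  moreover have "map (\<lambda>q. q z) ?qs = x @ [z ! 0]" for z
    using x by (intro nth_equalityI) (auto simp: nth_append)
  ultimately have "{z. length z = 1 \<and> x @ [z ! 0] \<in> A} \<in> \<O> 1" by simp
  from tame_line[OF this] show ?thesis by simp
qed

lemma tame_slab:
  assumes "A \<in> \<O> (Suc k)"
  shows "{x. length x = k \<and> (\<forall>t. c < t \<and> t < d \<longrightarrow> x @ [t] \<in> A)} \<in> \<O> k"
proof -
  have 1: "{z. length z = Suc k \<and> c < z ! k} \<in> \<O> (Suc k)" "{z. length z = Suc k \<and> z ! k < d} \<in> \<O> (Suc k)"
    by (rule tame_poly_less; (rule poly_const | rule poly_coord, simp))+
  let ?B = "({z. length z = Suc k \<and> c < z ! k} \<inter> {z. length z = Suc k \<and> z ! k < d}) - A"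
  have "{x. length x = k \<and> (\<forall>t. c < t \<and> t < d \<longrightarrow> x @ [t] \<in> A)} = {x. length x = k} - butlast ` ?B" (is "?L = ?R")
  proof
    show "?L \<subseteq> ?R"
    proof
      fix x assume x: "x \<in> ?L"
      have "x \<notin> butlast ` ?B"
      proof
        assume "x \<in> butlast ` ?B"
        then obtain z where *: "z \<notin> A" "length z = Suc k" "c < z ! k" "z ! k < d" "x = butlast z" by blast
        then have "z = butlast z @ [z ! k]"
          by (metis append_butlast_last_id diff_Suc_1 last_conv_nth length_0_conv nat.distinct(1))
        moreover have "butlast z @ [z ! k] \<in> A" using x * by blast
        ultimately show False using * by metis
      qed
      with x show "x \<in> ?R" by blast
    qed
    show "?R \<subseteq> ?L"
    proof
      fix x assume x: "x \<in> ?R"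
      have "x @ [t] \<in> A" if t: "c < t" "t < d" for t
      proof (rule ccontr)
        assume "x @ [t] \<notin> A"
        then have "x @ [t] \<in> ?B" using x t by (auto simp: nth_append)
        then have "butlast (x @ [t]) \<in> butlast ` ?B" by (rule imageI)
        then show False using x by simp
      qed
      with x show "x \<in> ?L" by blast
    qed
  qed
  moreover have "?B \<in> \<O> (Suc k)" by (intro tame_Diff tame_Int 1 assms)
  then have "{x. length x = k} - butlast ` ?B \<in> \<O> k" by (intro tame_compl tame_butlast)
  ultimately show ?thesis by (simp only:)
qed

end

definition list_box :: "nat \<Rightarrow> real list \<Rightarrow> real list \<Rightarrow> real list set" where
  "list_box k a b = {x. length x = k \<and> (\<forall>i<k. a ! i < x ! i \<and> x ! i < b ! i)}"

definition rat_boxes :: "nat \<Rightarrow> real list set set" where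
  "rat_boxes k = (\<Union>a\<in>lists \<rat>. list_box k a ` lists \<rat>)"

text \<open>The points that no rational box separates from the frontier. Countably many boxes suffice, so this set is
  measurable for an arbitrary \<open>A\<close>; \<open>list_frontier_iff\<close> shows that it is the topological frontier in the sup norm,
  which is a first-order description and hence definable with \<open>A\<close>.\<close>

definition list_frontier :: "nat \<Rightarrow> real list set \<Rightarrow> real list set" where
  "list_frontier k A = {x. length x = k} - \<Union>{B \<in> rat_boxes k. B \<subseteq> A \<or> B \<inter> A = {}}"

text \<open>Lists of length \<open>k\<close> as points of the product measure space over \<open>{..<k}\<close>, where Fubini's theorem is available.\<close>

definition fun_set :: "nat \<Rightarrow> real list set \<Rightarrow> (nat \<Rightarrow> real) set" where
  "fun_set k S = {f \<in> {..<k} \<rightarrow>\<^sub>E UNIV. map f [0..<k] \<in> S}"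

abbreviation cube_measure :: "nat \<Rightarrow> (nat \<Rightarrow> real) measure" where
  "cube_measure k \<equiv> Pi\<^sub>M {..<k} (\<lambda>_. lborel)"

definition list_null :: "nat \<Rightarrow> real list set \<Rightarrow> bool" where
  "list_null k S \<longleftrightarrow> fun_set k S \<in> null_sets (cube_measure k)"

lemma countable_rat_boxes: "countable (rat_boxes k)"
  unfolding rat_boxes_def by (intro countable_UN countable_image countable_lists countable_rat)

lemma list_box_rat: "list_box k (map real_of_rat a) (map real_of_rat b) \<in> rat_boxes k"
  unfolding rat_boxes_def by (intro UN_I[of "map real_of_rat a"] imageI) auto

lemma sets_fun_set_box: "B \<in> rat_boxes k \<Longrightarrow> fun_set k B \<in> sets (cube_measure k)"
proof -
  assume "B \<in> rat_boxes k"
  then obtain a b where B: "B = list_box k a b" unfolding rat_boxes_def by blast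
  have "fun_set k B = Pi\<^sub>E {..<k} (\<lambda>i. {a ! i <..< b ! i})"
  proof (rule set_eqI)
    fix f show "f \<in> fun_set k B \<longleftrightarrow> f \<in> Pi\<^sub>E {..<k} (\<lambda>i. {a ! i <..< b ! i})"
      unfolding B fun_set_def list_box_def mem_Collect_eq PiE_iff by (simp, blast)
  qed
  then show ?thesis by (simp add: sets_PiM_I_finite)
qed

lemma sets_list_frontier: "fun_set k (list_frontier k A) \<in> sets (cube_measure k)"
proof -
  define \<B> where "\<B> = {B \<in> rat_boxes k. B \<subseteq> A \<or> B \<inter> A = {}}"
  have "fun_set k (list_frontier k A) = space (cube_measure k) - (\<Union>B\<in>\<B>. fun_set k B)"
    unfolding fun_set_def list_frontier_def space_PiM space_lborel \<B>_def[symmetric] by auto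
  moreover have "(\<Union>B\<in>\<B>. fun_set k B) \<in> sets (cube_measure k)"
  proof (rule sets.countable_UN'')
    show "countable \<B>" unfolding \<B>_def by (rule countable_subset[OF _ countable_rat_boxes]) blast
    show "fun_set k B \<in> sets (cube_measure k)" if "B \<in> \<B>" for B
      using that sets_fun_set_box unfolding \<B>_def by blast
  qed
  ultimately show ?thesis by (simp only: sets.Diff sets.top)
qed

lemma list_frontier_iff:
  "x \<in> list_frontier k A \<longleftrightarrow> length x = k \<and>
     (\<forall>e>0. (\<exists>y. length y = k \<and> (\<forall>i<k. \<bar>y ! i - x ! i\<bar> < e) \<and> y \<in> A) \<and>
            (\<exists>y. length y = k \<and> (\<forall>i<k. \<bar>y ! i - x ! i\<bar> < e) \<and> y \<notin> A))"
proof -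
  define near where "near = (\<lambda>e. {y. length y = k \<and> (\<forall>i<k. \<bar>y ! i - x ! i\<bar> < e)})"
  have eq: "(\<exists>B\<in>rat_boxes k. (B \<subseteq> A \<or> B \<inter> A = {}) \<and> x \<in> B) \<longleftrightarrow> (\<exists>e>0. near e \<subseteq> A \<or> near e \<inter> A = {})" (is "?L \<longleftrightarrow> ?R")
    if len: "length x = k"
  proof
    assume ?L
    then obtain a b where B: "list_box k a b \<subseteq> A \<or> list_box k a b \<inter> A = {}" "x \<in> list_box k a b"
      unfolding rat_boxes_def by blast
    have "\<forall>\<^sub>F e in at_right 0. \<forall>i\<in>{..<k}. e < x ! i - a ! i \<and> e < b ! i - x ! i"
      using B(2) by (intro eventually_ball_finite ballI eventually_conj order_tendstoD(2)[OF tendsto_ident_at])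
        (auto simp: list_box_def)
    then have "\<forall>\<^sub>F e in at_right (0::real). e > 0 \<and> (\<forall>i\<in>{..<k}. e < x ! i - a ! i \<and> e < b ! i - x ! i)"
      using eventually_at_right_less by (rule eventually_conj[rotated])
    then obtain e where e: "e > 0" "\<forall>i\<in>{..<k}. e < x ! i - a ! i \<and> e < b ! i - x ! i"
      using eventually_happens'[OF trivial_limit_at_right_real] by blast
    have "near e \<subseteq> list_box k a b"
    proof
      fix y assume y: "y \<in> near e"
      have "a ! i < y ! i \<and> y ! i < b ! i" if "i < k" for i
      proof -
        have "\<bar>y ! i - x ! i\<bar> < e" using y that by (simp add: near_def)
        moreover have "e < x ! i - a ! i" "e < b ! i - x ! i" using e(2) that by auto
        ultimately show ?thesis by linarith
      qed
      then show "y \<in> list_box k a b" using y by (simp add: near_def list_box_def)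
    qed
    with B e(1) show ?R by blast
  next
    assume ?R
    then obtain e where e: "e > 0" "near e \<subseteq> A \<or> near e \<inter> A = {}" by blast
    have "\<exists>q. x ! i - e < of_rat q \<and> of_rat q < x ! i" "\<exists>q. x ! i < of_rat q \<and> of_rat q < x ! i + e" for i
      using of_rat_dense[of "x ! i - e" "x ! i"] of_rat_dense[of "x ! i" "x ! i + e"] e by auto
    then obtain p q where pq: "\<And>i. x ! i - e < of_rat (p i) \<and> of_rat (p i) < x ! i"
      "\<And>i. x ! i < of_rat (q i) \<and> of_rat (q i) < x ! i + e" by metis
    let ?B = "list_box k (map real_of_rat (map p [0..<k])) (map real_of_rat (map q [0..<k]))"
    have "?B \<subseteq> near e"
    proof
      fix y assume y: "y \<in> ?B"
      have "\<bar>y ! i - x ! i\<bar> < e" if "i < k" for i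
      proof -
        have "of_rat (p i) < y ! i" "y ! i < of_rat (q i)" using y that by (auto simp: list_box_def)
        then show ?thesis using pq[of i] by linarith
      qed
      then show "y \<in> near e" using y by (auto simp: near_def list_box_def)
    qed
    moreover have "x \<in> ?B" using pq len by (auto simp: list_box_def)
    moreover have "?B \<in> rat_boxes k" by (rule list_box_rat)
    ultimately show ?L using e by blast
  qed
  have near_iff: "near e \<subseteq> A \<longleftrightarrow> \<not> (\<exists>y. length y = k \<and> (\<forall>i<k. \<bar>y ! i - x ! i\<bar> < e) \<and> y \<notin> A)"
    "near e \<inter> A = {} \<longleftrightarrow> \<not> (\<exists>y. length y = k \<and> (\<forall>i<k. \<bar>y ! i - x ! i\<bar> < e) \<and> y \<in> A)" for e
    unfolding near_def by blast+
  have fr: "x \<in> list_frontier k A \<longleftrightarrow> length x = k \<and> \<not> (\<exists>B\<in>rat_boxes k. (B \<subseteq> A \<or> B \<inter> A = {}) \<and> x \<in> B)"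
    unfolding list_frontier_def by blast
  show ?thesis
  proof (cases "length x = k")
    case True
    show ?thesis unfolding fr eq[OF True] near_iff by blast
  next
    case False
    then show ?thesis unfolding fr by blast
  qed
qed

context tame_structure begin

text \<open>The tolerance and the nearby points of \<open>list_frontier_iff\<close> become additional coordinates, which are projected away.\<close>

lemma tame_list_frontier:
  assumes A: "A \<in> \<O> k" shows "list_frontier k A \<in> \<O> k"
proof -
  let ?N = "Suc k + k"
  have near: "{z. length z = ?N \<and> (\<forall>i<k. \<bar>z ! (Suc k + i) - z ! i\<bar> < z ! k)} \<in> \<O> ?N"
  proof (rule tame_Ball)
    fix j assume j: "j < k"
    have abs_split: "\<bar>a - b\<bar> < c \<longleftrightarrow> a - b < c \<and> b - a < c" for a b c :: real by auto
    have "{z :: real list. length z = ?N \<and> \<bar>z ! (Suc k + j) - z ! j\<bar> < z ! k} =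
      {z. length z = ?N \<and> z ! (Suc k + j) - z ! j < z ! k} \<inter> {z. length z = ?N \<and> z ! j - z ! (Suc k + j) < z ! k}" (is "?l = ?r")
      proof (rule set_eqI)
      fix z :: "real list" show "z \<in> ?l \<longleftrightarrow> z \<in> ?r"
        using abs_split[of "z ! (Suc k + j)" "z ! j" "z ! k"] by blast
    qed
    also have "\<dots> \<in> \<O> ?N" using j by (intro tame_Int tame_poly_less poly_fun_diff poly_coord) auto
    finally show "{z. length z = ?N \<and> \<bar>z ! (Suc k + j) - z ! j\<bar> < z ! k} \<in> \<O> ?N" .
  qed
  have ex: "{x. length x = k \<and> (\<exists>e>0. \<not> (\<exists>y. length y = k \<and> (\<forall>i<k. \<bar>y ! i - x ! i\<bar> < e) \<and> y \<in> C))} \<in> \<O> k"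
    if C: "C \<in> \<O> k" for C
  proof -
    let ?W = "{z. length z = ?N \<and> (\<forall>i<k. \<bar>z ! (Suc k + i) - z ! i\<bar> < z ! k)} \<inter> {a @ b | a b. a \<in> {x. length x = Suc k} \<and> b \<in> C}"
    let ?V = "{z. length z = Suc k \<and> 0 < z ! k} - take (Suc k) ` ?W"
    have "?V \<in> \<O> (Suc k)"
      by (intro tame_Diff tame_take[where m=k] tame_Int near tame_append tame_space C tame_poly_pos poly_coord) auto
    then have "butlast ` ?V \<in> \<O> k" by (rule tame_butlast)
    moreover have W: "(x @ [e] \<in> take (Suc k) ` ?W) \<longleftrightarrow> (\<exists>y. length y = k \<and> (\<forall>i<k. \<bar>y ! i - x ! i\<bar> < e) \<and> y \<in> C)"
      if "length x = k" for x e
    proof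
      assume "x @ [e] \<in> take (Suc k) ` ?W"
      then obtain a b where ab: "length a = Suc k" "b \<in> C" "a @ b \<in> ?W" "x @ [e] = take (Suc k) (a @ b)" by blast
      then have a: "a = x @ [e]" by simp
      then have "length b = k" "\<forall>i<k. \<bar>b ! i - x ! i\<bar> < e"
        using ab(3) that by (auto simp: nth_append)
      with ab show "\<exists>y. length y = k \<and> (\<forall>i<k. \<bar>y ! i - x ! i\<bar> < e) \<and> y \<in> C" by blast
    next
      assume "\<exists>y. length y = k \<and> (\<forall>i<k. \<bar>y ! i - x ! i\<bar> < e) \<and> y \<in> C"
      then obtain y where y: "length y = k" "\<forall>i<k. \<bar>y ! i - x ! i\<bar> < e" "y \<in> C" by blast
      have 1: "(x @ [e]) @ y \<in> {z. length z = ?N \<and> (\<forall>i<k. \<bar>z ! (Suc k + i) - z ! i\<bar> < z ! k)}"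
        using y that by (simp add: nth_append)
      have "(x @ [e]) @ y \<in> {a @ b | a b. a \<in> {x. length x = Suc k} \<and> b \<in> C}"
        using y that by (intro CollectI exI[of _ "x @ [e]"] exI[of _ y]) simp
      with 1 have "(x @ [e]) @ y \<in> ?W" by (rule IntI)
      then have "take (Suc k) ((x @ [e]) @ y) \<in> take (Suc k) ` ?W" by (rule imageI)
      then show "x @ [e] \<in> take (Suc k) ` ?W" using that by simp
    qed
    have "butlast ` ?V = {x. length x = k \<and> (\<exists>e>0. x @ [e] \<notin> take (Suc k) ` ?W)}" (is "?L = ?R")
    proof
      show "?L \<subseteq> ?R"
      proof
        fix x assume "x \<in> ?L"
        then obtain z where *: "z \<notin> take (Suc k) ` ?W" "length z = Suc k" "0 < z ! k" "x = butlast z" by blast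
        then have "z = butlast z @ [z ! k]"
          by (metis append_butlast_last_id diff_Suc_1 last_conv_nth length_0_conv nat.distinct(1))
        with * have "x @ [z ! k] \<notin> take (Suc k) ` ?W" "length x = k" by simp_all
        with * show "x \<in> ?R" by blast
      qed
      show "?R \<subseteq> ?L"
      proof
        fix x assume "x \<in> ?R"
        then obtain e where *: "length x = k" "e > 0" "x @ [e] \<notin> take (Suc k) ` ?W" by blast
        then have "x @ [e] \<in> ?V" by (simp add: nth_append del: take_append)
        then have "butlast (x @ [e]) \<in> ?L" by (rule imageI)
        then show "x \<in> ?L" by (simp only: butlast_snoc)
      qed
    qed
    also have "\<dots> = {x. length x = k \<and> (\<exists>e>0. \<not> (\<exists>y. length y = k \<and> (\<forall>i<k. \<bar>y ! i - x ! i\<bar> < e) \<and> y \<in> C))}"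
    proof (rule Collect_cong, rule conj_cong[OF refl])
      fix x :: "real list" assume "length x = k"
      then show "(\<exists>e>0. x @ [e] \<notin> take (Suc k) ` ?W) \<longleftrightarrow>
          (\<exists>e>0. \<not> (\<exists>y. length y = k \<and> (\<forall>i<k. \<bar>y ! i - x ! i\<bar> < e) \<and> y \<in> C))"
        by (simp only: W)
    qed
    finally show ?thesis .
  qed
  have "list_frontier k A = {x. length x = k} -
    ({x. length x = k \<and> (\<exists>e>0. \<not> (\<exists>y. length y = k \<and> (\<forall>i<k. \<bar>y ! i - x ! i\<bar> < e) \<and> y \<in> A))} \<union>
     {x. length x = k \<and> (\<exists>e>0. \<not> (\<exists>y. length y = k \<and> (\<forall>i<k. \<bar>y ! i - x ! i\<bar> < e) \<and> y \<in> {y. length y = k} - A))})"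
    by (rule set_eqI, unfold list_frontier_iff Un_iff Diff_iff mem_Collect_eq, blast)
  also have "\<dots> \<in> \<O> k" by (intro tame_compl tame_Un ex A)
  finally show ?thesis .
qed

end

section \<open>Frontiers of definable sets are null\<close>

text \<open>Fubini: a measurable set is null if almost all of its fibres over the first \<open>k\<close> coordinates are null.\<close>

lemma AE_cube_Suc:
  assumes C: "fun_set (Suc k) C \<in> sets (cube_measure (Suc k))"
    and null: "AE f in cube_measure k. {t. map f [0..<k] @ [t] \<in> C} \<in> null_sets lborel"
  shows "fun_set (Suc k) C \<in> null_sets (cube_measure (Suc k))"
proof -
  interpret product_sigma_finite "\<lambda>_::nat. lborel :: real measure" ..
  have "emeasure (cube_measure (Suc k)) (fun_set (Suc k) C) = (\<integral>\<^sup>+f. indicator (fun_set (Suc k) C) f \<partial>cube_measure (Suc k))"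
    using C by simp
  also have "\<dots> = (\<integral>\<^sup>+f. (\<integral>\<^sup>+t. indicator (fun_set (Suc k) C) (f(k := t)) \<partial>lborel) \<partial>cube_measure k)"
    unfolding lessThan_Suc using C by (intro product_nn_integral_insert) (auto simp: lessThan_Suc)
  also have "\<dots> = (\<integral>\<^sup>+f. 0 \<partial>cube_measure k)"
  proof (rule nn_integral_cong_AE, use null AE_space in eventually_elim)
    case (elim f)
    then have f: "f \<in> {..<k} \<rightarrow>\<^sub>E UNIV" by (simp add: space_PiM)
    have "map (f(k := t)) [0..<Suc k] = map f [0..<k] @ [t]" for t by simp
    moreover have "f(k := t) \<in> {..<Suc k} \<rightarrow>\<^sub>E UNIV" for t
      using f by (auto simp: PiE_iff extensional_def)
    ultimately have "indicator (fun_set (Suc k) C) (f(k := t)) = (indicator {t. map f [0..<k] @ [t] \<in> C} t :: ennreal)" for t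
      unfolding fun_set_def indicator_def by simp
    then have "(\<integral>\<^sup>+t. indicator (fun_set (Suc k) C) (f(k := t)) \<partial>lborel) = emeasure lborel {t. map f [0..<k] @ [t] \<in> C}"
      using nn_integral_indicator[OF null_setsD2[OF elim(1)]] by simp
    then show ?case using elim(1) by (simp add: null_setsD1)
  qed
  finally show ?thesis using C by (simp add: null_sets_def)
qed

text \<open>The dichotomy behind o-minimality: a tame subset of the line is finite or contains an interval.\<close>

lemma finite_Un_intervals_cases:
  assumes "finite \<I>" "\<forall>I\<in>\<I>. is_interval (I :: real set)"
  shows "finite (\<Union>\<I> \<inter> {c<..<d}) \<or> (\<exists>p q. p < q \<and> {p<..<q} \<subseteq> \<Union>\<I> \<inter> {c<..<d})"
proof (cases "\<forall>I\<in>\<I>. finite (I \<inter> {c<..<d})")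
  case True
  then have "finite (\<Union>I\<in>\<I>. I \<inter> {c<..<d})" using assms by (intro finite_UN_I) auto
  moreover have "(\<Union>I\<in>\<I>. I \<inter> {c<..<d}) = \<Union>\<I> \<inter> {c<..<d}" by blast
  ultimately have "finite (\<Union>\<I> \<inter> {c<..<d})" by (simp only:)
  then show ?thesis ..
next
  case False
  then obtain I where I: "I \<in> \<I>" "infinite (I \<inter> {c<..<d})" by blast
  have "\<exists>p q. p \<in> I \<inter> {c<..<d} \<and> q \<in> I \<inter> {c<..<d} \<and> p < q"
  proof (rule ccontr)
    assume *: "\<not> ?thesis"
    have "I \<inter> {c<..<d} \<noteq> {}" using I(2) by (metis finite.emptyI)
    then obtain p where "p \<in> I \<inter> {c<..<d}" by blast
    with * have "I \<inter> {c<..<d} \<subseteq> {p}" by (metis insert_iff linorder_neqE_linordered_idom subsetI)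
    then show False using I(2) finite_subset by blast
  qed
  then obtain p q where pq: "p \<in> I" "q \<in> I" "c < p" "q < d" "p < q" by auto
  have "is_interval I" using I assms by blast
  then have "{p<..<q} \<subseteq> I"
    using pq unfolding is_interval_1 by (meson greaterThanLessThan_iff less_imp_le subsetI)
  moreover have "{p<..<q} \<subseteq> {c<..<d}" using pq by auto
  ultimately have "{p<..<q} \<subseteq> \<Union>\<I> \<inter> {c<..<d}" using I by blast
  then show ?thesis using pq by blast
qed

lemma finite_avoids_interval:
  assumes "finite (S :: real set)" "c < d"
  shows "\<exists>p q. c < p \<and> p < q \<and> q < d \<and> {p<..<q} \<inter> S = {}"
proof -
  obtain m where m: "c < m" "m < d" using assms dense by blast
  have "\<forall>\<^sub>F q in at_right m. \<forall>s\<in>S. q \<le> s \<or> s \<le> m"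
  proof (rule eventually_ball_finite[OF assms(1)], rule ballI)
    fix s assume "s \<in> S"
    show "\<forall>\<^sub>F q in at_right m. q \<le> s \<or> s \<le> m"
    proof (cases "s \<le> m")
      case False
      then have "\<forall>\<^sub>F q in at_right m. q < s" by (intro order_tendstoD(2)[OF tendsto_ident_at]) auto
      then show ?thesis by (rule eventually_mono) auto
    qed simp
  qed
  moreover have "\<forall>\<^sub>F q in at_right m. q < d" using m by (intro order_tendstoD(2)[OF tendsto_ident_at]) auto
  ultimately have "\<forall>\<^sub>F q in at_right m. m < q \<and> q < d \<and> (\<forall>s\<in>S. q \<le> s \<or> s \<le> m)"
    using eventually_at_right_less[of m] by eventually_elim auto
  then obtain q where "m < q" "q < d" "\<forall>s\<in>S. q \<le> s \<or> s \<le> m"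
    using eventually_happens'[OF trivial_limit_at_right_real] by blast
  then show ?thesis using m by (intro exI[of _ m] exI[of _ q]) (auto simp: not_le[symmetric])
qed

lemma rational_subinterval:
  assumes "p < (q::real)"
  shows "\<exists>r s::rat. p < of_rat r \<and> of_rat r < (of_rat s :: real) \<and> of_rat s < q"
proof -
  obtain r where "p < of_rat r" "of_rat r < q" using of_rat_dense[OF assms] by blast
  moreover obtain s where "of_rat r < (of_rat s :: real)" "of_rat s < q" using of_rat_dense[OF calculation(2)] by blast
  ultimately show ?thesis by blast
qed

lemma list_box_snoc:
  assumes "length a = k" "length b = k"
  shows "list_box (Suc k) (a @ [c]) (b @ [d]) = {x @ [t] | x t. x \<in> list_box k a b \<and> c < t \<and> t < d}" (is "?L = ?R")
proof
  show "?L \<subseteq> ?R"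
  proof
    fix z assume z: "z \<in> ?L"
    then have len: "length z = Suc k" and *: "\<And>i. i < Suc k \<Longrightarrow> (a @ [c]) ! i < z ! i \<and> z ! i < (b @ [d]) ! i"
      unfolding list_box_def by blast+
    have zz: "z = butlast z @ [z ! k]"
      using len by (metis append_butlast_last_id diff_Suc_1 last_conv_nth length_0_conv nat.distinct(1))
    have "butlast z \<in> list_box k a b"
      unfolding list_box_def
    proof (intro CollectI conjI allI impI)
      show "length (butlast z) = k" using len by simp
    next
      fix i assume "i < k"
      then show "a ! i < butlast z ! i" "butlast z ! i < b ! i"
        using *[of i] assms len by (simp_all add: nth_append nth_butlast)
    qed
    moreover have "c < z ! k" "z ! k < d" using *[of k] assms by (simp_all add: nth_append)
    ultimately show "z \<in> ?R" using zz by blast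
  qed
  show "?R \<subseteq> ?L" using assms by (auto simp: list_box_def nth_append less_Suc_eq)
qed

lemma list_null_mono_countable:
  assumes "countable \<F>" "\<And>S. S \<in> \<F> \<Longrightarrow> list_null k S" "T \<subseteq> \<Union>\<F>"
  shows "\<exists>N\<in>null_sets (cube_measure k). fun_set k T \<subseteq> N"
proof -
  have "(\<Union>S\<in>\<F>. fun_set k S) \<in> null_sets (cube_measure k)"
    using assms unfolding list_null_def by (intro null_sets_UN') auto
  moreover have "fun_set k T \<subseteq> (\<Union>S\<in>\<F>. fun_set k S)" using assms(3) unfolding fun_set_def by blast
  ultimately show ?thesis by blast
qed

text \<open>Boxes have positive measure, and the argument needs this for outer measure because the sets that are compared with
  boxes are not known to be measurable.\<close>

lemma list_box_nonnull:
  assumes "fun_set k (list_box k a b) \<subseteq> N" "N \<in> null_sets (cube_measure k)" "length x = k" "x \<in> list_box k a b"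
  shows False
proof -
  interpret product_sigma_finite "\<lambda>_::nat. lborel :: real measure" ..
  have ab: "a ! i < b ! i" if "i < k" for i using assms(4) that unfolding list_box_def by force
  have "fun_set k (list_box k a b) = Pi\<^sub>E {..<k} (\<lambda>i. {a ! i <..< b ! i})"
  proof (rule set_eqI)
    fix f show "f \<in> fun_set k (list_box k a b) \<longleftrightarrow> f \<in> Pi\<^sub>E {..<k} (\<lambda>i. {a ! i <..< b ! i})"
      unfolding fun_set_def list_box_def mem_Collect_eq PiE_iff by (simp, blast)
  qed
  then have "emeasure (cube_measure k) (fun_set k (list_box k a b)) = (\<Prod>i<k. ennreal (b ! i - a ! i))"
    using ab by (simp add: emeasure_PiM less_imp_le)
  also have "\<dots> = ennreal (\<Prod>i<k. b ! i - a ! i)"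
    using ab by (intro prod_ennreal) (auto simp: less_imp_le)
  also have "\<dots> > 0" using ab by (auto intro!: prod_pos)
  finally have "emeasure (cube_measure k) (fun_set k (list_box k a b)) > 0" .
  moreover have "emeasure (cube_measure k) (fun_set k (list_box k a b)) \<le> emeasure (cube_measure k) N"
    using assms by (intro emeasure_mono) auto
  ultimately show False using assms(2) by (simp add: null_setsD1)
qed

lemma rat_boxes_subbox: "B \<in> rat_boxes k \<Longrightarrow> x \<in> B \<Longrightarrow> \<exists>a b. length a = k \<and> length b = k \<and> B = list_box k a b \<and> x \<in> list_box k a b"
proof -
  assume B: "B \<in> rat_boxes k" "x \<in> B"
  then obtain a b where ab: "B = list_box k a b" unfolding rat_boxes_def by blast
  have "list_box k a b = list_box k (map (\<lambda>i. a ! i) [0..<k]) (map (\<lambda>i. b ! i) [0..<k])"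
    unfolding list_box_def by auto
  with B ab show ?thesis by (intro exI[of _ "map (\<lambda>i. a ! i) [0..<k]"] exI[of _ "map (\<lambda>i. b ! i) [0..<k]"]) simp
qed

context tame_structure begin

text \<open>Baire-type argument with measure in place of category: if frontiers are null, a non-null set is not covered by the
  frontiers of the countably many members of \<open>\<F>\<close>, so some point of it lies in a box inside one member.\<close>

lemma tame_countable_cover_box:
  assumes fr: "\<And>A. A \<in> \<O> k \<Longrightarrow> list_null k (list_frontier k A)"
    and \<F>: "countable \<F>" "\<F> \<subseteq> \<O> k" and T: "T \<subseteq> \<Union>\<F>" "\<not> (\<exists>N\<in>null_sets (cube_measure k). fun_set k T \<subseteq> N)"
  shows "\<exists>S\<in>\<F>. \<exists>a b x. length a = k \<and> length b = k \<and> x \<in> list_box k a b \<and> x \<in> T \<and> list_box k a b \<subseteq> S"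
proof (rule ccontr)
  assume none: "\<not> ?thesis"
  have "T \<subseteq> \<Union>(list_frontier k ` \<F>)"
  proof
    fix x assume x: "x \<in> T"
    then obtain S where S: "S \<in> \<F>" "x \<in> S" using T by blast
    then have "length x = k" using \<F> tame_length by blast
    have "x \<in> list_frontier k S"
    proof (rule ccontr)
      assume "x \<notin> list_frontier k S"
      then obtain B where B: "B \<in> rat_boxes k" "B \<subseteq> S \<or> B \<inter> S = {}" "x \<in> B"
        using \<open>length x = k\<close> unfolding list_frontier_def by blast
      then have "B \<subseteq> S" using S by blast
      with rat_boxes_subbox[OF B(1,3)] none S x show False by blast
    qed
    with S show "x \<in> \<Union>(list_frontier k ` \<F>)" by blast
  qed
  then have "\<exists>N\<in>null_sets (cube_measure k). fun_set k T \<subseteq> N"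
    using \<F> fr by (intro list_null_mono_countable[of "list_frontier k ` \<F>"]) auto
  with T show False by blast
qed

lemma list_frontier_box_contra:
  assumes "length a = k" "length b = k" "x \<in> list_box k a b" "list_box k a b \<subseteq> list_frontier k A"
    "list_box k a b \<subseteq> A \<or> list_box k a b \<inter> A = {}"
  shows False
proof -
  have len: "length x = k" using assms(3) unfolding list_box_def by blast
  have "\<forall>\<^sub>F e in at_right 0. \<forall>i\<in>{..<k}. e < x ! i - a ! i \<and> e < b ! i - x ! i"
    using assms(3) unfolding list_box_def
    by (intro eventually_ball_finite ballI eventually_conj order_tendstoD(2)[OF tendsto_ident_at]) auto
  then have "\<forall>\<^sub>F e in at_right (0::real). e > 0 \<and> (\<forall>i\<in>{..<k}. e < x ! i - a ! i \<and> e < b ! i - x ! i)"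
    using eventually_at_right_less by (rule eventually_conj[rotated])
  then obtain e where e: "e > 0" "\<forall>i\<in>{..<k}. e < x ! i - a ! i \<and> e < b ! i - x ! i"
    using eventually_happens'[OF trivial_limit_at_right_real] by blast
  have near: "y \<in> list_box k a b" if "length y = k" "\<forall>i<k. \<bar>y ! i - x ! i\<bar> < e" for y
  proof -
    have "a ! i < y ! i \<and> y ! i < b ! i" if "i < k" for i
    proof -
      have "\<bar>y ! i - x ! i\<bar> < e" "e < x ! i - a ! i" "e < b ! i - x ! i" using e(2) \<open>\<forall>i<k. \<bar>y ! i - x ! i\<bar> < e\<close> that by auto
      then show ?thesis by linarith
    qed
    with that show ?thesis by (simp add: list_box_def)
  qed
  have "x \<in> list_frontier k A" using assms by blast
  then show False using e(1) near assms(5) unfolding list_frontier_iff by blast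
qed

text \<open>Induction on the dimension. If the frontier \<open>C\<close> of \<open>A\<close> were not null, by Fubini
  non-null many fibres of \<open>C\<close> would be non-null, hence contain an interval with rational end points; by the induction
  hypothesis, one such interval works over a whole box, i.e. \<open>C\<close> contains a box. Over that box every fibre of \<open>A\<close> or of
  its complement contains a subinterval, and again one choice works over a smaller box. That box lies in \<open>C\<close> and is on one
  side of \<open>A\<close>, which is absurd for a frontier.\<close>

lemma list_null_frontier: "A \<in> \<O> k \<Longrightarrow> list_null k (list_frontier k A)"
proof (induction k arbitrary: A)
  case 0
  have "list_frontier 0 A = {}"
  proof (rule equals0I)
    fix x assume "x \<in> list_frontier 0 A"
    then show False unfolding list_frontier_iff by (metis length_0_conv zero_less_one)
  qed
  then show ?case by (simp add: list_null_def fun_set_def)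
next
  case (Suc k)
  define C where "C = list_frontier (Suc k) A"
  have C: "C \<in> \<O> (Suc k)" unfolding C_def by (rule tame_list_frontier[OF Suc.prems])
  define T where "T = {x. length x = k \<and> {t. x @ [t] \<in> C} \<notin> null_sets lborel}"
  define B :: "real list set \<Rightarrow> real \<Rightarrow> real \<Rightarrow> real list set" where "B = (\<lambda>D c d. {x. length x = k \<and> (\<forall>t. c < t \<and> t < d \<longrightarrow> x @ [t] \<in> D)})"
  have B: "D \<in> \<O> (Suc k) \<Longrightarrow> B D c d \<in> \<O> k" for D c d unfolding B_def by (rule tame_slab)
  \<comment> \<open>the bases over which the fibre of \<open>C\<close> contains a fixed rational interval\<close>
  define \<G> where "\<G> = (\<Union>r::rat. \<Union>s\<in>{s. r < s}. {B C (of_rat r) (of_rat s)})"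
  show ?case
  proof (rule ccontr)
    assume "\<not> ?case"
    then have nn: "\<not> (AE f in cube_measure k. {t. map f [0..<k] @ [t] \<in> C} \<in> null_sets lborel)"
      using AE_cube_Suc sets_list_frontier unfolding list_null_def C_def by blast
    have "\<not> (\<exists>N\<in>null_sets (cube_measure k). fun_set k T \<subseteq> N)"
    proof
      assume "\<exists>N\<in>null_sets (cube_measure k). fun_set k T \<subseteq> N"
      then obtain N where N: "N \<in> null_sets (cube_measure k)" "fun_set k T \<subseteq> N" by blast
      have "AE f in cube_measure k. {t. map f [0..<k] @ [t] \<in> C} \<in> null_sets lborel"
      proof (rule AE_I'[OF N(1)], rule subsetI)
        fix f assume f: "f \<in> {f \<in> space (cube_measure k). {t. map f [0..<k] @ [t] \<in> C} \<notin> null_sets lborel}"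
        then have "f \<in> fun_set k T" unfolding fun_set_def T_def by (simp add: space_PiM)
        with N show "f \<in> N" by blast
      qed
      with nn show False by blast
    qed
    moreover have "T \<subseteq> \<Union>\<G>"
    proof
      fix x assume "x \<in> T"
      then have x: "length x = k" "{t. x @ [t] \<in> C} \<notin> null_sets lborel" unfolding T_def by blast+
      obtain \<I> where I: "finite \<I>" "\<forall>I\<in>\<I>. is_interval (I :: real set)" "{t. x @ [t] \<in> C} = \<Union>\<I>"
        using tame_section[OF C x(1)] by blast
      have "\<exists>I\<in>\<I>. infinite I"
      proof (rule ccontr)
        assume "\<not> ?thesis"
        then have "finite {t. x @ [t] \<in> C}" using I by auto
        then show False using x(2) by (simp add: finite_imp_null_set_lborel)
      qed
      then obtain I where "I \<in> \<I>" "infinite I" by blast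
      then obtain p q where pq: "p \<in> I" "q \<in> I" "p < q"
        by (metis finite.emptyI finite.insertI finite_subset insertI1 linorder_neqE_linordered_idom subsetI equals0I)
      obtain r s :: rat where rs: "p < of_rat r" "of_rat r < (of_rat s :: real)" "of_rat s < q"
        using rational_subinterval[OF pq(3)] by blast
      have "is_interval I" using \<open>I \<in> \<I>\<close> I by blast
      then have "t \<in> I" if "of_rat r < t" "t < of_rat s" for t
        using pq rs that unfolding is_interval_1 by (meson less_imp_le less_trans)
      then have "x @ [t] \<in> C" if "of_rat r < t" "t < of_rat s" for t
        using that I(3) \<open>I \<in> \<I>\<close> by blast
      then have "x \<in> B C (of_rat r) (of_rat s)" unfolding B_def using x by blast
      then show "x \<in> \<Union>\<G>"
        using rs(2) unfolding \<G>_def of_rat_less by blast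
    qed
    moreover have "countable \<G>" unfolding \<G>_def by (intro countable_UN) auto
    moreover have "\<G> \<subseteq> \<O> k" unfolding \<G>_def using B[OF C] by blast
    ultimately obtain S a b x where S: "S \<in> \<G>"
      "length a = k" "length b = k" "x \<in> list_box k a b" "list_box k a b \<subseteq> S"
      using tame_countable_cover_box[OF Suc.IH, of \<G> T] by blast
    then obtain r s :: rat where rs: "r < s" "S = B C (of_rat r) (of_rat s)" unfolding \<G>_def by blast
    define c d :: real where "c = of_rat r" "d = of_rat s"
    have cd: "c < d" using rs by (simp add: c_d_def of_rat_less)
    have box: "list_box k a b \<subseteq> B C c d" using S rs by (simp add: c_d_def)
    \<comment> \<open>the same for subintervals of \<open>(c,d)\<close> on which the fibre lies in \<open>A\<close> or in its complement\<close>
    define \<F> where "\<F> = (\<Union>r::rat. \<Union>s\<in>{s. r < s \<and> c < of_rat r \<and> of_rat s < d}. {B A (of_rat r) (of_rat s), B ({z. length z = Suc k} - A) (of_rat r) (of_rat s)})"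
    have "list_box k a b \<subseteq> \<Union>\<F>"
    proof
      fix x assume "x \<in> list_box k a b"
      then have x: "length x = k" unfolding list_box_def by blast
      obtain \<I> where I: "finite \<I>" "\<forall>I\<in>\<I>. is_interval (I :: real set)" "{t. x @ [t] \<in> A} = \<Union>\<I>"
        using tame_section[OF Suc.prems x] by blast
      have "\<exists>p q. p < q \<and> c \<le> p \<and> q \<le> d \<and> ((\<forall>t. p < t \<and> t < q \<longrightarrow> x @ [t] \<in> A) \<or> (\<forall>t. p < t \<and> t < q \<longrightarrow> x @ [t] \<notin> A))"
        using finite_Un_intervals_cases[OF I(1,2), of c d]
      proof
        assume fin: "finite (\<Union>\<I> \<inter> {c<..<d})"
        obtain p q where pq: "c < p" "p < q" "q < d" "{p<..<q} \<inter> (\<Union>\<I> \<inter> {c<..<d}) = {}"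
          using finite_avoids_interval[OF fin cd] by blast
        have "x @ [t] \<notin> A" if "p < t" "t < q" for t
        proof
          assume "x @ [t] \<in> A"
          then have "t \<in> \<Union>\<I>" using I(3) by blast
          with pq that show False by auto
        qed
        with pq show ?thesis by (meson less_imp_le)
      next
        assume "\<exists>p q. p < q \<and> {p<..<q} \<subseteq> \<Union>\<I> \<inter> {c<..<d}"
        then obtain p q where pq: "p < q" "{p<..<q} \<subseteq> \<Union>\<I> \<inter> {c<..<d}" by blast
        then have "{p<..<q} \<subseteq> {c<..<d}" by blast
        then have "c \<le> p" "q \<le> d" using pq(1) by (simp_all add: greaterThanLessThan_subseteq_greaterThanLessThan)
        moreover have "x @ [t] \<in> A" if "p < t" "t < q" for t
        proof -
          have "t \<in> \<Union>\<I>" using that pq by auto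
          then show ?thesis using I(3) by blast
        qed
        ultimately show ?thesis using pq(1) by blast
      qed
      then obtain p q where pq: "p < q" "c \<le> p" "q \<le> d"
        "(\<forall>t. p < t \<and> t < q \<longrightarrow> x @ [t] \<in> A) \<or> (\<forall>t. p < t \<and> t < q \<longrightarrow> x @ [t] \<notin> A)" by blast
      obtain r s :: rat where rs: "p < of_rat r" "of_rat r < (of_rat s :: real)" "of_rat s < q"
        using rational_subinterval[OF pq(1)] by blast
      have "x \<in> B A (of_rat r) (of_rat s) \<or> x \<in> B ({z. length z = Suc k} - A) (of_rat r) (of_rat s)"
        using pq(4)
      proof
        assume *: "\<forall>t. p < t \<and> t < q \<longrightarrow> x @ [t] \<in> A"
        have "x @ [t] \<in> A" if "of_rat r < t" "t < of_rat s" for t using * rs that by (meson less_trans)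
        then show ?thesis using x unfolding B_def by blast
      next
        assume *: "\<forall>t. p < t \<and> t < q \<longrightarrow> x @ [t] \<notin> A"
        have "x @ [t] \<notin> A" if "of_rat r < t" "t < of_rat s" for t using * rs that by (meson less_trans)
        then show ?thesis using x unfolding B_def by simp
      qed
      moreover have "r < s" using rs by (simp add: of_rat_less)
      moreover have "c < of_rat r" "of_rat s < d" using pq rs by linarith+
      ultimately show "x \<in> \<Union>\<F>" unfolding \<F>_def by blast
    qed
    moreover have "\<not> (\<exists>N\<in>null_sets (cube_measure k). fun_set k (list_box k a b) \<subseteq> N)"
      using list_box_nonnull S(4) unfolding list_box_def by blast
    moreover have "countable \<F>" unfolding \<F>_def by (intro countable_UN) auto
    moreover have "\<F> \<subseteq> \<O> k" unfolding \<F>_def using B[OF Suc.prems] B[OF tame_compl[OF Suc.prems]] by blast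
    ultimately obtain S' a' b' x' where S': "S' \<in> \<F>" "length a' = k" "length b' = k" "x' \<in> list_box k a' b'"
      "x' \<in> list_box k a b" "list_box k a' b' \<subseteq> S'"
      using tame_countable_cover_box[OF Suc.IH, of \<F> "list_box k a b"] by blast
    then obtain r' s' where rs': "r' < s'" "c < of_rat r'" "of_rat s' < d"
      "S' = B A (of_rat r') (of_rat s') \<or> S' = B ({z. length z = Suc k} - A) (of_rat r') (of_rat s')"
      unfolding \<F>_def by blast
    define a2 b2 where "a2 = map (\<lambda>i. max (a ! i) (a' ! i)) [0..<k] @ [of_rat r']"
       and "b2 = map (\<lambda>i. min (b ! i) (b' ! i)) [0..<k] @ [of_rat s' :: real]"
    have int: "list_box k (map (\<lambda>i. max (a ! i) (a' ! i)) [0..<k]) (map (\<lambda>i. min (b ! i) (b' ! i)) [0..<k]) = list_box k a b \<inter> list_box k a' b'"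
      unfolding list_box_def by auto
    have box2: "list_box (Suc k) a2 b2 = {x @ [t] | x t. x \<in> list_box k a b \<inter> list_box k a' b' \<and> of_rat r' < t \<and> t < of_rat s'}"
      unfolding a2_def b2_def int[symmetric] by (rule list_box_snoc) auto
    have "(of_rat r' :: real) < of_rat s'" using rs'(1) by (simp add: of_rat_less)
    then obtain t :: real where t: "of_rat r' < t" "t < of_rat s'" using dense by blast
    show False
    proof (rule list_frontier_box_contra)
      show "length a2 = Suc k" "length b2 = Suc k" by (simp_all add: a2_def b2_def)
      show "x' @ [t] \<in> list_box (Suc k) a2 b2" unfolding box2 using S' t by blast
      show "list_box (Suc k) a2 b2 \<subseteq> list_frontier (Suc k) A"
      proof
        fix z assume "z \<in> list_box (Suc k) a2 b2"
        then obtain x t where z: "z = x @ [t]" "x \<in> list_box k a b" "of_rat r' < t" "t < of_rat s'" unfolding box2 by blast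
        then have "x \<in> B C c d" "c < t" "t < d" using box rs' by auto
        then show "z \<in> list_frontier (Suc k) A" unfolding z C_def[symmetric] B_def by blast
      qed
      show "list_box (Suc k) a2 b2 \<subseteq> A \<or> list_box (Suc k) a2 b2 \<inter> A = {}"
        using rs'(4)
      proof
        assume "S' = B A (of_rat r') (of_rat s')"
        then have "list_box k a' b' \<subseteq> B A (of_rat r') (of_rat s')" using S' by blast
        then have "list_box (Suc k) a2 b2 \<subseteq> A" unfolding box2 B_def by blast
        then show ?thesis ..
      next
        assume "S' = B ({z. length z = Suc k} - A) (of_rat r') (of_rat s')"
        then have "list_box k a' b' \<subseteq> B ({z. length z = Suc k} - A) (of_rat r') (of_rat s')" using S' by blast
        then have "list_box (Suc k) a2 b2 \<inter> A = {}" unfolding box2 B_def by blast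
        then show ?thesis ..
      qed
    qed
  qed
qed

end

section \<open>A calculus of definable sets and maps in Euclidean spaces\<close>

text \<open>An arbitrary enumeration of the standard basis. It transports definability from lists to any Euclidean space; in
  particular products of spaces are handled without index arithmetic.\<close>

definition basis_list :: "'a::euclidean_space list" where
  "basis_list = (SOME l. distinct l \<and> set l = Basis)"

lemma basis_list: "distinct (basis_list :: 'a::euclidean_space list)" "set (basis_list :: 'a list) = Basis"
proof -
  have "\<exists>l. distinct l \<and> set l = (Basis :: 'a set)" using finite_distinct_list[OF finite_Basis] by blast
  then have "distinct (basis_list :: 'a list) \<and> set (basis_list :: 'a list) = Basis"
    unfolding basis_list_def by (rule someI_ex)
  then show "distinct (basis_list :: 'a list)" "set (basis_list :: 'a list) = Basis" by blast+
qed

lemma length_basis_list: "length (basis_list :: 'a::euclidean_space list) = DIM('a)"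
  using basis_list[where 'a='a] distinct_card by metis

lemma basis_list_nth: "i < DIM('a) \<Longrightarrow> (basis_list ! i :: 'a::euclidean_space) \<in> Basis"
  using basis_list(2)[where 'a='a] length_basis_list[where 'a='a] nth_mem by metis

lemma bij_basis_list: "bij_betw ((!) basis_list) {..<DIM('a)} (Basis :: 'a::euclidean_space set)"
  using bij_betw_nth[OF basis_list(1)[where 'a='a], of "{..<DIM('a)}" Basis]
  by (simp add: length_basis_list basis_list)

definition to_list :: "'a::euclidean_space \<Rightarrow> real list" where
  "to_list x = map (\<lambda>b. x \<bullet> b) basis_list"

definition of_list :: "real list \<Rightarrow> 'a::euclidean_space" where
  "of_list xs = (\<Sum>i<DIM('a). xs ! i *\<^sub>R basis_list ! i)"

lemma length_to_list [simp]: "length (to_list (x::'a::euclidean_space)) = DIM('a)"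
  by (simp add: to_list_def length_basis_list)

lemma to_list_nth: "i < DIM('a) \<Longrightarrow> to_list (x::'a::euclidean_space) ! i = x \<bullet> basis_list ! i"
  by (simp add: to_list_def length_basis_list)

lemma of_list_to_list [simp]: "of_list (to_list x) = (x::'a::euclidean_space)"
proof -
  have "of_list (to_list x) = (\<Sum>i<DIM('a). (x \<bullet> basis_list ! i) *\<^sub>R (basis_list ! i :: 'a))"
    by (simp add: of_list_def to_list_nth)
  also have "\<dots> = (\<Sum>b\<in>Basis. (x \<bullet> b) *\<^sub>R b)"
    by (rule sum.reindex_bij_betw[OF bij_basis_list])
  finally show ?thesis by (simp add: euclidean_representation)
qed

lemma of_list_inner: "(of_list xs :: 'a::euclidean_space) \<bullet> c = (\<Sum>i<DIM('a). xs ! i * (basis_list ! i \<bullet> c))"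
  by (simp add: of_list_def inner_sum_left)

text \<open>Polynomial functions in coordinate-free form.\<close>

inductive pol :: "('a::euclidean_space \<Rightarrow> real) \<Rightarrow> bool" where
  pol_const: "pol (\<lambda>_. c)"
| pol_inner: "pol (\<lambda>x. x \<bullet> c)"
| pol_add: "pol f \<Longrightarrow> pol g \<Longrightarrow> pol (\<lambda>x. f x + g x)"
| pol_mult: "pol f \<Longrightarrow> pol g \<Longrightarrow> pol (\<lambda>x. f x * g x)"

lemma pol_sum: "(\<And>i. i \<in> I \<Longrightarrow> pol (f i)) \<Longrightarrow> pol (\<lambda>x. \<Sum>i\<in>I. f i x)"
  by (induction I rule: infinite_finite_induct) (auto intro: pol.intros)

lemma poly_fun_pol: "pol (p :: 'a::euclidean_space \<Rightarrow> real) \<Longrightarrow> poly_fun DIM('a) (\<lambda>xs. p (of_list xs))"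
proof (induction rule: pol.induct)
  case (pol_inner c)
  show ?case unfolding of_list_inner
    by (intro poly_fun_sum poly_mult poly_const poly_coord) simp
qed (auto intro: poly_fun.intros)

definition polymap :: "('a::euclidean_space \<Rightarrow> 'b::euclidean_space) \<Rightarrow> bool" where
  "polymap f \<longleftrightarrow> (\<forall>c. pol (\<lambda>x. f x \<bullet> c))"

lemma polymap_real: "polymap (f :: 'a::euclidean_space \<Rightarrow> real) \<longleftrightarrow> pol f"
proof
  assume "polymap f"
  then have "pol (\<lambda>x. f x \<bullet> 1)" unfolding polymap_def by blast
  then show "pol f" by simp
next
  assume "pol f"
  then show "polymap f" unfolding polymap_def inner_real_def by (intro allI pol_mult pol_const)
qed

lemma pol_uminus: "pol f \<Longrightarrow> pol (\<lambda>x. - f x)"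
  using pol_mult[OF pol_const[of "-1"]] by simp

lemma polymap_id: "polymap (\<lambda>x. x)"
  unfolding polymap_def by (intro allI pol_inner)

lemma polymap_const: "polymap (\<lambda>x. c)"
  unfolding polymap_def by (intro allI pol_const)

lemma polymap_add: "polymap f \<Longrightarrow> polymap g \<Longrightarrow> polymap (\<lambda>x. f x + g x)"
  unfolding polymap_def inner_add_left by (intro allI pol_add) auto

lemma polymap_uminus: "polymap f \<Longrightarrow> polymap (\<lambda>x. - f x)"
  unfolding polymap_def inner_minus_left by (intro allI pol_uminus) auto

lemma polymap_diff: "polymap f \<Longrightarrow> polymap g \<Longrightarrow> polymap (\<lambda>x. f x - g x)"
  using polymap_add[OF _ polymap_uminus] by simp

lemma polymap_linear:
  assumes "linear L" "polymap f" shows "polymap (\<lambda>x. L (f x))"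
proof -
  have "L (f x) \<bullet> c = f x \<bullet> adjoint L c" for x c by (simp add: adjoint_works[OF assms(1)])
  then show ?thesis using assms(2) unfolding polymap_def by simp
qed

lemma polymap_comp:
  assumes "polymap f" "polymap g" shows "polymap (\<lambda>x. f (g x))"
proof -
  have "pol (\<lambda>x. p (g x))" if "pol p" for p
    using that by (induction rule: pol.induct) (use assms(2) in \<open>auto intro: pol.intros simp: polymap_def\<close>)
  then show ?thesis using assms(1) unfolding polymap_def by blast
qed

lemma polymap_fst: "polymap f \<Longrightarrow> polymap (\<lambda>x. fst (f x))"
  by (rule polymap_linear[OF linear_fst])

lemma polymap_snd: "polymap f \<Longrightarrow> polymap (\<lambda>x. snd (f x))"
  by (rule polymap_linear[OF linear_snd])

lemma polymap_Pair: "polymap f \<Longrightarrow> polymap g \<Longrightarrow> polymap (\<lambda>x. (f x, g x))"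
  unfolding polymap_def inner_prod_def by (auto intro: pol_add)

lemma polymap_scaleR: "polymap r \<Longrightarrow> polymap f \<Longrightarrow> polymap (\<lambda>x. r x *\<^sub>R f x)"
  unfolding polymap_real polymap_def inner_scaleR_left by (intro allI pol_mult) auto

lemma polymap_inner: "polymap f \<Longrightarrow> polymap g \<Longrightarrow> polymap (\<lambda>x. f x \<bullet> g x)"
proof -
  assume "polymap f" "polymap g"
  then have "pol (\<lambda>x. \<Sum>b\<in>Basis. (f x \<bullet> b) * (g x \<bullet> b))"
    unfolding polymap_def by (intro pol_sum pol_mult) auto
  moreover have "(\<lambda>x. f x \<bullet> g x) = (\<lambda>x. \<Sum>b\<in>Basis. (f x \<bullet> b) * (g x \<bullet> b))"
    by (rule ext) (rule euclidean_inner)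
  ultimately show ?thesis unfolding polymap_real by (simp only:)
qed

lemmas polymap_mult = polymap_inner[where 'b=real, unfolded inner_real_def]

lemmas polymap_intros = polymap_id polymap_const polymap_fst polymap_snd polymap_Pair polymap_add
  polymap_diff polymap_uminus polymap_inner polymap_mult polymap_scaleR

lemma gderiv_iff:
  "GDERIV f x :> D \<longleftrightarrow> (\<forall>e. e > 0 \<longrightarrow> (\<exists>d. d > 0 \<and> (\<forall>y. norm (y - x) < d \<longrightarrow> norm (f y - f x - (y - x) \<bullet> D) \<le> e * norm (y - x))))"
  unfolding gderiv_def has_derivative_at_alt by (simp add: bounded_linear_inner_left)

lemma gderiv_unique: "GDERIV f x :> D \<Longrightarrow> GDERIV f x :> E \<Longrightarrow> D = E"
  unfolding gderiv_def by (metis has_derivative_unique vector_eq_ldot)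

lemma grad_eq: "GDERIV f x :> D \<Longrightarrow> grad f x = D"
  unfolding grad_def using gderiv_unique by blast

context tame_structure begin

text \<open>Definable subsets and (below) maps with definable graph of a Euclidean space. The closure rules mirror first-order logic,
  so that definability of a set is read off from the formula that describes it.\<close>

definition dset :: "'a::euclidean_space set \<Rightarrow> bool" where
  "dset S \<longleftrightarrow> {xs. length xs = DIM('a) \<and> of_list xs \<in> S} \<in> \<O> DIM('a)"

lemma dset_list:
  fixes qs :: "('a::euclidean_space \<Rightarrow> real) list"
  assumes "A \<in> \<O> m" "length qs = m" "\<And>q. q \<in> set qs \<Longrightarrow> pol q"
  shows "dset {x. map (\<lambda>q. q x) qs \<in> A}"
proof -
  have "{xs. length xs = DIM('a) \<and> map (\<lambda>q. q xs) (map (\<lambda>q xs. q (of_list xs)) qs) \<in> A} \<in> \<O> DIM('a)"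
    using assms by (intro tame_vimage_poly) (auto intro: poly_fun_pol)
  then show ?thesis unfolding dset_def by (simp add: comp_def)
qed

lemma dset_vimage_poly:
  fixes f :: "'a::euclidean_space \<Rightarrow> 'b::euclidean_space"
  assumes S: "dset S" and f: "polymap f" shows "dset {x. f x \<in> S}"
proof -
  have "dset {x. map (\<lambda>q. q x) (map (\<lambda>b x. f x \<bullet> b) basis_list) \<in> {xs. length xs = DIM('b) \<and> (of_list xs :: 'b) \<in> S}}"
    using S f by (intro dset_list) (auto simp: dset_def length_basis_list polymap_def)
  moreover have "map (\<lambda>q. q x) (map (\<lambda>b x. f x \<bullet> b) basis_list) = to_list (f x)" for x
    by (simp add: to_list_def comp_def)
  ultimately show ?thesis by (simp only: mem_Collect_eq length_to_list of_list_to_list simp_thms)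
qed

lemma dset_not: assumes "dset {x::'a::euclidean_space. P x}" shows "dset {x. \<not> P x}"
proof -
  have "{xs. length xs = DIM('a) \<and> of_list xs \<in> {x. \<not> P x}} =
    {xs. length xs = DIM('a)} - {xs. length xs = DIM('a) \<and> (of_list xs :: 'a) \<in> {x. P x}}" by auto
  then show ?thesis using assms unfolding dset_def by (simp only: tame_compl)
qed

lemma dset_conj:
  assumes "dset {x::'a::euclidean_space. P x}" "dset {x. Q x}" shows "dset {x. P x \<and> Q x}"
proof -
  have "{xs. length xs = DIM('a) \<and> of_list xs \<in> {x. P x \<and> Q x}} =
    {xs. length xs = DIM('a) \<and> (of_list xs :: 'a) \<in> {x. P x}} \<inter> {xs. length xs = DIM('a) \<and> (of_list xs :: 'a) \<in> {x. Q x}}" by auto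
  then show ?thesis using assms unfolding dset_def by (simp only: tame_Int)
qed

lemma dset_disj:
  assumes "dset {x::'a::euclidean_space. P x}" "dset {x. Q x}" shows "dset {x. P x \<or> Q x}"
  using dset_not[OF dset_conj[OF dset_not[OF assms(1)] dset_not[OF assms(2)]]] by simp

lemma dset_imp:
  assumes "dset {x::'a::euclidean_space. P x}" "dset {x. Q x}" shows "dset {x. P x \<longrightarrow> Q x}"
  using dset_disj[OF dset_not[OF assms(1)] assms(2)] by (simp only: imp_conv_disj)

lemma dset_less_poly:
  assumes "polymap f" "polymap g" shows "dset {x::'a::euclidean_space. f x < (g x :: real)}"
proof -
  have "dset {x::'a. map (\<lambda>q. q x) [f, g] \<in> {z. length z = 2 \<and> z ! 0 < z ! 1}}"
    using assms unfolding polymap_real by (intro dset_list[where m=2] tame_poly_less poly_coord) auto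
  then show ?thesis by simp
qed

text \<open>Projection, i.e. the existential quantifier. The coordinates of the two factors are appended, and
  the projection drops the last coordinates one by one.\<close>

lemma dset_fst:
  fixes S :: "('a::euclidean_space \<times> 'b::euclidean_space) set"
  assumes S: "dset S" shows "dset {x. \<exists>y. (x, y) \<in> S}"
proof -
  let ?n = "DIM('a)" and ?m = "DIM('b)"
  define f :: "real list \<Rightarrow> 'a \<times> 'b" where "f = (\<lambda>z. (of_list (take ?n z), of_list (drop ?n z)))"
  define qs where "qs = map (\<lambda>c z. f z \<bullet> c) basis_list"
  have f_inner: "f z \<bullet> c = (\<Sum>i<?n. z ! i * (basis_list ! i \<bullet> fst c)) + (\<Sum>i<?m. z ! (?n + i) * (basis_list ! i \<bullet> snd c))"
    if "length z = ?n + ?m" for z c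
    using that unfolding f_def by (simp add: inner_prod_def of_list_inner)
  define qs where "qs = map (\<lambda>c z. (\<Sum>i<?n. z ! i * (basis_list ! i \<bullet> fst c)) + (\<Sum>i<?m. z ! (?n + i) * (basis_list ! i \<bullet> snd c))) (basis_list :: ('a \<times> 'b) list)"
  have "{z. length z = ?n + ?m \<and> map (\<lambda>q. q z) qs \<in> {xs. length xs = DIM('a \<times> 'b) \<and> of_list xs \<in> S}} \<in> \<O> (?n + ?m)"
  proof (rule tame_vimage_poly)
    show "{xs. length xs = DIM('a \<times> 'b) \<and> of_list xs \<in> S} \<in> \<O> DIM('a \<times> 'b)" using S unfolding dset_def .
    show "length qs = DIM('a \<times> 'b)" unfolding qs_def by (simp add: length_basis_list)
    fix q assume "q \<in> set qs"
    then show "poly_fun (?n + ?m) q" unfolding qs_def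
      by (auto intro!: poly_add poly_fun_sum poly_mult poly_const poly_coord)
  qed
  also have "{z. length z = ?n + ?m \<and> map (\<lambda>q. q z) qs \<in> {xs. length xs = DIM('a \<times> 'b) \<and> of_list xs \<in> S}} =
    {z. length z = ?n + ?m \<and> f z \<in> S}"
  proof (rule Collect_cong, rule conj_cong[OF refl])
    fix z :: "real list" assume z: "length z = ?n + ?m"
    have "map (\<lambda>q. q z) qs = to_list (f z)"
      unfolding qs_def to_list_def using f_inner[OF z] by simp
    then show "map (\<lambda>q. q z) qs \<in> {xs. length xs = DIM('a \<times> 'b) \<and> of_list xs \<in> S} \<longleftrightarrow> f z \<in> S"
      by (simp only: mem_Collect_eq length_to_list of_list_to_list simp_thms)
  qed
  finally have "take ?n ` {z. length z = ?n + ?m \<and> f z \<in> S} \<in> \<O> ?n" by (rule tame_take)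
  also have "take ?n ` {z. length z = ?n + ?m \<and> f z \<in> S} = {xs. length xs = ?n \<and> of_list xs \<in> {x. \<exists>y. (x, y) \<in> S}}" (is "?L = ?R")
  proof
    show "?L \<subseteq> ?R"
    proof
      fix x assume "x \<in> ?L"
      then obtain z where "length z = ?n + ?m" "f z \<in> S" "x = take ?n z" by blast
      then show "x \<in> ?R" unfolding f_def by auto
    qed
    show "?R \<subseteq> ?L"
    proof
      fix x assume "x \<in> ?R"
      then obtain y where xy: "length x = ?n" "(of_list x, y) \<in> S" by blast
      then have "length (x @ to_list y) = ?n + ?m" "f (x @ to_list y) \<in> S" "x = take ?n (x @ to_list y)"
        unfolding f_def by simp_all
      then show "x \<in> ?L" by blast
    qed
  qed
  finally show ?thesis unfolding dset_def .
qed

lemma dset_ex: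
  assumes "dset {p :: 'a::euclidean_space \<times> 'b::euclidean_space. P (fst p) (snd p)}"
  shows "dset {x. \<exists>y. P x y}"
  using dset_fst[OF assms] by simp

lemma dset_all:
  assumes "dset {p :: 'a::euclidean_space \<times> 'b::euclidean_space. P (fst p) (snd p)}"
  shows "dset {x. \<forall>y. P x y}"
  using dset_not[OF dset_ex[of "\<lambda>x y. \<not> P x y"], OF dset_not[OF assms]] by simp

lemma dset_ball:
  assumes "finite I" "\<And>i. i \<in> I \<Longrightarrow> dset {x::'a::euclidean_space. P i x}"
  shows "dset {x. \<forall>i\<in>I. P i x}"
  using assms
proof (induction I)
  case empty
  show ?case using dset_less_poly[OF polymap_const[of 0] polymap_const[of 1]] by simp
next
  case (insert i I)
  then have "dset {x. P i x \<and> (\<forall>i\<in>I. P i x)}" by (intro dset_conj) auto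
  then show ?case by simp
qed

lemma dset_eq_real_poly:
  assumes "polymap f" "polymap g" shows "dset {x::'a::euclidean_space. f x = (g x :: real)}"
proof -
  have "dset {x. \<not> f x < g x \<and> \<not> g x < f x}" using assms by (intro dset_conj dset_not dset_less_poly)
  moreover have "{x. \<not> f x < g x \<and> \<not> g x < f x} = {x. f x = g x}" by auto
  ultimately show ?thesis by simp
qed

lemma dset_eq_poly:
  fixes f g :: "'a::euclidean_space \<Rightarrow> 'b::euclidean_space"
  assumes "polymap f" "polymap g" shows "dset {x. f x = g x}"
proof -
  have "dset {x. \<forall>b\<in>Basis. f x \<bullet> b = g x \<bullet> b}"
    using assms by (intro dset_ball dset_eq_real_poly polymap_inner polymap_const) auto
  then show ?thesis by (simp only: euclidean_eq_iff[symmetric])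
qed

definition dmap :: "('a::euclidean_space \<Rightarrow> 'b::euclidean_space) \<Rightarrow> bool" where
  "dmap f \<longleftrightarrow> dset {p. snd p = f (fst p)}"

lemma dmap_poly: "polymap f \<Longrightarrow> dmap f"
  unfolding dmap_def
  by (rule dset_eq_poly[OF polymap_snd[OF polymap_id] polymap_comp[OF _ polymap_fst[OF polymap_id]]])

lemma dset_vimage:
  assumes S: "dset S" and f: "dmap f" shows "dset {x. f x \<in> S}"
proof -
  have "dset {p. snd p \<in> S \<and> p \<in> {p. snd p = f (fst p)}}"
    using f unfolding dmap_def by (intro dset_conj dset_vimage_poly[OF S] dset_vimage_poly[of "{p. snd p = f (fst p)}"] polymap_intros)
  then have "dset {x. \<exists>y. y \<in> S \<and> y = f x}" by (intro dset_ex) simp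
  then show ?thesis by simp
qed

lemma dmap_Pair:
  assumes f: "dmap f" and g: "dmap g" shows "dmap (\<lambda>x. (f x, g x))"
proof -
  have "dset {p. (fst p, fst (snd p)) \<in> {p. snd p = f (fst p)} \<and> (fst p, snd (snd p)) \<in> {p. snd p = g (fst p)}}"
    using assms unfolding dmap_def
    by (intro dset_conj dset_vimage_poly[of "{p. snd p = f (fst p)}"] dset_vimage_poly[of "{p. snd p = g (fst p)}"] polymap_intros)
  then show ?thesis unfolding dmap_def by (simp add: prod_eq_iff)
qed

lemma dmap_comp:
  assumes f: "dmap f" and g: "dmap g" shows "dmap (\<lambda>x. f (g x))"
proof -
  have "dset {q. (fst (fst q), snd q) \<in> {p. snd p = g (fst p)} \<and> (snd q, snd (fst q)) \<in> {p. snd p = f (fst p)}}"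
    using assms unfolding dmap_def
    by (intro dset_conj dset_vimage_poly[of "{p. snd p = f (fst p)}"] dset_vimage_poly[of "{p. snd p = g (fst p)}"] polymap_intros)
  then have "dset {p. \<exists>y. y = g (fst p) \<and> snd p = f y}" by (intro dset_ex) simp
  then show ?thesis unfolding dmap_def by simp
qed

lemma dmap_id: "dmap (\<lambda>x. x)" and dmap_const: "dmap (\<lambda>x. c)"
  by (intro dmap_poly polymap_intros)+

lemma dmap_poly_comp: "polymap g \<Longrightarrow> dmap f \<Longrightarrow> dmap (\<lambda>x. g (f x))"
  by (rule dmap_comp[OF dmap_poly])

lemma dmap_fst: "dmap f \<Longrightarrow> dmap (\<lambda>x. fst (f x))" and dmap_snd: "dmap f \<Longrightarrow> dmap (\<lambda>x. snd (f x))"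
  and dmap_uminus: "dmap h \<Longrightarrow> dmap (\<lambda>x. - h x)"
  by (erule dmap_poly_comp[rotated], intro polymap_intros)+

lemma dmap_add: assumes "dmap f" "dmap g" shows "dmap (\<lambda>x. f x + g x)"
  using dmap_poly_comp[OF _ dmap_Pair[OF assms], of "\<lambda>p. fst p + snd p"] by (simp add: polymap_intros)

lemma dmap_diff: assumes "dmap f" "dmap g" shows "dmap (\<lambda>x. f x - g x)"
  using dmap_poly_comp[OF _ dmap_Pair[OF assms], of "\<lambda>p. fst p - snd p"] by (simp add: polymap_intros)

lemma dmap_inner: assumes "dmap f" "dmap g" shows "dmap (\<lambda>x. f x \<bullet> g x)"
  using dmap_poly_comp[OF _ dmap_Pair[OF assms], of "\<lambda>p. fst p \<bullet> snd p"] by (simp add: polymap_intros)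

lemma dmap_mult: fixes f g :: "_ \<Rightarrow> real" assumes "dmap f" "dmap g" shows "dmap (\<lambda>x. f x * g x)"
  using dmap_inner[OF assms] by simp

lemma dmap_scaleR: assumes "dmap f" "dmap g" shows "dmap (\<lambda>x. f x *\<^sub>R g x)"
  using dmap_poly_comp[OF _ dmap_Pair[OF assms], of "\<lambda>p. fst p *\<^sub>R snd p"] by (simp add: polymap_intros)

lemma dset_less: assumes "dmap f" "dmap g" shows "dset {x. f x < (g x :: real)}"
proof -
  have "dset {p. fst p < (snd p :: real)}" by (intro dset_less_poly polymap_intros)
  from dset_vimage[OF this dmap_Pair[OF assms]] show ?thesis by simp
qed

lemma dset_le: assumes "dmap f" "dmap g" shows "dset {x. f x \<le> (g x :: real)}"
  using dset_not[OF dset_less[OF assms(2,1)]] by (simp add: not_less)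

lemma dset_eq: assumes "dmap f" "dmap g" shows "dset {x. f x = g x}"
proof -
  have "dset {p. fst p = (snd p :: 'b)}" by (intro dset_eq_poly polymap_intros)
  from dset_vimage[OF this dmap_Pair[OF assms]] show ?thesis by simp
qed

lemma dmap_norm: assumes "dmap f" shows "dmap (\<lambda>x. norm (f x))"
proof -
  have "dmap (norm :: 'b \<Rightarrow> real)"
  proof -
    have "dset {p. 0 \<le> snd p \<and> snd p * snd p = fst p \<bullet> (fst p :: 'b)}"
      by (intro dset_conj dset_le dset_eq dmap_poly polymap_intros)
    moreover have "(0 \<le> r \<and> r * r = x \<bullet> x) \<longleftrightarrow> r = norm x" for r and x :: 'b
      by (metis dot_square_norm norm_ge_zero power2_eq_square power2_eq_imp_eq)
    ultimately show ?thesis unfolding dmap_def by simp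
  qed
  then show ?thesis using assms by (rule dmap_comp)
qed

lemmas dmap_intros = dmap_id dmap_const dmap_fst dmap_snd dmap_uminus dmap_Pair dmap_add dmap_diff dmap_inner
  dmap_mult dmap_scaleR dmap_norm

lemmas dset_intros = dset_not dset_conj dset_disj dset_imp dset_ex dset_all dset_less dset_le dset_eq

text \<open>The epsilon-delta definition of the gradient is a first-order formula in \<open>f\<close>.\<close>

lemma dset_gderiv:
  fixes f :: "'c::euclidean_space \<Rightarrow> 'a::euclidean_space \<Rightarrow> real"
  assumes f: "dmap (\<lambda>p. f (fst p) (snd p))" and c: "dmap c" and x: "dmap x" and D: "dmap D"
  shows "dset {p. GDERIV (f (c p)) (x p) :> D p}"
proof -
  have f': "dmap (\<lambda>p. f (u p) (v p))" if "dmap u" "dmap v" for u v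
    using dmap_comp[OF f dmap_Pair[OF that]] by simp
  have "dset {q::(('c \<times> 'a) \<times> 'a). GDERIV (f (fst (fst q))) (snd (fst q)) :> snd q}"
    unfolding gderiv_iff by (intro dset_intros f' dmap_intros)
  from dset_vimage[OF this dmap_Pair[OF dmap_Pair[OF c x] D]] show ?thesis by simp
qed

text \<open>Where there is no gradient, \<open>grad\<close> has a fixed default value, so its graph is definable on the whole space.\<close>

lemma dmap_grad:
  fixes f :: "'c::euclidean_space \<Rightarrow> 'a::euclidean_space \<Rightarrow> real"
  assumes f: "dmap (\<lambda>p. f (fst p) (snd p))" and c: "dmap c" and x: "dmap x"
  shows "dmap (\<lambda>p. grad (f (c p)) (x p))"
proof -
  define z :: 'a where "z = (THE D. False)"
  have *: "D = grad g u \<longleftrightarrow> (GDERIV g u :> D) \<or> (\<not> (\<exists>D. GDERIV g u :> D) \<and> D = z)" for g :: "'a \<Rightarrow> real" and u D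
  proof (cases "\<exists>D. GDERIV g u :> D")
    case True
    then show ?thesis using grad_eq by metis
  next
    case False
    then have e: "gderiv g u = (\<lambda>D. False)" by (intro ext) blast
    have "grad g u = z" unfolding grad_def z_def e ..
    with False show ?thesis by blast
  qed
  have cx: "dmap (\<lambda>p. c (fst p))" "dmap (\<lambda>p. x (fst p))" "dmap (\<lambda>p. c (fst (fst p)))" "dmap (\<lambda>p. x (fst (fst p)))"
    using dmap_comp[OF c dmap_fst[OF dmap_id]] dmap_comp[OF x dmap_fst[OF dmap_id]]
      dmap_comp[OF c dmap_fst[OF dmap_fst[OF dmap_id]]] dmap_comp[OF x dmap_fst[OF dmap_fst[OF dmap_id]]] by auto
  show ?thesis unfolding dmap_def *
    by (intro dset_intros dset_gderiv[OF f] cx dmap_intros)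
qed

end

section \<open>Genericity\<close>

context tame_structure begin

text \<open>The coordinate map to the product space preserves Lebesgue measure and frontiers, so \<open>list_null_frontier\<close> applies.\<close>

lemma null_frontier:
  fixes S :: "'a::euclidean_space set"
  assumes S: "dset S" shows "frontier S \<in> null_sets lborel"
proof -
  interpret product_sigma_finite "\<lambda>_::nat. lborel :: real measure" ..
  let ?n = "DIM('a)"
  define bl where "bl = (basis_list :: 'a list)"
  note bij = bij_basis_list[where 'a='a, folded bl_def]
  define A where "A = {xs. length xs = ?n \<and> (of_list xs :: 'a) \<in> S}"
  define T where "T = (\<lambda>x::'a. \<lambda>i\<in>{..<?n}. x \<bullet> bl ! i)"
  have null: "fun_set ?n (list_frontier ?n A) \<in> null_sets (cube_measure ?n)"
    using list_null_frontier S unfolding A_def dset_def list_null_def by blast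
  have T: "T \<in> measurable lborel (cube_measure ?n)"
    unfolding T_def by (intro measurable_restrict) simp
  have "distr lborel (cube_measure ?n) T = cube_measure ?n"
  proof (rule PiM_eqI)
    fix B :: "nat \<Rightarrow> real set" assume B: "\<And>i. i \<in> {..<?n} \<Longrightarrow> B i \<in> sets lborel"
    define idx where "idx = inv_into {..<?n} ((!) bl)"
    have idx: "idx (bl ! i) = i" if "i < ?n" for i
      unfolding idx_def using that bij by (intro inv_into_f_f) (auto simp: bij_betw_def)
    have idx_lt: "idx b < ?n" if "b \<in> Basis" for b
    proof -
      have "b \<in> (!) bl ` {..<?n}" using bij that by (simp add: bij_betw_def)
      then obtain i where "i \<in> {..<?n}" "b = bl ! i" by (elim imageE)
      then show ?thesis using idx by simp
    qed
    have PB: "Pi\<^sub>E {..<?n} B \<in> sets (cube_measure ?n)" using B by (intro sets_PiM_I_finite) auto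
    have "indicator (T -` Pi\<^sub>E {..<?n} B \<inter> space lborel) x = (\<Prod>b\<in>Basis. indicator (B (idx b)) (x \<bullet> b) :: ennreal)" for x
    proof -
      have "(\<Prod>b\<in>Basis. indicator (B (idx b)) (x \<bullet> b) :: ennreal) = (\<Prod>i<?n. indicator (B (idx (bl ! i))) (x \<bullet> (bl ! i)))"
        by (rule prod.reindex_bij_betw[OF bij, symmetric])
      also have "\<dots> = (\<Prod>i<?n. indicator (B i) (x \<bullet> (bl ! i)))" by (rule prod.cong) (auto simp: idx)
      also have "\<dots> = indicator (T -` Pi\<^sub>E {..<?n} B \<inter> space lborel) x"
      proof (cases "\<forall>i<?n. x \<bullet> bl ! i \<in> B i")
        case True
        then show ?thesis unfolding T_def by (auto simp: indicator_def PiE_iff)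
      next
        case False
        then obtain i where i: "i < ?n" "x \<bullet> bl ! i \<notin> B i" by blast
        then have "(\<Prod>i<?n. indicator (B i) (x \<bullet> (bl ! i)) :: ennreal) = 0" by (intro prod_zero bexI[of _ i]) auto
        moreover have "T x \<notin> Pi\<^sub>E {..<?n} B" using i unfolding T_def by (auto simp: PiE_iff)
        ultimately show ?thesis by simp
      qed
      finally show ?thesis ..
    qed
    then have "emeasure lborel (T -` Pi\<^sub>E {..<?n} B \<inter> space lborel) = (\<integral>\<^sup>+x. (\<Prod>b\<in>Basis. indicator (B (idx b)) (x \<bullet> b)) \<partial>lborel)"
      using nn_integral_indicator[OF measurable_sets[OF T PB]] by (simp only:)
    also have "\<dots> = (\<Prod>b\<in>Basis. (\<integral>\<^sup>+t. indicator (B (idx b)) t \<partial>lborel))"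
      using B idx_lt by (intro nn_integral_lborel_prod) auto
    also have "\<dots> = (\<Prod>b\<in>Basis. emeasure lborel (B (idx b)))"
      using B idx_lt by (intro prod.cong) auto
    also have "\<dots> = (\<Prod>i<?n. emeasure lborel (B (idx (bl ! i))))"
      by (rule prod.reindex_bij_betw[OF bij, symmetric])
    also have "\<dots> = (\<Prod>i<?n. emeasure lborel (B i))" by (rule prod.cong) (auto simp: idx)
    finally show "emeasure (distr lborel (cube_measure ?n) T) (Pi\<^sub>E {..<?n} B) = (\<Prod>i<?n. emeasure lborel (B i))"
      using PB by (simp add: emeasure_distr[OF T])
  qed simp_all
  then have 1: "T -` fun_set ?n (list_frontier ?n A) \<inter> space lborel \<in> null_sets lborel"
    using null null_sets_distr_iff[OF T] by metis
  have "frontier S \<subseteq> T -` fun_set ?n (list_frontier ?n A) \<inter> space lborel"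
  proof
    fix x assume x: "x \<in> frontier S"
    have "to_list x \<in> list_frontier ?n A"
      unfolding list_frontier_iff
    proof (intro conjI allI impI)
      show "length (to_list x) = ?n" by simp
    next
      fix e :: real assume "e > 0"
      then obtain y z where yz: "y \<in> S" "dist x y < e" "z \<notin> S" "dist x z < e"
        using x unfolding frontier_straddle by blast
      have near: "\<forall>i<?n. \<bar>to_list w ! i - to_list x ! i\<bar> < e" if "dist x w < e" for w
      proof (intro allI impI)
        fix i assume i: "i < ?n"
        have "\<bar>to_list w ! i - to_list x ! i\<bar> = \<bar>(w - x) \<bullet> basis_list ! i\<bar>"
          using i by (simp add: to_list_nth inner_diff_left)
        also have "\<dots> \<le> norm (w - x)" using basis_list_nth[OF i] by (rule Basis_le_norm)
        finally show "\<bar>to_list w ! i - to_list x ! i\<bar> < e" using that by (simp add: dist_norm norm_minus_commute)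
      qed
      show "\<exists>y. length y = ?n \<and> (\<forall>i<?n. \<bar>y ! i - to_list x ! i\<bar> < e) \<and> y \<in> A"
        using yz near[of y] by (intro exI[of _ "to_list y"]) (simp add: A_def)
      show "\<exists>y. length y = ?n \<and> (\<forall>i<?n. \<bar>y ! i - to_list x ! i\<bar> < e) \<and> y \<notin> A"
        using yz near[of z] by (intro exI[of _ "to_list z"]) (simp add: A_def)
    qed
    moreover have "map (T x) [0..<?n] = to_list x"
      by (rule nth_equalityI) (auto simp: T_def to_list_nth bl_def)
    ultimately show "x \<in> T -` fun_set ?n (list_frontier ?n A) \<inter> space lborel"
      unfolding fun_set_def by (simp add: T_def)
  qed
  then show ?thesis by (intro null_sets_subset[OF 1]) simp_all
qed

text \<open>The workhorse of the a.e. differentiability proof. A property that is expressed by countably many definable conditions and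
  holds at a point holds, for almost every point, in a whole neighbourhood.\<close>

lemma generic_interior:
  fixes \<F> :: "'a::euclidean_space set set"
  assumes "countable \<F>" "\<And>S. S \<in> \<F> \<Longrightarrow> dset S"
  shows "AE y in lborel. \<forall>S\<in>\<F>. y \<in> S \<longrightarrow> y \<in> interior S"
proof (rule AE_I')
  show "(\<Union>S\<in>\<F>. frontier S) \<in> null_sets lborel"
    using assms null_frontier by (intro null_sets_UN') auto
  show "{y \<in> space lborel. \<not> (\<forall>S\<in>\<F>. y \<in> S \<longrightarrow> y \<in> interior S)} \<subseteq> (\<Union>S\<in>\<F>. frontier S)"
  proof
    fix y assume "y \<in> {y \<in> space lborel. \<not> (\<forall>S\<in>\<F>. y \<in> S \<longrightarrow> y \<in> interior S)}"
    then obtain S where "S \<in> \<F>" "y \<in> S" "y \<notin> interior S" by blast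
    then show "y \<in> (\<Union>S\<in>\<F>. frontier S)"
      using closure_subset[of S] unfolding frontier_def by (intro UN_I[of S]) auto
  qed
qed

text \<open>Continuity at \<open>y\<close> says that \<open>y\<close> is interior to the preimages of the balls with rational radii and centres in a
  countable dense set that contain it.\<close>

lemma generic_continuity:
  fixes f :: "'a::euclidean_space \<Rightarrow> 'b::euclidean_space"
  assumes f: "dmap f" shows "AE y in lborel. isCont f y"
proof -
  obtain D :: "'b set" where D: "countable D" "\<And>U. open U \<Longrightarrow> U \<noteq> {} \<Longrightarrow> \<exists>d\<in>D. d \<in> U"
    using countable_dense_exists by blast
  define \<F> where "\<F> = (\<Union>c\<in>D. \<Union>k::nat. {{y. norm (f y - c) < inverse (real (Suc k))}})"
  have "AE y in lborel. \<forall>S\<in>\<F>. y \<in> S \<longrightarrow> y \<in> interior S"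
  proof (rule generic_interior)
    show "countable \<F>" unfolding \<F>_def using D by (intro countable_UN) auto
    fix S assume "S \<in> \<F>"
    then show "dset S" unfolding \<F>_def by (auto intro!: dset_intros dmap_intros f)
  qed
  then show ?thesis
  proof eventually_elim
    case (elim y)
    show "isCont f y"
      unfolding isCont_def
    proof (rule tendstoI)
      fix e :: real assume "e > 0"
      then obtain k where k: "inverse (real (Suc k)) < e / 2" using reals_Archimedean[of "e/2"] by auto
      have "\<exists>d\<in>D. d \<in> ball (f y) (inverse (real (Suc k)))" by (rule D) auto
      then obtain c where c: "c \<in> D" "norm (f y - c) < inverse (real (Suc k))" by (auto simp: dist_norm)
      define V where "V = {y. norm (f y - c) < inverse (real (Suc k))}"
      have "V \<in> \<F>" unfolding \<F>_def V_def using c(1) by (intro UN_I[of c] UN_I[of k]) simp_all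
      moreover have "y \<in> V" using c(2) by (simp add: V_def)
      ultimately have "y \<in> interior V" using elim by simp
      then have "\<forall>\<^sub>F z in at y. z \<in> interior V"
        by (rule eventually_at_in_open'[OF open_interior])
      then show "\<forall>\<^sub>F z in at y. dist (f z) (f y) < e"
      proof eventually_elim
        case (elim z)
        then have "z \<in> V" using interior_subset[of V] by (rule rev_subsetD)
        then have "norm (f z - c) < inverse (real (Suc k))" by (simp add: V_def)
        then show ?case using c(2) k dist_triangle2[of "f z" "f y" c] by (simp add: dist_norm)
      qed
    qed
  qed
qed

end

lemma inj_list_of_vec: "list_of_vec x = list_of_vec y \<longleftrightarrow> x = (y :: real^'m)"
proof
  assume eq: "list_of_vec x = list_of_vec y"
  show "x = y"
  proof (rule vec_eq_iff[THEN iffD2], rule allI)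
    fix k :: 'm
    obtain i where "i < CARD('m)" "from_nat_into UNIV i = k"
      using bij_betw_from_nat_into_finite[of "UNIV :: 'm set"] unfolding bij_betw_def by (metis UNIV_I finite image_iff lessThan_iff)
    then show "x $ k = y $ k" using arg_cong[OF eq, of "\<lambda>l. l ! i"] by (simp add: list_of_vec_def)
  qed
qed simp

lemma length_list_of_vec [simp]: "length (list_of_vec (x :: real^'m)) = CARD('m)"
  by (simp add: list_of_vec_def)

lemma polymap_nth: "polymap (f :: _ \<Rightarrow> real^'m) \<Longrightarrow> polymap (\<lambda>x. f x $ k)"
  using polymap_inner[of f "\<lambda>_. axis k 1"] by (simp add: inner_axis polymap_const)

context tame_structure begin

text \<open>The enumerations of the coordinates in \<open>list_of_vec\<close> and \<open>basis_list\<close> differ by a permutation, which is a polynomial map.\<close>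

lemma dset_definable_set:
  assumes "definable_set \<O> (A :: (real^'m) set)" shows "dset A"
proof -
  have "dset {x :: real^'m. map (\<lambda>q. q x) (map (\<lambda>i x. x $ from_nat_into UNIV i) [0..<CARD('m)]) \<in> list_of_vec ` A}"
    using assms unfolding definable_set_def
    by (intro dset_list) (auto simp: polymap_real[symmetric] intro!: polymap_nth polymap_id)
  also have "{x :: real^'m. map (\<lambda>q. q x) (map (\<lambda>i x. x $ from_nat_into UNIV i) [0..<CARD('m)]) \<in> list_of_vec ` A} = A"
  proof -
    have "map (\<lambda>q. q x) (map (\<lambda>i x. x $ from_nat_into UNIV i) [0..<CARD('m)]) = list_of_vec x" for x :: "real^'m"
      by (simp add: list_of_vec_def)
    then show ?thesis by (auto simp: image_iff inj_list_of_vec)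
  qed
  finally show ?thesis .
qed

lemma dmap_definable_loss:
  fixes F :: "real^'p \<Rightarrow> real^'n \<Rightarrow> real"
  assumes "definable_loss \<O> F" shows "dmap (\<lambda>p. F (fst p) (snd p))"
proof -
  let ?A = "{list_of_vec \<beta> @ list_of_vec y @ [F \<beta> y] | \<beta> y. True}"
  let ?qs = "map (\<lambda>i p. fst (fst p) $ from_nat_into UNIV i) [0..<CARD('p)] @
    map (\<lambda>i p. snd (fst p) $ from_nat_into UNIV i) [0..<CARD('n)] @ [snd]"
  have "dset {p :: ((real^'p) \<times> (real^'n)) \<times> real. map (\<lambda>q. q p) ?qs \<in> ?A}"
    using assms unfolding definable_loss_def
    by (intro dset_list[where m="CARD('p) + CARD('n) + 1"])
      (auto simp: polymap_real[symmetric] intro!: polymap_nth polymap_intros)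
  also have "{p :: ((real^'p) \<times> (real^'n)) \<times> real. map (\<lambda>q. q p) ?qs \<in> ?A} = {p. snd p = F (fst (fst p)) (snd (fst p))}"
  proof -
    have "map (\<lambda>q. q p) ?qs = list_of_vec (fst (fst p)) @ list_of_vec (snd (fst p)) @ [snd p]"
      for p :: "((real^'p) \<times> (real^'n)) \<times> real"
      by (simp add: list_of_vec_def comp_def)
    moreover have "list_of_vec b @ list_of_vec y @ [r] \<in> ?A \<longleftrightarrow> r = F b y" for b :: "real^'p" and y :: "real^'n" and r
      by (auto simp: inj_list_of_vec append_eq_append_conv)
    ultimately show ?thesis by (simp only:)
  qed
  finally show ?thesis unfolding dmap_def .
qed

lemma dset_definable_ext:
  fixes J :: "real^'p \<Rightarrow> ereal"
  assumes "definable_ext \<O> J" shows "dset {p. J (fst p) = ereal (snd p)}"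
proof -
  let ?A = "{list_of_vec \<beta> @ [r] | \<beta> r. J \<beta> = ereal r}"
  let ?qs = "map (\<lambda>i p. fst p $ from_nat_into UNIV i) [0..<CARD('p)] @ [snd]"
  have "dset {p :: (real^'p) \<times> real. map (\<lambda>q. q p) ?qs \<in> ?A}"
    using assms unfolding definable_ext_def
    by (intro dset_list[where m="CARD('p) + 1"])
      (auto simp: polymap_real[symmetric] intro!: polymap_nth polymap_intros)
  also have "{p :: (real^'p) \<times> real. map (\<lambda>q. q p) ?qs \<in> ?A} = {p. J (fst p) = ereal (snd p)}"
  proof -
    have "map (\<lambda>q. q p) ?qs = list_of_vec (fst p) @ [snd p]" for p :: "(real^'p) \<times> real"
      by (simp add: list_of_vec_def comp_def)
    moreover have "list_of_vec b @ [r] \<in> ?A \<longleftrightarrow> J b = ereal r" for b :: "real^'p" and r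
      by (auto simp: inj_list_of_vec)
    ultimately show ?thesis by (simp only:)
  qed
  finally show ?thesis .
qed

end

section \<open>Subdifferentials and the transition space\<close>

lemma subdiff_finite:
  assumes "proper_ext J" "v \<in> subdiff J b" shows "\<exists>r. J b = ereal r"
proof -
  obtain x where x: "J x \<noteq> \<infinity>" using assms(1) unfolding proper_ext_def by blast
  have "J b + ereal (v \<bullet> (x - b)) \<le> J x" using assms(2) unfolding subdiff_def by blast
  then have "J b \<noteq> \<infinity>" using x by auto
  moreover have "J b \<noteq> -\<infinity>" using assms(1) unfolding proper_ext_def by blast
  ultimately show ?thesis by (cases "J b") auto
qed

text \<open>A description by real numbers only, as needed for a first-order formula over the graph of \<open>J\<close>.\<close>

lemma subdiff_iff:
  assumes "proper_ext J"
  shows "v \<in> subdiff J b \<longleftrightarrow> (\<exists>r. J b = ereal r \<and> (\<forall>z s. J z = ereal s \<longrightarrow> r + v \<bullet> (z - b) \<le> s))"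
proof
  assume v: "v \<in> subdiff J b"
  then obtain r where r: "J b = ereal r" using subdiff_finite[OF assms] by blast
  have "r + v \<bullet> (z - b) \<le> s" if "J z = ereal s" for z s
  proof -
    have "J b + ereal (v \<bullet> (z - b)) \<le> J z" using v unfolding subdiff_def by blast
    then show ?thesis unfolding r that by simp
  qed
  with r show "\<exists>r. J b = ereal r \<and> (\<forall>z s. J z = ereal s \<longrightarrow> r + v \<bullet> (z - b) \<le> s)" by blast
next
  assume "\<exists>r. J b = ereal r \<and> (\<forall>z s. J z = ereal s \<longrightarrow> r + v \<bullet> (z - b) \<le> s)"
  then obtain r where r: "J b = ereal r" "\<And>z s. J z = ereal s \<Longrightarrow> r + v \<bullet> (z - b) \<le> s" by blast
  have "J b + ereal (v \<bullet> (z - b)) \<le> J z" for z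
  proof (cases "J z")
    case (real s)
    then show ?thesis using r(2)[OF real] r(1) by simp
  next
    case MInf
    then show ?thesis using assms unfolding proper_ext_def by blast
  qed simp
  then show "v \<in> subdiff J b" unfolding subdiff_def by blast
qed

lemma closed_subdiff: assumes "proper_ext J" shows "closed (subdiff J b)"
proof (cases "\<exists>r. J b = ereal r")
  case True
  then obtain r where r: "J b = ereal r" by blast
  have "subdiff J b = (\<Inter>p\<in>{p. J (fst p) = ereal (snd p)}. {v. r + v \<bullet> (fst p - b) \<le> snd p})"
    by (rule set_eqI) (auto simp: subdiff_iff[OF assms] r)
  also have "closed \<dots>" by (intro closed_INT ballI closed_Collect_le continuous_intros)
  finally show ?thesis .
next
  case False
  then have "subdiff J b = {}" using subdiff_finite[OF assms] by blast
  then show ?thesis by simp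
qed

lemma convex_subdiff: assumes "proper_ext J" shows "convex (subdiff J b)"
proof (cases "\<exists>r. J b = ereal r")
  case True
  then obtain r where r: "J b = ereal r" by blast
  show ?thesis
  proof (rule convexI)
    fix x y u v assume xy: "x \<in> subdiff J b" "y \<in> subdiff J b" and uv: "0 \<le> u" "0 \<le> v" "u + v = (1::real)"
    have "r + (u *\<^sub>R x + v *\<^sub>R y) \<bullet> (z - b) \<le> s" if "J z = ereal s" for z s
    proof -
      have "r + x \<bullet> (z - b) \<le> s" "r + y \<bullet> (z - b) \<le> s"
        using xy that unfolding subdiff_iff[OF assms] r by auto
      then have "u * (r + x \<bullet> (z - b)) + v * (r + y \<bullet> (z - b)) \<le> u * s + v * s"
        using uv by (intro add_mono mult_left_mono) auto
      moreover have "u * (r + x \<bullet> (z - b)) + v * (r + y \<bullet> (z - b)) = (u + v) * r + (u *\<^sub>R x + v *\<^sub>R y) \<bullet> (z - b)"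
        by (simp add: inner_add_left distrib_left distrib_right)
      moreover have "u * s + v * s = (u + v) * s" by (simp add: distrib_right)
      ultimately show ?thesis using uv(3) by simp
    qed
    then show "u *\<^sub>R x + v *\<^sub>R y \<in> subdiff J b" unfolding subdiff_iff[OF assms] r by blast
  qed
next
  case False
  then have "subdiff J b = {}" using subdiff_finite[OF assms] by blast
  then show ?thesis by simp
qed

text \<open>For closed convex sets, the relative interior consists of the points beyond which every segment of the set can be
  prolonged. This description quantifies over points only, so it is first-order.\<close>

lemma rel_frontier_iff_closed_convex:
  fixes S :: "'a::euclidean_space set"
  assumes "closed S" "convex S"
  shows "x \<in> rel_frontier S \<longleftrightarrow> x \<in> S \<and> \<not> (\<forall>z. z \<in> S \<longrightarrow> (\<exists>e. e > 1 \<and> (1 - e) *\<^sub>R z + e *\<^sub>R x \<in> S))"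
proof (cases "S = {}")
  case False
  then show ?thesis unfolding rel_frontier_def closure_closed[OF assms(1)]
    using convex_rel_interior_iff[OF assms(2) False, of x] by blast
qed (simp add: rel_frontier_def)

context tame_structure begin

lemma dset_subdiff:
  assumes J: "dset {p. J (fst p) = ereal (snd p)}" and proper: "proper_ext J"
    and f: "dmap f" and g: "dmap g"
  shows "dset {x. f x \<in> subdiff J (g x)}"
proof -
  have J': "dset {x. J (u x) = ereal (w x)}" if "dmap u" "dmap w" for u w
    using dset_vimage[OF J dmap_Pair[OF that]] by simp
  have "dset {p. snd p \<in> subdiff J (fst p)}"
    unfolding subdiff_iff[OF proper] by (intro dset_intros J' dmap_intros)
  from dset_vimage[OF this dmap_Pair[OF g f]] show ?thesis by simp
qed

lemma dset_rel_frontier_subdiff: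
  assumes J: "dset {p. J (fst p) = ereal (snd p)}" and proper: "proper_ext J"
    and f: "dmap f" and g: "dmap g"
  shows "dset {x. f x \<in> rel_frontier (subdiff J (g x))}"
proof -
  have "dset {p. snd p \<in> rel_frontier (subdiff J (fst p))}"
    unfolding rel_frontier_iff_closed_convex[OF closed_subdiff[OF proper] convex_subdiff[OF proper]]
    by (intro dset_intros dset_subdiff[OF J proper] dmap_intros)
  from dset_vimage[OF this dmap_Pair[OF g f]] show ?thesis by simp
qed

lemma dmap_grad_loss:
  assumes F: "dmap (\<lambda>p. F (fst p) (snd p))" and "dmap b" "dmap y"
  shows "dmap (\<lambda>x. grad (\<lambda>b. F b (y x)) (b x))"
proof -
  have "dmap (\<lambda>p. F (snd p) (fst p))"
    using dmap_comp[OF F dmap_Pair[OF dmap_snd[OF dmap_id] dmap_fst[OF dmap_id]]] by simp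
  from dmap_grad[OF this assms(3,2)] show ?thesis .
qed

end

text \<open>Each of the finitely many sets whose boundary enters the transition space is definable, as the projection of a set given by
  a first-order formula.\<close>

theorem transition_space_null:
  fixes X :: "real^'p^'n"
  assumes O: "cond_O X F0 J Mf" and proper: "proper_ext J" and fin: "finite (manifolds J Mf)"
  shows "transition_space X F0 J Mf \<in> null_sets lborel"
proof -
  obtain \<O> where *: "o_minimal \<O>" "definable_loss \<O> (loss X F0)" "definable_ext \<O> J"
    "\<And>M. M \<in> manifolds J Mf \<Longrightarrow> definable_set \<O> (tilde_manifold J Mf M)"
    using O unfolding cond_O_def by blast
  interpret tame_structure \<O> by (standard, rule *(1))
  note F = dmap_definable_loss[OF *(2)]
  note J = dset_definable_ext[OF *(3)]
  have "frontier (fst ` {(y, \<beta>). \<beta> \<in> tilde_manifold J Mf M \<and>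
                 - grad (\<lambda>b. loss X F0 b y) \<beta> \<in> rel_frontier (subdiff J \<beta>)}) \<in> null_sets lborel"
    if M: "M \<in> manifolds J Mf" for M
  proof (rule null_frontier)
    have t: "dset {x. f x \<in> tilde_manifold J Mf M}" if "dmap f" for f
      by (rule dset_vimage[OF dset_definable_set[OF *(4)[OF M]] that])
    have "dset {y. \<exists>\<beta>. \<beta> \<in> tilde_manifold J Mf M \<and> - grad (\<lambda>b. loss X F0 b y) \<beta> \<in> rel_frontier (subdiff J \<beta>)}"
      by (intro dset_intros t dset_rel_frontier_subdiff[OF J proper] dmap_grad_loss[OF F] dmap_intros)
    moreover have "fst ` {(y, \<beta>). \<beta> \<in> T \<and> Q y \<beta>} = {y. \<exists>\<beta>. \<beta> \<in> T \<and> Q y \<beta>}" for T :: "(real^'p) set" and Q :: "real^'n \<Rightarrow> _"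
      by force
    ultimately show "dset (fst ` {(y, \<beta>). \<beta> \<in> tilde_manifold J Mf M \<and>
                 - grad (\<lambda>b. loss X F0 b y) \<beta> \<in> rel_frontier (subdiff J \<beta>)})" by simp
  qed
  then show ?thesis unfolding transition_space_def
    by (intro null_sets_UN' countable_finite fin) auto
qed

section \<open>Lipschitz continuity of the prediction\<close>

text \<open>A one-sided difference quotient bound passes to the derivative; the quadratic term absorbs the strong convexity defect.\<close>

lemma gderiv_at_right_le:
  assumes g: "GDERIV f x :> D" and le: "\<And>t. 0 < t \<Longrightarrow> t \<le> 1 \<Longrightarrow> f (x + t *\<^sub>R v) - f x \<le> t * b + t * t * c"
  shows "D \<bullet> v \<le> b"
proof -
  have "((\<lambda>t. f (x + t *\<^sub>R v)) has_derivative (\<lambda>s. (s *\<^sub>R v) \<bullet> D)) (at 0)"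
    by (rule has_derivative_compose[of "\<lambda>t. x + t *\<^sub>R v"]) (use g in \<open>auto intro!: derivative_eq_intros simp: gderiv_def\<close>)
  then have "((\<lambda>t. f (x + t *\<^sub>R v)) has_real_derivative (v \<bullet> D)) (at 0)"
    unfolding has_field_derivative_def by (simp add: mult.commute[of _ "v \<bullet> D"])
  then have "((\<lambda>t. (f (x + t *\<^sub>R v) - f x) / t) \<longlongrightarrow> v \<bullet> D) (at 0)"
    unfolding DERIV_def by simp
  then have "((\<lambda>t. (f (x + t *\<^sub>R v) - f x) / t) \<longlongrightarrow> v \<bullet> D) (at_right 0)"
    by (rule Lim_at_imp_Lim_at_within)
  moreover have "((\<lambda>t. b + t * c) \<longlongrightarrow> b + 0 * c) (at_right 0)" by (intro tendsto_intros)
  moreover have "\<forall>\<^sub>F t in at_right 0. (f (x + t *\<^sub>R v) - f x) / t \<le> b + t * c"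
  proof -
    have "\<forall>\<^sub>F t in at_right (0::real). t \<in> {0<..<1}" by (rule eventually_at_right_real) simp
    then show ?thesis
    proof eventually_elim
      case (elim t)
      then have "f (x + t *\<^sub>R v) - f x \<le> t * (b + t * c)" using le[of t] by (auto simp: algebra_simps)
      then show ?case using elim by (simp add: pos_divide_le_eq mult.commute)
    qed
  qed
  ultimately have "v \<bullet> D \<le> b + 0 * c" by (intro tendsto_le[OF trivial_limit_at_right_real])
  then show ?thesis by (simp add: inner_commute)
qed

lemma strongly_convex_gradient_monotone:
  assumes f: "strongly_convex \<tau> f" and a: "GDERIV f a :> Da" and b: "GDERIV f b :> Db"
  shows "\<tau> * (norm (a - b))\<^sup>2 \<le> (Da - Db) \<bullet> (a - b)"
proof -
  have 1: "D \<bullet> (u - w) \<le> f u - f w - \<tau> / 2 * (norm (u - w))\<^sup>2" if "GDERIV f w :> D" for u w D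
  proof (rule gderiv_at_right_le[OF that, of _ _ "\<tau> / 2 * (norm (u - w))\<^sup>2"])
    fix t :: real assume t: "0 < t" "t \<le> 1"
    have "w + t *\<^sub>R (u - w) = t *\<^sub>R u + (1 - t) *\<^sub>R w" by (simp add: algebra_simps)
    then have 1: "f (w + t *\<^sub>R (u - w)) \<le> t * f u + (1 - t) * f w - \<tau> / 2 * t * (1 - t) * (norm (u - w))\<^sup>2"
      using f t unfolding strongly_convex_def by simp
    define c where "c = \<tau> / 2 * (norm (u - w))\<^sup>2"
    have "a * t * (1 - t) * N = t * (a * N) - t * t * (a * N)" for a N :: real by (simp add: algebra_simps)
    then have "\<tau> / 2 * t * (1 - t) * (norm (u - w))\<^sup>2 = t * c - t * t * c" unfolding c_def .
    with 1 show "f (w + t *\<^sub>R (u - w)) - f w \<le> t * (f u - f w - \<tau> / 2 * (norm (u - w))\<^sup>2) + t * t * (\<tau> / 2 * (norm (u - w))\<^sup>2)"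
      unfolding c_def[symmetric] by (simp add: algebra_simps)
  qed
  have "Db \<bullet> (a - b) \<le> f a - f b - \<tau> / 2 * (norm (a - b))\<^sup>2" by (rule 1[OF b])
  moreover have "Da \<bullet> (b - a) \<le> f b - f a - \<tau> / 2 * (norm (a - b))\<^sup>2" using 1[OF a, of b] by (simp add: norm_minus_commute)
  ultimately have "Db \<bullet> (a - b) + Da \<bullet> (b - a) \<le> - \<tau> * (norm (a - b))\<^sup>2" by (simp add: field_simps)
  moreover have "(Da - Db) \<bullet> (a - b) = - (Db \<bullet> (a - b) + Da \<bullet> (b - a))" by (simp add: inner_diff_left inner_diff_right)
  ultimately show ?thesis by simp
qed

lemma subdiff_monotone:
  assumes J: "proper_ext J" and v: "v \<in> subdiff J a" and w: "w \<in> subdiff J b"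
  shows "0 \<le> (v - w) \<bullet> (a - b)"
proof -
  obtain r where r: "J a = ereal r" "\<And>z s. J z = ereal s \<Longrightarrow> r + v \<bullet> (z - a) \<le> s"
    using v unfolding subdiff_iff[OF J] by blast
  obtain s where s: "J b = ereal s" "\<And>z t. J z = ereal t \<Longrightarrow> s + w \<bullet> (z - b) \<le> t"
    using w unfolding subdiff_iff[OF J] by blast
  have "r + v \<bullet> (b - a) \<le> s" "s + w \<bullet> (a - b) \<le> r" using r s by blast+
  then show ?thesis by (simp add: inner_diff_left inner_diff_right)
qed

text \<open>Fermat's rule for a sum of a differentiable and a convex function: moving
  from the minimiser towards \<open>z\<close> by a step \<open>t\<close>, convexity of \<open>J\<close> bounds its increase by \<open>t (J z - J b)\<close>.\<close>

lemma solution_subgradient: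
  fixes f :: "'a::euclidean_space \<Rightarrow> real"
  assumes J: "proper_ext J" "convex_ext J" and f: "GDERIV f b :> D"
    and min: "is_arg_min (\<lambda>b. ereal (f b) + J b) (\<lambda>_. True) b"
  shows "- D \<in> subdiff J b"
proof -
  have min: "ereal (f b) + J b \<le> ereal (f z) + J z" for z
    using min unfolding is_arg_min_def by (simp add: not_less)
  obtain x where x: "J x \<noteq> \<infinity>" using J(1) unfolding proper_ext_def by blast
  have "J b \<noteq> \<infinity>" using min[of x] x by auto
  moreover have "J b \<noteq> -\<infinity>" using J(1) unfolding proper_ext_def by blast
  ultimately obtain r where r: "J b = ereal r" by (cases "J b") auto
  have "r + - D \<bullet> (z - b) \<le> s" if s: "J z = ereal s" for z s
  proof -
    have "- (D \<bullet> (z - b)) \<le> s - r"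
    proof -
      have g: "GDERIV (\<lambda>z. - f z) b :> - D" using f unfolding gderiv_def inner_minus_right by (rule has_derivative_minus)
      have "- D \<bullet> (z - b) \<le> s - r"
      proof (rule gderiv_at_right_le[OF g, of _ _ 0])
        fix t :: real assume t: "0 < t" "t \<le> 1"
        have "(b, r) \<in> {(x, r). J x \<le> ereal r}" "(z, s) \<in> {(x, r). J x \<le> ereal r}" using r s by auto
        then have "(1 - t) *\<^sub>R (b, r) + t *\<^sub>R (z, s) \<in> {(x, r). J x \<le> ereal r}"
          using J(2) t unfolding convex_ext_def by (intro convexD) auto
        then have "J ((1 - t) *\<^sub>R b + t *\<^sub>R z) \<le> ereal ((1 - t) * r + t * s)" by simp
        moreover have "(1 - t) *\<^sub>R b + t *\<^sub>R z = b + t *\<^sub>R (z - b)" by (simp add: algebra_simps)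
        ultimately have Jt: "J (b + t *\<^sub>R (z - b)) \<le> ereal ((1 - t) * r + t * s)" by simp
        have "ereal (f b) + ereal r \<le> ereal (f (b + t *\<^sub>R (z - b))) + J (b + t *\<^sub>R (z - b))" using min[of "b + t *\<^sub>R (z - b)"] r by simp
        also have "\<dots> \<le> ereal (f (b + t *\<^sub>R (z - b))) + ereal ((1 - t) * r + t * s)" using Jt by (rule add_left_mono)
        finally have "f b + r \<le> f (b + t *\<^sub>R (z - b)) + ((1 - t) * r + t * s)" by simp
        then show "- f (b + t *\<^sub>R (z - b)) - - f b \<le> t * (s - r) + t * t * 0" by (simp add: algebra_simps)
      qed
      then show ?thesis by simp
    qed
    then show ?thesis by simp
  qed
  then show ?thesis unfolding subdiff_iff[OF J(1)] using r by blast
qed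

lemma gderiv_differentiable: "f differentiable (at x) \<Longrightarrow> GDERIV f x :> grad f x" for f :: "'a::euclidean_space \<Rightarrow> real"
proof -
  assume "f differentiable (at x)"
  then obtain f' where f': "(f has_derivative f') (at x)" unfolding differentiable_def by blast
  have "f' = (\<lambda>h. h \<bullet> adjoint f' 1)"
    using adjoint_works[OF has_derivative_linear[OF f']] by (simp add: fun_eq_iff)
  then have "GDERIV f x :> adjoint f' 1" using f' unfolding gderiv_def by simp
  then show ?thesis using grad_eq by metis
qed

lemma gderiv_loss:
  fixes X :: "real^'p^'n"
  assumes "GDERIV (\<lambda>m. F0 m y) (X *v b) :> D"
  shows "GDERIV (\<lambda>b. loss X F0 b y) b :> transpose X *v D"
proof -
  have "((\<lambda>b. F0 (X *v b) y) has_derivative (\<lambda>h. (X *v h) \<bullet> D)) (at b)"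
    by (rule has_derivative_compose[of "\<lambda>b. X *v b"])
      (use assms in \<open>auto simp: gderiv_def intro: bounded_linear_imp_has_derivative matrix_vector_mul_bounded_linear\<close>)
  moreover have "(X *v h) \<bullet> D = h \<bullet> (transpose X *v D)" for h by (simp add: dot_lmul_matrix[symmetric] inner_commute)
  ultimately show ?thesis unfolding gderiv_def loss_def by simp
qed

lemma matrix_works_real: "linear f \<Longrightarrow> matrix f *v x = f x" for f :: "real^'m \<Rightarrow> real^'k"
proof -
  have "((*s) :: real \<Rightarrow> real^'m \<Rightarrow> _) = (*\<^sub>R)" by (intro ext) (simp add: scalar_mult_eq_scaleR)
  moreover have "((*s) :: real \<Rightarrow> real^'k \<Rightarrow> _) = (*\<^sub>R)" by (intro ext) (simp add: scalar_mult_eq_scaleR)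
  ultimately show "linear f \<Longrightarrow> matrix f *v x = f x" using matrix_vector_mul[of f] by (simp add: fun_eq_iff)
qed

lemma transpose_inner: "(transpose X *v a) \<bullet> b = a \<bullet> (X *v b)" for X :: "real^'p^'n"
  by (simp add: dot_lmul_matrix)

lemma D_grad_derivative:
  assumes "(\<lambda>y'. grad (\<lambda>m. F0 m y') \<mu>) differentiable (at y)"
  shows "((\<lambda>y'. grad (\<lambda>m. F0 m y') \<mu>) has_derivative (\<lambda>v. D_grad F0 \<mu> y *v v)) (at y)"
proof -
  let ?f' = "frechet_derivative (\<lambda>y'. grad (\<lambda>m. F0 m y') \<mu>) (at y)"
  have 1: "((\<lambda>y'. grad (\<lambda>m. F0 m y') \<mu>) has_derivative ?f') (at y)"
    using assms unfolding frechet_derivative_works .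
  show ?thesis using 1 unfolding D_grad_def jacobian_def by (simp add: matrix_works_real[OF has_derivative_linear[OF 1]])
qed

lemma grad_lipschitz_in_data:
  fixes F0 :: "real^'n \<Rightarrow> real^'n \<Rightarrow> real"
  assumes "\<And>\<mu> y. (\<lambda>y'. grad (\<lambda>m. F0 m y') \<mu>) differentiable (at y)"
    and "\<And>\<mu> y. onorm ((*v) (D_grad F0 \<mu> y)) \<le> L"
  shows "norm (grad (\<lambda>m. F0 m y1) \<mu> - grad (\<lambda>m. F0 m y2) \<mu>) \<le> L * norm (y1 - y2)"
  by (rule differentiable_bound[of UNIV "\<lambda>y'. grad (\<lambda>m. F0 m y') \<mu>" "\<lambda>y v. D_grad F0 \<mu> y *v v"])
    (use assms(2) D_grad_derivative[OF assms(1)] in auto)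

text \<open>Adding the monotonicity of the subdifferential to the strong monotonicity of the gradient gives
  \<open>\<tau> |\<mu>\<^sub>1 - \<mu>\<^sub>2| \<le> L |y\<^sub>1 - y\<^sub>2|\<close>. For equal data this is uniqueness of the prediction, and only criticality of the points
  enters, so it also identifies the predictions of arbitrary critical points.\<close>

lemma critical_image_lipschitz:
  fixes X :: "real^'p^'n"
  assumes J: "proper_ext J" and \<tau>: "\<tau> > 0" "\<And>y. strongly_convex \<tau> (\<lambda>m. F0 m y)"
    and diff: "\<And>\<mu> y. (\<lambda>m. F0 m y) differentiable (at \<mu>)"
    and L: "\<And>\<mu> y1 y2. norm (grad (\<lambda>m. F0 m y1) \<mu> - grad (\<lambda>m. F0 m y2) \<mu>) \<le> L * norm (y1 - y2)"
    and b1: "- grad (\<lambda>b. loss X F0 b y1) b1 \<in> subdiff J b1"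
    and b2: "- grad (\<lambda>b. loss X F0 b y2) b2 \<in> subdiff J b2"
  shows "norm (X *v b1 - X *v b2) \<le> L / \<tau> * norm (y1 - y2)"
proof -
  let ?g = "\<lambda>m y. grad (\<lambda>m. F0 m y) m"
  define m1 m2 where "m1 = X *v b1" and "m2 = X *v b2"
  have gr: "grad (\<lambda>b. loss X F0 b y) b = transpose X *v ?g (X *v b) y" for b y
    by (rule grad_eq[OF gderiv_loss[OF gderiv_differentiable[OF diff]]])
  have "0 \<le> (- (transpose X *v ?g m1 y1) - - (transpose X *v ?g m2 y2)) \<bullet> (b1 - b2)"
    using subdiff_monotone[OF J b1 b2] unfolding gr m1_def m2_def .
  also have "\<dots> = - ((transpose X *v (?g m1 y1 - ?g m2 y2)) \<bullet> (b1 - b2))"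
    by (simp add: matrix_vector_mult_diff_distrib inner_diff_left)
  also have "(transpose X *v (?g m1 y1 - ?g m2 y2)) \<bullet> (b1 - b2) = (?g m1 y1 - ?g m2 y2) \<bullet> (m1 - m2)"
    unfolding m1_def m2_def transpose_inner by (simp only: matrix_vector_mult_diff_distrib)
  finally have 1: "(?g m1 y1 - ?g m2 y2) \<bullet> (m1 - m2) \<le> 0" by simp
  have "\<tau> * (norm (m1 - m2))\<^sup>2 \<le> (?g m1 y1 - ?g m2 y1) \<bullet> (m1 - m2)"
    by (rule strongly_convex_gradient_monotone[OF \<tau>(2)[of y1] gderiv_differentiable[OF diff] gderiv_differentiable[OF diff]])
  also have "\<dots> = (?g m1 y1 - ?g m2 y2) \<bullet> (m1 - m2) + (?g m2 y2 - ?g m2 y1) \<bullet> (m1 - m2)"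
    by (simp add: inner_diff_left)
  also have "\<dots> \<le> (?g m2 y2 - ?g m2 y1) \<bullet> (m1 - m2)" using 1 by simp
  also have "\<dots> \<le> norm (?g m2 y2 - ?g m2 y1) * norm (m1 - m2)" by (rule norm_cauchy_schwarz)
  also have "\<dots> \<le> (L * norm (y1 - y2)) * norm (m1 - m2)"
    using L[of y2 m2 y1] by (intro mult_right_mono) (simp_all add: norm_minus_commute)
  finally have 2: "\<tau> * norm (m1 - m2) * norm (m1 - m2) \<le> L * norm (y1 - y2) * norm (m1 - m2)"
    by (simp add: power2_eq_square mult.assoc)
  have "\<tau> * norm (m1 - m2) \<le> L * norm (y1 - y2)"
  proof (cases "norm (m1 - m2) = 0")
    case True
    have "0 \<le> L * norm (y1 - y2)" using L[of y1 0 y2] norm_ge_zero order_trans by blast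
    then show ?thesis unfolding True by simp
  next
    case False
    then show ?thesis using 2 by (metis mult_le_cancel_right_pos norm_ge_zero order_le_less)
  qed
  then show ?thesis unfolding m1_def m2_def using \<tau>(1) by (simp add: field_simps)
qed

section \<open>Projections, pseudo-inverses and second derivatives\<close>

lemma proj_mat_works:
  fixes E :: "(real^'m) set"
  assumes E: "subspace E"
  shows "proj_mat E *v x \<in> E" and "e \<in> E \<Longrightarrow> (x - proj_mat E *v x) \<bullet> e = 0"
proof -
  have cp: "closest_point E z = y" if y: "y \<in> E" "\<And>w. w \<in> E \<Longrightarrow> (z - y) \<bullet> w = 0" for y z
  proof (rule closest_point_unique[symmetric, OF _ _ y(1)])
    show "convex E" by (rule subspace_imp_convex[OF E])
    show "closed E" by (rule closed_subspace[OF E])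
    show "\<forall>w\<in>E. dist z y \<le> dist z w"
    proof
      fix w assume "w \<in> E"
      then have "(z - y) \<bullet> (y - w) = 0" using y E subspace_diff by blast
      then have "(norm (z - w))\<^sup>2 = (norm (z - y))\<^sup>2 + (norm (y - w))\<^sup>2"
        using norm_add_Pythagorean[of "z - y" "y - w"] by (simp add: orthogonal_def)
      then have "(norm (z - y))\<^sup>2 \<le> (norm (z - w))\<^sup>2" by simp
      then show "dist z y \<le> dist z w" unfolding dist_norm by (rule power2_le_imp_le) simp
    qed
  qed
  have ex: "\<exists>y. y \<in> E \<and> (\<forall>w\<in>E. (z - y) \<bullet> w = 0)" for z
  proof -
    obtain y u where "y \<in> span E" "\<And>w. w \<in> span E \<Longrightarrow> orthogonal u w" "z = y + u"
      using orthogonal_subspace_decomp_exists[of E z] by metis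
    then show ?thesis using E by (intro exI[of _ y]) (auto simp: orthogonal_def span_eq_iff[THEN iffD2])
  qed
  have P: "closest_point E z \<in> E" "\<And>w. w \<in> E \<Longrightarrow> (z - closest_point E z) \<bullet> w = 0" for z
    using ex[of z] cp[of _ z] by auto
  have "linear (closest_point E)"
  proof (rule linearI)
    fix a b :: "real^'m" and c :: real
    show "closest_point E (a + b) = closest_point E a + closest_point E b"
    proof (rule cp)
      show "closest_point E a + closest_point E b \<in> E" using P(1) E subspace_add by blast
      fix w assume "w \<in> E"
      then show "(a + b - (closest_point E a + closest_point E b)) \<bullet> w = 0"
        using P(2)[of w a] P(2)[of w b] by (simp add: inner_diff_left inner_add_left)
    qed
    show "closest_point E (c *\<^sub>R a) = c *\<^sub>R closest_point E a"
    proof (rule cp)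
      show "c *\<^sub>R closest_point E a \<in> E" using P(1) E subspace_scale by blast
      fix w assume "w \<in> E"
      then show "(c *\<^sub>R a - c *\<^sub>R closest_point E a) \<bullet> w = 0"
        using P(2)[of w a] by (simp add: inner_diff_left)
    qed
  qed
  then have "proj_mat E *v z = closest_point E z" for z unfolding proj_mat_def by (rule matrix_works_real)
  then show "proj_mat E *v x \<in> E" "e \<in> E \<Longrightarrow> (x - proj_mat E *v x) \<bullet> e = 0" using P by simp_all
qed

lemma proj_mat_unique:
  assumes E: "subspace E" and y: "y \<in> E" "\<And>w. w \<in> E \<Longrightarrow> (x - y) \<bullet> w = 0"
  shows "proj_mat E *v x = y"
proof -
  let ?d = "proj_mat E *v x - y"
  have d: "?d \<in> E" using proj_mat_works(1)[OF E] y(1) E subspace_diff by blast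
  have "?d = (x - y) - (x - proj_mat E *v x)" by simp
  then have "?d \<bullet> ?d = (x - y) \<bullet> ?d - (x - proj_mat E *v x) \<bullet> ?d" by (metis inner_diff_left)
  then have "?d \<bullet> ?d = 0" using y(2)[OF d] proj_mat_works(2)[OF E d] by simp
  then show ?thesis by simp
qed

lemma proj_mat_id: "subspace E \<Longrightarrow> x \<in> E \<Longrightarrow> proj_mat E *v x = x"
  by (rule proj_mat_unique) auto

lemma proj_mat_idem: assumes "subspace E" shows "proj_mat E ** proj_mat E = proj_mat E"
proof -
  have "(proj_mat E ** proj_mat E) *v x = proj_mat E *v x" for x
    using proj_mat_id[OF assms proj_mat_works(1)[OF assms]] by (simp add: matrix_vector_mul_assoc[symmetric])
  then show ?thesis unfolding matrix_eq by blast
qed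

lemma proj_mat_sym_inner: assumes E: "subspace E" shows "(proj_mat E *v x) \<bullet> y = x \<bullet> (proj_mat E *v y)"
proof -
  have "(x - proj_mat E *v x) \<bullet> (proj_mat E *v y) = 0" by (rule proj_mat_works(2)[OF E proj_mat_works(1)[OF E]])
  moreover have "(y - proj_mat E *v y) \<bullet> (proj_mat E *v x) = 0" by (rule proj_mat_works(2)[OF E proj_mat_works(1)[OF E]])
  ultimately have a: "x \<bullet> (proj_mat E *v y) = (proj_mat E *v x) \<bullet> (proj_mat E *v y)"
    and b: "y \<bullet> (proj_mat E *v x) = (proj_mat E *v y) \<bullet> (proj_mat E *v x)"
    by (simp_all only: inner_diff_left right_minus_eq)
  show ?thesis using a b by (metis inner_commute)
qed

lemma proj_mat_sym: assumes E: "subspace E" shows "transpose (proj_mat E) = proj_mat E"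
proof -
  have "(transpose (proj_mat E) *v x) = proj_mat E *v x" for x
  proof (rule vector_eq_rdot[THEN iffD1], rule allI)
    fix y show "(transpose (proj_mat E) *v x) \<bullet> y = (proj_mat E *v x) \<bullet> y"
      unfolding transpose_inner proj_mat_sym_inner[OF E] ..
  qed
  then show ?thesis unfolding matrix_eq by blast
qed

lemma proj_mat_comp: assumes E: "subspace E" shows "proj_mat (E\<^sup>\<bottom>) *v x = x - proj_mat E *v x"
proof (rule proj_mat_unique[OF subspace_orthogonal_comp])
  show "x - proj_mat E *v x \<in> E\<^sup>\<bottom>"
    using proj_mat_works(2)[OF E] by (auto simp: orthogonal_comp_def orthogonal_def inner_commute)
  fix w assume "w \<in> E\<^sup>\<bottom>"
  then show "(x - (x - proj_mat E *v x)) \<bullet> w = 0"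
    using proj_mat_works(1)[OF E, of x] by (simp add: orthogonal_comp_def orthogonal_def)
qed

lemma pinv_eqI:
  assumes B: "A ** B ** A = A" "B ** A ** B = B" "transpose (A ** B) = A ** B" "transpose (B ** A) = B ** A"
  shows "pinv A = B"
  unfolding pinv_def
proof (rule the_equality)
  show "A ** B ** A = A \<and> B ** A ** B = B \<and> transpose (A ** B) = A ** B \<and> transpose (B ** A) = B ** A" using B by blast
  fix C assume "A ** C ** A = A \<and> C ** A ** C = C \<and> transpose (A ** C) = A ** C \<and> transpose (C ** A) = C ** A"
  then have C: "A ** C ** A = A" "C ** A ** C = C" "transpose (A ** C) = A ** C" "transpose (C ** A) = C ** A" by blast+
  have "A ** B = (A ** C) ** (A ** B)" using C(1) by (simp add: matrix_mul_assoc)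
  also have "\<dots> = transpose ((A ** B) ** (A ** C))" using B(3) C(3) by (simp add: matrix_transpose_mul)
  also have "(A ** B) ** (A ** C) = A ** C" using B(1) by (simp add: matrix_mul_assoc)
  finally have 1: "A ** B = A ** C" using C(3) by simp
  have "B ** A = (B ** A) ** (C ** A)" using C(1) by (simp add: matrix_mul_assoc[symmetric])
  also have "\<dots> = transpose ((C ** A) ** (B ** A))" using B(4) C(4) by (simp add: matrix_transpose_mul)
  also have "(C ** A) ** (B ** A) = C ** A" using B(1) by (simp add: matrix_mul_assoc[symmetric])
  finally have 2: "B ** A = C ** A" using C(4) by simp
  have "C = (C ** A) ** C" using C(2) by simp
  also have "\<dots> = B ** (A ** C)" unfolding 2[symmetric] by (simp add: matrix_mul_assoc)
  also have "\<dots> = B" unfolding 1[symmetric] using B(2) by (simp add: matrix_mul_assoc)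
  finally show "C = B" .
qed

text \<open>An operator that maps \<open>E\<close> bijectively to itself and vanishes on the complement has the inverse on \<open>E\<close>, extended by zero, as
  pseudo-inverse. It is computed from the inverse of \<open>Q + (1 - P)\<close>.\<close>

lemma pinv_of_bijection_on_subspace:
  fixes Q :: "real^'m^'m"
  assumes E: "subspace E" and PQ: "proj_mat E ** Q = Q" and QP: "Q ** proj_mat E = Q"
    and inj: "\<And>\<xi>. \<xi> \<in> E \<Longrightarrow> Q *v \<xi> = 0 \<Longrightarrow> \<xi> = 0"
  shows "pinv Q ** Q = proj_mat E" and "proj_mat E ** pinv Q = pinv Q" and "pinv Q ** proj_mat E = pinv Q"
proof -
  let ?P = "proj_mat E"
  note PP = proj_mat_idem[OF E]
  define R where "R = Q + (mat 1 - ?P)"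
  have v: "Q *v (?P *v x) = Q *v x" "?P *v (Q *v x) = Q *v x" "?P *v (?P *v x) = ?P *v x" for x
    by (simp_all add: matrix_vector_mul_assoc QP PQ PP)
  have Rv: "R *v x = Q *v x + (x - ?P *v x)" for x unfolding R_def
    by (simp add: matrix_vector_mult_add_rdistrib matrix_vector_mult_diff_rdistrib)
  have RP: "R ** ?P = Q" unfolding matrix_eq
    by (simp add: matrix_vector_mul_assoc[symmetric] Rv v)
  have PR: "?P ** R = Q" unfolding matrix_eq
    by (simp add: matrix_vector_mul_assoc[symmetric] Rv v matrix_vector_right_distrib matrix_vector_mult_diff_distrib)
  have "x = 0" if x: "R *v x = 0" for x
  proof -
    have "?P *v (R *v x) = 0" using x by simp
    then have Qx: "Q *v x = 0" by (simp add: matrix_vector_mul_assoc PR)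
    have "x = ?P *v x" using x Qx Rv[of x] by simp
    then have "x \<in> E" using proj_mat_works(1)[OF E, of x] by simp
    then show ?thesis using inj Qx by blast
  qed
  then obtain R' where R': "R' ** R = mat 1" using matrix_left_invertible_ker[of R] by blast
  then have RR': "R ** R' = mat 1" by (simp add: matrix_left_right_inverse)
  define B where "B = R' ** ?P"
  have comm: "?P ** R' = R' ** ?P"
  proof -
    have "R' ** ?P = R' ** ?P ** (R ** R')" by (simp add: RR')
    also have "\<dots> = R' ** (?P ** R) ** R'" by (simp add: matrix_mul_assoc)
    also have "?P ** R = R ** ?P" by (simp add: PR RP)
    also have "R' ** (R ** ?P) ** R' = ?P ** R'" by (simp add: matrix_mul_assoc R')
    finally show ?thesis ..
  qed
  have BQ: "B ** Q = ?P"
  proof -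
    have "B ** Q = R' ** (?P ** Q)" unfolding B_def by (simp add: matrix_mul_assoc)
    also have "\<dots> = R' ** R ** ?P" unfolding PQ by (simp add: RP[symmetric] matrix_mul_assoc)
    finally show ?thesis by (simp add: R')
  qed
  have QB: "Q ** B = ?P"
  proof -
    have "Q ** B = ?P ** (R ** R') ** ?P" unfolding B_def by (simp add: PR[symmetric] matrix_mul_assoc)
    then show ?thesis by (simp add: RR' PP)
  qed
  have PB: "?P ** B = B" unfolding B_def by (simp add: matrix_mul_assoc comm) (simp add: matrix_mul_assoc[symmetric] PP)
  have BP: "B ** ?P = B" unfolding B_def by (simp add: matrix_mul_assoc[symmetric] PP)
  have "pinv Q = B"
    by (rule pinv_eqI) (simp_all add: QB BQ PQ PB proj_mat_sym[OF E])
  then show "pinv Q ** Q = ?P" "?P ** pinv Q = pinv Q" "pinv Q ** ?P = pinv Q" using BQ PB BP by simp_all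
qed

text \<open>The difference set of a convex set is convex and symmetric, so that the cone over it is already a subspace.\<close>

lemma subspace_Lin:
  assumes C: "convex C" "C \<noteq> {}" shows "subspace (Lin C)"
proof (rule subspaceI)
  obtain c where c: "c \<in> C" using C by blast
  have pos: "\<exists>t a b. x = t *\<^sub>R (a - b) \<and> 0 \<le> t \<and> a \<in> C \<and> b \<in> C" if "x \<in> Lin C" for x
  proof -
    obtain t a b where x: "x = t *\<^sub>R (a - b)" "a \<in> C" "b \<in> C" using \<open>x \<in> Lin C\<close> unfolding Lin_def by blast
    show ?thesis
    proof (cases "0 \<le> t")
      case False
      then show ?thesis using x by (intro exI[of _ "- t"] exI[of _ b] exI[of _ a]) (simp add: algebra_simps)
    qed (use x in blast)
  qed
  show "0 \<in> Lin C" unfolding Lin_def using c by (intro CollectI exI[of _ 0] exI[of _ c]) simp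
  show "s *\<^sub>R x \<in> Lin C" if x: "x \<in> Lin C" for s x
  proof -
    obtain t a b where "x = t *\<^sub>R (a - b)" "a \<in> C" "b \<in> C" using x unfolding Lin_def by blast
    then show ?thesis unfolding Lin_def by (intro CollectI exI[of _ "s * t"] exI[of _ a] exI[of _ b]) simp
  qed
  fix x y assume "x \<in> Lin C" "y \<in> Lin C"
  then obtain t a b s a' b' where x: "x = t *\<^sub>R (a - b)" "0 \<le> t" "a \<in> C" "b \<in> C"
    and y: "y = s *\<^sub>R (a' - b')" "0 \<le> s" "a' \<in> C" "b' \<in> C" using pos by metis
  show "x + y \<in> Lin C"
  proof (cases "t + s = 0")
    case True
    then have "t = 0" "s = 0" using x(2) y(2) by linarith+
    then show ?thesis using x y \<open>0 \<in> Lin C\<close> by simp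
  next
    case False
    then have ts: "t + s > 0" using x(2) y(2) by linarith
    have cc: "(t / (t + s)) *\<^sub>R p + (s / (t + s)) *\<^sub>R q \<in> C" if "p \<in> C" "q \<in> C" for p q
      using that x(2) y(2) ts by (intro convexD[OF C(1)]) (auto simp: add_divide_distrib[symmetric])
    have e: "(t + s) * (t / (t + s)) = t" "(t + s) * (s / (t + s)) = s" using ts by simp_all
    have "x + y = (t + s) *\<^sub>R (((t / (t + s)) *\<^sub>R a + (s / (t + s)) *\<^sub>R a') - ((t / (t + s)) *\<^sub>R b + (s / (t + s)) *\<^sub>R b'))"
      unfolding x(1) y(1) scaleR_diff_right scaleR_add_right scaleR_scaleR e by (simp add: algebra_simps)
    then show ?thesis unfolding Lin_def using cc[OF x(3) y(3)] cc[OF x(4) y(4)] by blast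
  qed
qed

lemma Ck2_differentiable:
  assumes "Ck_on 2 U f" "x \<in> U"
  shows "(f has_derivative frechet_derivative f (at x)) (at x)"
    and "((\<lambda>z. frechet_derivative f (at z) v) has_derivative frechet_derivative (\<lambda>z. frechet_derivative f (at z) v) (at x)) (at x)"
    and "continuous_on U (\<lambda>z. frechet_derivative (\<lambda>z. frechet_derivative f (at z) v) (at z) w)"
  using assms unfolding numeral_2_eq_2 by (auto simp: frechet_derivative_works[symmetric])

text \<open>First and second derivatives as maps of the direction, which is the form in which \<open>Ck_on\<close> delivers them.\<close>

definition D1 :: "('a::euclidean_space \<Rightarrow> 'b::euclidean_space) \<Rightarrow> 'a \<Rightarrow> 'a \<Rightarrow> 'b" where
  "D1 f x v = frechet_derivative f (at x) v"

definition D2 :: "('a::euclidean_space \<Rightarrow> 'b::euclidean_space) \<Rightarrow> 'a \<Rightarrow> 'a \<Rightarrow> 'a \<Rightarrow> 'b" where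
  "D2 f x u v = frechet_derivative (\<lambda>z. D1 f z v) (at x) u"

lemma D1: "Ck_on 2 U f \<Longrightarrow> x \<in> U \<Longrightarrow> (f has_derivative D1 f x) (at x)"
  unfolding D1_def using Ck2_differentiable(1) by blast

lemma D2: "Ck_on 2 U f \<Longrightarrow> x \<in> U \<Longrightarrow> ((\<lambda>z. D1 f z v) has_derivative (\<lambda>u. D2 f x u v)) (at x)"
  unfolding D1_def D2_def using Ck2_differentiable(2) by blast

lemma D2_continuous: assumes "Ck_on 2 U f" shows "continuous_on U (\<lambda>z. D2 f z u v)"
proof (cases "U = {}")
  case False
  then obtain x where "x \<in> U" by blast
  then show ?thesis unfolding D1_def D2_def by (rule Ck2_differentiable(3)[OF assms])
qed simp

lemma D1_linear: "Ck_on 2 U f \<Longrightarrow> x \<in> U \<Longrightarrow> linear (D1 f x)"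
  using has_derivative_linear[OF D1] .

lemma D2_linear1: "Ck_on 2 U f \<Longrightarrow> x \<in> U \<Longrightarrow> linear (\<lambda>u. D2 f x u v)"
  using has_derivative_linear[OF D2] .

lemma D2_linear2:
  assumes f: "Ck_on 2 U f" and U: "open U" "x \<in> U" shows "linear (D2 f x u)"
proof (rule linearI)
  fix v w and c :: real
  have "((\<lambda>z. D1 f z v + D1 f z w) has_derivative (\<lambda>u. D2 f x u v + D2 f x u w)) (at x)"
    by (intro has_derivative_add D2[OF f U(2)])
  then have "((\<lambda>z. D1 f z (v + w)) has_derivative (\<lambda>u. D2 f x u v + D2 f x u w)) (at x)"
    by (rule has_derivative_transform_within_open[OF _ U]) (simp add: linear_add[OF D1_linear[OF f]])
  from has_derivative_unique[OF this D2[OF f U(2)]] show "D2 f x u (v + w) = D2 f x u v + D2 f x u w" by metis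
  have "((\<lambda>z. c *\<^sub>R D1 f z v) has_derivative (\<lambda>u. c *\<^sub>R D2 f x u v)) (at x)"
    by (intro has_derivative_scaleR_right D2[OF f U(2)])
  then have "((\<lambda>z. D1 f z (c *\<^sub>R v)) has_derivative (\<lambda>u. c *\<^sub>R D2 f x u v)) (at x)"
    by (rule has_derivative_transform_within_open[OF _ U]) (simp add: linear_scale[OF D1_linear[OF f]])
  from has_derivative_unique[OF this D2[OF f U(2)]] show "D2 f x u (c *\<^sub>R v) = c *\<^sub>R D2 f x u v" by metis
qed

section \<open>Charts of submanifolds\<close>

lemma line_MVT:
  fixes p :: "'a::euclidean_space \<Rightarrow> real"
  assumes p: "\<And>t. 0 \<le> t \<Longrightarrow> t \<le> h \<Longrightarrow> (p has_derivative p' (a + t *\<^sub>R v)) (at (a + t *\<^sub>R v))" and h: "0 < h"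
  shows "\<exists>t. 0 < t \<and> t < h \<and> p (a + h *\<^sub>R v) - p a = h * p' (a + t *\<^sub>R v) v"
proof -
  have "((\<lambda>s. p (a + s *\<^sub>R v)) has_real_derivative p' (a + t *\<^sub>R v) v) (at t)" if "0 \<le> t" "t \<le> h" for t
  proof -
    have "((\<lambda>s. a + s *\<^sub>R v) has_derivative (\<lambda>s. s *\<^sub>R v)) (at t)" by (auto intro!: derivative_eq_intros)
    from has_derivative_compose[OF this p[OF that]]
    have "((\<lambda>s. p (a + s *\<^sub>R v)) has_derivative (\<lambda>s. p' (a + t *\<^sub>R v) (s *\<^sub>R v))) (at t)" .
    moreover have "p' (a + t *\<^sub>R v) (s *\<^sub>R v) = p' (a + t *\<^sub>R v) v * s" for s
      using linear_scale[OF has_derivative_linear[OF p[OF that]]] by simp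
    ultimately show ?thesis unfolding has_field_derivative_def by simp
  qed
  from MVT2[OF h, of "\<lambda>s. p (a + s *\<^sub>R v)" "\<lambda>t. p' (a + t *\<^sub>R v) v", OF this] show ?thesis by auto
qed

text \<open>Two mean value theorems turn the mixed second difference into a value of \<open>D2\<close> nearby. The difference is symmetric in \<open>u\<close>
  and \<open>v\<close>, which gives Schwarz's theorem in the limit.\<close>

lemma second_difference:
  fixes f :: "'a::euclidean_space \<Rightarrow> real"
  assumes f: "Ck_on 2 U f" and ball: "ball x r \<subseteq> U" and h: "0 < h" "h * (norm u + norm v) < r"
  shows "\<exists>a. dist x a \<le> h * (norm u + norm v) \<and>
    f (x + h *\<^sub>R u + h *\<^sub>R v) - f (x + h *\<^sub>R u) - f (x + h *\<^sub>R v) + f x = h * (h * D2 f a v u)"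
proof -
  have near: "dist x (x + s *\<^sub>R u + t *\<^sub>R v) \<le> h * (norm u + norm v)" if "0 \<le> s" "s \<le> h" "0 \<le> t" "t \<le> h" for s t
  proof -
    have "norm (s *\<^sub>R u + t *\<^sub>R v) \<le> s * norm u + t * norm v" using that by (intro norm_triangle_le) simp
    also have "\<dots> \<le> h * norm u + h * norm v" using that by (intro add_mono mult_right_mono) auto
    finally show ?thesis by (simp add: dist_norm algebra_simps norm_minus_commute)
  qed
  have inU: "x + s *\<^sub>R u + t *\<^sub>R v \<in> U" if "0 \<le> s" "s \<le> h" "0 \<le> t" "t \<le> h" for s t
    using near[OF that] h(2) ball by (meson mem_ball order_le_less_trans subsetD)
  define p where "p = (\<lambda>z. f (z + h *\<^sub>R v) - f z)"
  have "\<exists>s. 0 < s \<and> s < h \<and> p (x + h *\<^sub>R u) - p x = h * (D1 f (x + s *\<^sub>R u + h *\<^sub>R v) u - D1 f (x + s *\<^sub>R u) u)"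
  proof (rule line_MVT[of h p "\<lambda>z w. D1 f (z + h *\<^sub>R v) w - D1 f z w" x u, OF _ h(1)])
    fix s assume s: "0 \<le> s" "s \<le> h"
    have "((\<lambda>z. f (z + h *\<^sub>R v)) has_derivative D1 f (x + s *\<^sub>R u + h *\<^sub>R v)) (at (x + s *\<^sub>R u))"
    proof -
      have "((\<lambda>z. z + h *\<^sub>R v) has_derivative (\<lambda>w. w)) (at (x + s *\<^sub>R u))"
        by (auto intro!: derivative_eq_intros)
      from has_derivative_compose[OF this D1[OF f inU[OF s, of h]]] show ?thesis using h(1) by simp
    qed
    moreover have "(f has_derivative D1 f (x + s *\<^sub>R u)) (at (x + s *\<^sub>R u))" using D1[OF f inU[OF s, of 0]] h(1) by simp
    ultimately show "(p has_derivative (\<lambda>w. D1 f (x + s *\<^sub>R u + h *\<^sub>R v) w - D1 f (x + s *\<^sub>R u) w)) (at (x + s *\<^sub>R u))"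
      unfolding p_def by (rule has_derivative_diff)
  qed
  then obtain s where s: "0 < s" "s < h" "p (x + h *\<^sub>R u) - p x = h * (D1 f (x + s *\<^sub>R u + h *\<^sub>R v) u - D1 f (x + s *\<^sub>R u) u)" by blast
  have "\<exists>t. 0 < t \<and> t < h \<and> D1 f (x + s *\<^sub>R u + h *\<^sub>R v) u - D1 f (x + s *\<^sub>R u) u = h * D2 f (x + s *\<^sub>R u + t *\<^sub>R v) v u"
    by (rule line_MVT[of h "\<lambda>z. D1 f z u" "\<lambda>z w. D2 f z w u", OF _ h(1)], rule D2[OF f], rule inU) (use s in auto)
  then obtain t where t: "0 < t" "t < h" "D1 f (x + s *\<^sub>R u + h *\<^sub>R v) u - D1 f (x + s *\<^sub>R u) u = h * D2 f (x + s *\<^sub>R u + t *\<^sub>R v) v u" by blast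
  have "dist x (x + s *\<^sub>R u + t *\<^sub>R v) \<le> h * (norm u + norm v)" by (rule near) (use s t in auto)
  moreover have "f (x + h *\<^sub>R u + h *\<^sub>R v) - f (x + h *\<^sub>R u) - f (x + h *\<^sub>R v) + f x = h * (h * D2 f (x + s *\<^sub>R u + t *\<^sub>R v) v u)"
    using s(3) unfolding t(3) p_def by simp
  ultimately show ?thesis by blast
qed

text \<open>Both orders of differentiation approximate the same second difference, and \<open>D2\<close> is continuous.\<close>

theorem D2_symmetric:
  fixes f :: "'a::euclidean_space \<Rightarrow> real"
  assumes f: "Ck_on 2 U f" and U: "open U" "x \<in> U"
  shows "D2 f x u v = D2 f x v u"
proof (rule ccontr)
  assume ne: "D2 f x u v \<noteq> D2 f x v u"
  define e where "e = \<bar>D2 f x u v - D2 f x v u\<bar> / 2"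
  have e: "e > 0" using ne by (simp add: e_def)
  obtain r where r: "r > 0" "ball x r \<subseteq> U" using U openE by blast
  have "isCont (\<lambda>z. D2 f z u v) x" "isCont (\<lambda>z. D2 f z v u) x"
    using D2_continuous[OF f] U by (simp_all add: continuous_on_eq_continuous_at)
  then obtain d1 d2 where d: "d1 > 0" "\<And>a. dist a x < d1 \<Longrightarrow> dist (D2 f a u v) (D2 f x u v) < e"
    "d2 > 0" "\<And>a. dist a x < d2 \<Longrightarrow> dist (D2 f a v u) (D2 f x v u) < e"
    using e unfolding continuous_at_eps_delta by metis
  define m where "m = min r (min d1 d2)"
  have m: "m > 0" using r d by (simp add: m_def)
  define c where "c = norm u + norm v + 1"
  have c: "c > 0" by (simp add: c_def add_nonneg_pos)
  define h where "h = m / (2 * c)"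
  have h: "h > 0" using m c by (simp add: h_def)
  have "h * (norm u + norm v) < h * c" using h by (simp add: c_def)
  also have "h * c = m / 2" using c by (simp add: h_def)
  also have "\<dots> < m" using m by simp
  finally have hm: "h * (norm u + norm v) < m" .
  then have hr: "h * (norm u + norm v) < r" "h * (norm v + norm u) < r" by (simp_all add: m_def add.commute)
  obtain a where a: "dist x a \<le> h * (norm u + norm v)"
    "f (x + h *\<^sub>R u + h *\<^sub>R v) - f (x + h *\<^sub>R u) - f (x + h *\<^sub>R v) + f x = h * (h * D2 f a v u)"
    using second_difference[OF f r(2) h hr(1)] by blast
  obtain b where b: "dist x b \<le> h * (norm v + norm u)"
    "f (x + h *\<^sub>R v + h *\<^sub>R u) - f (x + h *\<^sub>R v) - f (x + h *\<^sub>R u) + f x = h * (h * D2 f b u v)"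
    using second_difference[OF f r(2) h hr(2)] by blast
  have "x + h *\<^sub>R v + h *\<^sub>R u = x + h *\<^sub>R u + h *\<^sub>R v" by simp
  then have "h * (h * D2 f a v u) = h * (h * D2 f b u v)" using a(2) b(2) by (simp only:)
  then have eq: "D2 f a v u = D2 f b u v" using h by simp
  have "dist a x < d2" using a(1) hm by (simp add: m_def dist_commute)
  then have "dist (D2 f a v u) (D2 f x v u) < e" by (rule d(4))
  moreover have "dist b x < d1" using b(1) hm by (simp add: m_def dist_commute add.commute)
  then have "dist (D2 f b u v) (D2 f x u v) < e" by (rule d(2))
  ultimately show False unfolding eq e_def dist_real_def by argo
qed

lemma derivative_zero_on_line:
  fixes k :: "'a::euclidean_space \<Rightarrow> real"
  assumes k: "(k has_derivative k') (at u)" and z: "\<forall>\<^sub>F t in nhds 0. k (u + t *\<^sub>R h) = 0"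
  shows "k' h = 0"
proof -
  have "((\<lambda>s. u + s *\<^sub>R h) has_derivative (\<lambda>s. s *\<^sub>R h)) (at 0)" by (auto intro!: derivative_eq_intros)
  from has_derivative_compose[OF this, of k k'] k
  have 1: "((\<lambda>s. k (u + s *\<^sub>R h)) has_derivative (\<lambda>s. k' (s *\<^sub>R h))) (at 0)" by simp
  have "((\<lambda>s. k (u + s *\<^sub>R h)) has_derivative (\<lambda>s. 0)) (at 0)"
  proof (rule has_derivative_transform_eventually[OF has_derivative_const[of 0]])
    show "\<forall>\<^sub>F t in at 0. 0 = k (u + t *\<^sub>R h)"
      using z unfolding eventually_at_filter by (rule eventually_mono) simp
    show "0 = k (u + 0 *\<^sub>R h)" using eventually_nhds_x_imp_x[OF z] by simp
  qed simp
  from has_derivative_unique[OF 1 this] have "k' (1 *\<^sub>R h) = 0" by metis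
  then show ?thesis by simp
qed

lemma has_vector_derivative_quotient:
  fixes c :: "real \<Rightarrow> 'a::euclidean_space"
  assumes "(c has_vector_derivative v) (at 0)"
  shows "((\<lambda>t. (c t - c 0) /\<^sub>R t) \<longlongrightarrow> v) (at 0)"
proof (rule tendsto_componentwise_iff[THEN iffD2], rule ballI)
  fix b :: 'a
  have "((\<lambda>t. c t \<bullet> b) has_vector_derivative (v \<bullet> b)) (at 0)"
    by (rule bounded_linear.has_vector_derivative[OF bounded_linear_inner_left assms])
  then have "((\<lambda>t. (c t \<bullet> b - c 0 \<bullet> b) / t) \<longlongrightarrow> v \<bullet> b) (at 0)"
    unfolding has_real_derivative_iff_has_vector_derivative[symmetric] DERIV_def by simp
  then show "((\<lambda>t. ((c t - c 0) /\<^sub>R t) \<bullet> b) \<longlongrightarrow> v \<bullet> b) (at 0)"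
    by (simp add: inner_diff_left divide_inverse mult.commute)
qed

text \<open>A straightening chart: \<open>\<phi>\<close> maps the submanifold locally onto the subspace \<open>E\<close>, so that \<open>\<psi>\<close> restricted to \<open>E\<close>
  parametrises it.\<close>

locale C2_chart =
  fixes M :: "'a::euclidean_space set" and U V :: "'a set" and \<phi> \<psi> :: "'a \<Rightarrow> 'a" and E :: "'a set"
  assumes U: "open U" and V: "open V" and E: "subspace E" and hom: "homeomorphism U V \<phi> \<psi>"
    and C2\<phi>: "Ck_on 2 U \<phi>" and C2\<psi>: "Ck_on 2 V \<psi>" and straight: "\<phi> ` (M \<inter> U) = E \<inter> V"
begin

lemma \<phi>_in: "x \<in> U \<Longrightarrow> \<phi> x \<in> V" and \<psi>_in: "u \<in> V \<Longrightarrow> \<psi> u \<in> U"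
  and \<psi>\<phi>: "x \<in> U \<Longrightarrow> \<psi> (\<phi> x) = x" and \<phi>\<psi>: "u \<in> V \<Longrightarrow> \<phi> (\<psi> u) = u"
  using hom unfolding homeomorphism_def by auto

lemma \<phi>_E: "x \<in> M \<Longrightarrow> x \<in> U \<Longrightarrow> \<phi> x \<in> E"
  using straight by blast

lemma \<psi>_M: "u \<in> E \<Longrightarrow> u \<in> V \<Longrightarrow> \<psi> u \<in> M"
proof -
  assume "u \<in> E" "u \<in> V"
  then have "u \<in> \<phi> ` (M \<inter> U)" using straight by blast
  then obtain x where "x \<in> M" "x \<in> U" "u = \<phi> x" by blast
  then show ?thesis using \<psi>\<phi> by simp
qed

lemma \<psi>_D1: "u \<in> V \<Longrightarrow> (\<psi> has_derivative D1 \<psi> u) (at u)" by (rule D1[OF C2\<psi>])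
lemma \<phi>_D1: "x \<in> U \<Longrightarrow> (\<phi> has_derivative D1 \<phi> x) (at x)" by (rule D1[OF C2\<phi>])

lemma D1_inverse1: assumes "x \<in> U" shows "D1 \<psi> (\<phi> x) (D1 \<phi> x v) = v"
proof -
  have "((\<lambda>z. \<psi> (\<phi> z)) has_derivative (\<lambda>v. D1 \<psi> (\<phi> x) (D1 \<phi> x v))) (at x)"
    by (rule has_derivative_compose[OF \<phi>_D1[OF assms] \<psi>_D1[OF \<phi>_in[OF assms]]])
  then have "((\<lambda>z. z) has_derivative (\<lambda>v. D1 \<psi> (\<phi> x) (D1 \<phi> x v))) (at x)"
    by (rule has_derivative_transform_within_open[OF _ U assms]) (simp add: \<psi>\<phi>)
  from has_derivative_unique[OF this has_derivative_ident] show ?thesis by metis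
qed

lemma D1_inverse2: assumes "u \<in> V" shows "D1 \<phi> (\<psi> u) (D1 \<psi> u v) = v"
proof -
  have "((\<lambda>z. \<phi> (\<psi> z)) has_derivative (\<lambda>v. D1 \<phi> (\<psi> u) (D1 \<psi> u v))) (at u)"
    by (rule has_derivative_compose[OF \<psi>_D1[OF assms] \<phi>_D1[OF \<psi>_in[OF assms]]])
  then have "((\<lambda>z. z) has_derivative (\<lambda>v. D1 \<phi> (\<psi> u) (D1 \<psi> u v))) (at u)"
    by (rule has_derivative_transform_within_open[OF _ V assms]) (simp add: \<phi>\<psi>)
  from has_derivative_unique[OF this has_derivative_ident] show ?thesis by metis
qed

lemma eventually_line:
  assumes "open W" "u \<in> W" "u \<in> E" "e \<in> E"
  shows "\<forall>\<^sub>F t in nhds 0. u + t *\<^sub>R e \<in> W \<and> u + t *\<^sub>R e \<in> E"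
proof -
  have "((\<lambda>t. u + t *\<^sub>R e) \<longlongrightarrow> u + 0 *\<^sub>R e) (nhds 0)" by (intro tendsto_intros filterlim_ident)
  then have "\<forall>\<^sub>F t in nhds 0. u + t *\<^sub>R e \<in> W" using assms(1,2) by (intro topological_tendstoD) auto
  then show ?thesis
  proof (rule eventually_mono)
    fix t assume "u + t *\<^sub>R e \<in> W"
    moreover have "u + t *\<^sub>R e \<in> E" using assms(3,4) E by (intro subspace_add subspace_scale)
    ultimately show "u + t *\<^sub>R e \<in> W \<and> u + t *\<^sub>R e \<in> E" ..
  qed
qed

lemma tangent_vector:
  assumes u: "u \<in> V" "u \<in> E" and e: "e \<in> E"
  shows "D1 \<psi> u e \<in> tangent_space M (\<psi> u)"
  unfolding tangent_space_def
proof (intro CollectI exI[of _ "\<lambda>t. \<psi> (u + t *\<^sub>R e)"] conjI)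
  show "\<psi> (u + 0 *\<^sub>R e) = \<psi> u" by simp
  show "\<forall>\<^sub>F t in nhds 0. \<psi> (u + t *\<^sub>R e) \<in> M"
    using eventually_line[OF V u e] by (rule eventually_mono) (simp add: \<psi>_M)
  have "((\<lambda>s. u + s *\<^sub>R e) has_derivative (\<lambda>s. s *\<^sub>R e)) (at 0)" by (auto intro!: derivative_eq_intros)
  from has_derivative_compose[OF this, of \<psi> "D1 \<psi> u"] \<psi>_D1[OF u(1)]
  have "((\<lambda>s. \<psi> (u + s *\<^sub>R e)) has_derivative (\<lambda>s. D1 \<psi> u (s *\<^sub>R e))) (at 0)" by simp
  then show "((\<lambda>s. \<psi> (u + s *\<^sub>R e)) has_vector_derivative D1 \<psi> u e) (at 0)"
    unfolding has_vector_derivative_def by (simp add: linear_scale[OF D1_linear[OF C2\<psi> u(1)]])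
qed

text \<open>Conversely, a curve in \<open>M\<close> has its image under \<open>\<phi>\<close> in \<open>E\<close>, and closed subspaces contain the velocities of their curves.\<close>

lemma tangent_preimage:
  assumes x: "x \<in> U" and \<tau>: "\<tau> \<in> tangent_space M x"
  shows "D1 \<phi> x \<tau> \<in> E"
proof -
  obtain \<gamma> where g: "\<gamma> 0 = x" "\<forall>\<^sub>F t in nhds 0. \<gamma> t \<in> M" "(\<gamma> has_vector_derivative \<tau>) (at (0::real))"
    using \<tau> unfolding tangent_space_def by blast
  have "isCont \<gamma> 0" using g(3) by (rule has_vector_derivative_continuous)
  then have "\<forall>\<^sub>F t in at 0. \<gamma> t \<in> U" using U x g(1) unfolding isCont_def by (intro topological_tendstoD) auto
  moreover have "\<forall>\<^sub>F t in at 0. \<gamma> t \<in> M"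
    unfolding eventually_at_filter using g(2) by (rule eventually_mono) simp
  ultimately have ev0: "\<forall>\<^sub>F t in at 0. \<gamma> t \<in> U \<and> \<gamma> t \<in> M" by (rule eventually_conj)
  have xM: "x \<in> M" using eventually_nhds_x_imp_x[OF g(2)] g(1) by simp
  from ev0 have ev: "\<forall>\<^sub>F t in at 0. (\<phi> (\<gamma> t) - \<phi> (\<gamma> 0)) /\<^sub>R t \<in> E"
  proof (rule eventually_mono)
    fix t assume "\<gamma> t \<in> U \<and> \<gamma> t \<in> M"
    then show "(\<phi> (\<gamma> t) - \<phi> (\<gamma> 0)) /\<^sub>R t \<in> E"
      unfolding g(1) using x xM by (intro subspace_scale[OF E] subspace_diff[OF E] \<phi>_E) auto
  qed
  have "((\<lambda>t. \<phi> (\<gamma> t)) has_derivative (\<lambda>s. D1 \<phi> x (s *\<^sub>R \<tau>))) (at 0)"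
    using has_derivative_compose[of \<gamma> "\<lambda>s. s *\<^sub>R \<tau>" 0 UNIV \<phi> "D1 \<phi> x"] g(1,3) \<phi>_D1[OF x]
    unfolding has_vector_derivative_def by simp
  then have "((\<lambda>t. \<phi> (\<gamma> t)) has_vector_derivative D1 \<phi> x \<tau>) (at 0)"
    unfolding has_vector_derivative_def by (simp add: linear_scale[OF D1_linear[OF C2\<phi> x]])
  then have "((\<lambda>t. (\<phi> (\<gamma> t) - \<phi> (\<gamma> 0)) /\<^sub>R t) \<longlongrightarrow> D1 \<phi> x \<tau>) (at 0)"
    by (rule has_vector_derivative_quotient)
  then show ?thesis
    using ev closed_subspace[OF E] by (intro Lim_in_closed_set[of E]) auto
qed

lemma tangent_space_eq:
  assumes x: "x \<in> M" "x \<in> U" shows "tangent_space M x = D1 \<psi> (\<phi> x) ` E"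
proof
  show "tangent_space M x \<subseteq> D1 \<psi> (\<phi> x) ` E"
  proof
    fix \<tau> assume "\<tau> \<in> tangent_space M x"
    then have "D1 \<phi> x \<tau> \<in> E" by (rule tangent_preimage[OF x(2)])
    then show "\<tau> \<in> D1 \<psi> (\<phi> x) ` E" using D1_inverse1[OF x(2), of \<tau>] by (intro image_eqI) auto
  qed
  show "D1 \<psi> (\<phi> x) ` E \<subseteq> tangent_space M x"
    using tangent_vector[OF \<phi>_in[OF x(2)] \<phi>_E[OF x]] \<psi>\<phi>[OF x(2)] by auto
qed

lemma subspace_tangent: "x \<in> M \<Longrightarrow> x \<in> U \<Longrightarrow> subspace (tangent_space M x)"
  unfolding tangent_space_eq by (rule linear_subspace_image[OF D1_linear[OF C2\<psi> \<phi>_in] E])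

text \<open>The bilinear form on the right is the second derivative of \<open>f \<circ> \<psi>\<close>; it is the link between the derivatives along a path
  and the Riemannian Hessian.\<close>

lemma chart_second_derivative:
  fixes f :: "'a \<Rightarrow> real"
  assumes W: "open W" and f: "Ck_on 2 W f" and u: "u \<in> V" "\<psi> u \<in> W"
  shows "((\<lambda>w. D1 f (\<psi> w) (D1 \<psi> w e)) has_derivative
     (\<lambda>h. D2 f (\<psi> u) (D1 \<psi> u h) (D1 \<psi> u e) + D1 f (\<psi> u) (D2 \<psi> u h e))) (at u)"
proof -
  define G where "G = V \<inter> \<psi> -` W"
  have "continuous_on V \<psi>" using hom unfolding homeomorphism_def by blast
  then have G: "open G" unfolding G_def using V W by (rule continuous_open_preimage)
  have uO: "u \<in> G" using u by (simp add: G_def)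
  have expand: "L v = (\<Sum>b\<in>Basis. L b * (v \<bullet> b))" if "linear L" for L :: "'a \<Rightarrow> real" and v
  proof -
    have "L v = L (\<Sum>b\<in>Basis. (v \<bullet> b) *\<^sub>R b)" by (simp add: euclidean_representation)
    also have "\<dots> = (\<Sum>b\<in>Basis. (v \<bullet> b) *\<^sub>R L b)" by (simp only: linear_sum[OF that] linear_scale[OF that])
    finally show ?thesis by (simp add: mult.commute)
  qed
  have "((\<lambda>w. \<Sum>b\<in>Basis. D1 f (\<psi> w) b * (D1 \<psi> w e \<bullet> b)) has_derivative
    (\<lambda>h. \<Sum>b\<in>Basis. D1 f (\<psi> u) b * (D2 \<psi> u h e \<bullet> b) + D2 f (\<psi> u) (D1 \<psi> u h) b * (D1 \<psi> u e \<bullet> b))) (at u)"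
  proof (rule has_derivative_sum)
    fix b :: 'a
    have 1: "((\<lambda>w. D1 f (\<psi> w) b) has_derivative (\<lambda>h. D2 f (\<psi> u) (D1 \<psi> u h) b)) (at u)"
      by (rule has_derivative_compose[OF \<psi>_D1[OF u(1)] D2[OF f u(2)]])
    have 2: "((\<lambda>w. D1 \<psi> w e \<bullet> b) has_derivative (\<lambda>h. D2 \<psi> u h e \<bullet> b)) (at u)"
      by (rule has_derivative_inner_left[OF D2[OF C2\<psi> u(1)]])
    show "((\<lambda>w. D1 f (\<psi> w) b * (D1 \<psi> w e \<bullet> b)) has_derivative
      (\<lambda>h. D1 f (\<psi> u) b * (D2 \<psi> u h e \<bullet> b) + D2 f (\<psi> u) (D1 \<psi> u h) b * (D1 \<psi> u e \<bullet> b))) (at u)"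
      by (rule has_derivative_mult[OF 1 2])
  qed
  moreover have "(\<Sum>b\<in>Basis. D1 f (\<psi> u) b * (D2 \<psi> u h e \<bullet> b) + D2 f (\<psi> u) (D1 \<psi> u h) b * (D1 \<psi> u e \<bullet> b)) =
    D2 f (\<psi> u) (D1 \<psi> u h) (D1 \<psi> u e) + D1 f (\<psi> u) (D2 \<psi> u h e)" for h
    unfolding sum.distrib expand[OF D1_linear[OF f u(2)], of "D2 \<psi> u h e"] expand[OF D2_linear2[OF f W u(2)], of "D1 \<psi> u h" "D1 \<psi> u e"] by simp
  ultimately have "((\<lambda>w. \<Sum>b\<in>Basis. D1 f (\<psi> w) b * (D1 \<psi> w e \<bullet> b)) has_derivative
    (\<lambda>h. D2 f (\<psi> u) (D1 \<psi> u h) (D1 \<psi> u e) + D1 f (\<psi> u) (D2 \<psi> u h e))) (at u)" by simp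
  then show ?thesis
  proof (rule has_derivative_transform_within_open[OF _ G uO])
    fix w assume "w \<in> G"
    then show "(\<Sum>b\<in>Basis. D1 f (\<psi> w) b * (D1 \<psi> w e \<bullet> b)) = D1 f (\<psi> w) (D1 \<psi> w e)"
      using expand[OF D1_linear[OF f], of "\<psi> w" "D1 \<psi> w e"] by (simp add: G_def)
  qed
qed

lemma extension_first_order:
  fixes f1 f2 :: "'a \<Rightarrow> real"
  assumes W: "open W" and f: "Ck_on 2 W f1" "Ck_on 2 W f2" "\<And>z. z \<in> M \<Longrightarrow> z \<in> W \<Longrightarrow> f1 z = f2 z"
    and u: "u \<in> V" "u \<in> E" "\<psi> u \<in> W" and e: "e \<in> E"
  shows "D1 f1 (\<psi> u) (D1 \<psi> u e) = D1 f2 (\<psi> u) (D1 \<psi> u e)"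
proof -
  define G where "G = V \<inter> \<psi> -` W"
  have "continuous_on V \<psi>" using hom unfolding homeomorphism_def by blast
  then have G: "open G" unfolding G_def using V W by (rule continuous_open_preimage)
  have uO: "u \<in> G" using u by (simp add: G_def)
  have "((\<lambda>w. f1 (\<psi> w) - f2 (\<psi> w)) has_derivative (\<lambda>h. D1 f1 (\<psi> u) (D1 \<psi> u h) - D1 f2 (\<psi> u) (D1 \<psi> u h))) (at u)"
    by (intro has_derivative_diff has_derivative_compose[OF \<psi>_D1[OF u(1)] D1[OF f(1) u(3)]] has_derivative_compose[OF \<psi>_D1[OF u(1)] D1[OF f(2) u(3)]])
  note d = this
  have "\<forall>\<^sub>F t in nhds 0. f1 (\<psi> (u + t *\<^sub>R e)) - f2 (\<psi> (u + t *\<^sub>R e)) = 0"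
    using eventually_line[OF G uO u(2) e] by (rule eventually_mono) (simp add: G_def f(3) \<psi>_M)
  from derivative_zero_on_line[OF d this] show ?thesis by simp
qed

text \<open>The second derivative in the chart depends only on the values of the function on the submanifold. Together with
  the first order statement it makes the Riemannian Hessian independent of the chosen extension.\<close>

lemma extension_second_order:
  fixes f1 f2 :: "'a \<Rightarrow> real"
  assumes W: "open W" and f: "Ck_on 2 W f1" "Ck_on 2 W f2" "\<And>z. z \<in> M \<Longrightarrow> z \<in> W \<Longrightarrow> f1 z = f2 z"
    and u: "u \<in> V" "u \<in> E" "\<psi> u \<in> W" and e: "e \<in> E" and h: "h \<in> E"
  shows "D2 f1 (\<psi> u) (D1 \<psi> u h) (D1 \<psi> u e) + D1 f1 (\<psi> u) (D2 \<psi> u h e) =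
    D2 f2 (\<psi> u) (D1 \<psi> u h) (D1 \<psi> u e) + D1 f2 (\<psi> u) (D2 \<psi> u h e)"
proof -
  define G where "G = V \<inter> \<psi> -` W"
  have "continuous_on V \<psi>" using hom unfolding homeomorphism_def by blast
  then have G: "open G" unfolding G_def using V W by (rule continuous_open_preimage)
  have uO: "u \<in> G" using u by (simp add: G_def)
  note d = has_derivative_diff[OF chart_second_derivative[OF W f(1) u(1,3), of e] chart_second_derivative[OF W f(2) u(1,3), of e]]
  have "\<forall>\<^sub>F t in nhds 0. D1 f1 (\<psi> (u + t *\<^sub>R h)) (D1 \<psi> (u + t *\<^sub>R h) e) - D1 f2 (\<psi> (u + t *\<^sub>R h)) (D1 \<psi> (u + t *\<^sub>R h) e) = 0"
    using eventually_line[OF G uO u(2) h]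
  proof (rule eventually_mono)
    fix t assume "u + t *\<^sub>R h \<in> G \<and> u + t *\<^sub>R h \<in> E"
    then have "D1 f1 (\<psi> (u + t *\<^sub>R h)) (D1 \<psi> (u + t *\<^sub>R h) e) = D1 f2 (\<psi> (u + t *\<^sub>R h)) (D1 \<psi> (u + t *\<^sub>R h) e)"
      by (intro extension_first_order[OF W f _ _ _ e]) (auto simp: G_def)
    then show "D1 f1 (\<psi> (u + t *\<^sub>R h)) (D1 \<psi> (u + t *\<^sub>R h) e) - D1 f2 (\<psi> (u + t *\<^sub>R h)) (D1 \<psi> (u + t *\<^sub>R h) e) = 0" by simp
  qed
  from derivative_zero_on_line[OF d this] show ?thesis by simp
qed

end

section \<open>Weingarten map and Riemannian Hessian in a chart\<close>

lemma Ck_on_subset: "Ck_on k U f \<Longrightarrow> U' \<subseteq> U \<Longrightarrow> Ck_on k U' f"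
  by (induction k arbitrary: f) (auto intro: continuous_on_subset)

lemma dir_deriv_eq:
  assumes "(f has_derivative D) (at z)" shows "dir_deriv f z v = D v"
proof -
  have "((\<lambda>s. z + s *\<^sub>R v) has_derivative (\<lambda>s. s *\<^sub>R v)) (at 0)" by (auto intro!: derivative_eq_intros)
  from has_derivative_compose[OF this, of f D] assms
  have "((\<lambda>s. f (z + s *\<^sub>R v)) has_derivative (\<lambda>s. D (s *\<^sub>R v))) (at 0)" by simp
  moreover have "D (s *\<^sub>R v) = D v * s" for s using linear_scale[OF has_derivative_linear[OF assms]] by simp
  ultimately have "((\<lambda>s. f (z + s *\<^sub>R v)) has_real_derivative D v) (at 0)"
    unfolding has_field_derivative_def by simp
  then show ?thesis unfolding dir_deriv_def by (rule DERIV_imp_deriv)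
qed

lemma hess_form_D2:
  fixes f :: "'a::euclidean_space \<Rightarrow> real"
  assumes f: "Ck_on 2 W f" and W: "open W" "x \<in> W"
  shows "hess_form f x u v = D2 f x u v"
proof -
  have "((\<lambda>z. dir_deriv f z v) has_derivative (\<lambda>u. D2 f x u v)) (at x)"
    by (rule has_derivative_transform_within_open[OF D2[OF f W(2)] W]) (simp add: dir_deriv_eq[OF D1[OF f]])
  then show ?thesis unfolding hess_form_def by (rule dir_deriv_eq)
qed

lemma matrix_of_bilinear:
  fixes B :: "real^'m \<Rightarrow> real^'m \<Rightarrow> real"
  assumes B: "\<And>v. linear (\<lambda>u. B u v)" "\<And>u. linear (B u)"
  shows "((\<chi> i j. B (axis i 1) (axis j 1)) *v \<zeta>) \<bullet> \<eta> = B \<eta> \<zeta>"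
proof -
  have ex: "L v = (\<Sum>i\<in>UNIV. v $ i * L (axis i 1))" if "linear L" for L :: "real^'m \<Rightarrow> real" and v
  proof -
    have "L v = L (\<Sum>i\<in>UNIV. v $ i *\<^sub>R axis i 1)" using basis_expansion[of v] by (simp add: scalar_mult_eq_scaleR)
    also have "\<dots> = (\<Sum>i\<in>UNIV. v $ i *\<^sub>R L (axis i 1))" by (simp only: linear_sum[OF that] linear_scale[OF that])
    finally show ?thesis by simp
  qed
  have "B \<eta> \<zeta> = (\<Sum>i\<in>UNIV. \<eta> $ i * B (axis i 1) \<zeta>)" by (rule ex[OF B(1)])
  also have "\<dots> = (\<Sum>i\<in>UNIV. \<eta> $ i * (\<Sum>j\<in>UNIV. \<zeta> $ j * B (axis i 1) (axis j 1)))" by (subst ex[OF B(2), of _ \<zeta>]) simp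
  finally show ?thesis by (simp add: inner_vec_def matrix_vector_mult_def mult.commute)
qed

lemma hess_inner:
  fixes f :: "real^'m \<Rightarrow> real"
  assumes f: "Ck_on 2 W f" and W: "open W" "x \<in> W"
  shows "(hess f x *v \<zeta>) \<bullet> \<eta> = D2 f x \<zeta> \<eta>"
proof -
  have "hess f x = (\<chi> i j. D2 f x (axis i 1) (axis j 1))" unfolding hess_def hess_form_D2[OF f W] ..
  then have "(hess f x *v \<zeta>) \<bullet> \<eta> = D2 f x \<eta> \<zeta>"
    using matrix_of_bilinear[of "D2 f x", OF D2_linear1[OF f W(2)] D2_linear2[OF f W]] by simp
  then show ?thesis by (simp add: D2_symmetric[OF f W])
qed

lemma orthogonal_comp_inner: "n \<in> S\<^sup>\<bottom> \<Longrightarrow> \<tau> \<in> S \<Longrightarrow> n \<bullet> \<tau> = 0"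
  unfolding orthogonal_comp_def orthogonal_def by (metis (mono_tags, lifting) inner_commute mem_Collect_eq)

locale vec_chart = C2_chart M U V \<phi> \<psi> E
  for M :: "(real^'p) set" and U V :: "(real^'p) set" and \<phi> \<psi> :: "real^'p \<Rightarrow> real^'p" and E :: "(real^'p) set"
begin

text \<open>Freeze the covector \<open>w = (D\<psi>)\<^sup>* n\<close> in the chart, which annihilates \<open>E\<close>, and pull it back by \<open>D\<phi>\<close> at the moving
  point; the result annihilates all nearby tangent spaces.\<close>

lemma normal_extension_exists:
  assumes x: "x \<in> M" "x \<in> U" and n: "n \<in> (tangent_space M x)\<^sup>\<bottom>"
  shows "\<exists>W. normal_extension M x n W"
proof -
  define u where "u = \<phi> x"
  note uV = \<phi>_in[OF x(2), folded u_def]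
  define w where "w = adjoint (D1 \<psi> u) n"
  have w: "w \<bullet> h = n \<bullet> D1 \<psi> u h" for h
    using adjoint_works[OF D1_linear[OF C2\<psi> uV], of h n] unfolding w_def by (simp add: inner_commute)
  define W where "W = (\<lambda>z. \<Sum>b\<in>Basis. (w \<bullet> D1 \<phi> z b) *\<^sub>R b)"
  have Wi: "W z \<bullet> v = w \<bullet> D1 \<phi> z v" if "z \<in> U" for z v
  proof -
    have "w \<bullet> D1 \<phi> z v = w \<bullet> D1 \<phi> z (\<Sum>b\<in>Basis. (v \<bullet> b) *\<^sub>R b)" by (simp add: euclidean_representation)
    also have "\<dots> = (\<Sum>b\<in>Basis. (v \<bullet> b) * (w \<bullet> D1 \<phi> z b))"
      by (simp only: linear_sum[OF D1_linear[OF C2\<phi> that]] linear_scale[OF D1_linear[OF C2\<phi> that]] inner_sum_right inner_scaleR_right)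
    finally show ?thesis unfolding W_def
      by (simp only: inner_sum_left inner_scaleR_left) (simp add: inner_commute mult.commute)
  qed
  have d: "(W has_derivative (\<lambda>h. \<Sum>b\<in>Basis. (w \<bullet> D2 \<phi> z h b) *\<^sub>R b)) (at z)" if "z \<in> U" for z
    unfolding W_def
    by (intro has_derivative_sum has_derivative_scaleR_left has_derivative_inner_right D2[OF C2\<phi> that])
  have "Ck_on 1 U W"
  proof -
    have "continuous_on U (\<lambda>z. frechet_derivative W (at z) v)" for v
    proof -
      have 1: "continuous_on U (\<lambda>z. \<Sum>b\<in>Basis. (w \<bullet> D2 \<phi> z v b) *\<^sub>R b)"
        by (intro continuous_intros D2_continuous[OF C2\<phi>])
      show ?thesis
      proof (rule continuous_on_eq[OF 1])
        fix z assume "z \<in> U"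
        from fun_cong[OF frechet_derivative_at[OF d[OF this]], of v]
        show "(\<Sum>b\<in>Basis. (w \<bullet> D2 \<phi> z v b) *\<^sub>R b) = frechet_derivative W (at z) v" .
      qed
    qed
    moreover have "\<forall>z\<in>U. W differentiable (at z)" using d unfolding differentiable_def by blast
    ultimately show ?thesis unfolding One_nat_def by simp
  qed
  moreover have "W x = n"
  proof (rule vector_eq_rdot[THEN iffD1], rule allI)
    fix v show "W x \<bullet> v = n \<bullet> v" unfolding Wi[OF x(2)] w u_def D1_inverse1[OF x(2)] ..
  qed
  moreover have "W z \<in> (tangent_space M z)\<^sup>\<bottom>" if z: "z \<in> M \<inter> U" for z
  proof -
    have "W z \<bullet> \<tau> = 0" if "\<tau> \<in> tangent_space M z" for \<tau>
    proof -
      have "D1 \<phi> z \<tau> \<in> E" using tangent_preimage that z by blast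
      then have "D1 \<psi> u (D1 \<phi> z \<tau>) \<in> tangent_space M x"
        using tangent_vector[OF uV] \<phi>_E[OF x] \<psi>\<phi>[OF x(2)] unfolding u_def by metis
      then have "n \<bullet> D1 \<psi> u (D1 \<phi> z \<tau>) = 0" by (rule orthogonal_comp_inner[OF n])
      then show ?thesis using Wi z w by simp
    qed
    then show ?thesis by (simp add: orthogonal_comp_def orthogonal_def inner_commute)
  qed
  ultimately show ?thesis unfolding normal_extension_def using U x(2) by blast
qed

text \<open>Differentiating \<open>V(\<psi> u) \<bullet> D\<psi>(u) e = 0\<close> along \<open>E\<close> moves the derivative from the normal field to the parametrisation.
  In particular the Weingarten map does not depend on the extension \<open>V\<close>.\<close>

lemma weingarten_form:
  assumes x: "x \<in> M" "x \<in> U" and n: "n \<in> (tangent_space M x)\<^sup>\<bottom>" and he: "h \<in> E" "e \<in> E"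
  shows "weingarten M x (D1 \<psi> (\<phi> x) h) n \<bullet> D1 \<psi> (\<phi> x) e = n \<bullet> D2 \<psi> (\<phi> x) h e"
proof -
  define u where "u = \<phi> x"
  note uV = \<phi>_in[OF x(2), folded u_def] and uE = \<phi>_E[OF x, folded u_def]
  have \<psi>u: "\<psi> u = x" unfolding u_def by (rule \<psi>\<phi>[OF x(2)])
  define W where "W = (SOME W. normal_extension M x n W)"
  have "normal_extension M x n W" unfolding W_def by (rule someI_ex[OF normal_extension_exists[OF x n]])
  then obtain U' where W: "W x = n" "open U'" "x \<in> U'" "Ck_on 1 U' W" "\<And>z. z \<in> M \<inter> U' \<Longrightarrow> W z \<in> (tangent_space M z)\<^sup>\<bottom>"
    unfolding normal_extension_def by blast
  define W' where "W' = frechet_derivative W (at x)"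
  have dW: "(W has_derivative W') (at (\<psi> u))"
    using W(3,4) unfolding W'_def \<psi>u One_nat_def by (simp add: frechet_derivative_works[symmetric])
  define G where "G = V \<inter> \<psi> -` U'"
  have "continuous_on V \<psi>" using hom unfolding homeomorphism_def by blast
  then have G: "open G" unfolding G_def using V W(2) by (rule continuous_open_preimage)
  have uG: "u \<in> G" using uV W(3) \<psi>u by (simp add: G_def)
  have d: "((\<lambda>w. W (\<psi> w) \<bullet> D1 \<psi> w e) has_derivative
    (\<lambda>h. W (\<psi> u) \<bullet> D2 \<psi> u h e + W' (D1 \<psi> u h) \<bullet> D1 \<psi> u e)) (at u)"
    by (rule has_derivative_inner[OF has_derivative_compose[OF \<psi>_D1[OF uV] dW] D2[OF C2\<psi> uV]])
  have "\<forall>\<^sub>F t in nhds 0. W (\<psi> (u + t *\<^sub>R h)) \<bullet> D1 \<psi> (u + t *\<^sub>R h) e = 0"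
    using eventually_line[OF G uG uE he(1)]
  proof (rule eventually_mono)
    fix t assume t: "u + t *\<^sub>R h \<in> G \<and> u + t *\<^sub>R h \<in> E"
    then have "D1 \<psi> (u + t *\<^sub>R h) e \<in> tangent_space M (\<psi> (u + t *\<^sub>R h))" using he(2) by (intro tangent_vector) (auto simp: G_def)
    moreover have "W (\<psi> (u + t *\<^sub>R h)) \<in> (tangent_space M (\<psi> (u + t *\<^sub>R h)))\<^sup>\<bottom>"
      using t by (intro W(5)) (auto simp: G_def \<psi>_M)
    ultimately show "W (\<psi> (u + t *\<^sub>R h)) \<bullet> D1 \<psi> (u + t *\<^sub>R h) e = 0" by (rule orthogonal_comp_inner[rotated])
  qed
  from derivative_zero_on_line[OF d this]
  have 1: "n \<bullet> D2 \<psi> u h e + W' (D1 \<psi> u h) \<bullet> D1 \<psi> u e = 0" unfolding \<psi>u W(1) .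
  have sT: "subspace (tangent_space M x)" by (rule subspace_tangent[OF x])
  have \<eta>: "D1 \<psi> u e \<in> tangent_space M x" using tangent_vector[OF uV uE he(2)] \<psi>u by simp
  have "weingarten M x (D1 \<psi> u h) n \<bullet> D1 \<psi> u e = - ((proj_mat (tangent_space M x) *v W' (D1 \<psi> u h)) \<bullet> D1 \<psi> u e)"
    unfolding weingarten_def W_def[symmetric] W'_def by simp
  also have "\<dots> = - (W' (D1 \<psi> u h) \<bullet> D1 \<psi> u e)"
    unfolding proj_mat_sym_inner[OF sT] proj_mat_id[OF sT \<eta>] ..
  finally show ?thesis using 1 unfolding u_def by linarith
qed

lemma weingarten_tangent:
  assumes x: "x \<in> M" "x \<in> U"
  shows "proj_mat (tangent_space M x) *v weingarten M x \<xi> n = weingarten M x \<xi> n"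
proof -
  have sT: "subspace (tangent_space M x)" by (rule subspace_tangent[OF x])
  have "weingarten M x \<xi> n \<in> tangent_space M x"
    unfolding weingarten_def by (intro subspace_neg[OF sT] proj_mat_works[OF sT])
  then show ?thesis by (rule proj_mat_id[OF sT])
qed

lemma weingarten_linear:
  assumes x: "x \<in> M" "x \<in> U" and n: "n \<in> (tangent_space M x)\<^sup>\<bottom>"
  shows "linear (\<lambda>\<xi>. weingarten M x \<xi> n)"
proof -
  define W where "W = (SOME W. normal_extension M x n W)"
  have "normal_extension M x n W" unfolding W_def by (rule someI_ex[OF normal_extension_exists[OF x n]])
  then have "(W has_derivative frechet_derivative W (at x)) (at x)"
    unfolding normal_extension_def One_nat_def by (auto simp: frechet_derivative_works[symmetric])
  then have "linear (frechet_derivative W (at x))" by (rule has_derivative_linear)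
  then have "linear (\<lambda>\<xi>. - (proj_mat (tangent_space M x) *v frechet_derivative W (at x) \<xi>))"
    using linear_compose_neg[OF linear_compose[OF _ matrix_vector_mul_linear, of "frechet_derivative W (at x)" "proj_mat (tangent_space M x)"]]
    by (simp add: comp_def)
  then show ?thesis unfolding weingarten_def W_def .
qed

text \<open>In the chart, the Riemannian Hessian is \<open>D\<^sup>2f (D\<psi> h, D\<psi> e) + \<langle>P\<^sub>N \<nabla>f, D\<^sup>2\<psi> (h, e)\<rangle>\<close>. The choice of extension in the definition is harmless
  because two extensions have the same first and second order behaviour along the chart.\<close>

lemma riem_hess_properties:
  assumes x: "x \<in> M" "x \<in> U" and W: "open W" "x \<in> W" and f1: "Ck_on 2 W f1" "\<And>z. z \<in> M \<Longrightarrow> z \<in> W \<Longrightarrow> f1 z = f z"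
  shows "linear (riem_hess M f x)"
    and "proj_mat (tangent_space M x) *v riem_hess M f x \<xi> = riem_hess M f x \<xi>"
    and "riem_hess M f x (proj_mat (tangent_space M x) *v \<xi>) = riem_hess M f x \<xi>"
    and "h \<in> E \<Longrightarrow> e \<in> E \<Longrightarrow> riem_hess M f x (D1 \<psi> (\<phi> x) h) \<bullet> D1 \<psi> (\<phi> x) e =
      D2 f1 x (D1 \<psi> (\<phi> x) h) (D1 \<psi> (\<phi> x) e) + (proj_mat ((tangent_space M x)\<^sup>\<bottom>) *v grad f1 x) \<bullet> D2 \<psi> (\<phi> x) h e"
proof -
  define g0 where "g0 = (SOME g. C2_extension M x f g)"
  have ex: "\<exists>g. C2_extension M x f g" unfolding C2_extension_def using W f1 by blast
  have "C2_extension M x f g0" unfolding g0_def by (rule someI_ex[OF ex])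
  then obtain U0 where U0: "open U0" "x \<in> U0" "Ck_on 2 U0 g0" "\<And>z. z \<in> M \<Longrightarrow> z \<in> U0 \<Longrightarrow> g0 z = f z"
    unfolding C2_extension_def by blast
  let ?T = "tangent_space M x"
  define P N where "P = proj_mat ?T" and "N = proj_mat (?T\<^sup>\<bottom>)"
  have sT: "subspace ?T" by (rule subspace_tangent[OF x])
  have rh: "riem_hess M f x \<xi> = P *v (hess g0 x *v (P *v \<xi>)) + weingarten M x (P *v \<xi>) (N *v grad g0 x)" for \<xi>
    unfolding riem_hess_def g0_def[symmetric] Let_def P_def N_def ..
  have Nn: "N *v v \<in> ?T\<^sup>\<bottom>" for v unfolding N_def by (rule proj_mat_works[OF subspace_orthogonal_comp])
  have PP: "P *v (P *v v) = P *v v" for v unfolding P_def by (rule proj_mat_id[OF sT proj_mat_works(1)[OF sT]])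
  show "linear (riem_hess M f x)"
  proof -
    have "linear (\<lambda>\<xi>. P *v (hess g0 x *v (P *v \<xi>)))"
      using matrix_vector_mul_linear[of "P ** hess g0 x ** P"] by (simp add: matrix_vector_mul_assoc[symmetric])
    moreover have "linear (\<lambda>\<xi>. weingarten M x (P *v \<xi>) (N *v grad g0 x))"
      using linear_compose[OF matrix_vector_mul_linear[of P] weingarten_linear[OF x Nn]] by (simp add: comp_def)
    ultimately show ?thesis unfolding rh[abs_def] by (rule linear_compose_add)
  qed
  show "proj_mat ?T *v riem_hess M f x \<xi> = riem_hess M f x \<xi>"
    unfolding P_def[symmetric] rh matrix_vector_right_distrib PP
    using weingarten_tangent[OF x] unfolding P_def by simp
  show "riem_hess M f x (proj_mat ?T *v \<xi>) = riem_hess M f x \<xi>"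
    unfolding P_def[symmetric] rh PP ..
  assume he: "h \<in> E" "e \<in> E"
  define u where "u = \<phi> x"
  note uV = \<phi>_in[OF x(2), folded u_def] and uE = \<phi>_E[OF x, folded u_def]
  have \<psi>u: "\<psi> u = x" unfolding u_def by (rule \<psi>\<phi>[OF x(2)])
  define \<xi>0 \<eta>0 where "\<xi>0 = D1 \<psi> u h" and "\<eta>0 = D1 \<psi> u e"
  have T: "\<xi>0 \<in> ?T" "\<eta>0 \<in> ?T"
    using tangent_vector[OF uV uE he(1)] tangent_vector[OF uV uE he(2)] \<psi>u by (simp_all add: \<xi>0_def \<eta>0_def)
  have P\<xi>: "P *v \<xi>0 = \<xi>0" "P *v \<eta>0 = \<eta>0" unfolding P_def using proj_mat_id[OF sT] T by simp_all
  have Psym: "(P *v a) \<bullet> b = a \<bullet> (P *v b)" for a b unfolding P_def by (rule proj_mat_sym_inner[OF sT])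
  have "riem_hess M f x \<xi>0 \<bullet> \<eta>0 = D2 g0 x \<xi>0 \<eta>0 + (N *v grad g0 x) \<bullet> D2 \<psi> u h e"
    unfolding rh inner_add_left Psym P\<xi> hess_inner[OF U0(3,1,2)]
    using weingarten_form[OF x Nn[of "grad g0 x"] he] unfolding \<xi>0_def \<eta>0_def u_def by simp
  also have "\<dots> = D2 f1 x \<xi>0 \<eta>0 + (N *v grad f1 x) \<bullet> D2 \<psi> u h e"
  proof -
    define W0 where "W0 = W \<inter> U0"
    have W0: "open W0" "x \<in> W0" "Ck_on 2 W0 f1" "Ck_on 2 W0 g0" "\<And>z. z \<in> M \<Longrightarrow> z \<in> W0 \<Longrightarrow> g0 z = f1 z"
      using W U0 f1 Ck_on_subset[OF f1(1)] Ck_on_subset[OF U0(3)] by (auto simp: W0_def)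
    have gr: "D1 k x v = grad k x \<bullet> v" if "Ck_on 2 W0 k" for k v
    proof -
      have "GDERIV k x :> grad k x" using D1[OF that W0(2)] by (intro gderiv_differentiable) (auto simp: differentiable_def)
      then have "(k has_derivative (\<lambda>h. h \<bullet> grad k x)) (at x)" unfolding gderiv_def .
      from has_derivative_unique[OF D1[OF that W0(2)] this] show ?thesis by (simp add: inner_commute)
    qed
    have "grad g0 x \<bullet> \<tau> = grad f1 x \<bullet> \<tau>" if "\<tau> \<in> ?T" for \<tau>
    proof -
      have "\<tau> \<in> D1 \<psi> u ` E" using that unfolding tangent_space_eq[OF x] u_def .
      then obtain e' where "e' \<in> E" "\<tau> = D1 \<psi> u e'" by blast
      then show ?thesis
        using extension_first_order[OF W0(1,4,3,5) uV uE _ \<open>e' \<in> E\<close>] W0(2) \<psi>u gr[OF W0(4)] gr[OF W0(3)] by simp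
    qed
    then have "(grad g0 x - P *v grad f1 x) \<bullet> \<tau> = 0" if "\<tau> \<in> ?T" for \<tau>
      using that proj_mat_works(2)[OF sT that, of "grad f1 x"] unfolding P_def by (simp add: inner_diff_left)
    then have Pg: "P *v grad g0 x = P *v grad f1 x"
      unfolding P_def by (intro proj_mat_unique[OF sT] proj_mat_works(1)[OF sT])
    have split: "grad k x \<bullet> v = (P *v grad k x) \<bullet> v + (N *v grad k x) \<bullet> v" for k v
      unfolding P_def N_def proj_mat_comp[OF sT] by (simp add: inner_diff_left)
    have "D2 g0 x \<xi>0 \<eta>0 + D1 g0 x (D2 \<psi> u h e) = D2 f1 x \<xi>0 \<eta>0 + D1 f1 x (D2 \<psi> u h e)"
      using extension_second_order[OF W0(1,4,3,5) uV uE _ he(2,1)] W0(2) unfolding \<psi>u \<xi>0_def \<eta>0_def by blast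
    then show ?thesis
      unfolding gr[OF W0(4)] gr[OF W0(3)] split[of g0] split[of f1] Pg by linarith
  qed
  finally show "riem_hess M f x (D1 \<psi> (\<phi> x) h) \<bullet> D1 \<psi> (\<phi> x) e =
      D2 f1 x (D1 \<psi> (\<phi> x) h) (D1 \<psi> (\<phi> x) e) + (proj_mat (?T\<^sup>\<bottom>) *v grad f1 x) \<bullet> D2 \<psi> (\<phi> x) h e"
    unfolding \<xi>0_def \<eta>0_def u_def N_def .
qed

end

section \<open>Differentiating a path of critical points\<close>

text \<open>The Landau condition \<open>f = o(s)\<close> for vector valued \<open>f\<close>, in the form that is used under filters \<open>at y0\<close>.\<close>

definition negl_to :: "'a filter \<Rightarrow> ('a \<Rightarrow> 'b::real_normed_vector) \<Rightarrow> ('a \<Rightarrow> real) \<Rightarrow> bool" where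
  "negl_to F f s \<longleftrightarrow> (\<forall>\<epsilon>>0. \<forall>\<^sub>F y in F. norm (f y) \<le> \<epsilon> * s y)"

lemma negl_to_add:
  assumes "negl_to F f s" "negl_to F g s" shows "negl_to F (\<lambda>y. f y + g y) s"
  unfolding negl_to_def
proof (intro allI impI)
  fix \<epsilon> :: real assume "\<epsilon> > 0"
  then have "\<forall>\<^sub>F y in F. norm (f y) \<le> \<epsilon> / 2 * s y" "\<forall>\<^sub>F y in F. norm (g y) \<le> \<epsilon> / 2 * s y"
    using assms unfolding negl_to_def by (meson half_gt_zero)+
  then show "\<forall>\<^sub>F y in F. norm (f y + g y) \<le> \<epsilon> * s y"
  proof eventually_elim
    case (elim y)
    have "norm (f y + g y) \<le> norm (f y) + norm (g y)" by (rule norm_triangle_ineq)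
    also have "\<dots> \<le> \<epsilon> / 2 * s y + \<epsilon> / 2 * s y" using elim by (rule add_mono)
    finally show ?case by simp
  qed
qed

lemma negl_to_bounded:
  assumes "negl_to F f s" and C: "C > 0" "\<forall>\<^sub>F y in F. norm (g y) \<le> C * norm (f y)"
  shows "negl_to F g s"
  unfolding negl_to_def
proof (intro allI impI)
  fix \<epsilon> :: real assume "\<epsilon> > 0"
  then have "\<forall>\<^sub>F y in F. norm (f y) \<le> \<epsilon> / C * s y"
    using assms(1) C unfolding negl_to_def by (meson divide_pos_pos)
  then show "\<forall>\<^sub>F y in F. norm (g y) \<le> \<epsilon> * s y"
    using C(2)
  proof eventually_elim
    case (elim y)
    have "norm (g y) \<le> C * norm (f y)" by (rule elim(2))
    also have "\<dots> \<le> C * (\<epsilon> / C * s y)" using elim(1) C by (intro mult_left_mono) auto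
    finally show ?case using C by simp
  qed
qed

lemma negl_to_scale:
  assumes "negl_to F f s" "C > 0" "\<forall>\<^sub>F y in F. s y \<le> C * r y" shows "negl_to F f r"
  unfolding negl_to_def
proof (intro allI impI)
  fix \<epsilon> :: real assume e: "\<epsilon> > 0"
  then have "\<forall>\<^sub>F y in F. norm (f y) \<le> \<epsilon> / C * s y"
    using assms(1,2) unfolding negl_to_def by (meson divide_pos_pos)
  then show "\<forall>\<^sub>F y in F. norm (f y) \<le> \<epsilon> * r y"
    using assms(3)
  proof eventually_elim
    case (elim y)
    have "\<epsilon> / C * s y \<le> \<epsilon> / C * (C * r y)" using elim(2) e assms(2) by (intro mult_left_mono) auto
    then show ?case using elim(1) assms(2) by simp
  qed
qed

lemma negl_to_cong:
  assumes "negl_to F f s" "\<forall>\<^sub>F y in F. f y = g y" shows "negl_to F g s"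
  using negl_to_bounded[OF assms(1), of 1 g] eventually_mono[OF assms(2), of "\<lambda>y. norm (g y) \<le> 1 * norm (f y)"] by simp

text \<open>The product of an \<open>O(s)\<close> and an \<open>o(1)\<close> term is \<open>o(s)\<close>.\<close>

lemma negl_to_mult_tendsto:
  fixes f g :: "'a \<Rightarrow> 'b::real_inner"
  assumes g: "(g \<longlongrightarrow> 0) F" and f: "\<forall>\<^sub>F y in F. norm (f y) \<le> C * s y" and C: "C > 0" and s: "\<And>y. 0 \<le> s y"
  shows "negl_to F (\<lambda>y. f y \<bullet> g y) s"
  unfolding negl_to_def
proof (intro allI impI)
  fix \<epsilon> :: real assume e: "\<epsilon> > 0"
  have "\<forall>\<^sub>F y in F. norm (g y) < \<epsilon> / C"
    using tendstoD[OF g, of "\<epsilon> / C"] e C by (simp add: dist_norm)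
  then show "\<forall>\<^sub>F y in F. norm (f y \<bullet> g y) \<le> \<epsilon> * s y"
    using f
  proof eventually_elim
    case (elim y)
    have "norm (f y \<bullet> g y) \<le> norm (f y) * norm (g y)" using Cauchy_Schwarz_ineq2[of "f y" "g y"] by simp
    also have "\<dots> \<le> (C * s y) * (\<epsilon> / C)" using elim C s[of y] by (intro mult_mono) auto
    finally show ?case using C by (simp add: mult.commute)
  qed
qed

lemma has_derivative_negl_to:
  assumes k: "(k has_derivative k') (at u0)" and u: "(u \<longlongrightarrow> u0) F" and s: "\<And>y. norm (u y - u0) \<le> s y"
  shows "negl_to F (\<lambda>y. k (u y) - k u0 - k' (u y - u0)) s"
  unfolding negl_to_def
proof (intro allI impI)
  fix \<epsilon> :: real assume e: "\<epsilon> > 0"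
  then obtain d where d: "d > 0" "\<And>w. norm (w - u0) < d \<Longrightarrow> norm (k w - k u0 - k' (w - u0)) \<le> \<epsilon> * norm (w - u0)"
    using k unfolding has_derivative_at_alt by blast
  have "\<forall>\<^sub>F y in F. dist (u y) u0 < d" by (rule tendstoD[OF u d(1)])
  then show "\<forall>\<^sub>F y in F. norm (k (u y) - k u0 - k' (u y - u0)) \<le> \<epsilon> * s y"
  proof eventually_elim
    case (elim y)
    have "norm (k (u y) - k u0 - k' (u y - u0)) \<le> \<epsilon> * norm (u y - u0)" using elim by (intro d(2)) (simp add: dist_norm)
    also have "\<dots> \<le> \<epsilon> * s y" using s e by (intro mult_left_mono) auto
    finally show ?case .
  qed
qed

lemma negl_to_componentwise:
  fixes R :: "'a \<Rightarrow> 'b::euclidean_space"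
  assumes R: "\<And>b. b \<in> Basis \<Longrightarrow> negl_to F (\<lambda>y. R y \<bullet> b) s"
  shows "negl_to F R s"
  unfolding negl_to_def
proof (intro allI impI)
  fix \<epsilon> :: real assume e: "\<epsilon> > 0"
  have "\<forall>\<^sub>F y in F. \<forall>b\<in>Basis. norm (R y \<bullet> b) \<le> \<epsilon> / DIM('b) * s y"
  proof (intro eventually_ball_finite ballI)
    fix b :: 'b assume "b \<in> Basis"
    moreover have "0 < \<epsilon> / DIM('b)" using e by simp
    ultimately show "\<forall>\<^sub>F y in F. norm (R y \<bullet> b) \<le> \<epsilon> / DIM('b) * s y" using R unfolding negl_to_def by blast
  qed simp
  then show "\<forall>\<^sub>F y in F. norm (R y) \<le> \<epsilon> * s y"
  proof eventually_elim
    case (elim y)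
    have "norm (R y) \<le> (\<Sum>b\<in>Basis. \<bar>R y \<bullet> b\<bar>)" by (rule norm_le_l1)
    also have "\<dots> \<le> (\<Sum>b\<in>(Basis::'b set). \<epsilon> / DIM('b) * s y)" using elim by (intro sum_mono) simp
    finally show ?case by simp
  qed
qed

context vec_chart begin

text \<open>The path \<open>b\<close> of critical points of the perturbed functions on the manifold is only assumed continuous at \<open>y0\<close>. Expanding the critical equation at \<open>x0\<close> in the chart gives \<open>Q \<xi> + A (y - y0) = o(s)\<close> on the tangent space, where
  \<open>\<xi>\<close> is the linearised step and \<open>s\<close> the sum of the step and the data perturbation. Inverting \<open>Q\<close> bounds \<open>s\<close> by a
  multiple of \<open>|y - y0|\<close>, after which the expansion is the asserted derivative.\<close>

theorem critical_path_derivative: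
  fixes b :: "real^'n \<Rightarrow> real^'p" and r :: "real^'n \<Rightarrow> real^'p" and A :: "real^'n^'p" and f :: "real^'p \<Rightarrow> real"
  assumes x0: "x0 \<in> M" "x0 \<in> U" and W: "open W" "x0 \<in> W" and f: "Ck_on 2 W f"
    and b: "(b \<longlongrightarrow> x0) (at y0)" "\<forall>\<^sub>F y in at y0. b y \<in> M" "b y0 = x0"
    and crit: "\<forall>\<^sub>F y in at y0. \<forall>e\<in>E. D1 f (b y) (D1 \<psi> (\<phi> (b y)) e) + r y \<bullet> D1 \<psi> (\<phi> (b y)) e = 0"
    and crit0: "\<And>e. e \<in> E \<Longrightarrow> D1 f x0 (D1 \<psi> (\<phi> x0) e) = 0"
    and r: "negl_to (at y0) (\<lambda>y. r y - A *v (y - y0)) (\<lambda>y. norm (y - y0))"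
    and PQ: "proj_mat (tangent_space M x0) ** Q = Q" and QP: "Q ** proj_mat (tangent_space M x0) = Q"
    and Q: "\<And>h e. h \<in> E \<Longrightarrow> e \<in> E \<Longrightarrow> (Q *v D1 \<psi> (\<phi> x0) h) \<bullet> D1 \<psi> (\<phi> x0) e =
        D2 f x0 (D1 \<psi> (\<phi> x0) h) (D1 \<psi> (\<phi> x0) e) + D1 f x0 (D2 \<psi> (\<phi> x0) h e)"
    and inj: "\<And>\<xi>. \<xi> \<in> tangent_space M x0 \<Longrightarrow> Q *v \<xi> = 0 \<Longrightarrow> \<xi> = 0"
  shows "(b has_derivative (\<lambda>v. - ((pinv Q ** proj_mat (tangent_space M x0) ** A) *v v))) (at y0)"
proof -
  let ?T = "tangent_space M x0"
  define u0 where "u0 = \<phi> x0"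
  note u0V = \<phi>_in[OF x0(2), folded u0_def] and u0E = \<phi>_E[OF x0, folded u0_def]
  have \<psi>u0: "\<psi> u0 = x0" unfolding u0_def by (rule \<psi>\<phi>[OF x0(2)])
  have sT: "subspace ?T" by (rule subspace_tangent[OF x0])
  define P where "P = proj_mat ?T"
  define B where "B = pinv Q ** P ** A"
  define u where "u = (\<lambda>y. \<phi> (b y))"
  define du where "du = (\<lambda>y. u y - u0)"
  define s where "s = (\<lambda>y. norm (du y) + norm (y - y0))"
  have s0: "0 \<le> s y" "norm (du y) \<le> s y" "norm (y - y0) \<le> s y" for y unfolding s_def by simp_all
  have "isCont \<phi> x0" using has_derivative_continuous[OF \<phi>_D1[OF x0(2)]] .
  then have u_lim: "(u \<longlongrightarrow> u0) (at y0)" unfolding u_def u0_def by (rule isCont_tendsto_compose[OF _ b(1)])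
  have bU: "\<forall>\<^sub>F y in at y0. b y \<in> U" by (rule topological_tendstoD[OF b(1) U x0(2)])
  have bW: "\<forall>\<^sub>F y in at y0. b y \<in> W" by (rule topological_tendstoD[OF b(1) W])
  have uE: "\<forall>\<^sub>F y in at y0. u y \<in> V \<and> u y \<in> E \<and> \<psi> (u y) = b y"
    using bU b(2) by eventually_elim (simp add: u_def \<phi>_in \<phi>_E \<psi>\<phi>)
  define \<xi> where "\<xi> = (\<lambda>y. D1 \<psi> u0 (du y))"
  have r_bound: "\<forall>\<^sub>F y in at y0. norm (r y) \<le> (onorm ((*v) A) + 1) * s y"
  proof -
    have "\<forall>\<^sub>F y in at y0. norm (r y - A *v (y - y0)) \<le> 1 * norm (y - y0)" using r unfolding negl_to_def by (simp only: zero_less_one)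
    then show ?thesis
    proof eventually_elim
      case (elim y)
      have "norm (A *v (y - y0)) \<le> onorm ((*v) A) * norm (y - y0)" by (rule onorm[OF matrix_vector_mul_bounded_linear])
      moreover have "norm (r y) \<le> norm (r y - A *v (y - y0)) + norm (A *v (y - y0))" using norm_triangle_ineq[of "r y - A *v (y - y0)" "A *v (y - y0)"] by simp
      ultimately have "norm (r y) \<le> (onorm ((*v) A) + 1) * norm (y - y0)" using elim by (simp add: distrib_right)
      also have "\<dots> \<le> (onorm ((*v) A) + 1) * s y"
        using s0(3) onorm_pos_le[OF matrix_vector_mul_bounded_linear, of A] by (intro mult_left_mono) auto
      finally show ?case .
    qed
  qed
  have lin: "negl_to (at y0) (\<lambda>y. (Q *v \<xi> y + A *v (y - y0)) \<bullet> D1 \<psi> u0 e) s" if e: "e \<in> E" for e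
  proof -
    define k where "k = (\<lambda>w. D1 f (\<psi> w) (D1 \<psi> w e))"
    define k' where "k' = (\<lambda>h. D2 f (\<psi> u0) (D1 \<psi> u0 h) (D1 \<psi> u0 e) + D1 f (\<psi> u0) (D2 \<psi> u0 h e))"
    have "(k has_derivative k') (at u0)" unfolding k_def k'_def
      using W(2) \<psi>u0 by (intro chart_second_derivative[OF W(1) f u0V]) simp
    from has_derivative_negl_to[OF this u_lim, of s]
    have 1: "negl_to (at y0) (\<lambda>y. k (u y) - k u0 - k' (u y - u0)) s" using s0(2) unfolding du_def by blast
    have k0: "k u0 = 0" unfolding k_def \<psi>u0 using crit0[OF e] u0_def by simp
    have k'Q: "\<forall>\<^sub>F y in at y0. k' (u y - u0) = (Q *v \<xi> y) \<bullet> D1 \<psi> u0 e"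
      using uE
    proof eventually_elim
      case (elim y)
      have "u y - u0 \<in> E" using elim u0E by (intro subspace_diff[OF E]) auto
      from Q[folded u0_def, OF this e] show ?case unfolding k'_def \<xi>_def du_def \<psi>u0 by simp
    qed
    have kr: "\<forall>\<^sub>F y in at y0. k (u y) = - (r y \<bullet> D1 \<psi> (u y) e)"
      using uE crit
    proof eventually_elim
      case (elim y)
      then have "D1 f (b y) (D1 \<psi> (u y) e) + r y \<bullet> D1 \<psi> (u y) e = 0" using e unfolding u_def by blast
      then show ?case unfolding k_def using elim by simp
    qed
    have "((\<lambda>w. D1 \<psi> w e) \<longlongrightarrow> D1 \<psi> u0 e) (at u0)"
      using has_derivative_continuous[OF D2[OF C2\<psi> u0V, of e]] unfolding isCont_def .
    then have "isCont (\<lambda>w. D1 \<psi> w e) u0" unfolding isCont_def .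
    then have "((\<lambda>y. D1 \<psi> (u y) e) \<longlongrightarrow> D1 \<psi> u0 e) (at y0)" by (rule isCont_tendsto_compose[OF _ u_lim])
    then have "((\<lambda>y. D1 \<psi> (u y) e - D1 \<psi> u0 e) \<longlongrightarrow> 0) (at y0)" by (simp add: LIM_zero)
    then have 2: "negl_to (at y0) (\<lambda>y. r y \<bullet> (D1 \<psi> (u y) e - D1 \<psi> u0 e)) s"
      by (rule negl_to_mult_tendsto[OF _ r_bound _ s0(1)]) (use onorm_pos_le[OF matrix_vector_mul_bounded_linear, of A] in simp)
    have "negl_to (at y0) (\<lambda>y. r y - A *v (y - y0)) s"
      by (rule negl_to_scale[OF r, of 1]) (simp_all add: s0(3))
    then have 3: "negl_to (at y0) (\<lambda>y. (r y - A *v (y - y0)) \<bullet> D1 \<psi> u0 e) s"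
    proof (rule negl_to_bounded[of _ _ _ "norm (D1 \<psi> u0 e) + 1"])
      show "\<forall>\<^sub>F y in at y0. norm ((r y - A *v (y - y0)) \<bullet> D1 \<psi> u0 e) \<le> (norm (D1 \<psi> u0 e) + 1) * norm (r y - A *v (y - y0))"
      proof (rule always_eventually, rule allI)
        fix y
        have "norm ((r y - A *v (y - y0)) \<bullet> D1 \<psi> u0 e) \<le> norm (r y - A *v (y - y0)) * norm (D1 \<psi> u0 e)" using Cauchy_Schwarz_ineq2 by simp
        then show "norm ((r y - A *v (y - y0)) \<bullet> D1 \<psi> u0 e) \<le> (norm (D1 \<psi> u0 e) + 1) * norm (r y - A *v (y - y0))"
          by (simp add: distrib_right mult.commute add_increasing2)
      qed
    qed (simp add: add_nonneg_pos)
    have m: "negl_to F (\<lambda>y. - g y) s" if "negl_to F g s" for F and g :: "real^'n \<Rightarrow> real"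
      using that unfolding negl_to_def by simp
    have "negl_to (at y0) (\<lambda>y. - (k (u y) - k u0 - k' (u y - u0)) + (- (r y \<bullet> (D1 \<psi> (u y) e - D1 \<psi> u0 e)) + - ((r y - A *v (y - y0)) \<bullet> D1 \<psi> u0 e))) s"
      by (intro negl_to_add m 1 2 3)
    then show ?thesis
    proof (rule negl_to_cong)
      show "\<forall>\<^sub>F y in at y0. - (k (u y) - k u0 - k' (u y - u0)) + (- (r y \<bullet> (D1 \<psi> (u y) e - D1 \<psi> u0 e)) + - ((r y - A *v (y - y0)) \<bullet> D1 \<psi> u0 e)) =
        (Q *v \<xi> y + A *v (y - y0)) \<bullet> D1 \<psi> u0 e"
        using kr k'Q by eventually_elim (simp add: k0 inner_diff_left inner_diff_right inner_add_left)
    qed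
  qed
  define R where "R = (\<lambda>y. Q *v \<xi> y + P *v (A *v (y - y0)))"
  have PPv: "P *v (P *v v) = P *v v" for v unfolding P_def by (rule proj_mat_id[OF sT proj_mat_works(1)[OF sT]])
  have PQv: "P *v (Q *v v) = Q *v v" for v using PQ unfolding P_def[symmetric] by (simp add: matrix_vector_mul_assoc)
  have Psym: "(P *v a) \<bullet> c = a \<bullet> (P *v c)" for a c unfolding P_def by (rule proj_mat_sym_inner[OF sT])
  have Rneg: "negl_to (at y0) R s"
  proof (rule negl_to_componentwise)
    fix a :: "real^'p"
    have "P *v a \<in> ?T" unfolding P_def by (rule proj_mat_works(1)[OF sT])
    then obtain e where e: "e \<in> E" "P *v a = D1 \<psi> u0 e" unfolding tangent_space_eq[OF x0] u0_def by blast
    have "R y \<bullet> a = (Q *v \<xi> y + A *v (y - y0)) \<bullet> D1 \<psi> u0 e" for y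
    proof -
      have "R y = P *v (Q *v \<xi> y + A *v (y - y0))" unfolding R_def by (simp add: matrix_vector_right_distrib PQv)
      then show ?thesis unfolding e(2)[symmetric] using Psym by simp
    qed
    then show "negl_to (at y0) (\<lambda>y. R y \<bullet> a) s" using lin[OF e(1)] by simp
  qed
  note pinv = pinv_of_bijection_on_subspace[OF sT PQ QP inj, folded P_def]
  have xi: "\<forall>\<^sub>F y in at y0. pinv Q *v R y = \<xi> y + B *v (y - y0)"
    using uE
  proof eventually_elim
    case (elim y)
    have "\<xi> y \<in> ?T" unfolding \<xi>_def du_def tangent_space_eq[OF x0] u0_def[symmetric]
      using elim u0E by (intro imageI subspace_diff[OF E]) auto
    then have "P *v \<xi> y = \<xi> y" unfolding P_def by (rule proj_mat_id[OF sT])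
    then show ?case unfolding R_def B_def matrix_vector_right_distrib
      using pinv(1) by (simp add: matrix_vector_mul_assoc matrix_mul_assoc)
  qed
  have "negl_to (at y0) (\<lambda>y. pinv Q *v R y) s"
  proof (rule negl_to_bounded[OF Rneg, of "onorm ((*v) (pinv Q)) + 1"])
    show "\<forall>\<^sub>F y in at y0. norm (pinv Q *v R y) \<le> (onorm ((*v) (pinv Q)) + 1) * norm (R y)"
    proof (rule always_eventually, rule allI)
      fix y
      have "norm (pinv Q *v R y) \<le> onorm ((*v) (pinv Q)) * norm (R y)" by (rule onorm[OF matrix_vector_mul_bounded_linear])
      then show "norm (pinv Q *v R y) \<le> (onorm ((*v) (pinv Q)) + 1) * norm (R y)" by (simp add: distrib_right add_increasing2)
    qed
  qed (use onorm_pos_le[OF matrix_vector_mul_bounded_linear, of "pinv Q"] in simp)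
  then have \<xi>B: "negl_to (at y0) (\<lambda>y. \<xi> y + B *v (y - y0)) s" using xi by (rule negl_to_cong)
  \<comment> \<open>the step in the chart is of the order of the data perturbation\<close>
  have blin: "bounded_linear (D1 \<phi> x0)" using \<phi>_D1[OF x0(2)] by (rule has_derivative_bounded_linear)
  define c where "c = onorm (D1 \<phi> x0)"
  have c0: "c \<ge> 0" unfolding c_def by (rule onorm_pos_le[OF blin])
  define \<beta> where "\<beta> = onorm ((*v) B)"
  have \<beta>0: "\<beta> \<ge> 0" unfolding \<beta>_def by (rule onorm_pos_le[OF matrix_vector_mul_bounded_linear])
  have du\<xi>: "norm (du y) \<le> c * norm (\<xi> y)" for y
  proof -
    have "du y = D1 \<phi> x0 (\<xi> y)" unfolding \<xi>_def using D1_inverse2[OF u0V, of "du y"] \<psi>u0 by simp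
    then show ?thesis unfolding c_def using onorm[OF blin, of "\<xi> y"] by simp
  qed
  define C where "C = c * (2 * \<beta> + 1) + 1"
  have "\<forall>\<^sub>F y in at y0. norm (\<xi> y + B *v (y - y0)) \<le> 1 / (2 * (c + 1)) * s y"
    by (rule \<xi>B[unfolded negl_to_def, rule_format]) (use c0 in simp)
  then have sC: "\<forall>\<^sub>F y in at y0. s y \<le> C * norm (y - y0)"
  proof eventually_elim
    case (elim y)
    let ?x = "norm (\<xi> y)" and ?d = "norm (y - y0)"
    have "s y \<le> c * ?x + ?d" unfolding s_def using du\<xi>[of y] by simp
    also have "\<dots> \<le> (c + 1) * ?x + (c + 1) * ?d"
      using c0 by (intro add_mono mult_right_mono) (auto simp: distrib_right)
    finally have "s y \<le> (c + 1) * (?x + ?d)" by (simp add: distrib_left)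
    then have "1 / (2 * (c + 1)) * s y \<le> 1 / (2 * (c + 1)) * ((c + 1) * (?x + ?d))"
      using c0 by (intro mult_left_mono) auto
    also have "\<dots> = (?x + ?d) / 2" using c0 by (simp add: field_simps)
    finally have "norm (\<xi> y + B *v (y - y0)) \<le> (?x + ?d) / 2" using elim by linarith
    moreover have "norm (B *v (y - y0)) \<le> \<beta> * ?d" unfolding \<beta>_def by (rule onorm[OF matrix_vector_mul_bounded_linear])
    moreover have "?x \<le> norm (\<xi> y + B *v (y - y0)) + norm (B *v (y - y0))"
      using norm_triangle_ineq4[of "\<xi> y + B *v (y - y0)" "B *v (y - y0)"] by simp
    ultimately have "?x \<le> 2 * (\<beta> * ?d) + ?d" by argo
    then have "c * ?x \<le> c * (2 * (\<beta> * ?d) + ?d)" using c0 by (rule mult_left_mono)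
    then have "s y \<le> c * (2 * (\<beta> * ?d) + ?d) + ?d" unfolding s_def using du\<xi>[of y] by linarith
    then show ?case unfolding C_def by (simp add: algebra_simps)
  qed
  have C0: "C > 0" unfolding C_def using c0 \<beta>0 by (intro add_nonneg_pos mult_nonneg_nonneg) auto
  have "negl_to (at y0) (\<lambda>y. (\<psi> (u y) - \<psi> u0 - D1 \<psi> u0 (u y - u0)) + (\<xi> y + B *v (y - y0))) s"
    using has_derivative_negl_to[OF \<psi>_D1[OF u0V] u_lim, of s] s0(2) unfolding du_def by (intro negl_to_add \<xi>B) blast
  then have "negl_to (at y0) (\<lambda>y. b y - b y0 - - (B *v (y - y0))) s"
  proof (rule negl_to_cong)
    show "\<forall>\<^sub>F y in at y0. (\<psi> (u y) - \<psi> u0 - D1 \<psi> u0 (u y - u0)) + (\<xi> y + B *v (y - y0)) = b y - b y0 - - (B *v (y - y0))"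
      using uE by eventually_elim (simp add: \<psi>u0 b(3) \<xi>_def du_def)
  qed
  then have "negl_to (at y0) (\<lambda>y. b y - b y0 - - (B *v (y - y0))) (\<lambda>y. norm (y - y0))" by (rule negl_to_scale[OF _ C0 sC])
  then show ?thesis unfolding has_derivative_within_alt2 negl_to_def B_def P_def
    by (auto intro: bounded_linear_minus matrix_vector_mul_bounded_linear)
qed

end

section \<open>The matrix \<open>\<Delta>\<close> in terms of the Hessian in a chart\<close>

lemma Ck2_add:
  fixes f g :: "'a::euclidean_space \<Rightarrow> real"
  assumes f: "Ck_on 2 W f" and g: "Ck_on 2 W g" and W: "open W"
  shows "Ck_on 2 W (\<lambda>x. f x + g x)"
    and "x \<in> W \<Longrightarrow> D1 (\<lambda>x. f x + g x) x v = D1 f x v + D1 g x v"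
    and "x \<in> W \<Longrightarrow> D2 (\<lambda>x. f x + g x) x u v = D2 f x u v + D2 g x u v"
proof -
  have d: "((\<lambda>x. f x + g x) has_derivative (\<lambda>v. D1 f x v + D1 g x v)) (at x)" if "x \<in> W" for x
    by (rule has_derivative_add[OF D1[OF f that] D1[OF g that]])
  have 1: "D1 (\<lambda>x. f x + g x) x v = D1 f x v + D1 g x v" if "x \<in> W" for x v
    unfolding D1_def[of "\<lambda>x. f x + g x"] using fun_cong[OF frechet_derivative_at[OF d[OF that]], of v] by simp
  have dd: "((\<lambda>x. D1 (\<lambda>x. f x + g x) x v) has_derivative (\<lambda>u. D2 f x u v + D2 g x u v)) (at x)" if "x \<in> W" for x v
    by (rule has_derivative_transform_within_open[OF has_derivative_add[OF D2[OF f that] D2[OF g that]] W that]) (simp add: 1)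
  have 2: "D2 (\<lambda>x. f x + g x) x u v = D2 f x u v + D2 g x u v" if "x \<in> W" for x u v
    unfolding D2_def[of "\<lambda>x. f x + g x"] using fun_cong[OF frechet_derivative_at[OF dd[OF that]], of u] by simp
  have "continuous_on W (\<lambda>z. D2 (\<lambda>x. f x + g x) z u v)" for u v
  proof (rule continuous_on_eq)
    show "continuous_on W (\<lambda>z. D2 f z u v + D2 g z u v)" by (intro continuous_intros D2_continuous f g)
  qed (simp add: 2)
  moreover have "(\<lambda>x. f x + g x) differentiable (at x)" if "x \<in> W" for x using d[OF that] by (auto simp: differentiable_def)
  moreover have "(\<lambda>x. D1 (\<lambda>x. f x + g x) x v) differentiable (at x)" if "x \<in> W" for x v using dd[OF that] by (auto simp: differentiable_def)
  ultimately show "Ck_on 2 W (\<lambda>x. f x + g x)" unfolding numeral_2_eq_2 D2_def D1_def by simp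
  show "x \<in> W \<Longrightarrow> D1 (\<lambda>x. f x + g x) x v = D1 f x v + D1 g x v" by (rule 1)
  show "x \<in> W \<Longrightarrow> D2 (\<lambda>x. f x + g x) x u v = D2 f x u v + D2 g x u v" by (rule 2)
qed

lemma D1_grad:
  fixes k :: "'a::euclidean_space \<Rightarrow> real"
  assumes "Ck_on 2 W k" "x \<in> W" shows "D1 k x v = grad k x \<bullet> v"
proof -
  have "GDERIV k x :> grad k x" using D1[OF assms] by (intro gderiv_differentiable) (auto simp: differentiable_def)
  then have "(k has_derivative (\<lambda>h. h \<bullet> grad k x)) (at x)" unfolding gderiv_def .
  from has_derivative_unique[OF D1[OF assms] this] show ?thesis by (simp add: inner_commute)
qed

text \<open>The matrix \<open>hess_pullback\<close> only sees \<open>F0\<close> through the loss, which is the function that is known to be \<open>C\<^sup>2\<close>.\<close>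

lemma hess_form_loss:
  fixes X :: "real^'p^'n"
  shows "hess_form (\<lambda>m. F0 m y) (X *v x) (X *v u) (X *v v) = hess_form (\<lambda>b. loss X F0 b y) x u v"
proof -
  have line: "X *v z + t *\<^sub>R (X *v w) = X *v (z + t *\<^sub>R w)" for z w t
    by (simp add: matrix_vector_right_distrib matrix_vector_mult_scaleR)
  show ?thesis unfolding hess_form_def dir_deriv_def line loss_def ..
qed

text \<open>All subgradients have the same tangential part, the derivative of \<open>J\<close> along the manifold: along a curve in
  \<open>M\<close>, \<open>J - \<langle>w, \<cdot>\<rangle>\<close> has a minimum at \<open>x\<close>.\<close>

lemma subgradient_tangential:
  fixes g :: "'a::euclidean_space \<Rightarrow> real"
  assumes J: "proper_ext J" and w: "w \<in> subdiff J x" and W: "open W" "x \<in> W"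
    and g: "(g has_derivative g') (at x)" "\<And>z. z \<in> M \<Longrightarrow> z \<in> W \<Longrightarrow> J z = ereal (g z)"
    and \<tau>: "\<tau> \<in> tangent_space M x"
  shows "g' \<tau> = w \<bullet> \<tau>"
proof -
  obtain \<gamma> where c: "\<gamma> 0 = x" "\<forall>\<^sub>F t in nhds 0. \<gamma> t \<in> M" "(\<gamma> has_vector_derivative \<tau>) (at (0::real))"
    using \<tau> unfolding tangent_space_def by blast
  have "isCont \<gamma> 0" using c(3) by (rule has_vector_derivative_continuous)
  then have "(\<gamma> \<longlongrightarrow> x) (nhds 0)" using c(1) by (simp add: tendsto_nhds_iff isCont_def)
  then have "\<forall>\<^sub>F t in nhds 0. \<gamma> t \<in> W" using W by (rule topological_tendstoD)
  with c(2) have ev: "\<forall>\<^sub>F t in nhds 0. \<gamma> t \<in> M \<and> \<gamma> t \<in> W" by (rule eventually_conj)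
  have xM: "x \<in> M" using eventually_nhds_x_imp_x[OF ev] c(1) by simp
  define k where "k = (\<lambda>t. g (\<gamma> t) - w \<bullet> (\<gamma> t - x))"
  have min: "k 0 \<le> k t" if "\<gamma> t \<in> M \<and> \<gamma> t \<in> W" for t
  proof -
    obtain r where r: "J x = ereal r" "\<And>z s. J z = ereal s \<Longrightarrow> r + w \<bullet> (z - x) \<le> s"
      using w unfolding subdiff_iff[OF J] by blast
    have "r = g x" using r(1) g(2)[OF xM W(2)] by simp
    moreover have "r + w \<bullet> (\<gamma> t - x) \<le> g (\<gamma> t)" using r(2) g(2) that by blast
    ultimately show ?thesis unfolding k_def c(1) by simp
  qed
  obtain d where d: "d > 0" "\<And>t. dist t 0 < d \<Longrightarrow> \<gamma> t \<in> M \<and> \<gamma> t \<in> W"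
    using ev unfolding eventually_nhds_metric by blast
  have gd: "((\<lambda>t. g (\<gamma> t)) has_derivative (\<lambda>s. g' (s *\<^sub>R \<tau>))) (at 0)"
    using has_derivative_compose[of \<gamma> "\<lambda>s. s *\<^sub>R \<tau>" 0 UNIV g g'] c(1,3) g(1) unfolding has_vector_derivative_def by simp
  have "((\<lambda>t. w \<bullet> (\<gamma> t - x)) has_derivative (\<lambda>s. w \<bullet> (s *\<^sub>R \<tau>))) (at 0)"
    using c(3) unfolding has_vector_derivative_def by (auto intro!: derivative_eq_intros)
  from has_derivative_diff[OF gd this]
  have "(k has_derivative (\<lambda>s. (g' \<tau> - w \<bullet> \<tau>) * s)) (at 0)"
    unfolding k_def using linear_scale[OF has_derivative_linear[OF g(1)]] by (simp add: algebra_simps)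
  then have "(k has_real_derivative (g' \<tau> - w \<bullet> \<tau>)) (at 0)" unfolding has_field_derivative_def .
  then have "g' \<tau> - w \<bullet> \<tau> = 0"
    by (rule DERIV_local_min[OF _ d(1)]) (use min d(2) in \<open>auto simp: dist_real_def abs_minus_commute\<close>)
  then show ?thesis by simp
qed

context vec_chart begin

text \<open>The operator inside the pseudo-inverse in \<open>\<Delta>\<close> is the second derivative, in the chart, of the loss plus a smooth
  representative of \<open>J\<close>. Indeed the two Hessians contribute the terms with \<open>D\<^sup>2\<psi>\<close> against the normal parts of the two
  gradients, and at a critical point the tangential parts cancel. The hypothesis \<open>cond_C\<close> makes it injective on the tangent space.\<close>

lemma Delta_matrix:
  fixes X :: "real^'p^'n"
  assumes x: "x \<in> M" "x \<in> U" and Mf: "Mf x = M" and T: "tangent_space M x = T_sp J x"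
    and J: "proper_ext J" "subdiff J x \<noteq> {}"
    and F: "Ck_on 2 UNIV (\<lambda>b. loss X F0 b y)" "\<And>m. (\<lambda>m. F0 m y) differentiable (at m)"
    and W: "open W" "x \<in> W" and g: "Ck_on 2 W g" "\<And>z. z \<in> M \<Longrightarrow> z \<in> W \<Longrightarrow> g z = real_of_ereal (J z)"
    and crit: "\<And>\<tau>. \<tau> \<in> tangent_space M x \<Longrightarrow> grad (\<lambda>b. loss X F0 b y) x \<bullet> \<tau> + grad g x \<bullet> \<tau> = 0"
    and C: "cond_C X F0 J Mf x y"
  shows "\<exists>Q. proj_mat (tangent_space M x) ** Q = Q \<and> Q ** proj_mat (tangent_space M x) = Q \<and>
    (\<forall>h\<in>E. \<forall>e\<in>E. (Q *v D1 \<psi> (\<phi> x) h) \<bullet> D1 \<psi> (\<phi> x) e =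
       D2 (\<lambda>b. loss X F0 b y + g b) x (D1 \<psi> (\<phi> x) h) (D1 \<psi> (\<phi> x) e) + D1 (\<lambda>b. loss X F0 b y + g b) x (D2 \<psi> (\<phi> x) h e)) \<and>
    (\<forall>\<xi>\<in>tangent_space M x. Q *v \<xi> = 0 \<longrightarrow> \<xi> = 0) \<and>
    Delta X F0 J Mf (X *v x) x y =
      - (X ** (pinv Q ** proj_mat (tangent_space M x) ** (transpose X ** D_grad F0 (X *v x) y)))"
proof -
  let ?T = "tangent_space M x" and ?fF = "\<lambda>b. loss X F0 b y" and ?J = "\<lambda>b. real_of_ereal (J b)"
  define P where "P = proj_mat ?T"
  define N where "N = proj_mat (?T\<^sup>\<bottom>)"
  have sT: "subspace ?T" by (rule subspace_tangent[OF x])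
  have sS: "subspace (S_sp J x)" unfolding S_sp_def by (rule subspace_Lin[OF convex_subdiff[OF J(1)] J(2)])
  have TS: "?T\<^sup>\<bottom> = S_sp J x" unfolding T T_sp_def by (rule orthogonal_comp_self[OF sS])
  have Psym: "(P *v a) \<bullet> b = a \<bullet> (P *v b)" for a b unfolding P_def by (rule proj_mat_sym_inner[OF sT])
  have PP: "P *v (P *v v) = P *v v" for v unfolding P_def by (rule proj_mat_id[OF sT proj_mat_works(1)[OF sT]])
  have Nn: "N *v v \<in> ?T\<^sup>\<bottom>" for v unfolding N_def by (rule proj_mat_works[OF subspace_orthogonal_comp])
  have F': "Ck_on 2 W ?fF" using Ck_on_subset[OF F(1)] by simp
  have gF: "grad ?fF x = transpose X *v grad (\<lambda>m. F0 m y) (X *v x)"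
    by (rule grad_eq, rule gderiv_loss, rule gderiv_differentiable, rule F(2))
  define v where "v = transpose (X ** N) *v grad (\<lambda>m. F0 m y) (X *v x)"
  have v: "v = N *v grad ?fF x" unfolding v_def gF N_def
    by (simp add: matrix_transpose_mul proj_mat_sym[OF subspace_orthogonal_comp] matrix_vector_mul_assoc del: transpose_matrix_vector)
  define HP where "HP = hess_pullback (X ** P) (\<lambda>m. F0 m y) (X *v x)"
  define Q where "Q = HP + matrix (\<lambda>\<xi>. weingarten M x (P *v \<xi>) v) + matrix (riem_hess M ?J x)"
  have rhJ: "linear (riem_hess M ?J x)"
    "\<And>\<xi>. proj_mat ?T *v riem_hess M ?J x \<xi> = riem_hess M ?J x \<xi>"
    "\<And>\<xi>. riem_hess M ?J x (proj_mat ?T *v \<xi>) = riem_hess M ?J x \<xi>"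
    by (rule riem_hess_properties[OF x W g(1)], rule g(2), assumption, assumption)+
  have rhJ4: "riem_hess M ?J x (D1 \<psi> (\<phi> x) h) \<bullet> D1 \<psi> (\<phi> x) e =
      D2 g x (D1 \<psi> (\<phi> x) h) (D1 \<psi> (\<phi> x) e) + (proj_mat (?T\<^sup>\<bottom>) *v grad g x) \<bullet> D2 \<psi> (\<phi> x) h e"
    if "h \<in> E" "e \<in> E" for h e
    by (rule riem_hess_properties(4)[OF x W g(1)], rule g(2), assumption, assumption, rule that(1), rule that(2))
  note rhF = riem_hess_properties[OF x open_UNIV UNIV_I F(1), of ?fF, OF refl]
  have HPi: "(HP *v \<zeta>) \<bullet> \<eta> = D2 ?fF x (P *v \<eta>) (P *v \<zeta>)" for \<zeta> \<eta>
  proof -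
    define B where "B = (\<lambda>a c. D2 ?fF x (P *v a) (P *v c))"
    have "column i (X ** P) = X *v (P *v axis i 1)" for i
      unfolding matrix_vector_mult_basis by (simp add: vec_eq_iff column_def matrix_matrix_mult_def matrix_vector_mult_def)
    then have "HP = (\<chi> i j. B (axis i 1) (axis j 1))"
      unfolding HP_def hess_pullback_def B_def hess_form_D2[OF F(1) open_UNIV UNIV_I, symmetric]
      by (simp only: hess_form_loss)
    moreover have "linear (\<lambda>a. B a c)" for c
      using linear_compose[OF matrix_vector_mul_linear[of P] D2_linear1[OF F(1) UNIV_I, of x "P *v c"]] unfolding B_def by (simp add: comp_def)
    moreover have "linear (B a)" for a
      using linear_compose[OF matrix_vector_mul_linear[of P] D2_linear2[OF F(1) open_UNIV UNIV_I, of x "P *v a"]] unfolding B_def by (simp add: comp_def)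
    ultimately show ?thesis using matrix_of_bilinear[of B] unfolding B_def by simp
  qed
  have linW: "linear (\<lambda>\<xi>. weingarten M x (P *v \<xi>) v)"
    using linear_compose[OF matrix_vector_mul_linear[of P] weingarten_linear[OF x Nn[of "grad ?fF x"]]] unfolding v by (simp add: comp_def)
  note mJ = matrix_works_real[OF rhJ(1)]
  have Qv: "Q *v \<zeta> = HP *v \<zeta> + weingarten M x (P *v \<zeta>) v + riem_hess M ?J x \<zeta>" for \<zeta>
    unfolding Q_def matrix_vector_mult_add_rdistrib matrix_works_real[OF linW] mJ ..
  have PHP: "P *v (HP *v \<zeta>) = HP *v \<zeta>" for \<zeta>
  proof (rule vector_eq_rdot[THEN iffD1], rule allI)
    fix \<eta> show "(P *v (HP *v \<zeta>)) \<bullet> \<eta> = (HP *v \<zeta>) \<bullet> \<eta>" unfolding Psym HPi PP ..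
  qed
  have HPP: "HP *v (P *v \<zeta>) = HP *v \<zeta>" for \<zeta>
  proof (rule vector_eq_rdot[THEN iffD1], rule allI)
    fix \<eta> show "(HP *v (P *v \<zeta>)) \<bullet> \<eta> = (HP *v \<zeta>) \<bullet> \<eta>" unfolding HPi PP ..
  qed
  have PQ: "P ** Q = Q" unfolding matrix_eq
    by (simp add: matrix_vector_mul_assoc[symmetric] Qv matrix_vector_right_distrib PHP
        weingarten_tangent[OF x, folded P_def] rhJ(2)[folded P_def])
  have QP: "Q ** P = Q" unfolding matrix_eq
    by (simp add: matrix_vector_mul_assoc[symmetric] Qv HPP PP rhJ(3)[folded P_def])
  define u where "u = \<phi> x"
  note uV = \<phi>_in[OF x(2), folded u_def] and uE = \<phi>_E[OF x, folded u_def]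
  have \<psi>u: "\<psi> u = x" unfolding u_def by (rule \<psi>\<phi>[OF x(2)])
  have tv: "D1 \<psi> u e \<in> ?T" if "e \<in> E" for e using tangent_vector[OF uV uE that] \<psi>u by simp
  have tP: "P *v D1 \<psi> u e = D1 \<psi> u e" if "e \<in> E" for e unfolding P_def by (rule proj_mat_id[OF sT tv[OF that]])
  have Qform: "(Q *v D1 \<psi> u h) \<bullet> D1 \<psi> u e = D2 ?fF x (D1 \<psi> u h) (D1 \<psi> u e) + (N *v grad ?fF x) \<bullet> D2 \<psi> u h e
     + riem_hess M ?J x (D1 \<psi> u h) \<bullet> D1 \<psi> u e" if "h \<in> E" "e \<in> E" for h e
    unfolding Qv inner_add_left HPi tP[OF that(1)] tP[OF that(2)] D2_symmetric[OF F(1) open_UNIV UNIV_I, of x "D1 \<psi> u e"]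
    using weingarten_form[OF x Nn[of "grad ?fF x"] that] unfolding v u_def by simp
  have Qsum: "(Q *v D1 \<psi> u h) \<bullet> D1 \<psi> u e = D2 (\<lambda>b. ?fF b + g b) x (D1 \<psi> u h) (D1 \<psi> u e) + D1 (\<lambda>b. ?fF b + g b) x (D2 \<psi> u h e)"
    if he: "h \<in> E" "e \<in> E" for h e
  proof -
    have "P *v (grad ?fF x + grad g x) = 0"
      unfolding P_def by (rule proj_mat_unique[OF sT subspace_0[OF sT]]) (simp add: inner_add_left crit)
    then have n: "(grad ?fF x + grad g x) \<bullet> w = (N *v grad ?fF x) \<bullet> w + (N *v grad g x) \<bullet> w" for w
      unfolding N_def proj_mat_comp[OF sT] P_def[symmetric] by (simp add: inner_add_left inner_diff_left matrix_vector_right_distrib add_eq_0_iff)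
    have "D1 (\<lambda>b. ?fF b + g b) x (D2 \<psi> u h e) = (grad ?fF x + grad g x) \<bullet> D2 \<psi> u h e"
      unfolding Ck2_add(2)[OF F' g(1) W] D1_grad[OF F' W(2)] D1_grad[OF g(1) W(2)] by (simp add: inner_add_left)
    then show ?thesis
      unfolding Qform[OF he] rhJ4[OF he, folded u_def N_def] Ck2_add(3)[OF F' g(1) W] n by simp
  qed
  have inj: "\<xi> = 0" if \<xi>: "\<xi> \<in> ?T" "Q *v \<xi> = 0" for \<xi>
  proof (rule ccontr)
    assume "\<xi> \<noteq> 0"
    then have pos: "0 < (riem_hess M ?fF x \<xi> + riem_hess M ?J x \<xi>) \<bullet> \<xi>"
      using C \<xi>(1) unfolding cond_C_def Mf T by blast
    have "\<xi> \<in> D1 \<psi> u ` E" using \<xi>(1) unfolding tangent_space_eq[OF x] u_def .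
    then obtain h where h: "h \<in> E" "\<xi> = D1 \<psi> u h" by blast
    have "(riem_hess M ?fF x \<xi> + riem_hess M ?J x \<xi>) \<bullet> \<xi> = (Q *v \<xi>) \<bullet> \<xi>"
      unfolding h(2) Qform[OF h(1) h(1)] inner_add_left rhF(4)[OF h(1) h(1), folded u_def N_def] by simp
    with pos \<xi>(2) show False by simp
  qed
  have "Delta X F0 J Mf (X *v x) x y = - ((X ** P) ** pinv Q ** transpose (X ** P) ** D_grad F0 (X *v x) y)"
    unfolding Delta_def Let_def Mf T[symmetric] TS[symmetric] P_def[symmetric] N_def[symmetric] v_def[symmetric] HP_def[symmetric] Q_def[symmetric] ..
  also have "\<dots> = - (X ** (P ** pinv Q ** P) ** (transpose X ** D_grad F0 (X *v x) y))"
    by (simp add: matrix_transpose_mul proj_mat_sym[OF sT] P_def matrix_mul_assoc)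
  also have "P ** pinv Q ** P = pinv Q ** P"
    using pinv_of_bijection_on_subspace(2)[OF sT PQ[unfolded P_def] QP[unfolded P_def] inj] unfolding P_def by simp
  finally have "Delta X F0 J Mf (X *v x) x y = - (X ** (pinv Q ** P ** (transpose X ** D_grad F0 (X *v x) y)))"
    by (simp add: matrix_mul_assoc)
  then show ?thesis using PQ QP Qsum inj unfolding P_def u_def by blast
qed

end

section \<open>Almost everywhere derivative of the prediction\<close>

text \<open>Near-minimal choice of the distance to \<open>\<beta>0\<close>; the slack \<open>|y - y0|\<close> is positive off \<open>y0\<close> and tends to zero.\<close>

lemma tendsto_selection:
  fixes \<beta>0 :: "'b::metric_space" and y0 :: "'a::real_normed_vector"
  assumes "\<And>\<eta>. \<eta> > 0 \<Longrightarrow> \<forall>\<^sub>F y in at y0. \<exists>\<beta>. Q y \<beta> \<and> dist \<beta> \<beta>0 < \<eta>"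
  shows "\<exists>b. (b \<longlongrightarrow> \<beta>0) (at y0) \<and> (\<forall>\<^sub>F y in at y0. Q y (b y))"
proof -
  define d where "d y = Inf {dist \<beta> \<beta>0 | \<beta>. Q y \<beta>}" for y
  define b where "b y = (SOME \<beta>. Q y \<beta> \<and> dist \<beta> \<beta>0 < d y + norm (y - y0))" for y
  have bdd: "bdd_below {dist \<beta> \<beta>0 | \<beta>. Q y \<beta>}" for y by (rule bdd_belowI[of _ 0]) auto
  have b: "Q y (b y) \<and> dist (b y) \<beta>0 < d y + norm (y - y0)" if "\<exists>\<beta>. Q y \<beta> \<and> dist \<beta> \<beta>0 < \<eta>" "y \<noteq> y0" for y \<eta>
    unfolding b_def
  proof (rule someI_ex)
    let ?S = "{dist \<beta> \<beta>0 | \<beta>. Q y \<beta>}"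
    have "Inf ?S < d y + norm (y - y0)" using that(2) unfolding d_def by simp
    moreover have "?S \<noteq> {}" using that(1) by auto
    ultimately obtain s where s: "s \<in> ?S" "s < d y + norm (y - y0)" using cInf_lessD[of ?S "d y + norm (y - y0)"] by auto
    from s show "\<exists>\<beta>. Q y \<beta> \<and> dist \<beta> \<beta>0 < d y + norm (y - y0)" by auto
  qed
  have ne: "\<forall>\<^sub>F y in at y0. y \<noteq> y0" by (simp add: eventually_at_filter)
  have "(b \<longlongrightarrow> \<beta>0) (at y0)"
  proof (rule tendstoI)
    fix \<eta> :: real assume \<eta>: "\<eta> > 0"
    have 1: "\<forall>\<^sub>F y in at y0. \<exists>\<beta>. Q y \<beta> \<and> dist \<beta> \<beta>0 < \<eta> / 2" by (rule assms) (use \<eta> in simp)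
    have 2: "\<forall>\<^sub>F y in at y0. norm (y - y0) < \<eta> / 2"
    proof -
      have "\<forall>\<^sub>F y in at y0. dist y y0 < \<eta> / 2" by (rule tendstoD[OF tendsto_ident_at]) (use \<eta> in simp)
      then show ?thesis by (simp add: dist_norm)
    qed
    from 1 2 ne show "\<forall>\<^sub>F y in at y0. dist (b y) \<beta>0 < \<eta>"
    proof eventually_elim
      case (elim y)
      obtain \<beta> where \<beta>: "Q y \<beta>" "dist \<beta> \<beta>0 < \<eta> / 2" using elim(1) by blast
      have "d y \<le> dist \<beta> \<beta>0" unfolding d_def by (rule cInf_lower[OF _ bdd]) (use \<beta>(1) in auto)
      with \<beta>(2) b[OF elim(1,3)] elim(2) show ?case by simp
    qed
  qed
  moreover have "\<forall>\<^sub>F y in at y0. Q y (b y)"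
    using assms[OF zero_less_one] ne
  proof eventually_elim
    case (elim y)
    show ?case using b[OF elim] by blast
  qed
  ultimately show ?thesis by blast
qed

text \<open>The data of the third part of the theorem. The selection \<open>bhat\<close> is arbitrary among the critical points and need not be definable.\<close>

locale tame_problem = tame_structure \<O> for \<O> :: "nat \<Rightarrow> real list set set" +
  fixes X :: "real^'p^'n" and F0 :: "real^'n \<Rightarrow> real^'n \<Rightarrow> real" and J :: "real^'p \<Rightarrow> ereal"
    and Mf :: "real^'p \<Rightarrow> (real^'p) set" and bhat :: "real^'n \<Rightarrow> real^'p" and \<tau> L :: real
  assumes F_definable: "definable_loss \<O> (loss X F0)" and J_definable: "definable_ext \<O> J"
    and tilde_definable: "\<And>M. M \<in> manifolds J Mf \<Longrightarrow> definable_set \<O> (tilde_manifold J Mf M)"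
    and finite_manifolds: "finite (manifolds J Mf)" and proper: "proper_ext J"
    and J_partly_smooth: "\<And>\<beta>. subdiff J \<beta> \<noteq> {} \<Longrightarrow> partly_smooth J \<beta> (Mf \<beta>)"
    and \<tau>: "\<tau> > 0" "\<And>y. strongly_convex \<tau> (\<lambda>m. F0 m y)"
    and F0_diff: "\<And>\<mu> y. (\<lambda>m. F0 m y) differentiable (at \<mu>)"
    and grad_diff: "\<And>\<mu> y. (\<lambda>y'. grad (\<lambda>m. F0 m y') \<mu>) differentiable (at y)"
    and L: "\<And>\<mu> y. onorm ((*v) (D_grad F0 \<mu> y)) \<le> L"
    and loss_C2: "\<And>y. Ck_on 2 UNIV (\<lambda>\<beta>. loss X F0 \<beta> y)"
    and bhat_critical: "\<And>y. - grad (\<lambda>b. loss X F0 b y) (bhat y) \<in> subdiff J (bhat y)"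
begin

abbreviation "grad_loss \<beta> y \<equiv> grad (\<lambda>b. loss X F0 b y) \<beta>"

lemma critical_image:
  assumes "- grad_loss \<beta> y \<in> subdiff J \<beta>" shows "X *v \<beta> = X *v bhat y"
  using critical_image_lipschitz[OF proper \<tau> F0_diff grad_lipschitz_in_data[OF grad_diff L] assms bhat_critical[of y]] by simp

lemma grad_loss_eq: "grad_loss \<beta> y = transpose X *v grad (\<lambda>m. F0 m y) (X *v \<beta>)"
  by (rule grad_eq, rule gderiv_loss, rule gderiv_differentiable, rule F0_diff)

text \<open>The gradient of the loss for the data \<open>z\<close>, at the prediction for the data \<open>y\<close>. It depends on the prediction only, which
  makes it definable although \<open>bhat\<close> is an arbitrary selection.\<close>

definition \<rho> :: "real^'n \<Rightarrow> real^'n \<Rightarrow> real^'p" where "\<rho> y z = grad_loss (bhat y) z"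

text \<open>The Jacobian of \<open>\<rho> y\<close> at \<open>y\<close>.\<close>

definition A :: "real^'n \<Rightarrow> real^'n^'p" where "A y = transpose X ** D_grad F0 (X *v bhat y) y"

lemma critical_grad_loss: "- grad_loss \<beta> y \<in> subdiff J \<beta> \<Longrightarrow> grad_loss \<beta> z = \<rho> y z"
  unfolding \<rho>_def grad_loss_eq[of z \<beta>] grad_loss_eq[of z "bhat y"] by (simp only: critical_image)

lemma dset_critical: "dmap y \<Longrightarrow> dmap b \<Longrightarrow> dset {x. - grad_loss (b x) (y x) \<in> subdiff J (b x)}"
  by (intro dset_subdiff[OF dset_definable_ext[OF J_definable] proper] dmap_uminus
      dmap_grad_loss[OF dmap_definable_loss[OF F_definable]])

text \<open>The graph is obtained by quantifying over all critical points, which lead to the same value.\<close>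

lemma dmap_\<rho>: assumes "dmap u" "dmap v" shows "dmap (\<lambda>x. \<rho> (u x) (v x))"
proof -
  have "dset {q. \<exists>\<beta>. - grad_loss \<beta> (fst (fst q)) \<in> subdiff J \<beta> \<and> snd q = grad_loss \<beta> (snd (fst q))}"
    by (intro dset_intros dset_critical dmap_grad_loss[OF dmap_definable_loss[OF F_definable]] dmap_intros)
  moreover have "(\<exists>\<beta>. - grad_loss \<beta> y \<in> subdiff J \<beta> \<and> r = grad_loss \<beta> z) \<longleftrightarrow> r = \<rho> y z" for y z r
    using critical_grad_loss bhat_critical[of y] by metis
  ultimately have "dmap (\<lambda>p. \<rho> (fst p) (snd p))" unfolding dmap_def by simp
  from dmap_comp[OF this dmap_Pair[OF assms]] show ?thesis by simp
qed

lemma \<rho>_derivative: "(\<rho> y has_derivative (\<lambda>v. A y *v v)) (at y)"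
proof -
  have "((\<lambda>z. transpose X *v grad (\<lambda>m. F0 m z) (X *v bhat y)) has_derivative
      (\<lambda>v. transpose X *v (D_grad F0 (X *v bhat y) y *v v))) (at y)"
    by (rule bounded_linear.has_derivative[OF matrix_vector_mul_bounded_linear D_grad_derivative[OF grad_diff]])
  moreover have "\<rho> y = (\<lambda>z. transpose X *v grad (\<lambda>m. F0 m z) (X *v bhat y))"
    unfolding fun_eq_iff \<rho>_def grad_loss_eq by blast
  ultimately show ?thesis unfolding A_def by (simp only: matrix_vector_mul_assoc)
qed

lemma \<rho>_component_derivative: "GDERIV (\<lambda>z. \<rho> y z \<bullet> i) y :> transpose (A y) *v i"
proof -
  have "((\<lambda>z. \<rho> y z \<bullet> i) has_derivative (\<lambda>v. (A y *v v) \<bullet> i)) (at y)"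
    by (rule has_derivative_inner_left[OF \<rho>_derivative])
  moreover have "(A y *v v) \<bullet> i = v \<bullet> (transpose (A y) *v i)" for v
    using transpose_inner[of "A y" i v] by (simp only: inner_commute)
  ultimately show ?thesis unfolding gderiv_def by simp
qed

text \<open>Along the critical path the gradient of the loss is evaluated at a moving point, but \<open>D_grad\<close> exists only for a
  fixed one and nothing is known about its continuity in the first argument. For almost every \<open>y0\<close> this is no obstacle: the
  estimate that defines the derivative at \<open>y0\<close> with given \<open>\<epsilon>\<close> and \<open>\<delta>\<close> holds, by genericity, at all nearby \<open>y\<close> and can be
  read from \<open>y\<close> back to \<open>y0\<close>; the derivative, being definable, is continuous at almost every \<open>y0\<close>.\<close>

lemma diagonal_derivative_component:
  "AE y0 in lborel. negl_to (at y0) (\<lambda>y. (\<rho> y y - \<rho> y y0 - A y0 *v (y - y0)) \<bullet> i) (\<lambda>y. norm (y - y0))"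
proof -
  define a where "a y = grad (\<lambda>z. \<rho> y z \<bullet> i) y" for y
  have aA: "a y \<bullet> v = (A y *v v) \<bullet> i" for y v
    unfolding a_def grad_eq[OF \<rho>_component_derivative] transpose_inner by (rule inner_commute)
  have "dmap (\<lambda>p. \<rho> (fst p) (snd p) \<bullet> i)" by (intro dmap_inner dmap_\<rho> dmap_intros)
  from dmap_grad[OF this dmap_id dmap_id] have da: "dmap a" unfolding a_def .
  define W where "W k l = {y. \<forall>z. norm (z - y) < 1 / real (Suc l) \<longrightarrow>
      norm ((\<rho> y z - \<rho> y y) \<bullet> i - a y \<bullet> (z - y)) \<le> 1 / real (Suc k) * norm (z - y)}" for k l
  have dW: "dset (W k l)" for k l
    unfolding W_def by (intro dset_intros dmap_\<rho> dmap_comp[OF da] dmap_intros)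
  have inW: "\<exists>l. y \<in> W k l" for y k
  proof -
    have "((\<lambda>z. \<rho> y z \<bullet> i) has_derivative (\<lambda>v. a y \<bullet> v)) (at y)"
      using \<rho>_component_derivative[of y i] unfolding gderiv_def
      unfolding a_def grad_eq[OF \<rho>_component_derivative] by (simp only: inner_commute[of "transpose (A y) *v i"])
    moreover have "(0::real) < 1 / real (Suc k)" by simp
    ultimately have "\<exists>d>0. \<forall>z. norm (z - y) < d \<longrightarrow> norm (\<rho> y z \<bullet> i - \<rho> y y \<bullet> i - a y \<bullet> (z - y)) \<le> 1 / real (Suc k) * norm (z - y)"
      unfolding has_derivative_at_alt by (elim conjE allE[of _ "1 / real (Suc k)"] impE)
    then obtain d where d: "d > 0" "\<And>z. norm (z - y) < d \<Longrightarrow> norm (\<rho> y z \<bullet> i - \<rho> y y \<bullet> i - a y \<bullet> (z - y)) \<le> 1 / real (Suc k) * norm (z - y)"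
      by (elim exE conjE) simp
    obtain l where l: "1 / real (Suc l) < d" using reals_Archimedean[OF d(1)] by (auto simp: inverse_eq_divide)
    have "y \<in> W k l" unfolding W_def mem_Collect_eq inner_diff_left[of "\<rho> y _"]
    proof (intro allI impI)
      fix z assume "norm (z - y) < 1 / real (Suc l)"
      with l have "norm (z - y) < d" by simp
      then show "norm (\<rho> y z \<bullet> i - \<rho> y y \<bullet> i - a y \<bullet> (z - y)) \<le> 1 / real (Suc k) * norm (z - y)" by (rule d(2))
    qed
    then show ?thesis by blast
  qed
  have "AE y in lborel. \<forall>S\<in>range (\<lambda>(k, l). W k l). y \<in> S \<longrightarrow> y \<in> interior S"
    by (rule generic_interior) (use dW in auto)
  with generic_continuity[OF da] show ?thesis
  proof eventually_elim
    case (elim y0)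
    show ?case unfolding negl_to_def
    proof (intro allI impI)
      fix \<epsilon> :: real assume \<epsilon>: "\<epsilon> > 0"
      obtain k where k: "1 / real (Suc k) < \<epsilon> / 2" using reals_Archimedean[of "\<epsilon> / 2"] \<epsilon> by (auto simp: inverse_eq_divide)
      obtain l where l: "y0 \<in> W k l" using inW by blast
      have "y0 \<in> interior (W k l)" using elim(2) l by auto
      then have 1: "\<forall>\<^sub>F y in at y0. y \<in> interior (W k l)"
        by (intro topological_tendstoD[OF tendsto_ident_at]) auto
      have 2: "\<forall>\<^sub>F y in at y0. dist y y0 < 1 / real (Suc l)" by (rule tendstoD[OF tendsto_ident_at]) simp
      have 3: "\<forall>\<^sub>F y in at y0. dist (a y) (a y0) < \<epsilon> / 2" by (rule tendstoD[OF elim(1)[unfolded isCont_def]]) (use \<epsilon> in simp)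
      from 1 2 3 show "\<forall>\<^sub>F y in at y0. norm ((\<rho> y y - \<rho> y y0 - A y0 *v (y - y0)) \<bullet> i) \<le> \<epsilon> * norm (y - y0)"
      proof eventually_elim
        case (elim y)
        let ?N = "norm (y - y0)"
        have "y \<in> W k l" using elim(1) interior_subset by blast
        \<comment> \<open>the estimate at \<open>y\<close>, applied to \<open>z = y0\<close>\<close>
        then have "norm ((\<rho> y y0 - \<rho> y y) \<bullet> i - a y \<bullet> (y0 - y)) \<le> 1 / real (Suc k) * norm (y0 - y)"
          using elim(2) unfolding W_def by (simp add: dist_norm norm_minus_commute)
        also have "\<dots> \<le> \<epsilon> / 2 * ?N" using k by (simp only: norm_minus_commute) (intro mult_right_mono, simp_all)
        finally have 1: "\<bar>(\<rho> y y0 - \<rho> y y) \<bullet> i - a y \<bullet> (y0 - y)\<bar> \<le> \<epsilon> / 2 * ?N" by simp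
        have "\<bar>(a y - a y0) \<bullet> (y - y0)\<bar> \<le> norm (a y - a y0) * ?N" by (rule Cauchy_Schwarz_ineq2)
        also have "\<dots> \<le> \<epsilon> / 2 * ?N" using elim(3) by (intro mult_right_mono) (simp_all add: dist_norm)
        finally have 2: "\<bar>(a y - a y0) \<bullet> (y - y0)\<bar> \<le> \<epsilon> / 2 * ?N" .
        have "(\<rho> y y - \<rho> y y0 - A y0 *v (y - y0)) \<bullet> i
            = - ((\<rho> y y0 - \<rho> y y) \<bullet> i - a y \<bullet> (y0 - y)) + (a y - a y0) \<bullet> (y - y0)"
          unfolding inner_diff_left[of _ "A y0 *v (y - y0)"] aA[symmetric] by (simp add: inner_diff_left inner_diff_right)
        with 1 2 show ?case unfolding real_norm_def by argo
      qed
    qed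
  qed
qed

lemma diagonal_derivative:
  "AE y0 in lborel. negl_to (at y0) (\<lambda>y. \<rho> y y - \<rho> y y0 - A y0 *v (y - y0)) (\<lambda>y. norm (y - y0))"
proof -
  have "AE y0 in lborel. \<forall>i\<in>Basis. negl_to (at y0) (\<lambda>y. (\<rho> y y - \<rho> y y0 - A y0 *v (y - y0)) \<bullet> i) (\<lambda>y. norm (y - y0))"
    by (rule AE_finite_allI[OF finite_Basis diagonal_derivative_component])
  then show ?thesis
  proof eventually_elim
    case (elim y0)
    show ?case by (rule negl_to_componentwise) (use elim in blast)
  qed
qed

text \<open>For almost every \<open>y0\<close>, every critical point \<open>\<beta>0\<close> at \<open>y0\<close> is the limit of critical points at the nearby data that
  have the same manifold: that such points exist in a given ball with centre in a countable dense set is a definable condition on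
  the data, and \<open>\<beta>0\<close> shows that it holds at \<open>y0\<close>.\<close>

lemma stable_stratum:
  "AE y0 in lborel. \<forall>\<beta>0. - grad_loss \<beta>0 y0 \<in> subdiff J \<beta>0 \<longrightarrow>
     (\<forall>\<eta>>0. \<forall>\<^sub>F y in at y0. \<exists>\<beta>. (\<beta> \<in> tilde_manifold J Mf (Mf \<beta>0) \<and> - grad_loss \<beta> y \<in> subdiff J \<beta>) \<and> dist \<beta> \<beta>0 < \<eta>)"
proof -
  obtain C :: "(real^'p) set" where C: "countable C" "\<And>U. open U \<Longrightarrow> U \<noteq> {} \<Longrightarrow> \<exists>c\<in>C. c \<in> U"
    using countable_dense_exists by blast
  define S where "S M c k = {y. \<exists>\<beta>. \<beta> \<in> tilde_manifold J Mf M \<and> norm (\<beta> - c) < 1 / real (Suc k) \<and> - grad_loss \<beta> y \<in> subdiff J \<beta>}" for M c k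
  have dS: "dset (S M c k)" if M: "M \<in> manifolds J Mf" for M c k
  proof -
    have t: "dset {x. f x \<in> tilde_manifold J Mf M}" if "dmap f" for f
      by (rule dset_vimage[OF dset_definable_set[OF tilde_definable[OF M]] that])
    show ?thesis unfolding S_def by (intro dset_intros t dset_critical dmap_intros)
  qed
  have "AE y in lborel. \<forall>S\<in>(\<lambda>(M, c, k). S M c k) ` (manifolds J Mf \<times> C \<times> UNIV). y \<in> S \<longrightarrow> y \<in> interior S"
    by (rule generic_interior) (use dS in \<open>auto intro!: countable_image countable_SIGMA countable_finite[OF finite_manifolds] C(1)\<close>)
  then show ?thesis
  proof eventually_elim
    case (elim y0)
    show ?case
    proof (intro allI impI)
      fix \<beta>0 and \<eta> :: real assume \<beta>0: "- grad_loss \<beta>0 y0 \<in> subdiff J \<beta>0" and \<eta>: "\<eta> > 0"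
      let ?M = "Mf \<beta>0"
      have M: "?M \<in> manifolds J Mf" using \<beta>0 unfolding manifolds_def by blast
      have t0: "\<beta>0 \<in> tilde_manifold J Mf ?M" using \<beta>0 unfolding tilde_manifold_def by blast
      obtain k where k: "1 / real (Suc k) < \<eta> / 2" using reals_Archimedean[of "\<eta> / 2"] \<eta> by (auto simp: inverse_eq_divide)
      obtain c where c: "c \<in> C" "c \<in> ball \<beta>0 (1 / real (Suc k))"
        using C(2)[of "ball \<beta>0 (1 / real (Suc k))"] by auto
      have "y0 \<in> S ?M c k" unfolding S_def using t0 \<beta>0 c(2) by (auto simp: dist_norm)
      moreover have "S ?M c k \<in> (\<lambda>(M, c, k). S M c k) ` (manifolds J Mf \<times> C \<times> UNIV)" using M c(1) by force
      ultimately have "y0 \<in> interior (S ?M c k)" using bspec[OF elim] by simp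
      then have "\<forall>\<^sub>F y in at y0. y \<in> interior (S ?M c k)"
        by (intro topological_tendstoD[OF tendsto_ident_at]) auto
      then show "\<forall>\<^sub>F y in at y0. \<exists>\<beta>. (\<beta> \<in> tilde_manifold J Mf ?M \<and> - grad_loss \<beta> y \<in> subdiff J \<beta>) \<and> dist \<beta> \<beta>0 < \<eta>"
      proof eventually_elim
        case (elim y)
        then have "y \<in> S ?M c k" using interior_subset by blast
        then obtain \<beta> where \<beta>: "\<beta> \<in> tilde_manifold J Mf ?M" "norm (\<beta> - c) < 1 / real (Suc k)" "- grad_loss \<beta> y \<in> subdiff J \<beta>"
          unfolding S_def mem_Collect_eq by (elim exE conjE)
        have "dist \<beta> \<beta>0 \<le> norm (\<beta> - c) + dist \<beta>0 c" using dist_triangle[of \<beta> \<beta>0 c] by (simp add: dist_norm norm_minus_commute)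
        also have "\<dots> < \<eta>" using \<beta>(2) c(2) k by simp
        finally show ?case using \<beta>(1,3) by blast
      qed
    qed
  qed
qed

text \<open>On the manifold the subdifferential of \<open>J\<close> acts on tangent vectors as the derivative of a \<open>C\<^sup>2\<close> function \<open>g\<close>.
  The selected critical points thus are critical points on \<open>M\<close> of the fixed function \<open>f = F(\<cdot>, y0) + g\<close>, perturbed by the linear form
  \<open>\<rho> y y - \<rho> y y0\<close>.\<close>

theorem image_derivative_at:
  assumes y0: "negl_to (at y0) (\<lambda>y. \<rho> y y - \<rho> y y0 - A y0 *v (y - y0)) (\<lambda>y. norm (y - y0))"
    and crit0: "- grad_loss \<beta>0 y0 \<in> subdiff J \<beta>0"
    and stable: "\<And>\<eta>. \<eta> > 0 \<Longrightarrow> \<forall>\<^sub>F y in at y0. \<exists>\<beta>. (\<beta> \<in> tilde_manifold J Mf (Mf \<beta>0) \<and> - grad_loss \<beta> y \<in> subdiff J \<beta>) \<and> dist \<beta> \<beta>0 < \<eta>"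
    and C: "cond_C X F0 J Mf \<beta>0 y0"
  shows "((\<lambda>y. X *v bhat y) has_derivative (\<lambda>v. Delta X F0 J Mf (X *v \<beta>0) \<beta>0 y0 *v v)) (at y0)"
proof -
  define M where "M = Mf \<beta>0"
  have ps: "partly_smooth J \<beta>0 M" unfolding M_def by (rule J_partly_smooth) (use crit0 in blast)
  then have M0: "\<beta>0 \<in> M" and T0: "tangent_space M \<beta>0 = T_sp J \<beta>0" unfolding partly_smooth_def by blast+
  have "C2_submanifold_around M \<beta>0" using ps unfolding partly_smooth_def by (elim conjE)
  then obtain U V \<phi> \<psi> and E :: "(real^'p) set" where ch: "open U" "\<beta>0 \<in> U" "open V" "subspace E" "homeomorphism U V \<phi> \<psi>"
      "Ck_on 2 U \<phi>" "Ck_on 2 V \<psi>" "\<phi> ` (M \<inter> U) = E \<inter> V"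
    unfolding C2_submanifold_around_def by (elim exE conjE)
  interpret vec_chart M U V \<phi> \<psi> E by (unfold_locales) (fact ch)+
  have "\<exists>U g. open U \<and> \<beta>0 \<in> U \<and> Ck_on 2 U g \<and> (\<forall>z\<in>M \<inter> U. J z = ereal (g z))"
    using ps unfolding partly_smooth_def by (elim conjE)
  then obtain W g where W: "open W" "\<beta>0 \<in> W" and g: "Ck_on 2 W g" and gJ: "\<forall>z\<in>M \<inter> W. J z = ereal (g z)"
    by (elim exE conjE)
  have gJ': "J z = ereal (g z)" if "z \<in> M" "z \<in> W" for z using gJ that by blast
  let ?F = "\<lambda>b. loss X F0 b y0"
  have F: "Ck_on 2 W ?F" using Ck_on_subset[OF loss_C2] by simp
  define f where "f = (\<lambda>b. ?F b + g b)"
  have f: "Ck_on 2 W f" unfolding f_def by (rule Ck2_add(1)[OF F g W(1)])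
  \<comment> \<open>the subgradient and \<open>g\<close> agree on tangent vectors\<close>
  have stationary: "D1 f \<beta> t + (\<rho> y y - \<rho> y y0) \<bullet> t = 0"
    if \<beta>: "- grad_loss \<beta> y \<in> subdiff J \<beta>" "\<beta> \<in> W" and t: "t \<in> tangent_space M \<beta>" for \<beta> y t
  proof -
    have "D1 g \<beta> t = (- grad_loss \<beta> y) \<bullet> t"
      by (rule subgradient_tangential[OF proper \<beta>(1) W(1) \<beta>(2) D1[OF g \<beta>(2)] gJ' t])
    moreover have "D1 f \<beta> t = grad_loss \<beta> y0 \<bullet> t + D1 g \<beta> t"
      unfolding f_def Ck2_add(2)[OF F g W(1) \<beta>(2)] D1_grad[OF F \<beta>(2)] ..
    ultimately show ?thesis unfolding critical_grad_loss[OF \<beta>(1)] by (simp add: inner_diff_left)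
  qed
  have st0: "D1 f \<beta>0 t = 0" if "t \<in> tangent_space M \<beta>0" for t
    using stationary[OF crit0 W(2) that] by simp
  have img: "X *v \<beta>0 = X *v bhat y0" by (rule critical_image[OF crit0])
  obtain Q where Q: "proj_mat (tangent_space M \<beta>0) ** Q = Q" "Q ** proj_mat (tangent_space M \<beta>0) = Q"
    "\<forall>h\<in>E. \<forall>e\<in>E. (Q *v D1 \<psi> (\<phi> \<beta>0) h) \<bullet> D1 \<psi> (\<phi> \<beta>0) e =
       D2 f \<beta>0 (D1 \<psi> (\<phi> \<beta>0) h) (D1 \<psi> (\<phi> \<beta>0) e) + D1 f \<beta>0 (D2 \<psi> (\<phi> \<beta>0) h e)"
    "\<forall>\<xi>\<in>tangent_space M \<beta>0. Q *v \<xi> = 0 \<longrightarrow> \<xi> = 0"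
    "Delta X F0 J Mf (X *v \<beta>0) \<beta>0 y0 = - (X ** (pinv Q ** proj_mat (tangent_space M \<beta>0) ** A y0))"
  proof (atomize_elim, unfold f_def A_def img[symmetric], rule Delta_matrix[OF M0 ch(2) _ T0 proper _ loss_C2 F0_diff W g _ _ C])
    show "Mf \<beta>0 = M" unfolding M_def ..
    show "subdiff J \<beta>0 \<noteq> {}" using crit0 by blast
    show "g z = real_of_ereal (J z)" if "z \<in> M" "z \<in> W" for z using gJ'[OF that] by simp
    show "grad_loss \<beta>0 y0 \<bullet> t + grad g \<beta>0 \<bullet> t = 0" if "t \<in> tangent_space M \<beta>0" for t
      using st0[OF that] unfolding f_def Ck2_add(2)[OF F g W(1) W(2)] D1_grad[OF F W(2)] D1_grad[OF g W(2)] .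
  qed
  have "\<exists>b. (b \<longlongrightarrow> \<beta>0) (at y0) \<and>
      (\<forall>\<^sub>F y in at y0. b y \<in> tilde_manifold J Mf M \<and> - grad_loss (b y) y \<in> subdiff J (b y))"
    unfolding M_def by (rule tendsto_selection, rule stable)
  then obtain b0 where b0: "(b0 \<longlongrightarrow> \<beta>0) (at y0)"
      "\<forall>\<^sub>F y in at y0. b0 y \<in> tilde_manifold J Mf M \<and> - grad_loss (b0 y) y \<in> subdiff J (b0 y)"
    by blast
  \<comment> \<open>continuity at \<open>y0\<close> needs the value \<open>\<beta>0\<close> there, which the limit does not determine\<close>
  define b where "b = b0(y0 := \<beta>0)"
  have b_eq: "\<forall>\<^sub>F y in at y0. b0 y = b y" unfolding b_def by (simp add: eventually_at_filter)
  have b: "(b \<longlongrightarrow> \<beta>0) (at y0)" by (rule Lim_transform_eventually[OF b0(1) b_eq])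
  have b_crit: "\<forall>\<^sub>F y in at y0. b y \<in> M \<and> - grad_loss (b y) y \<in> subdiff J (b y)"
    using b0(2) b_eq
  proof eventually_elim
    case (elim y)
    then have "b y \<in> tilde_manifold J Mf M" "- grad_loss (b y) y \<in> subdiff J (b y)" by simp_all
    moreover from this have "partly_smooth J (b y) M" using J_partly_smooth[of "b y"] unfolding tilde_manifold_def by auto
    ultimately show ?case unfolding partly_smooth_def by blast
  qed
  have bU: "\<forall>\<^sub>F y in at y0. b y \<in> U" by (rule topological_tendstoD[OF b ch(1,2)])
  have bW: "\<forall>\<^sub>F y in at y0. b y \<in> W" by (rule topological_tendstoD[OF b W])
  have "(b has_derivative (\<lambda>v. - ((pinv Q ** proj_mat (tangent_space M \<beta>0) ** A y0) *v v))) (at y0)"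
  proof (rule critical_path_derivative[OF M0 ch(2) W f b _ _ _ _ y0 Q(1,2)])
    show "\<forall>\<^sub>F y in at y0. b y \<in> M" using b_crit by eventually_elim blast
    show "b y0 = \<beta>0" unfolding b_def by simp
    show "\<forall>\<^sub>F y in at y0. \<forall>e\<in>E. D1 f (b y) (D1 \<psi> (\<phi> (b y)) e) + (\<rho> y y - \<rho> y y0) \<bullet> D1 \<psi> (\<phi> (b y)) e = 0"
      using b_crit bU bW
    proof eventually_elim
      case (elim y)
      show ?case
      proof
        fix e assume e: "e \<in> E"
        have "D1 \<psi> (\<phi> (b y)) e \<in> tangent_space M (b y)"
          using tangent_vector[OF \<phi>_in \<phi>_E e, of "b y"] elim \<psi>\<phi>[of "b y"] by simp
        then show "D1 f (b y) (D1 \<psi> (\<phi> (b y)) e) + (\<rho> y y - \<rho> y y0) \<bullet> D1 \<psi> (\<phi> (b y)) e = 0"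
          using elim by (intro stationary) blast+
      qed
    qed
    show "D1 f \<beta>0 (D1 \<psi> (\<phi> \<beta>0) e) = 0" if "e \<in> E" for e
      using tangent_vector[OF \<phi>_in[OF ch(2)] \<phi>_E[OF M0 ch(2)] that] \<psi>\<phi>[OF ch(2)] by (intro st0) simp
    show "(Q *v D1 \<psi> (\<phi> \<beta>0) h) \<bullet> D1 \<psi> (\<phi> \<beta>0) e =
       D2 f \<beta>0 (D1 \<psi> (\<phi> \<beta>0) h) (D1 \<psi> (\<phi> \<beta>0) e) + D1 f \<beta>0 (D2 \<psi> (\<phi> \<beta>0) h e)" if "h \<in> E" "e \<in> E" for h e
      using Q(3) that by blast
    show "\<xi> = 0" if "\<xi> \<in> tangent_space M \<beta>0" "Q *v \<xi> = 0" for \<xi> using Q(4) that by blast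
  qed
  from bounded_linear.has_derivative[OF matrix_vector_mul_bounded_linear[of X] this]
  have "((\<lambda>y. X *v b y) has_derivative (\<lambda>v. X *v (- ((pinv Q ** proj_mat (tangent_space M \<beta>0) ** A y0) *v v)))) (at y0)" .
  moreover have "X *v (- (B *v v)) = - (X ** B) *v v" for B :: "real^'n^'p" and v
  proof -
    have "X *v (- (B *v v)) = - (X *v (B *v v))" by (rule linear_neg[OF matrix_vector_mul_linear])
    also have "\<dots> = - ((X ** B) *v v)" by (simp only: matrix_vector_mul_assoc)
    also have "\<dots> = - (X ** B) *v v" by (simp add: vec_eq_iff matrix_vector_mult_def sum_negf)
    finally show ?thesis .
  qed
  ultimately have "((\<lambda>y. X *v b y) has_derivative (\<lambda>v. Delta X F0 J Mf (X *v \<beta>0) \<beta>0 y0 *v v)) (at y0)"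
    unfolding Q(5) by simp
  moreover have "\<forall>\<^sub>F y in at y0. X *v b y = X *v bhat y"
    using b_crit by eventually_elim (simp only: critical_image)
  ultimately show ?thesis
    by (rule has_derivative_transform_eventually) (simp_all add: b_def img)
qed

theorem image_derivative_AE:
  "AE y in lborel. \<forall>\<beta>. - grad_loss \<beta> y \<in> subdiff J \<beta> \<longrightarrow> cond_C X F0 J Mf \<beta> y \<longrightarrow>
     ((\<lambda>y. X *v bhat y) has_derivative (\<lambda>v. Delta X F0 J Mf (X *v \<beta>) \<beta> y *v v)) (at y)"
  using diagonal_derivative stable_stratum
proof eventually_elim
  case (elim y)
  show ?case
  proof (intro allI impI)
    fix \<beta> assume "- grad_loss \<beta> y \<in> subdiff J \<beta>" "cond_C X F0 J Mf \<beta> y"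
    then show "((\<lambda>y. X *v bhat y) has_derivative (\<lambda>v. Delta X F0 J Mf (X *v \<beta>) \<beta> y *v v)) (at y)"
      using elim by (intro image_derivative_at) simp_all
  qed
qed

end

section \<open>Smooth bumps and the fundamental lemma of the calculus of variations\<close>

text \<open>Polynomials in \<open>1/t\<close> are included to make the class closed under differentiation. Then \<open>bump 1\<close> is the standard smooth
  function that vanishes on the negative half-line.\<close>

definition bump :: "real poly \<Rightarrow> real \<Rightarrow> real" where
  "bump p t = (if t > 0 then poly p (1 / t) * exp (- 1 / t) else 0)"

lemma poly_exp_tendsto_0: "((\<lambda>x. poly p x * exp (- x)) \<longlongrightarrow> (0::real)) at_top"
proof -
  have "((\<lambda>x. \<Sum>i\<le>degree p. coeff p i * (x ^ i / exp x)) \<longlongrightarrow> (\<Sum>i\<le>degree p. coeff p i * 0)) at_top"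
    by (intro tendsto_intros tendsto_power_div_exp_0)
  moreover have "(\<Sum>i\<le>degree p. coeff p i * (x ^ i / exp x)) = poly p x * exp (- x)" for x
    by (simp add: poly_altdef sum_distrib_right exp_minus field_simps sum_divide_distrib)
  ultimately show ?thesis by simp
qed

lemma bump_at_right_0: "((\<lambda>t. poly p (1 / t) * exp (- 1 / t)) \<longlongrightarrow> (0::real)) (at_right 0)"
proof -
  have "LIM t at_right (0::real). 1 / t :> at_top"
    using filterlim_inverse_at_top_right by (simp add: inverse_eq_divide)
  from filterlim_compose[OF poly_exp_tendsto_0 this] show ?thesis by simp
qed

definition bump_deriv :: "real poly \<Rightarrow> real poly" where
  "bump_deriv p = [:0, 0, 1:] * (p - pderiv p)"

lemma DERIV_bump: "(bump p has_real_derivative bump (bump_deriv p) t) (at t)"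
proof (cases t "0::real" rule: linorder_cases)
  case less
  have "((\<lambda>_. 0) has_real_derivative 0) (at t)" by simp
  then have "(bump p has_real_derivative 0) (at t)"
    by (rule has_field_derivative_transform_within_open[of _ _ _ "{..<0}"]) (use less in \<open>auto simp: bump_def\<close>)
  then show ?thesis using less by (simp add: bump_def)
next
  case greater
  have "((\<lambda>t. poly p (1 / t) * exp (- 1 / t)) has_real_derivative bump (bump_deriv p) t) (at t)"
    using greater
    by (auto intro!: derivative_eq_intros poly_DERIV[THEN DERIV_chain2] simp: bump_def bump_deriv_def field_simps power2_eq_square)
  then show ?thesis
    by (rule has_field_derivative_transform_within_open[of _ _ _ "{0<..}"]) (use greater in \<open>auto simp: bump_def\<close>)
next
  case equal
  have "((\<lambda>h. (bump p (0 + h) - bump p 0) / h) \<longlongrightarrow> 0) (at 0)"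
  proof (rule filterlim_split_at)
    have "\<forall>\<^sub>F h in at_left (0::real). 0 = (bump p (0 + h) - bump p 0) / h"
      unfolding eventually_at_filter by (rule always_eventually) (simp add: bump_def)
    then show "((\<lambda>h. (bump p (0 + h) - bump p 0) / h) \<longlongrightarrow> 0) (at_left 0)"
      by (rule Lim_transform_eventually[OF tendsto_const])
    have "\<forall>\<^sub>F h in at_right (0::real). poly ([:0, 1:] * p) (1 / h) * exp (- 1 / h) = (bump p (0 + h) - bump p 0) / h"
      using eventually_at_right_less[of "0::real"] by eventually_elim (simp add: bump_def)
    then show "((\<lambda>h. (bump p (0 + h) - bump p 0) / h) \<longlongrightarrow> 0) (at_right 0)"
      by (rule Lim_transform_eventually[OF bump_at_right_0])
  qed
  then show ?thesis unfolding equal DERIV_def by (simp add: bump_def)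
qed

text \<open>The algebra generated by the bumps of affine functionals. It contains its directional derivatives, hence
  consists of functions of class \<open>C\<^sup>k\<close> for all \<open>k\<close>.\<close>

inductive smooth_alg :: "('a::euclidean_space \<Rightarrow> real) \<Rightarrow> bool" where
  smooth_const: "smooth_alg (\<lambda>_. c)"
| smooth_bump: "smooth_alg (\<lambda>x. bump p (x \<bullet> c + d))"
| smooth_add: "smooth_alg f \<Longrightarrow> smooth_alg g \<Longrightarrow> smooth_alg (\<lambda>x. f x + g x)"
| smooth_mult: "smooth_alg f \<Longrightarrow> smooth_alg g \<Longrightarrow> smooth_alg (\<lambda>x. f x * g x)"

lemma smooth_alg_deriv:
  "smooth_alg f \<Longrightarrow> \<exists>f'. (\<forall>x. (f has_derivative f' x) (at x)) \<and> (\<forall>v. smooth_alg (\<lambda>x. f' x v))"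
proof (induction rule: smooth_alg.induct)
  case (smooth_const c)
  show ?case by (intro exI[of _ "\<lambda>_ _. 0"]) (auto intro: smooth_alg.smooth_const)
next
  case (smooth_bump p c d)
  show ?case
  proof (intro exI[of _ "\<lambda>x v. bump (bump_deriv p) (x \<bullet> c + d) * (v \<bullet> c)"] conjI allI)
    fix x :: 'a
    show "((\<lambda>x. bump p (x \<bullet> c + d)) has_derivative (\<lambda>v. bump (bump_deriv p) (x \<bullet> c + d) * (v \<bullet> c))) (at x)"
      using DERIV_compose_FDERIV[where f="bump p" and g="\<lambda>x. x \<bullet> c + d" and g'="\<lambda>v. v \<bullet> c" and s=UNIV, OF DERIV_bump]
      by (simp add: mult.commute has_derivative_add_const bounded_linear_imp_has_derivative bounded_linear_inner_left)
  next
    fix v show "smooth_alg (\<lambda>x. bump (bump_deriv p) (x \<bullet> c + d) * (v \<bullet> c))"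
      by (intro smooth_alg.intros)
  qed
next
  case (smooth_add f g)
  then obtain f' g' where "\<And>x. (f has_derivative f' x) (at x)" "\<And>v. smooth_alg (\<lambda>x. f' x v)"
    "\<And>x. (g has_derivative g' x) (at x)" "\<And>v. smooth_alg (\<lambda>x. g' x v)" by blast
  then show ?case by (intro exI[of _ "\<lambda>x v. f' x v + g' x v"]) (auto intro: smooth_alg.intros has_derivative_add)
next
  case (smooth_mult f g)
  then obtain f' g' where fg: "\<And>x. (f has_derivative f' x) (at x)" "\<And>v. smooth_alg (\<lambda>x. f' x v)"
    "\<And>x. (g has_derivative g' x) (at x)" "\<And>v. smooth_alg (\<lambda>x. g' x v)" by blast
  show ?case
  proof (intro exI[of _ "\<lambda>x v. f x * g' x v + f' x v * g x"] conjI allI)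
    show "((\<lambda>x. f x * g x) has_derivative (\<lambda>v. f x * g' x v + f' x v * g x)) (at x)" for x
      by (rule has_derivative_mult[OF fg(1,3)])
    show "smooth_alg (\<lambda>x. f x * g' x v + f' x v * g x)" for v
      by (intro smooth_alg.smooth_add smooth_alg.smooth_mult smooth_mult.hyps fg)
  qed
qed

lemma smooth_alg_Ck_on: "smooth_alg f \<Longrightarrow> Ck_on k UNIV f"
proof (induction k arbitrary: f)
  case 0
  then obtain f' where "\<And>x. (f has_derivative f' x) (at x)" using smooth_alg_deriv by blast
  then show ?case by (auto intro!: continuous_at_imp_continuous_on has_derivative_continuous)
next
  case (Suc k)
  then obtain f' where f': "\<And>x. (f has_derivative f' x) (at x)" "\<And>v. smooth_alg (\<lambda>x. f' x v)"
    using smooth_alg_deriv by blast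
  have "frechet_derivative f (at x) = f' x" for x
    using frechet_derivative_at[OF f'(1)] by simp
  then show ?case using Suc.IH f' by (auto simp: differentiable_def)
qed

lemma smooth_alg_prod: "finite I \<Longrightarrow> (\<And>i. i \<in> I \<Longrightarrow> smooth_alg (f i)) \<Longrightarrow> smooth_alg (\<lambda>x. \<Prod>i\<in>I. f i x)"
  by (induction I rule: finite_induct) (auto intro: smooth_alg.intros)

text \<open>Test functions that converge to the indicator of a box.\<close>

definition box_bump :: "real^'n \<Rightarrow> real^'n \<Rightarrow> nat \<Rightarrow> real^'n \<Rightarrow> real" where
  "box_bump a b k y = (\<Prod>i\<in>UNIV. bump 1 (real (Suc k) * (y $ i - a $ i)) * bump 1 (real (Suc k) * (b $ i - y $ i)))"

lemma bump_1: "0 \<le> bump 1 t" "bump 1 t \<le> 1" "t \<le> 0 \<Longrightarrow> bump 1 t = 0"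
  by (auto simp: bump_def)

lemma box_bump_outside: "y \<notin> box a b \<Longrightarrow> box_bump a b k y = 0"
proof -
  assume "y \<notin> box a b"
  then obtain i where "\<not> (a $ i < y $ i \<and> y $ i < b $ i)" by (auto simp: mem_box_cart)
  then have "real (Suc k) * (y $ i - a $ i) \<le> 0 \<or> real (Suc k) * (b $ i - y $ i) \<le> 0"
    by (auto simp: mult_le_0_iff)
  then have "bump 1 (real (Suc k) * (y $ i - a $ i)) * bump 1 (real (Suc k) * (b $ i - y $ i)) = 0"
    using bump_1(3) by auto
  then show ?thesis unfolding box_bump_def by (intro prod_zero) auto
qed

lemma box_bump_bounds: "0 \<le> box_bump a b k y" "box_bump a b k y \<le> 1"
  unfolding box_bump_def by (auto intro!: prod_nonneg prod_le_1 mult_le_one simp: bump_1)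

lemma box_bump_tendsto: "(\<lambda>k. box_bump a b k y) \<longlonglongrightarrow> indicator (box a b) y"
proof (cases "y \<in> box a b")
  case True
  have "(\<lambda>k. bump 1 (real (Suc k) * s)) \<longlonglongrightarrow> 1" if "s > 0" for s :: real
  proof -
    have "(\<lambda>k. - (1 / s) * inverse (real (Suc k))) \<longlonglongrightarrow> - (1 / s) * 0"
      by (intro tendsto_intros LIMSEQ_inverse_real_of_nat)
    then have "(\<lambda>k. exp (- (1 / s) * inverse (real (Suc k)))) \<longlonglongrightarrow> exp 0"
      by (intro tendsto_exp) simp
    moreover have "exp (- (1 / s) * inverse (real (Suc k))) = bump 1 (real (Suc k) * s)" for k
      using that by (simp add: bump_def field_simps del: of_nat_Suc)
    ultimately show ?thesis by simp
  qed
  then have "(\<lambda>k. box_bump a b k y) \<longlonglongrightarrow> (\<Prod>i\<in>(UNIV::'a set). 1 * 1)"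
    unfolding box_bump_def using True by (intro tendsto_prod tendsto_mult) (auto simp: mem_box_cart)
  then show ?thesis using True by simp
qed (simp add: box_bump_outside)

lemma test_function_box_bump: "test_function (box_bump a b k)"
  unfolding test_function_def
proof (intro conjI allI)
  have "smooth_alg (box_bump a b k)"
  proof -
    have "bump 1 (real (Suc k) * (y $ i - a $ i)) * bump 1 (real (Suc k) * (b $ i - y $ i)) =
      bump 1 (y \<bullet> (real (Suc k) *\<^sub>R axis i 1) + - real (Suc k) * a $ i) *
      bump 1 (y \<bullet> (- real (Suc k) *\<^sub>R axis i 1) + real (Suc k) * b $ i)" for y i
      by (simp add: inner_axis algebra_simps del: of_nat_Suc)
    then show ?thesis unfolding box_bump_def[abs_def]
      by (simp only:) (intro smooth_alg_prod smooth_alg.intros finite)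
  qed
  then show "Ck_on m UNIV (box_bump a b k)" for m by (rule smooth_alg_Ck_on)
  have "{y. box_bump a b k y \<noteq> 0} \<subseteq> cbox a b"
    using box_bump_outside box_subset_cbox by blast
  then have "closure {y. box_bump a b k y \<noteq> 0} \<subseteq> cbox a b" by (rule closure_minimal) (rule closed_cbox)
  then show "compact (closure {y. box_bump a b k y \<noteq> 0})"
    using compact_cbox bounded_subset compact_eq_bounded_closed by (metis closed_closure)
qed

text \<open>Boxes generate the Borel sets and are stable under intersection, and the Borel sets over which \<open>f\<close> integrates to zero are
  closed under complements and disjoint unions.\<close>

lemma AE_zero_of_box_integrals:
  fixes f :: "'a::euclidean_space \<Rightarrow> real"
  assumes f: "integrable lborel f" and box: "\<And>a b. (LINT y|lborel. indicator (box a b) y * f y) = 0"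
    and total: "(LINT y|lborel. f y) = 0"
  shows "AE y in lborel. f y = 0"
proof (rule sigma_finite_measure.density_zero[OF sigma_finite_lborel f])
  fix A :: "'a set" assume "A \<in> sets lborel"
  then have A: "A \<in> sigma_sets UNIV (range (\<lambda>(a, b). box a b))"
    by (simp add: borel_eq_box)
  have I: "Int_stable (range (\<lambda>(a, b). box a b :: 'a set))"
    by (auto simp: Int_stable_def box_Int_box)
  have P: "range (\<lambda>(a, b). box a b :: 'a set) \<subseteq> Pow UNIV" by simp
  from I P A have "(LINT y|lborel. indicator A y * f y) = 0"
  proof (induction rule: sigma_sets_induct_disjoint)
    case (basic A)
    then show ?case using box by auto
  next
    case empty
    show ?case by simp
  next
    case (compl A)
    then have A: "A \<in> sets lborel" by (simp add: borel_eq_box)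
    have "(LINT y|lborel. indicator (UNIV - A) y * f y) = (LINT y|lborel. f y - indicator A y * f y)"
      by (intro Bochner_Integration.integral_cong) (auto simp: indicator_def)
    also have "\<dots> = (LINT y|lborel. f y) - (LINT y|lborel. indicator A y * f y)"
      using f integrable_mult_indicator[OF A f] by (intro Bochner_Integration.integral_diff) auto
    finally show ?case using compl total by simp
  next
    case (union A)
    then have A: "\<And>i. A i \<in> sets lborel" by (auto simp: borel_eq_box)
    have "(LINT y:(\<Union>i. A i)|lborel. f y) = (\<Sum>i. (LINT y:(A i)|lborel. f y))"
      using A union(1) f integrable_mult_indicator[OF sets.countable_UN[of A UNIV lborel] f]
      by (intro lebesgue_integral_countable_add) (auto simp: disjoint_family_on_def set_integrable_def)
    then show ?case using union by (simp add: set_lebesgue_integral_def)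
  qed
  then show "set_lebesgue_integral lborel A f = 0" by (simp add: set_lebesgue_integral_def)
qed

lemma AE_zero_of_test_functions:
  fixes f :: "real^'n \<Rightarrow> real"
  assumes f: "f \<in> borel_measurable borel" and loc: "\<And>a b. set_integrable lborel (box a b) f"
    and test: "\<And>\<phi>. test_function \<phi> \<Longrightarrow> (LINT y|lborel. f y * \<phi> y) = 0"
  shows "AE y in lborel. f y = 0"
proof -
  have box: "(LINT y|lborel. indicator (box a b) y * f y) = 0" for a b
  proof -
    have "(\<lambda>k. LINT y|lborel. f y * box_bump a b k y) \<longlonglongrightarrow> (LINT y|lborel. f y * indicator (box a b) y)"
    proof (rule integral_dominated_convergence)
      show "integrable lborel (\<lambda>y. norm (indicator (box a b) y *\<^sub>R f y))"
        using loc unfolding set_integrable_def by (rule integrable_norm)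
      show "AE y in lborel. (\<lambda>k. f y * box_bump a b k y) \<longlonglongrightarrow> f y * indicator (box a b) y"
        by (intro AE_I2 tendsto_intros box_bump_tendsto)
      show "(\<lambda>y. f y * indicator (box a b) y) \<in> borel_measurable lborel" using f by simp
      have "continuous_on UNIV (box_bump a b k)" for k
        using test_function_box_bump[of a b k] unfolding test_function_def by (metis Ck_on.simps(1))
      then show "(\<lambda>y. f y * box_bump a b k y) \<in> borel_measurable lborel" for k
        using f borel_measurable_continuous_onI by (intro borel_measurable_times) auto
      show "AE y in lborel. norm (f y * box_bump a b k y) \<le> norm (indicator (box a b) y *\<^sub>R f y)" for k
      proof (rule AE_I2)
        fix y show "norm (f y * box_bump a b k y) \<le> norm (indicator (box a b) y *\<^sub>R f y)"
          using box_bump_bounds[of a b k y] mult_left_mono[of "\<bar>box_bump a b k y\<bar>" 1 "\<bar>f y\<bar>"]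
          by (cases "y \<in> box a b") (auto simp: box_bump_outside abs_mult)
      qed
    qed
    then have "(\<lambda>k. 0) \<longlonglongrightarrow> (LINT y|lborel. f y * indicator (box a b) y)"
      using test[OF test_function_box_bump] by simp
    then show ?thesis by (simp add: LIMSEQ_const_iff mult.commute)
  qed
  have "AE y in lborel. indicator (box (- (real k *\<^sub>R One)) (real k *\<^sub>R One)) y * f y = 0" for k :: nat
  proof (rule AE_zero_of_box_integrals)
    show "integrable lborel (\<lambda>y. indicator (box (- (real k *\<^sub>R One)) (real k *\<^sub>R One)) y * f y)"
      using loc unfolding set_integrable_def by simp
    fix a b
    have "(LINT y|lborel. indicator (box a b) y * (indicator (box (- (real k *\<^sub>R One)) (real k *\<^sub>R One)) y * f y)) =
      (LINT y|lborel. indicator (box a b \<inter> box (- (real k *\<^sub>R One)) (real k *\<^sub>R One)) y * f y)"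
      by (intro Bochner_Integration.integral_cong) (auto simp: indicator_def)
    then show "(LINT y|lborel. indicator (box a b) y * (indicator (box (- (real k *\<^sub>R One)) (real k *\<^sub>R One)) y * f y)) = 0"
      unfolding box_Int_box by (simp add: box)
  qed (rule box)
  then have "AE y in lborel. \<forall>k::nat. indicator (box (- (real k *\<^sub>R One)) (real k *\<^sub>R One)) y * f y = 0"
    by (intro AE_all_countable[THEN iffD2] allI)
  then show ?thesis
  proof eventually_elim
    case (elim y)
    have "y \<in> (\<Union>k::nat. box (- (real k *\<^sub>R One)) (real k *\<^sub>R One))"
      by (simp only: UN_box_eq_UNIV UNIV_I)
    then obtain k :: nat where "y \<in> box (- (real k *\<^sub>R One)) (real k *\<^sub>R One)" by (elim UN_E)
    with elim[rule_format, of k] show ?case by simp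
  qed
qed

section \<open>Weak limits of bounded sequences\<close>

text \<open>Weak-* compactness of bounded sets, by minimal norm elements. Let \<open>C k\<close> be the set of bounded functions whose moments are
  at least as close to the limits as those of all \<open>w l\<close> with \<open>l \<ge> k\<close>. These sets are decreasing, nonempty and stable under
  midpoints, so by the parallelogram identity their nearly minimal elements in \<open>L\<^sup>2\<close> of an equivalent finite measure form a
  Cauchy sequence. A subsequence converges almost everywhere, and dominated convergence identifies the moments of its limit.\<close>

lemma weak_limit_of_bounded_sequence:
  fixes w :: "nat \<Rightarrow> 'a \<Rightarrow> real"
  assumes M: "sigma_finite_measure M"
    and w [measurable]: "\<And>n. w n \<in> borel_measurable M" and bound: "\<And>n x. \<bar>w n x\<bar> \<le> K"
    and \<Phi>: "\<And>\<phi>. \<phi> \<in> \<Phi> \<Longrightarrow> integrable M \<phi>"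
    and lim: "\<And>\<phi>. \<phi> \<in> \<Phi> \<Longrightarrow> (\<lambda>n. LINT x|M. w n x * \<phi> x) \<longlonglongrightarrow> a \<phi>"
  shows "\<exists>f\<in>borel_measurable M. (\<forall>x. \<bar>f x\<bar> \<le> K) \<and> (\<forall>\<phi>\<in>\<Phi>. (LINT x|M. f x * \<phi> x) = a \<phi>)"
proof -
  have K: "K \<ge> 0" using bound[of 0 undefined] by linarith
  obtain h where h: "h \<in> borel_measurable M" "integral\<^sup>N M h \<noteq> \<infinity>" "\<And>x. x \<in> space M \<Longrightarrow> 0 < h x \<and> h x < \<infinity>"
    using sigma_finite_measure.Ex_finite_integrable_function[OF M] by blast
  define \<rho> where "\<rho> = density M h"
  have "emeasure \<rho> (space \<rho>) = integral\<^sup>N M h"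
    using h(1) by (simp add: \<rho>_def emeasure_density cong: nn_integral_cong)
  then interpret \<rho>: finite_measure \<rho> using h(2) by (intro finite_measureI) (simp add: infinity_ennreal_def)
  have sets\<rho> [measurable_cong]: "sets \<rho> = sets M" by (simp add: \<rho>_def)
  have AE\<rho>: "(AE x in M. P x)" if "AE x in \<rho>. P x" for P
  proof -
    have "AE x in M. 0 < h x \<longrightarrow> P x" using that unfolding \<rho>_def by (simp add: AE_density[OF h(1)])
    then show ?thesis using AE_space
    proof eventually_elim
      case (elim x)
      then show ?case using h(3)[of x] by simp
    qed
  qed
  define C where "C = (\<lambda>k. {f \<in> borel_measurable M. (\<forall>x. \<bar>f x\<bar> \<le> K) \<and> (\<forall>\<phi>\<in>\<Phi>. \<forall>e.
     (\<forall>l\<ge>k. \<bar>(LINT x|M. w l x * \<phi> x) - a \<phi>\<bar> \<le> e) \<longrightarrow> \<bar>(LINT x|M. f x * \<phi> x) - a \<phi>\<bar> \<le> e)})"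
  define N where "N = (\<lambda>f::'a \<Rightarrow> real. LINT x|\<rho>. (f x)\<^sup>2)"
  have CI: "f \<in> C k" if "f \<in> borel_measurable M" "\<And>x. \<bar>f x\<bar> \<le> K"
    "\<And>\<phi> e. \<phi> \<in> \<Phi> \<Longrightarrow> (\<And>l. l \<ge> k \<Longrightarrow> \<bar>(LINT x|M. w l x * \<phi> x) - a \<phi>\<bar> \<le> e) \<Longrightarrow> \<bar>(LINT x|M. f x * \<phi> x) - a \<phi>\<bar> \<le> e" for f k
    unfolding C_def using that by simp
  have CD: "f \<in> borel_measurable M" "\<bar>f x\<bar> \<le> K" if "f \<in> C k" for f k x
    using that unfolding C_def by simp_all
  have CD3: "\<bar>(LINT x|M. f x * \<phi> x) - a \<phi>\<bar> \<le> e"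
    if "f \<in> C k" "\<phi> \<in> \<Phi>" "\<And>l. l \<ge> k \<Longrightarrow> \<bar>(LINT x|M. w l x * \<phi> x) - a \<phi>\<bar> \<le> e" for f k \<phi> e
    using that unfolding C_def by simp
  have wC: "w k \<in> C k" for k by (rule CI) (use w bound in simp_all)
  have C_anti: "C l \<subseteq> C k" if "k \<le> l" for k l
  proof
    fix f assume f: "f \<in> C l"
    show "f \<in> C k"
    proof (rule CI[OF CD[OF f]])
      fix \<phi> e assume *: "\<phi> \<in> \<Phi>" "\<And>l. l \<ge> k \<Longrightarrow> \<bar>(LINT x|M. w l x * \<phi> x) - a \<phi>\<bar> \<le> e"
      show "\<bar>(LINT x|M. f x * \<phi> x) - a \<phi>\<bar> \<le> e"
        by (rule CD3[OF f *(1)], rule *(2)) (use \<open>k \<le> l\<close> in simp)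
    qed
  qed
  have prod_int: "integrable M (\<lambda>x. f x * \<phi> x)" if "f \<in> borel_measurable M" "\<And>x. \<bar>f x\<bar> \<le> K" "\<phi> \<in> \<Phi>" for f \<phi>
  proof (rule Bochner_Integration.integrable_bound)
    show "integrable M (\<lambda>x. K * \<bar>\<phi> x\<bar>)" using \<Phi>[OF that(3)] by (intro integrable_mult_right integrable_abs)
    show "(\<lambda>x. f x * \<phi> x) \<in> borel_measurable M" using that(1) \<Phi>[OF that(3)] by (intro borel_measurable_times) auto
    show "AE x in M. norm (f x * \<phi> x) \<le> norm (K * \<bar>\<phi> x\<bar>)"
      using that(2) K by (intro AE_I2) (auto simp: abs_mult intro!: mult_right_mono)
  qed
  have mid: "(\<lambda>x. (f x + g x) / 2) \<in> C k" if "f \<in> C k" "g \<in> C k" for f g k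
  proof -
    have fg: "f \<in> borel_measurable M" "g \<in> borel_measurable M" "\<And>x. \<bar>f x\<bar> \<le> K" "\<And>x. \<bar>g x\<bar> \<le> K"
      using that CD by blast+
    have mK: "\<bar>(f x + g x) / 2\<bar> \<le> K" for x using fg(3)[of x] fg(4)[of x] by simp
    have "\<bar>(LINT x|M. (f x + g x) / 2 * \<phi> x) - a \<phi>\<bar> \<le> e"
      if \<phi>: "\<phi> \<in> \<Phi>" and e: "\<And>l. l \<ge> k \<Longrightarrow> \<bar>(LINT x|M. w l x * \<phi> x) - a \<phi>\<bar> \<le> e" for \<phi> e
    proof -
      have "(LINT x|M. (f x + g x) / 2 * \<phi> x) = (LINT x|M. (f x * \<phi> x) / 2 + (g x * \<phi> x) / 2)"
        by (intro Bochner_Integration.integral_cong) (auto simp: field_simps)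
      also have "\<dots> = (LINT x|M. f x * \<phi> x) / 2 + (LINT x|M. g x * \<phi> x) / 2"
        using prod_int[OF fg(1,3) \<phi>] prod_int[OF fg(2,4) \<phi>] by simp
      finally have eq: "(LINT x|M. (f x + g x) / 2 * \<phi> x) = \<dots>" .
      have "\<bar>(LINT x|M. f x * \<phi> x) - a \<phi>\<bar> \<le> e" "\<bar>(LINT x|M. g x * \<phi> x) - a \<phi>\<bar> \<le> e"
        using CD3[OF \<open>f \<in> C k\<close> \<phi> e] CD3[OF \<open>g \<in> C k\<close> \<phi> e] by simp_all
      then show ?thesis unfolding eq by (simp add: abs_le_iff field_simps)
    qed
    then show ?thesis using mK fg by (intro CI) simp_all
  qed
  have sq: "t\<^sup>2 \<le> B\<^sup>2" if "\<bar>t\<bar> \<le> B" for t B :: real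
    using that power_mono[OF that, of 2] by simp
  have int2: "integrable \<rho> (\<lambda>x. (f x)\<^sup>2)" if "f \<in> borel_measurable M" "\<And>x. \<bar>f x\<bar> \<le> B" for f :: "'a \<Rightarrow> real" and B :: real
  proof (rule \<rho>.integrable_const_bound[where B="B\<^sup>2"])
    show "(\<lambda>x. (f x)\<^sup>2) \<in> borel_measurable \<rho>" using that(1) by (simp add: \<rho>_def)
    show "AE x in \<rho>. norm ((f x)\<^sup>2) \<le> B\<^sup>2" using sq[OF that(2)] by (intro AE_I2) simp
  qed
  define d where "d = (\<lambda>k. Inf (N ` C k))"
  have N0: "0 \<le> N f" for f unfolding N_def by (intro integral_nonneg_AE) auto
  have bdd: "bdd_below (N ` C k)" for k using N0 by (intro bdd_belowI[of _ 0]) auto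
  have dN: "d k \<le> N f" if "f \<in> C k" for k f unfolding d_def using that bdd by (intro cInf_lower) auto
  have d_mono: "d k \<le> d l" if "k \<le> l" for k l
    unfolding d_def using wC[of l] C_anti[OF that] bdd by (intro cInf_superset_mono image_mono) auto
  have "N (w k) \<le> K\<^sup>2 * measure \<rho> (space \<rho>)" for k
  proof -
    have "N (w k) \<le> (LINT x|\<rho>. K\<^sup>2)"
      unfolding N_def using int2[of "w k" K] bound
      by (intro integral_mono) (auto intro: sq)
    then show ?thesis by (simp add: mult.commute)
  qed
  then have dB: "d k \<le> K\<^sup>2 * measure \<rho> (space \<rho>)" for k using dN[OF wC[of k]] by (rule order_trans[rotated])
  have "convergent d"
  proof -
    define B where "B = \<bar>d 0\<bar> + K\<^sup>2 * measure \<rho> (space \<rho>)"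
    have "norm (d k) \<le> B" for k
    proof -
      have "- \<bar>d 0\<bar> \<le> d k" using d_mono[of 0 k] by simp
      moreover have "0 \<le> K\<^sup>2 * measure \<rho> (space \<rho>)" by simp
      ultimately show ?thesis using dB[of k] unfolding B_def real_norm_def by linarith
    qed
    then have "Bseq d" by (intro BseqI'[of d B])
    then show ?thesis by (rule Bseq_mono_convergent) (simp add: d_mono)
  qed
  then have "Cauchy d" by (rule convergent_Cauchy)
  define q where "q = (\<lambda>k. inverse (real (Suc k)))"
  have "\<exists>f\<in>C k. N f < d k + q k" for k
  proof -
    have "Inf (N ` C k) < d k + q k" unfolding d_def by (simp add: q_def)
    then show ?thesis using cInf_less_iff[OF _ bdd] wC[of k] by (metis (no_types, lifting) empty_iff imageE image_is_empty)
  qed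
  then obtain c where c: "\<And>k. c k \<in> C k" "\<And>k. N (c k) < d k + q k" by metis
  have cm: "c k \<in> borel_measurable M" and cK: "\<bar>c k x\<bar> \<le> K" for k x using CD[OF c(1)[of k]] by simp_all
  \<comment> \<open>parallelogram identity, with the midpoint as a competitor in the minimisation over \<open>C k\<close>\<close>
  have par: "(LINT x|\<rho>. (c k x - c l x)\<^sup>2) \<le> 2 * (d l - d k) + 4 * q k" if "k \<le> l" for k l
  proof -
    let ?m = "\<lambda>x. (c k x + c l x) / 2"
    have "c l \<in> C k" using c(1)[of l] C_anti[OF that] by blast
    then have m: "?m \<in> C k" using mid c(1) by blast
    note mm = CD[OF m]
    note i = int2[OF cm cK, of k] int2[OF cm cK, of l] int2[OF mm]
    have "(LINT x|\<rho>. (c k x - c l x)\<^sup>2) = (LINT x|\<rho>. 2 * (c k x)\<^sup>2 + 2 * (c l x)\<^sup>2 - 4 * (?m x)\<^sup>2)"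
      by (intro Bochner_Integration.integral_cong) (auto simp: power2_eq_square field_simps)
    also have "\<dots> = 2 * N (c k) + 2 * N (c l) - 4 * N ?m"
      unfolding N_def using i by simp
    also have "\<dots> \<le> 2 * (d l - d k) + 4 * q k"
    proof -
      have lin: "2 * A + 2 * B - 4 * m \<le> 2 * (y - x) + 4 * i" if "A < x + i" "B < y + j" "x \<le> m" "j \<le> i"
        for A B m x y i j :: real using that by simp
      have "q l \<le> q k" using that by (auto simp: q_def field_simps)
      then show ?thesis by (rule lin[OF c(2) c(2) dN[OF m]])
    qed
    finally show ?thesis .
  qed
  have intc: "integrable \<rho> (c k)" for k
    using cm[of k] cK[of k] by (intro \<rho>.integrable_const_bound[where B=K]) (auto simp: \<rho>_def)
  have cauchy: "\<exists>N0. \<forall>k\<ge>N0. \<forall>l\<ge>N0. (LINT x|\<rho>. norm (c k x - c l x)) < e" if "e > 0" for e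
  proof -
    define m where "m = measure \<rho> (space \<rho>)"
    have m0: "m \<ge> 0" by (simp add: m_def)
    define \<delta> where "\<delta> = e / (2 * (m + 1))"
    have \<delta>: "\<delta> > 0" using that m0 by (simp add: \<delta>_def)
    have "\<delta> * m \<le> e / 2"
      using that m0 by (simp add: \<delta>_def field_simps)
    obtain N1 where N1: "\<And>k l. k \<ge> N1 \<Longrightarrow> l \<ge> N1 \<Longrightarrow> \<bar>d k - d l\<bar> < \<delta> * e / 16"
      using metric_CauchyD[OF \<open>Cauchy d\<close>, of "\<delta> * e / 16"] \<delta> \<open>e > 0\<close> by (auto simp: dist_real_def)
    obtain N2 where N2: "q N2 < \<delta> * e / 32"
      using reals_Archimedean[of "\<delta> * e / 32"] \<delta> \<open>e > 0\<close> by (auto simp: q_def)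
    have small: "(LINT x|\<rho>. norm (c k x - c l x)) < e" if "k \<ge> N1" "k \<ge> N2" "k \<le> l" for k l
    proof -
      have b2: "\<bar>c k x - c l x\<bar> \<le> 2 * K" for x using cK[of k x] cK[of l x] by linarith
      have i: "integrable \<rho> (\<lambda>x. (c k x - c l x)\<^sup>2)" using int2[of "\<lambda>x. c k x - c l x" "2 * K"] cm b2 by auto
      have pt: "norm (c k x - c l x) \<le> \<delta> + (c k x - c l x)\<^sup>2 / \<delta>" for x
      proof (cases "\<bar>c k x - c l x\<bar> \<le> \<delta>")
        case True
        then show ?thesis using \<delta> by (simp add: add_increasing2)
      next
        case False
        then have "\<bar>c k x - c l x\<bar> * \<delta> \<le> \<bar>c k x - c l x\<bar> * \<bar>c k x - c l x\<bar>" by (intro mult_left_mono) auto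
        then have "\<bar>c k x - c l x\<bar> \<le> (c k x - c l x)\<^sup>2 / \<delta>" using \<delta> by (simp add: field_simps power2_eq_square abs_mult_self_eq)
        then show ?thesis using \<delta> by simp
      qed
      have "(LINT x|\<rho>. norm (c k x - c l x)) \<le> (LINT x|\<rho>. \<delta> + (c k x - c l x)\<^sup>2 / \<delta>)"
        using i intc pt by (intro integral_mono) auto
      also have "\<dots> = \<delta> * m + (LINT x|\<rho>. (c k x - c l x)\<^sup>2) / \<delta>"
        using i by (simp add: m_def mult.commute)
      also have "\<dots> \<le> e / 2 + (2 * (d l - d k) + 4 * q k) / \<delta>"
        using par[OF that(3)] \<open>\<delta> * m \<le> e / 2\<close> \<delta> by (intro add_mono divide_right_mono) auto
      also have "\<dots> < e / 2 + (\<delta> * e / 4) / \<delta>"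
      proof -
        have "q k \<le> q N2" using that by (auto simp: q_def field_simps)
        moreover have "d l - d k < \<delta> * e / 16" using abs_le_D1[OF order_refl, of "d l - d k"] N1[of l k] that by auto
        ultimately have "2 * (d l - d k) + 4 * q k < \<delta> * e / 4" using N2 by argo
        then show ?thesis by (rule add_strict_left_mono[OF divide_strict_right_mono[OF _ \<delta>]])
      qed
      also have "\<dots> < e" using \<delta> \<open>e > 0\<close> by simp
      finally show ?thesis .
    qed
    show ?thesis
    proof (intro exI allI impI)
      fix k l assume kl: "k \<ge> max N1 N2" "l \<ge> max N1 N2"
      show "(LINT x|\<rho>. norm (c k x - c l x)) < e"
      proof (cases "k \<le> l")
        case True
        then show ?thesis using small kl by auto
      next
        case False
        then have "(LINT x|\<rho>. norm (c l x - c k x)) < e" using small[of l k] kl by auto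
        then show ?thesis by (simp only: norm_minus_commute[of "c l _"])
      qed
    qed
  qed
  obtain r where r: "strict_mono r" "AE x in \<rho>. Cauchy (\<lambda>i. c (r i) x)"
    using cauchy_L1_AE_cauchy_subseq[of \<rho> c, OF intc cauchy] by blast
  define f where "f = (\<lambda>x. max (- K) (min K (lim (\<lambda>i. c (r i) x))))"
  have fm: "f \<in> borel_measurable M"
    unfolding f_def using cm by (intro borel_measurable_max borel_measurable_min borel_measurable_lim_metric) auto
  have fK: "\<bar>f x\<bar> \<le> K" for x unfolding f_def using K by (auto simp: abs_le_iff)
  have conv: "AE x in M. (\<lambda>i. c (r i) x) \<longlonglongrightarrow> f x"
    using AE\<rho>[OF r(2)]
  proof eventually_elim
    case (elim x)
    then have L: "(\<lambda>i. c (r i) x) \<longlonglongrightarrow> lim (\<lambda>i. c (r i) x)" by (simp add: Cauchy_convergent convergent_LIMSEQ_iff[symmetric])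
    have "\<bar>lim (\<lambda>i. c (r i) x)\<bar> \<le> K"
      by (rule LIMSEQ_le_const2[OF tendsto_rabs[OF L]]) (use cK in auto)
    then have "f x = lim (\<lambda>i. c (r i) x)" unfolding f_def by auto
    with L show ?case by simp
  qed
  have "(LINT x|M. f x * \<phi> x) = a \<phi>" if \<phi>: "\<phi> \<in> \<Phi>" for \<phi>
  proof -
    have \<phi>m: "\<phi> \<in> borel_measurable M" using \<Phi>[OF \<phi>] by auto
    have "(\<lambda>i. LINT x|M. c (r i) x * \<phi> x) \<longlonglongrightarrow> (LINT x|M. f x * \<phi> x)"
    proof (rule integral_dominated_convergence)
      show "integrable M (\<lambda>x. K * \<bar>\<phi> x\<bar>)" using \<Phi>[OF \<phi>] by (intro integrable_mult_right integrable_abs)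
      show "AE x in M. (\<lambda>i. c (r i) x * \<phi> x) \<longlonglongrightarrow> f x * \<phi> x"
        using conv by eventually_elim (intro tendsto_intros)
      show "AE x in M. norm (c (r i) x * \<phi> x) \<le> K * \<bar>\<phi> x\<bar>" for i
        using cK by (intro AE_I2) (auto simp: abs_mult intro!: mult_right_mono)
    qed (use fm cm \<phi>m in auto)
    moreover have "(\<lambda>i. LINT x|M. c (r i) x * \<phi> x) \<longlonglongrightarrow> a \<phi>"
    proof (rule LIMSEQ_I)
      fix e :: real assume "e > 0"
      then obtain k where k: "\<And>l. l \<ge> k \<Longrightarrow> norm ((LINT x|M. w l x * \<phi> x) - a \<phi>) < e / 2"
        using LIMSEQ_D[OF lim[OF \<phi>], of "e/2"] by auto
      have "norm ((LINT x|M. c (r i) x * \<phi> x) - a \<phi>) < e" if "i \<ge> k" for i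
      proof -
        have "r i \<ge> k" using seq_suble[OF r(1), of i] that by simp
        then have "c (r i) \<in> C k" using c(1) C_anti by blast
        then have "\<bar>(LINT x|M. c (r i) x * \<phi> x) - a \<phi>\<bar> \<le> e / 2"
          by (rule CD3[OF _ \<phi>]) (use k in \<open>simp add: less_imp_le\<close>)
        then show ?thesis using \<open>e > 0\<close> by simp
      qed
      then show "\<exists>no. \<forall>n\<ge>no. norm ((LINT x|M. c (r n) x * \<phi> x) - a \<phi>) < e" by blast
    qed
    ultimately show ?thesis by (rule LIMSEQ_unique)
  qed
  with fm fK show ?thesis by blast
qed

section \<open>Weak Jacobians of Lipschitz maps\<close>

lemma has_derivative_line:
  assumes "(f has_derivative f') (at (x + t *\<^sub>R v))"
  shows "((\<lambda>s. f (x + s *\<^sub>R v)) has_vector_derivative f' v) (at t)"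
proof -
  have "((\<lambda>s. x + s *\<^sub>R v) has_derivative (\<lambda>s. s *\<^sub>R v)) (at t)"
    by (auto intro!: derivative_eq_intros)
  from has_derivative_compose[OF this assms]
  have "((\<lambda>s. f (x + s *\<^sub>R v)) has_derivative (\<lambda>s. f' (s *\<^sub>R v))) (at t)" .
  moreover have "f' (s *\<^sub>R v) = s *\<^sub>R f' v" for s
    using linear_scale[OF has_derivative_linear[OF assms]] .
  ultimately show ?thesis unfolding has_vector_derivative_def by simp
qed

lemma test_function_differentiable: "test_function \<phi> \<Longrightarrow> (\<phi> has_derivative frechet_derivative \<phi> (at x)) (at x)"
  unfolding test_function_def using Ck_on.simps(2)[of 0 UNIV \<phi>] by (metis UNIV_I frechet_derivative_works)

lemma test_function_continuous: "test_function \<phi> \<Longrightarrow> continuous_on UNIV \<phi>"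
  unfolding test_function_def using Ck_on.simps(1)[of UNIV \<phi>] by blast

lemma test_function_deriv_continuous:
  "test_function \<phi> \<Longrightarrow> continuous_on UNIV (\<lambda>y. frechet_derivative \<phi> (at y) v)"
  unfolding test_function_def using Ck_on.simps(2)[of 0 UNIV \<phi>] by (metis Ck_on.simps(1))

lemma test_function_support:
  assumes "test_function \<phi>"
  obtains R where "R > 0" "\<And>y. norm y > R \<Longrightarrow> \<phi> y = 0" "\<And>y v. norm y > R \<Longrightarrow> frechet_derivative \<phi> (at y) v = 0"
proof -
  have "bounded (closure {y. \<phi> y \<noteq> 0})" using assms unfolding test_function_def by (simp add: compact_imp_bounded)
  then obtain R where R: "R > 0" "\<And>y. y \<in> closure {y. \<phi> y \<noteq> 0} \<Longrightarrow> norm y \<le> R" unfolding bounded_pos by blast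
  have 1: "\<phi> y = 0" if "norm y > R" for y
    using R(2)[of y] closure_subset[of "{y. \<phi> y \<noteq> 0}"] that by force
  have "frechet_derivative \<phi> (at y) v = 0" if "norm y > R" for y v
  proof -
    have "open {y::real^'a. norm y > R}" by (intro open_Collect_less continuous_intros)
    then have "(\<phi> has_derivative (\<lambda>_. 0)) (at y)"
      by (rule has_derivative_transform_within_open[OF has_derivative_const[of 0]]) (use that 1 in auto)
    then have "frechet_derivative \<phi> (at y) = (\<lambda>_. 0)" using frechet_derivative_at by metis
    then show ?thesis by simp
  qed
  with R 1 show ?thesis using that by blast
qed

lemma integrable_compact_support:
  fixes f :: "'a::euclidean_space \<Rightarrow> real"
  assumes "continuous_on UNIV f" "\<And>y. norm y > R \<Longrightarrow> f y = 0"
  shows "integrable lborel f"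
proof -
  have "integrable lborel (\<lambda>x. indicator (cball 0 R) x *\<^sub>R f x)"
    using assms(1) by (intro borel_integrable_compact compact_cball) (auto intro: continuous_on_subset)
  moreover have "(\<lambda>x. indicator (cball 0 R) x *\<^sub>R f x) = f"
  proof
    fix x show "indicator (cball 0 R) x *\<^sub>R f x = f x"
      using assms(2)[of x] by (cases "norm x \<le> R") (auto simp: indicator_def)
  qed
  ultimately show ?thesis by simp
qed

lemma lborel_integral_translate:
  fixes f :: "'a::euclidean_space \<Rightarrow> real"
  assumes "f \<in> borel_measurable borel"
  shows "(LINT y|lborel. f (y + c)) = (LINT y|lborel. f y)"
proof -
  have "(LINT y|lborel. f y) = (LINT y|distr lborel borel ((+) c). f y)" by (simp only: lborel_distr_plus)
  also have "\<dots> = (LINT y|lborel. f (c + y))" using assms by (intro integral_distr) auto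
  finally show ?thesis by (simp add: add.commute)
qed

text \<open>Summation by parts: by translation invariance the difference quotient is moved to the test function, where it converges
  boundedly with support in a fixed ball.\<close>

lemma difference_quotient_weak:
  fixes g :: "real^'n \<Rightarrow> real"
  assumes g: "continuous_on UNIV g" and \<phi>: "test_function \<phi>"
  shows "(\<lambda>k. LINT y|lborel. (real (Suc k) * (g (y + inverse (real (Suc k)) *\<^sub>R e) - g y)) * \<phi> y)
    \<longlonglongrightarrow> - (LINT y|lborel. g y * frechet_derivative \<phi> (at y) e)"
proof -
  define D where "D = (\<lambda>y. frechet_derivative \<phi> (at y) e)"
  obtain R where R: "R > 0" "\<And>y. norm y > R \<Longrightarrow> \<phi> y = 0" "\<And>y v. norm y > R \<Longrightarrow> frechet_derivative \<phi> (at y) v = 0"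
    using test_function_support[OF \<phi>] by blast
  have contD: "continuous_on UNIV D" unfolding D_def by (rule test_function_deriv_continuous[OF \<phi>])
  note cont\<phi> = test_function_continuous[OF \<phi>]
  have "bounded (D ` cball 0 R)"
    by (intro compact_imp_bounded compact_continuous_image continuous_on_subset[OF contD]) auto
  then obtain B where B0: "B > 0" "\<forall>x\<in>D ` cball 0 R. norm x \<le> B" unfolding bounded_pos by blast
  then have B: "\<And>y. y \<in> cball 0 R \<Longrightarrow> \<bar>D y\<bar> \<le> B" "B > 0" by auto
  have DB: "\<bar>D y\<bar> \<le> B" for y
    using B R(3)[of y e] by (cases "norm y \<le> R") (auto simp: D_def)
  define h where "h = (\<lambda>k. inverse (real (Suc k)))"
  have h: "h k > 0" "h k \<le> 1" for k unfolding h_def by (auto simp: field_simps)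
  have h0: "h \<longlonglongrightarrow> 0" unfolding h_def by (rule LIMSEQ_inverse_real_of_nat)
  define q where "q = (\<lambda>k y. real (Suc k) * (\<phi> (y - h k *\<^sub>R e) - \<phi> y))"
  have line: "((\<lambda>s. \<phi> (y + s *\<^sub>R e)) has_real_derivative D (y + t *\<^sub>R e)) (at t)" for y t
    using has_derivative_line[where x=y and t=t and v=e, OF test_function_differentiable[OF \<phi>]]
    unfolding D_def has_real_derivative_iff_has_vector_derivative .
  have qB: "\<bar>q k y\<bar> \<le> B" for k y
  proof -
    obtain z where "- h k < z" "z < 0"
      "\<phi> (y + 0 *\<^sub>R e) - \<phi> (y + (- h k) *\<^sub>R e) = (0 - - h k) * D (y + z *\<^sub>R e)"
      using MVT2[of "- h k" 0 "\<lambda>s. \<phi> (y + s *\<^sub>R e)" "\<lambda>t. D (y + t *\<^sub>R e)"] h(1)[of k] line by auto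
    then have "\<phi> (y - h k *\<^sub>R e) - \<phi> y = - (h k * D (y + z *\<^sub>R e))" by simp
    then have "q k y = - D (y + z *\<^sub>R e)" unfolding q_def h_def by simp
    then show ?thesis using DB by simp
  qed
  have q_outside: "q k y = 0" if "norm y > R + norm e" for k y
  proof -
    have "norm y - norm (h k *\<^sub>R e) \<le> norm (y - h k *\<^sub>R e)" by (rule norm_triangle_ineq2)
    moreover have "norm (h k *\<^sub>R e) \<le> norm e" using h[of k] by (simp add: mult_left_le_one_le)
    ultimately have "norm (y - h k *\<^sub>R e) > R" using that by linarith
    moreover have "norm y > R" using that norm_ge_zero[of e] by linarith
    ultimately show ?thesis using R(2) unfolding q_def by simp
  qed
  have q_lim: "(\<lambda>k. q k y) \<longlonglongrightarrow> - D y" for y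
  proof -
    have "((\<lambda>s. (\<phi> (y + s *\<^sub>R e) - \<phi> y) / s) \<longlongrightarrow> D y) (at 0)"
      using line[of y 0] unfolding DERIV_def by simp
    moreover have "LIM k sequentially. - h k :> at 0"
      unfolding filterlim_at using tendsto_minus[OF h0] h(1) by (auto simp: less_imp_neq[THEN not_sym])
    ultimately have "(\<lambda>k. (\<phi> (y + (- h k) *\<^sub>R e) - \<phi> y) / (- h k)) \<longlonglongrightarrow> D y" by (rule filterlim_compose)
    moreover have "(\<phi> (y + (- h k) *\<^sub>R e) - \<phi> y) / (- h k) = - q k y" for k
      unfolding q_def h_def by (simp add: divide_inverse mult.commute del: of_nat_Suc)
    ultimately have "(\<lambda>k. - q k y) \<longlonglongrightarrow> D y" by simp
    from tendsto_minus[OF this] show ?thesis by simp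
  qed
  have contq: "continuous_on UNIV (q k)" for k
    unfolding q_def by (intro continuous_intros continuous_on_compose2[OF cont\<phi>]) auto
  have shift: "(LINT y|lborel. (real (Suc k) * (g (y + h k *\<^sub>R e) - g y)) * \<phi> y) = (LINT y|lborel. g y * q k y)" for k
  proof -
    define F where "F = (\<lambda>y. g y * \<phi> (y - h k *\<^sub>R e))"
    have cF: "continuous_on UNIV F" unfolding F_def
      by (intro continuous_intros g continuous_on_compose2[OF cont\<phi>]) auto
    have iF: "integrable lborel F"
    proof (rule integrable_compact_support[OF cF])
      fix y :: "real^'n" assume "norm y > R + norm (h k *\<^sub>R e)"
      then have "norm (y - h k *\<^sub>R e) > R" using norm_triangle_ineq2[of y "h k *\<^sub>R e"] by linarith
      then show "F y = 0" using R(2) unfolding F_def by simp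
    qed
    have cF': "continuous_on UNIV (\<lambda>y. F (y + h k *\<^sub>R e))"
      by (intro continuous_on_compose2[OF cF] continuous_intros) auto
    have iF': "integrable lborel (\<lambda>y. F (y + h k *\<^sub>R e))"
      by (rule integrable_compact_support[OF cF', of R]) (use R(2) in \<open>simp add: F_def\<close>)
    have ig: "integrable lborel (\<lambda>y. g y * \<phi> y)"
      by (rule integrable_compact_support[of _ R]) (use R(2) g cont\<phi> in \<open>auto intro!: continuous_intros\<close>)
    have "(LINT y|lborel. (real (Suc k) * (g (y + h k *\<^sub>R e) - g y)) * \<phi> y) =
      (LINT y|lborel. real (Suc k) * (F (y + h k *\<^sub>R e) - g y * \<phi> y))"
      unfolding F_def by (intro Bochner_Integration.integral_cong) (auto simp: algebra_simps)
    also have "\<dots> = real (Suc k) * ((LINT y|lborel. F (y + h k *\<^sub>R e)) - (LINT y|lborel. g y * \<phi> y))"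
      using iF' ig by simp
    also have "(LINT y|lborel. F (y + h k *\<^sub>R e)) = (LINT y|lborel. F y)"
      using cF by (intro lborel_integral_translate borel_measurable_continuous_onI)
    also have "real (Suc k) * ((LINT y|lborel. F y) - (LINT y|lborel. g y * \<phi> y)) = (LINT y|lborel. real (Suc k) * (F y - g y * \<phi> y))"
      using iF ig by simp
    also have "\<dots> = (LINT y|lborel. g y * q k y)"
      unfolding F_def q_def by (intro Bochner_Integration.integral_cong) (auto simp: algebra_simps)
    finally show ?thesis .
  qed
  have "(\<lambda>k. LINT y|lborel. g y * q k y) \<longlonglongrightarrow> (LINT y|lborel. g y * - D y)"
  proof (rule integral_dominated_convergence)
    have "integrable lborel (\<lambda>y. indicator (cball 0 (R + norm e)) y *\<^sub>R (B * \<bar>g y\<bar>))"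
      using g by (intro borel_integrable_compact compact_cball continuous_intros) (auto intro: continuous_on_subset)
    then show "integrable lborel (\<lambda>y. indicator (cball 0 (R + norm e)) y * (B * \<bar>g y\<bar>))" by simp
    show "AE y in lborel. (\<lambda>k. g y * q k y) \<longlonglongrightarrow> g y * - D y"
      by (intro AE_I2 tendsto_intros q_lim)
    show "AE y in lborel. norm (g y * q k y) \<le> indicator (cball 0 (R + norm e)) y * (B * \<bar>g y\<bar>)" for k
    proof (rule AE_I2)
      fix y show "norm (g y * q k y) \<le> indicator (cball 0 (R + norm e)) y * (B * \<bar>g y\<bar>)"
        using q_outside[of y k] mult_mono[OF qB[of k y] order_refl[of "\<bar>g y\<bar>"]] B(2)
        by (cases "norm y \<le> R + norm e") (auto simp: abs_mult mult.commute)
    qed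
    show "(\<lambda>y. g y * - D y) \<in> borel_measurable lborel"
      using g contD by (simp add: borel_measurable_continuous_onI continuous_intros)
    show "(\<lambda>y. g y * q k y) \<in> borel_measurable lborel" for k
      using g contq by (simp add: borel_measurable_continuous_onI continuous_intros)
  qed
  then show ?thesis unfolding shift[unfolded h_def] D_def by simp
qed

lemma difference_quotient_bound:
  fixes g :: "'a::euclidean_space \<Rightarrow> real"
  assumes g: "K-lipschitz_on UNIV g" and e: "norm e \<le> 1"
  shows "\<bar>real (Suc k) * (g (y + inverse (real (Suc k)) *\<^sub>R e) - g y)\<bar> \<le> K"
proof -
  have K: "K \<ge> 0" using g by (rule lipschitz_on_nonneg)
    have "\<bar>g (y + inverse (real (Suc k)) *\<^sub>R e) - g y\<bar> \<le> K * norm (inverse (real (Suc k)) *\<^sub>R e)"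
      using lipschitz_onD[OF g, of "y + inverse (real (Suc k)) *\<^sub>R e" y] by (simp add: dist_norm)
    also have "\<dots> \<le> K * inverse (real (Suc k))" using e K by (intro mult_left_mono) (simp_all add: mult_left_le)
    finally have "real (Suc k) * \<bar>g (y + inverse (real (Suc k)) *\<^sub>R e) - g y\<bar> \<le> real (Suc k) * (K * inverse (real (Suc k)))"
      by (intro mult_left_mono) auto
    moreover have "real (Suc k) * (K * inverse (real (Suc k))) = K" by (simp del: of_nat_Suc)
    moreover have "\<bar>real (Suc k) * (g (y + inverse (real (Suc k)) *\<^sub>R e) - g y)\<bar> = real (Suc k) * \<bar>g (y + inverse (real (Suc k)) *\<^sub>R e) - g y\<bar>"
      unfolding abs_mult by simp
    ultimately show ?thesis by (simp only:)
qed

lemma lipschitz_weak_partial: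
  fixes g :: "real^'n \<Rightarrow> real"
  assumes g: "K-lipschitz_on UNIV g" and e: "norm e \<le> 1"
  shows "\<exists>w\<in>borel_measurable borel. (\<forall>y. \<bar>w y\<bar> \<le> K) \<and>
    (\<forall>\<phi>. test_function \<phi> \<longrightarrow> (LINT y|lborel. g y * frechet_derivative \<phi> (at y) e) = - (LINT y|lborel. w y * \<phi> y))"
proof -
  note cont = lipschitz_on_continuous_on[OF g]
  have K: "K \<ge> 0" using g by (rule lipschitz_on_nonneg)
  define q where "q = (\<lambda>k y. real (Suc k) * (g (y + inverse (real (Suc k)) *\<^sub>R e) - g y))"
  have qK: "\<bar>q k y\<bar> \<le> K" for k y
    unfolding q_def by (rule difference_quotient_bound[OF g e])
  have "continuous_on UNIV (q k)" for k
    unfolding q_def by (intro continuous_intros cont continuous_on_compose2[OF cont]) auto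
  then have qm: "q k \<in> borel_measurable lborel" for k by (simp add: borel_measurable_continuous_onI)
  have "\<exists>f\<in>borel_measurable lborel. (\<forall>x. \<bar>f x\<bar> \<le> K) \<and>
     (\<forall>\<phi>\<in>Collect test_function. (LINT x|lborel. f x * \<phi> x) = - (LINT y|lborel. g y * frechet_derivative \<phi> (at y) e))"
  proof (rule weak_limit_of_bounded_sequence[OF sigma_finite_lborel qm qK])
    fix \<phi> :: "real^'n \<Rightarrow> real" assume "\<phi> \<in> Collect test_function"
    then have \<phi>: "test_function \<phi>" by simp
    obtain R where R: "R > 0" "\<And>y. norm y > R \<Longrightarrow> \<phi> y = 0" "\<And>y v. norm y > R \<Longrightarrow> frechet_derivative \<phi> (at y) v = 0"
      using test_function_support[OF \<phi>] by blast
    show "integrable lborel \<phi>" by (rule integrable_compact_support[OF test_function_continuous[OF \<phi>] R(2)])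
    show "(\<lambda>n. LINT x|lborel. q n x * \<phi> x) \<longlonglongrightarrow> - (LINT y|lborel. g y * frechet_derivative \<phi> (at y) e)"
      unfolding q_def by (rule difference_quotient_weak[OF cont \<phi>])
  qed
  then show ?thesis by (auto intro!: bexI)
qed

lemma lebesgue_integral_lborel:
  fixes f :: "'a::euclidean_space \<Rightarrow> real"
  shows "f \<in> borel_measurable borel \<Longrightarrow> (LINT y|lebesgue. f y) = (LINT y|lborel. f y)"
  by (rule integral_completion) simp

lemma set_integrable_compact_bounded:
  fixes f :: "'a::euclidean_space \<Rightarrow> 'b::euclidean_space"
  assumes "f \<in> borel_measurable borel" "\<And>y. norm (f y) \<le> C" "compact K"
  shows "set_integrable lborel K f" "set_integrable lebesgue K f"
proof -
  have "integrable lborel (indicator K :: 'a \<Rightarrow> real)"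
    using borel_integrable_compact[OF assms(3), of "\<lambda>_. 1::real"] by simp
  then have "integrable lborel (\<lambda>y. C * indicator K y)" by simp
  then show 1: "set_integrable lborel K f"
    unfolding set_integrable_def
  proof (rule Bochner_Integration.integrable_bound)
    show "(\<lambda>y. indicator K y *\<^sub>R f y) \<in> borel_measurable lborel"
      using assms(1) compact_imp_closed[OF assms(3)] by simp
    show "AE y in lborel. norm (indicator K y *\<^sub>R f y) \<le> norm (C * indicator K y)"
      using assms(2) by (intro AE_I2) (auto simp: indicator_def intro: order_trans[OF _ abs_ge_self])
  qed
  show "set_integrable lebesgue K f"
    using 1 unfolding set_integrable_def
    by (subst integrable_completion) (use assms(1) compact_imp_closed[OF assms(3)] in auto)
qed

lemma locally_integrable_continuous:
  fixes f :: "'a::euclidean_space \<Rightarrow> 'b::euclidean_space"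
  assumes "continuous_on UNIV f" shows "locally_integrable f"
  unfolding locally_integrable_def
proof (intro allI impI)
  fix K :: "'a set" assume K: "compact K"
  have "set_integrable lborel K f"
    unfolding set_integrable_def by (rule borel_integrable_compact[OF K]) (rule continuous_on_subset[OF assms], simp)
  then show "set_integrable lebesgue K f"
    unfolding set_integrable_def
    by (subst integrable_completion) (use borel_measurable_continuous_onI[OF assms] compact_imp_closed[OF K] in auto)
qed

lemma lipschitz_component:
  fixes g :: "'a::metric_space \<Rightarrow> real^'m"
  assumes "K-lipschitz_on UNIV g" shows "K-lipschitz_on UNIV (\<lambda>y. g y $ i)"
proof (rule lipschitz_onI)
  fix x y :: 'a
  show "dist (g x $ i) (g y $ i) \<le> K * dist x y"
    using lipschitz_onD[OF assms, of x y] dist_vec_nth_le[of "g x" i "g y"] by simp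
qed (rule lipschitz_on_nonneg[OF assms])

text \<open>The difference quotients of a Lipschitz function are bounded, and their weak limits are weak partial derivatives.\<close>

theorem lipschitz_weak_jacobian:
  fixes g :: "real^'n \<Rightarrow> real^'m"
  assumes g: "K-lipschitz_on UNIV g"
  shows "\<exists>G. weak_jacobian g G \<and> (\<exists>C. \<forall>y. norm (G y) \<le> C)"
proof -
  have K: "K \<ge> 0" using g by (rule lipschitz_on_nonneg)
  define P where "P = (\<lambda>i j w. w \<in> borel_measurable borel \<and> (\<forall>y. \<bar>w y\<bar> \<le> K) \<and>
    (\<forall>\<phi>. test_function \<phi> \<longrightarrow> (LINT y|lborel. g y $ i * frechet_derivative \<phi> (at y) (axis j 1)) = - (LINT y|lborel. w y * \<phi> y)))"
  have "\<exists>w. P i j w" for i j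
    using lipschitz_weak_partial[OF lipschitz_component[OF g, of i], of "axis j 1"] unfolding P_def Bex_def by simp
  then have "P i j (SOME w. P i j w)" for i j by (rule someI_ex)
  moreover define w where "w = (\<lambda>i j. SOME w. P i j w)"
  ultimately have "P i j (w i j)" for i j by simp
  then have w: "\<And>i j. w i j \<in> borel_measurable borel" "\<And>i j y. \<bar>w i j y\<bar> \<le> K"
    "\<And>i j \<phi>. test_function \<phi> \<Longrightarrow> (LINT y|lborel. g y $ i * frechet_derivative \<phi> (at y) (axis j 1)) = - (LINT y|lborel. w i j y * \<phi> y)"
    unfolding P_def by simp_all
  define G where "G = (\<lambda>y. \<chi> i j. w i j y)"
  have Gm: "G \<in> borel_measurable borel"
  proof (rule borel_measurable_euclidean_space[THEN iffD2], rule ballI)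
    fix b :: "real^'n^'m" assume "b \<in> Basis"
    then obtain i j where "b = axis i (axis j 1)" unfolding Basis_vec_def by auto
    then have "(\<lambda>y. G y \<bullet> b) = w i j" by (auto simp: G_def inner_axis)
    then show "(\<lambda>y. G y \<bullet> b) \<in> borel_measurable borel" using w(1) by simp
  qed
  have GC: "norm (G y) \<le> real CARD('m) * (real CARD('n) * K)" for y
  proof -
    have "norm (G y) \<le> (\<Sum>i\<in>UNIV. norm (G y $ i))" by (simp add: norm_vec_def L2_set_le_sum)
    also have "\<dots> \<le> (\<Sum>i\<in>(UNIV::'m set). real CARD('n) * K)"
    proof (rule sum_mono)
      fix i :: 'm
      have "norm (G y $ i) \<le> (\<Sum>j\<in>UNIV. norm (G y $ i $ j))" by (simp add: norm_vec_def L2_set_le_sum)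
      also have "\<dots> \<le> (\<Sum>j\<in>(UNIV::'n set). K)" using w(2) by (intro sum_mono) (simp add: G_def)
      finally show "norm (G y $ i) \<le> real CARD('n) * K" by simp
    qed
    finally show ?thesis by simp
  qed
  have "weak_jacobian g G"
    unfolding weak_jacobian_def
  proof (intro conjI allI impI)
    show "locally_integrable g" by (rule locally_integrable_continuous[OF lipschitz_on_continuous_on[OF g]])
    show "locally_integrable G" unfolding locally_integrable_def
      using set_integrable_compact_bounded(2)[OF Gm GC] by blast
    fix \<phi> :: "real^'n \<Rightarrow> real" and i j assume \<phi>: "test_function \<phi>"
    have "(\<lambda>y. g y $ i * frechet_derivative \<phi> (at y) (axis j 1)) \<in> borel_measurable borel"
      by (intro borel_measurable_continuous_onI continuous_intros lipschitz_on_continuous_on[OF g] test_function_deriv_continuous[OF \<phi>])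
    moreover have "(\<lambda>y. G y $ i $ j * \<phi> y) \<in> borel_measurable borel"
      unfolding G_def using w(1) borel_measurable_continuous_onI[OF test_function_continuous[OF \<phi>]] by simp
    ultimately show "(LINT y|lebesgue. g y $ i * frechet_derivative \<phi> (at y) (axis j 1)) = - (LINT y|lebesgue. G y $ i $ j * \<phi> y)"
      using w(3)[OF \<phi>] by (simp add: lebesgue_integral_lborel) (simp add: G_def)
  qed
  with GC show ?thesis by blast
qed

lemma difference_quotient_limit:
  fixes f :: "'a::euclidean_space \<Rightarrow> real"
  assumes "(f has_derivative f') (at x)"
  shows "(\<lambda>k. real (Suc k) * (f (x + inverse (real (Suc k)) *\<^sub>R e) - f x)) \<longlonglongrightarrow> f' e"
proof -
  have "((\<lambda>s. f (x + s *\<^sub>R e)) has_vector_derivative f' e) (at 0)"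
    using has_derivative_line[of f f' x 0 e] assms by simp
  then have "((\<lambda>s. (f (x + s *\<^sub>R e) - f x) / s) \<longlongrightarrow> f' e) (at 0)"
    unfolding has_real_derivative_iff_has_vector_derivative[symmetric] DERIV_def by simp
  moreover have "LIM k sequentially. inverse (real (Suc k)) :> at 0"
    unfolding filterlim_at using LIMSEQ_inverse_real_of_nat by (simp del: of_nat_Suc)
  ultimately have "(\<lambda>k. (f (x + inverse (real (Suc k)) *\<^sub>R e) - f x) / inverse (real (Suc k))) \<longlonglongrightarrow> f' e"
    by (rule filterlim_compose)
  then show ?thesis by (simp add: divide_inverse mult.commute del: of_nat_Suc)
qed

text \<open>A Borel representative of a pointwise a.e. limit, truncated to keep the bound everywhere.\<close>

lemma bounded_borel_limit:
  fixes q :: "nat \<Rightarrow> 'a::euclidean_space \<Rightarrow> real"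
  assumes qm: "\<And>k. q k \<in> borel_measurable borel" and qK: "\<And>k y. \<bar>q k y\<bar> \<le> K"
    and qD: "AE y in lborel. (\<lambda>k. q k y) \<longlonglongrightarrow> D y"
  shows "\<exists>d\<in>borel_measurable borel. (\<forall>y. \<bar>d y\<bar> \<le> K) \<and> (AE y in lborel. d y = D y)"
proof -
  have K: "K \<ge> 0" using qK[of 0 0] by linarith
  define d where "d = (\<lambda>y. max (- K) (min K (lim (\<lambda>k. q k y))))"
  have dm: "d \<in> borel_measurable borel"
    unfolding d_def using qm by (intro borel_measurable_max borel_measurable_min borel_measurable_lim_metric) auto
  have dK: "\<bar>d y\<bar> \<le> K" for y unfolding d_def using K by (auto simp: abs_le_iff)
  have dD: "AE y in lborel. d y = D y"
    using qD
  proof eventually_elim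
    case (elim y)
    have "\<bar>D y\<bar> \<le> K"
      by (rule LIMSEQ_le_const2[OF tendsto_rabs[OF elim]]) (use qK in auto)
    then show ?case unfolding d_def limI[OF elim] by auto
  qed
  show ?thesis using dm dK dD by blast
qed

text \<open>Where the classical derivative exists almost everywhere, the difference quotients converge to it boundedly, so dominated
  convergence makes it a weak derivative; the fundamental lemma gives uniqueness.\<close>

theorem weak_jacobian_eq_derivative:
  fixes g :: "real^'n \<Rightarrow> real^'m"
  assumes g: "K-lipschitz_on UNIV g" and G: "weak_jacobian g G"
    and D: "AE y in lborel. (g has_derivative (\<lambda>v. D y *v v)) (at y)"
  shows "AE y in lebesgue. G y = D y"
proof -
  have "AE y in lebesgue. G y $ i $ j = D y $ i $ j" for i j
  proof -
    define e where "e = (axis j 1 :: real^'n)"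
    define gi where "gi = (\<lambda>y. g y $ i)"
    have gi: "K-lipschitz_on UNIV gi" unfolding gi_def by (rule lipschitz_component[OF g])
    note cont = lipschitz_on_continuous_on[OF gi]
    have K: "K \<ge> 0" using g by (rule lipschitz_on_nonneg)
    define q where "q = (\<lambda>k y. real (Suc k) * (gi (y + inverse (real (Suc k)) *\<^sub>R e) - gi y))"
    have qK: "\<bar>q k y\<bar> \<le> K" for k y
      unfolding q_def by (rule difference_quotient_bound[OF gi]) (simp add: e_def)
    have "continuous_on UNIV (q k)" for k
      unfolding q_def by (intro continuous_intros cont continuous_on_compose2[OF cont]) auto
    then have qm: "q k \<in> borel_measurable borel" for k by (simp add: borel_measurable_continuous_onI)
    have qD: "AE y in lborel. (\<lambda>k. q k y) \<longlonglongrightarrow> D y $ i $ j"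
      using D
    proof eventually_elim
      case (elim y)
      then have "(gi has_derivative (\<lambda>v. (D y *v v) $ i)) (at y)"
        unfolding gi_def by (rule bounded_linear.has_derivative[OF bounded_linear_vec_nth])
      from difference_quotient_limit[OF this, of e]
      show ?case unfolding q_def e_def by (simp add: matrix_vector_mul_component inner_axis)
    qed
    obtain d where dm: "d \<in> borel_measurable borel" and dK: "\<And>y. \<bar>d y\<bar> \<le> K"
      and dD: "AE y in lborel. d y = D y $ i $ j"
      using bounded_borel_limit[OF qm qK qD] by blast
    have qd: "AE y in lborel. (\<lambda>k. q k y) \<longlonglongrightarrow> d y"
      using qD dD by eventually_elim simp
    have Gloc: "integrable lebesgue (\<lambda>y. indicator C y * G y $ i $ j)" if "compact C" for C
    proof -
      have "integrable lebesgue (\<lambda>y. indicator C y *\<^sub>R G y)"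
        using G that unfolding weak_jacobian_def locally_integrable_def set_integrable_def by blast
      from integrable_bounded_linear[OF bounded_linear_vec_nth integrable_bounded_linear[OF bounded_linear_vec_nth this, of i], of j]
      show ?thesis by simp
    qed
    have Gm: "(\<lambda>y. G y $ i $ j) \<in> borel_measurable lebesgue"
    proof (rule borel_measurable_LIMSEQ_metric)
      show "(\<lambda>y. indicator (cball 0 (real k)) y * G y $ i $ j) \<in> borel_measurable lebesgue" for k :: nat
        using Gloc[OF compact_cball] by (rule borel_measurable_integrable)
      fix y :: "real^'n"
      obtain n :: nat where n: "norm y \<le> real n" using real_arch_simple by blast
      have "\<forall>\<^sub>F k in sequentially. G y $ i $ j = indicator (cball 0 (real k)) y * G y $ i $ j"
        using eventually_ge_at_top[of n] by eventually_elim (use n in \<open>auto simp: indicator_def\<close>)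
      then show "(\<lambda>k. indicator (cball 0 (real k)) y * G y $ i $ j) \<longlonglongrightarrow> G y $ i $ j"
        by (rule Lim_transform_eventually[OF tendsto_const])
    qed
    then obtain G' where G': "G' \<in> borel_measurable lborel" "AE y in lborel. G y $ i $ j = G' y"
      using completion_ex_borel_measurable_real by blast
    have G'loc: "integrable lborel (\<lambda>y. indicator C y * G' y)" if C: "compact C" for C
    proof -
      have Cm: "C \<in> sets borel" using compact_imp_closed[OF C] by simp
      have m: "(\<lambda>y. indicator C y * G' y) \<in> borel_measurable lborel" using G'(1) Cm by simp
      have "integrable lebesgue (\<lambda>y. indicator C y * G' y)"
      proof (rule integrable_cong_AE_imp[OF Gloc[OF C]])
        show "(\<lambda>y. indicator C y * G' y) \<in> borel_measurable lebesgue" using m by (rule measurable_completion)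
        show "AE y in lebesgue. indicator C y * G y $ i $ j = indicator C y * G' y"
          using AE_completion[OF G'(2)] by eventually_elim simp
      qed
      then show ?thesis using integrable_completion[OF m] by simp
    qed
    have "AE y in lborel. G' y - d y = 0"
    proof (rule AE_zero_of_test_functions)
      show "(\<lambda>y. G' y - d y) \<in> borel_measurable borel" using G' dm by simp
      fix a b :: "real^'n"
      have "set_integrable lborel (cbox a b) G'" using G'loc[OF compact_cbox] unfolding set_integrable_def by simp
      moreover have "set_integrable lborel (cbox a b) d"
        using dK by (intro set_integrable_compact_bounded[OF dm _ compact_cbox]) simp
      ultimately have "set_integrable lborel (cbox a b) (\<lambda>y. G' y - d y)" by (rule set_integral_diff)
      then show "set_integrable lborel (box a b) (\<lambda>y. G' y - d y)"
        by (rule set_integrable_subset) (auto simp: box_subset_cbox)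
    next
      fix \<phi> :: "real^'n \<Rightarrow> real" assume \<phi>: "test_function \<phi>"
      obtain R where R: "R > 0" "\<And>y. norm y > R \<Longrightarrow> \<phi> y = 0" "\<And>y v. norm y > R \<Longrightarrow> frechet_derivative \<phi> (at y) v = 0"
        using test_function_support[OF \<phi>] by blast
      note c\<phi> = test_function_continuous[OF \<phi>]
      have \<phi>m: "\<phi> \<in> borel_measurable borel" by (rule borel_measurable_continuous_onI[OF c\<phi>])
      have \<phi>i: "integrable lborel \<phi>" by (rule integrable_compact_support[OF c\<phi> R(2)])
      have "bounded (\<phi> ` cball 0 R)"
        by (intro compact_imp_bounded compact_continuous_image continuous_on_subset[OF c\<phi>]) auto
      then obtain B where B0: "B > 0" "\<forall>x\<in>\<phi> ` cball 0 R. norm x \<le> B" unfolding bounded_pos by blast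
      have iG: "integrable lborel (\<lambda>y. G' y * \<phi> y)"
      proof (rule Bochner_Integration.integrable_bound)
        show "integrable lborel (\<lambda>y. B * (indicator (cball 0 R) y * G' y))"
          by (intro integrable_mult_right G'loc compact_cball)
        show "(\<lambda>y. G' y * \<phi> y) \<in> borel_measurable lborel" using G'(1) \<phi>m by simp
        show "AE y in lborel. norm (G' y * \<phi> y) \<le> norm (B * (indicator (cball 0 R) y * G' y))"
        proof (rule AE_I2)
          fix y show "norm (G' y * \<phi> y) \<le> norm (B * (indicator (cball 0 R) y * G' y))"
          proof (cases "norm y \<le> R")
            case True
            then have "\<bar>\<phi> y\<bar> \<le> B" using B0 by simp
            then have "\<bar>G' y\<bar> * \<bar>\<phi> y\<bar> \<le> \<bar>G' y\<bar> * B" by (intro mult_left_mono) auto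
            then show ?thesis using True B0(1) by (simp add: abs_mult mult.commute)
          next
            case False
            then show ?thesis using R(2) by simp
          qed
        qed
      qed
      have id: "integrable lborel (\<lambda>y. d y * \<phi> y)"
      proof (rule Bochner_Integration.integrable_bound)
        show "integrable lborel (\<lambda>y. K * \<bar>\<phi> y\<bar>)" using \<phi>i by (intro integrable_mult_right integrable_abs)
        show "AE y in lborel. norm (d y * \<phi> y) \<le> norm (K * \<bar>\<phi> y\<bar>)"
          using dK K by (intro AE_I2) (auto simp: abs_mult intro!: mult_right_mono)
      qed (use dm \<phi>m in simp)
      have "(LINT y|lborel. G' y * \<phi> y) = (LINT y|lebesgue. G' y * \<phi> y)"
        using G'(1) \<phi>m by (intro lebesgue_integral_lborel[symmetric]) simp
      also have "\<dots> = (LINT y|lebesgue. G y $ i $ j * \<phi> y)"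
      proof (rule integral_cong_AE)
        show "AE y in lebesgue. G' y * \<phi> y = G y $ i $ j * \<phi> y"
          using AE_completion[OF G'(2)] by eventually_elim simp
        show "(\<lambda>y. G' y * \<phi> y) \<in> borel_measurable lebesgue"
          using G'(1) \<phi>m by (intro measurable_completion) simp
        show "(\<lambda>y. G y $ i $ j * \<phi> y) \<in> borel_measurable lebesgue"
          using Gm measurable_completion[of \<phi> lborel borel] \<phi>m by (intro borel_measurable_times) simp_all
      qed
      also have "\<dots> = - (LINT y|lebesgue. gi y * frechet_derivative \<phi> (at y) e)"
        using G \<phi> unfolding weak_jacobian_def gi_def e_def by simp
      also have "\<dots> = - (LINT y|lborel. gi y * frechet_derivative \<phi> (at y) e)"
        by (subst lebesgue_integral_lborel)
          (intro borel_measurable_continuous_onI continuous_intros cont test_function_deriv_continuous[OF \<phi>], simp)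
      finally have 1: "(LINT y|lborel. G' y * \<phi> y) = - (LINT y|lborel. gi y * frechet_derivative \<phi> (at y) e)" .
      have "(\<lambda>k. LINT y|lborel. q k y * \<phi> y) \<longlonglongrightarrow> (LINT y|lborel. d y * \<phi> y)"
      proof (rule integral_dominated_convergence)
        show "integrable lborel (\<lambda>y. K * \<bar>\<phi> y\<bar>)" using \<phi>i by (intro integrable_mult_right integrable_abs)
        show "AE y in lborel. (\<lambda>k. q k y * \<phi> y) \<longlonglongrightarrow> d y * \<phi> y"
          using qd by eventually_elim (intro tendsto_intros)
        show "AE y in lborel. norm (q k y * \<phi> y) \<le> K * \<bar>\<phi> y\<bar>" for k
          using qK by (intro AE_I2) (auto simp: abs_mult intro!: mult_right_mono)
      qed (use dm qm \<phi>m in auto)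
      moreover have "(\<lambda>k. LINT y|lborel. q k y * \<phi> y) \<longlonglongrightarrow> - (LINT y|lborel. gi y * frechet_derivative \<phi> (at y) e)"
        unfolding q_def by (rule difference_quotient_weak[OF cont \<phi>])
      ultimately have 2: "(LINT y|lborel. d y * \<phi> y) = - (LINT y|lborel. gi y * frechet_derivative \<phi> (at y) e)"
        by (rule LIMSEQ_unique)
      have "(LINT y|lborel. (G' y - d y) * \<phi> y) = (LINT y|lborel. G' y * \<phi> y - d y * \<phi> y)"
        by (simp add: left_diff_distrib)
      also have "\<dots> = 0" using iG id 1 2 by simp
      finally show "(LINT y|lborel. (G' y - d y) * \<phi> y) = 0" .
    qed
    with G'(2) dD have "AE y in lborel. G y $ i $ j = D y $ i $ j"
      by eventually_elim simp
    then show ?thesis by (rule AE_completion)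
  qed
  then have "AE y in lebesgue. \<forall>i\<in>UNIV. \<forall>j\<in>UNIV. G y $ i $ j = D y $ i $ j"
    by (intro AE_finite_allI) auto
  then show ?thesis by eventually_elim (simp add: vec_eq_iff)
qed

section \<open>Stein's identity\<close>

lemma prod_Basis_vec: "(\<Prod>b\<in>(Basis :: (real^'n) set). F b) = (\<Prod>i\<in>UNIV. F (axis i 1))"
proof -
  have inj: "inj (\<lambda>i::'n. axis i (1::real))" by (rule injI) (simp add: axis_eq_axis)
  have B: "(Basis :: (real^'n) set) = range (\<lambda>i. axis i 1)" by (auto simp: Basis_vec_def)
  show ?thesis unfolding B using prod.reindex[OF inj, of F] by (simp only: comp_def)
qed

text \<open>Fubini for products of functions of the single coordinates.\<close>

lemma integrable_prod_coordinates:
  fixes f :: "'n::finite \<Rightarrow> real \<Rightarrow> real"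
  assumes f: "\<And>i. integrable lborel (f i)" and pos: "\<And>i t. 0 \<le> f i t"
  shows "integrable lborel (\<lambda>y::real^'n. \<Prod>i\<in>UNIV. f i (y $ i))"
    and "(LINT y|lborel. (\<Prod>i\<in>UNIV. f i (y $ i))) = (\<Prod>i\<in>UNIV. LINT t|lborel. f i t)"
proof -
  define F where "F = (\<lambda>b::real^'n. \<lambda>t. ennreal (f (SOME i. b = axis i 1) t))"
  have F: "F (axis i 1) = (\<lambda>t. ennreal (f i t))" for i
  proof -
    have "(SOME j. axis i (1::real) = axis j 1) = i" by (rule some_equality) (auto simp: axis_eq_axis)
    then show ?thesis unfolding F_def by simp
  qed
  have fm: "f i \<in> borel_measurable borel" for i using f[of i] by simp
  have comp: "(\<lambda>y::real^'n. f i (y $ i)) \<in> borel_measurable borel" for i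
    by (rule measurable_compose[OF _ fm]) (intro borel_measurable_continuous_onI continuous_intros)
  have m: "(\<lambda>y::real^'n. \<Prod>i\<in>UNIV. f i (y $ i)) \<in> borel_measurable lborel"
    using comp by (intro borel_measurable_prod) simp
  have "(\<integral>\<^sup>+y. ennreal (\<Prod>i\<in>UNIV. f i (y $ i)) \<partial>lborel) = (\<integral>\<^sup>+y. (\<Prod>b\<in>Basis. F b (y \<bullet> b)) \<partial>lborel)"
    by (simp add: prod_Basis_vec F inner_axis prod_ennreal pos)
  also have "\<dots> = (\<Prod>b\<in>Basis. (\<integral>\<^sup>+t. F b t \<partial>lborel))"
    by (rule nn_integral_lborel_prod) (use fm in \<open>auto simp: F_def\<close>)
  also have "\<dots> = (\<Prod>i\<in>UNIV. (\<integral>\<^sup>+t. ennreal (f i t) \<partial>lborel))"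
    by (simp add: prod_Basis_vec F)
  also have "\<dots> = (\<Prod>i\<in>UNIV. ennreal (LINT t|lborel. f i t))"
    using f pos by (intro prod.cong refl nn_integral_eq_integral) auto
  also have "\<dots> = ennreal (\<Prod>i\<in>UNIV. LINT t|lborel. f i t)"
    using pos by (intro prod_ennreal) (auto intro!: integral_nonneg_AE)
  finally have *: "(\<integral>\<^sup>+y. ennreal (\<Prod>i\<in>UNIV. f i ((y::real^'n) $ i)) \<partial>lborel) = ennreal (\<Prod>i\<in>UNIV. LINT t|lborel. f i t)" .
  have n: "0 \<le> (\<Prod>i\<in>UNIV. f i ((y::real^'n) $ i))" for y by (intro prod_nonneg) (simp add: pos)
  show 1: "integrable lborel (\<lambda>y::real^'n. \<Prod>i\<in>UNIV. f i (y $ i))"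
    using m * n by (intro integrableI_nonneg) auto
  have "ennreal (LINT y|lborel. (\<Prod>i\<in>UNIV. f i ((y::real^'n) $ i))) = ennreal (\<Prod>i\<in>UNIV. LINT t|lborel. f i t)"
    using nn_integral_eq_integral[OF 1] n * by simp
  then show "(LINT y|lborel. (\<Prod>i\<in>UNIV. f i ((y::real^'n) $ i))) = (\<Prod>i\<in>UNIV. LINT t|lborel. f i t)"
    by (subst (asm) ennreal_inj) (auto intro!: integral_nonneg_AE prod_nonneg simp: pos n)
qed

text \<open>The normal density with values in the reals, for use in Bochner integrals.\<close>

definition gauss :: "real^'n \<Rightarrow> real \<Rightarrow> real^'n \<Rightarrow> real" where
  "gauss m \<sigma> y = (\<Prod>i\<in>UNIV. normal_density (m $ i) \<sigma> (y $ i))"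

lemma gauss_nonneg: "0 \<le> gauss m \<sigma> y"
  unfolding gauss_def by (intro prod_nonneg) simp

lemma gauss_measurable [measurable]: fixes m :: "real^'n" shows "gauss m \<sigma> \<in> borel_measurable borel"
proof -
  have "(\<lambda>y::real^'n. normal_density (m $ i) \<sigma> (y $ i)) \<in> borel_measurable borel" for i
    by (rule measurable_compose[OF _ borel_measurable_normal_density]) (intro borel_measurable_continuous_onI continuous_intros)
  then show ?thesis unfolding gauss_def[abs_def] by (intro borel_measurable_prod) simp
qed

lemma integrable_normal_abs_power:
  assumes "\<sigma> > 0" shows "integrable lborel (\<lambda>t. (1 + \<bar>t - \<mu>\<bar>) ^ k * normal_density \<mu> \<sigma> t)"
proof -
  have "(1 + \<bar>t - \<mu>\<bar>) ^ k * normal_density \<mu> \<sigma> t = (\<Sum>i\<le>k. real (k choose i) * (normal_density \<mu> \<sigma> t * \<bar>t - \<mu>\<bar> ^ (k - i)))" for t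
    unfolding binomial_ring by (simp add: sum_distrib_left sum_distrib_right ac_simps)
  then show ?thesis using integrable_normal_moment_abs[OF assms] by (simp only:) (intro Bochner_Integration.integrable_sum integrable_mult_right)
qed

text \<open>Shifts by at most 1 are dominated by a normal density of twice the variance; this gives the majorant for
  the difference quotients of the density.\<close>

lemma normal_density_shift_bound:
  assumes "\<sigma> > 0" "0 \<le> s" "s \<le> 1"
  shows "normal_density \<mu> \<sigma> (t - s) \<le> (sqrt 2 * exp (1 / (2 * \<sigma>\<^sup>2))) * normal_density \<mu> (sqrt 2 * \<sigma>) t"
proof -
  have "(t - \<mu>)\<^sup>2 / 2 - 1 \<le> (t - s - \<mu>)\<^sup>2"
  proof -
    have "(t - s - \<mu>)\<^sup>2 - ((t - \<mu>)\<^sup>2 / 2 - s\<^sup>2) = (t - \<mu> - 2 * s)\<^sup>2 / 2"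
      by (simp add: power2_eq_square field_simps)
    moreover have "s\<^sup>2 \<le> 1" using assms by (simp add: power_le_one)
    moreover have "0 \<le> (t - \<mu> - 2 * s)\<^sup>2 / 2" by simp
    ultimately show ?thesis by linarith
  qed
  then have "- (t - s - \<mu>)\<^sup>2 / (2 * \<sigma>\<^sup>2) \<le> (1 - (t - \<mu>)\<^sup>2 / 2) / (2 * \<sigma>\<^sup>2)"
    using assms by (intro divide_right_mono) auto
  also have "\<dots> = 1 / (2 * \<sigma>\<^sup>2) + - (t - \<mu>)\<^sup>2 / (2 * (sqrt 2 * \<sigma>)\<^sup>2)"
    using assms by (simp add: power_mult_distrib field_simps)
  finally have e: "exp (- (t - s - \<mu>)\<^sup>2 / (2 * \<sigma>\<^sup>2)) \<le> exp (1 / (2 * \<sigma>\<^sup>2)) * exp (- (t - \<mu>)\<^sup>2 / (2 * (sqrt 2 * \<sigma>)\<^sup>2))"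
    by (simp add: exp_add[symmetric])
  have "sqrt 2 * (1 / sqrt (2 * pi * (sqrt 2 * \<sigma>)\<^sup>2)) = 1 / sqrt (2 * pi * \<sigma>\<^sup>2)"
    using assms by (simp add: power_mult_distrib real_sqrt_mult field_simps)
  then have "(sqrt 2 * exp (1 / (2 * \<sigma>\<^sup>2))) * normal_density \<mu> (sqrt 2 * \<sigma>) t =
    1 / sqrt (2 * pi * \<sigma>\<^sup>2) * (exp (1 / (2 * \<sigma>\<^sup>2)) * exp (- (t - \<mu>)\<^sup>2 / (2 * (sqrt 2 * \<sigma>)\<^sup>2)))"
  proof -
    assume c: "sqrt 2 * (1 / sqrt (2 * pi * (sqrt 2 * \<sigma>)\<^sup>2)) = 1 / sqrt (2 * pi * \<sigma>\<^sup>2)"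
    have "(sqrt 2 * E) * (a * X) = (sqrt 2 * a) * (E * X)" for E a X :: real by (simp only: mult_ac)
    from this[of _ "1 / sqrt (2 * pi * (sqrt 2 * \<sigma>)\<^sup>2)", unfolded c]
    show ?thesis unfolding normal_density_def .
  qed
  moreover have "normal_density \<mu> \<sigma> (t - s) \<le> 1 / sqrt (2 * pi * \<sigma>\<^sup>2) * (exp (1 / (2 * \<sigma>\<^sup>2)) * exp (- (t - \<mu>)\<^sup>2 / (2 * (sqrt 2 * \<sigma>)\<^sup>2)))"
    unfolding normal_density_def using e by (intro mult_left_mono) auto
  ultimately show ?thesis by simp
qed

lemma DERIV_normal_density:
  assumes "\<sigma> > 0"
  shows "(normal_density \<mu> \<sigma> has_real_derivative - (t - \<mu>) / \<sigma>\<^sup>2 * normal_density \<mu> \<sigma> t) (at t)"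
proof -
  define c where "c = 1 / sqrt (2 * pi * \<sigma>\<^sup>2)"
  have "((\<lambda>t. - (t - \<mu>)\<^sup>2 / (2 * \<sigma>\<^sup>2)) has_real_derivative - (t - \<mu>) / \<sigma>\<^sup>2) (at t)"
    using assms by (auto intro!: derivative_eq_intros simp: power2_eq_square field_simps)
  from DERIV_cmult[OF DERIV_fun_exp[OF this], of c] show ?thesis
    unfolding normal_density_def[abs_def] c_def[symmetric] by (simp only: mult_ac)
qed

text \<open>A majorant of product form, so that its Gaussian integral factors over the coordinates.\<close>

lemma lipschitz_growth:
  fixes g :: "real^'n \<Rightarrow> real"
  assumes g: "K-lipschitz_on UNIV g"
  shows "\<bar>g y\<bar> \<le> (\<bar>g m\<bar> + K) * (\<Prod>j\<in>UNIV. 1 + \<bar>y $ j - m $ j\<bar>)"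
proof -
  have K: "K \<ge> 0" using g by (rule lipschitz_on_nonneg)
  have "\<bar>g y - g m\<bar> \<le> K * norm (y - m)" using lipschitz_onD[OF g, of y m] by (simp add: dist_norm)
  moreover have "norm (y - m) \<le> (\<Sum>j\<in>UNIV. \<bar>y $ j - m $ j\<bar>)" using norm_le_l1_cart[of "y - m"] by simp
  moreover have "1 + (\<Sum>j\<in>UNIV. \<bar>y $ j - m $ j\<bar>) \<le> (\<Prod>j\<in>UNIV. 1 + \<bar>y $ j - m $ j\<bar>)"
  proof -
    have "1 + (\<Sum>j\<in>I. \<bar>y $ j - m $ j\<bar>) \<le> (\<Prod>j\<in>I. 1 + \<bar>y $ j - m $ j\<bar>)" if "finite I" for I
      using that
    proof (induction I)
      case (insert j I)
      let ?s = "\<Sum>j\<in>I. \<bar>y $ j - m $ j\<bar>" and ?a = "\<bar>y $ j - m $ j\<bar>"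
      have "1 + (?a + ?s) \<le> (1 + ?a) * (1 + ?s)" by (simp add: algebra_simps sum_nonneg)
      also have "\<dots> \<le> (1 + ?a) * (\<Prod>j\<in>I. 1 + \<bar>y $ j - m $ j\<bar>)" using insert by (intro mult_left_mono) auto
      finally show ?case using insert by simp
    qed simp
    then show ?thesis by simp
  qed
  ultimately have 1: "\<bar>g y\<bar> \<le> \<bar>g m\<bar> + K * norm (y - m)" and 2: "1 + norm (y - m) \<le> (\<Prod>j\<in>UNIV. 1 + \<bar>y $ j - m $ j\<bar>)"
    by linarith+
  have "\<bar>g m\<bar> * 1 + K * norm (y - m) \<le> \<bar>g m\<bar> * (1 + norm (y - m)) + K * (1 + norm (y - m))"
    using K by (intro add_mono mult_left_mono) auto
  also have "\<dots> = (\<bar>g m\<bar> + K) * (1 + norm (y - m))" by (simp add: distrib_right)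
  also have "\<dots> \<le> (\<bar>g m\<bar> + K) * (\<Prod>j\<in>UNIV. 1 + \<bar>y $ j - m $ j\<bar>)" using 2 K by (intro mult_left_mono) auto
  finally show ?thesis using 1 by linarith
qed

lemma gauss_split:
  "gauss m \<sigma> y = normal_density (m $ i) \<sigma> (y $ i) * (\<Prod>j\<in>UNIV - {i}. normal_density (m $ j) \<sigma> (y $ j))"
  unfolding gauss_def by (simp add: prod.remove[of UNIV i])

lemma gauss_shift:
  "gauss m \<sigma> (y - s *\<^sub>R axis i 1) = normal_density (m $ i) \<sigma> (y $ i - s) * (\<Prod>j\<in>UNIV - {i}. normal_density (m $ j) \<sigma> (y $ j))"
  unfolding gauss_split[of _ _ _ i] by (auto intro!: arg_cong2[where f="(*)"] prod.cong simp: axis_def)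

text \<open>Stein's identity by difference quotients: translation invariance moves the quotient from \<open>g\<close> to the density, whose
  logarithmic derivative is \<open>- (y $ i - m $ i) / \<sigma>\<^sup>2\<close>. Both sides converge by dominated convergence.\<close>

theorem stein_component:
  fixes g :: "real^'n \<Rightarrow> real"
  assumes \<sigma>: "\<sigma> > 0" and g: "K-lipschitz_on UNIV g"
    and d: "d \<in> borel_measurable borel" "\<And>y. \<bar>d y\<bar> \<le> K"
    and lim: "AE y in lborel. (\<lambda>k. real (Suc k) * (g (y + inverse (real (Suc k)) *\<^sub>R axis i 1) - g y)) \<longlonglongrightarrow> d y"
  shows "integrable lborel (\<lambda>y. gauss m \<sigma> y * ((y $ i - m $ i) * g y))"
    and "integrable lborel (\<lambda>y. gauss m \<sigma> y * d y)"
    and "(LINT y|lborel. gauss m \<sigma> y * ((y $ i - m $ i) * g y)) = \<sigma>\<^sup>2 * (LINT y|lborel. gauss m \<sigma> y * d y)"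
proof -
  have K: "K \<ge> 0" using g by (rule lipschitz_on_nonneg)
  define e where "e = (axis i 1 :: real^'n)"
  define h where "h = (\<lambda>k. inverse (real (Suc k)))"
  have h: "h k > 0" "h k \<le> 1" for k unfolding h_def by (auto simp: field_simps)
  have h0: "h \<longlonglongrightarrow> 0" unfolding h_def by (rule LIMSEQ_inverse_real_of_nat)
  note cont = lipschitz_on_continuous_on[OF g]
  have gm: "g \<in> borel_measurable borel" by (rule borel_measurable_continuous_onI[OF cont])
  define n where "n = normal_density (m $ i) \<sigma>"
  define R where "R = (\<lambda>y::real^'n. \<Prod>j\<in>UNIV - {i}. normal_density (m $ j) \<sigma> (y $ j))"
  have R0: "0 \<le> R y" for y unfolding R_def by (intro prod_nonneg) simp
  have \<rho>: "gauss m \<sigma> y = n (y $ i) * R y" for y unfolding n_def R_def by (rule gauss_split)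
  have \<rho>s: "gauss m \<sigma> (y - s *\<^sub>R e) = n (y $ i - s) * R y" for y s unfolding n_def R_def e_def by (rule gauss_shift)
  define C where "C = sqrt 2 * exp (1 / (2 * \<sigma>\<^sup>2))"
  have C: "C > 0" unfolding C_def by simp
  define N where "N = normal_density (m $ i) (sqrt 2 * \<sigma>)"
  have N0: "0 \<le> N t" for t unfolding N_def by simp
  have nN: "n (t - s) \<le> C * N t" if "0 \<le> s" "s \<le> 1" for t s
    unfolding n_def N_def C_def by (rule normal_density_shift_bound[OF \<sigma> that])
  have n0: "0 \<le> n t" for t unfolding n_def by simp
  have dn: "(n has_real_derivative - (t - m $ i) / \<sigma>\<^sup>2 * n t) (at t)" for t
    unfolding n_def by (rule DERIV_normal_density[OF \<sigma>])
  define \<psi> where "\<psi> = (\<lambda>t. (1 + \<bar>t - m $ i\<bar>) / \<sigma>\<^sup>2 * (C * N t))"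
  have dq: "\<bar>real (Suc k) * (n (t - h k) - n t)\<bar> \<le> \<psi> t" for k t
  proof -
    obtain z where z: "t - h k < z" "z < t" "n t - n (t - h k) = (t - (t - h k)) * (- (z - m $ i) / \<sigma>\<^sup>2 * n z)"
      using MVT2[of "t - h k" t n "\<lambda>t. - (t - m $ i) / \<sigma>\<^sup>2 * n t"] h(1)[of k] dn by auto
    define c where "c = (z - m $ i) / \<sigma>\<^sup>2 * n z"
    have "- (z - m $ i) / \<sigma>\<^sup>2 * n z = - c" unfolding c_def by (simp only: minus_divide_left[symmetric] mult_minus_left)
    then have "n (t - h k) - n t = h k * c" using z(3) by simp
    then have "real (Suc k) * (n (t - h k) - n t) = real (Suc k) * h k * ((z - m $ i) / \<sigma>\<^sup>2 * n z)"
      unfolding c_def by (simp only: mult.assoc)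
    also have "real (Suc k) * h k = 1" unfolding h_def by simp
    finally have "\<bar>real (Suc k) * (n (t - h k) - n t)\<bar> = \<bar>z - m $ i\<bar> / \<sigma>\<^sup>2 * n z"
      using n0[of z] by (simp add: abs_mult)
    also have "\<dots> \<le> (1 + \<bar>t - m $ i\<bar>) / \<sigma>\<^sup>2 * (C * N t)"
    proof (rule mult_mono)
      show "\<bar>z - m $ i\<bar> / \<sigma>\<^sup>2 \<le> (1 + \<bar>t - m $ i\<bar>) / \<sigma>\<^sup>2" using z h(2)[of k] by (intro divide_right_mono) auto
      have "n z \<le> C * N t" using nN[of "t - z" t] z h(2)[of k] by simp
      then show "n z \<le> C * N t" .
    qed (use n0 in auto)
    finally show ?thesis unfolding \<psi>_def .
  qed
  have \<rho>m: "gauss m \<sigma> \<in> borel_measurable borel" by (rule gauss_measurable)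
  define W where "W = (\<lambda>y. (\<bar>g m\<bar> + K) * (\<Prod>j\<in>UNIV. 1 + \<bar>y $ j - m $ j\<bar>))"
  have gW: "\<bar>g y\<bar> \<le> W y" for y unfolding W_def by (rule lipschitz_growth[OF g])
  have major: "integrable lborel (\<lambda>y. Q (y $ i) * R y * W y)"
    if Q: "integrable lborel (\<lambda>t. (1 + \<bar>t - m $ i\<bar>) * Q t)" and Q0: "\<And>t. 0 \<le> Q t" for Q
  proof -
    define f where "f = (\<lambda>j t. if j = i then (1 + \<bar>t - m $ i\<bar>) * Q t else (1 + \<bar>t - m $ j\<bar>) ^ 1 * normal_density (m $ j) \<sigma> t)"
    have "integrable lborel (\<lambda>y::real^'n. \<Prod>j\<in>UNIV. f j (y $ j))"
    proof (rule integrable_prod_coordinates)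
      show "integrable lborel (f j)" for j
        using Q integrable_normal_abs_power[OF \<sigma>, of "m $ j" 1] unfolding f_def by (cases "j = i") simp_all
      show "0 \<le> f j t" for j t using Q0 unfolding f_def by (cases "j = i") simp_all
    qed
    then have int: "integrable lborel (\<lambda>y::real^'n. (\<bar>g m\<bar> + K) * (\<Prod>j\<in>UNIV. f j (y $ j)))" by (rule integrable_mult_right)
    have "(\<bar>g m\<bar> + K) * (\<Prod>j\<in>UNIV. f j (y $ j)) = Q (y $ i) * R y * W y" for y :: "real^'n"
    proof -
      have "(\<Prod>j\<in>UNIV. f j (y $ j)) = f i (y $ i) * (\<Prod>j\<in>UNIV - {i}. f j (y $ j))"
        by (rule prod.remove) auto
      also have "(\<Prod>j\<in>UNIV - {i}. f j (y $ j)) = (\<Prod>j\<in>UNIV - {i}. (1 + \<bar>y $ j - m $ j\<bar>) * normal_density (m $ j) \<sigma> (y $ j))"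
        by (rule prod.cong) (auto simp: f_def)
      also have "\<dots> = (\<Prod>j\<in>UNIV - {i}. 1 + \<bar>y $ j - m $ j\<bar>) * R y"
        unfolding R_def by (rule prod.distrib)
      finally have 1: "(\<Prod>j\<in>UNIV. f j (y $ j)) = ((1 + \<bar>y $ i - m $ i\<bar>) * Q (y $ i)) * ((\<Prod>j\<in>UNIV - {i}. 1 + \<bar>y $ j - m $ j\<bar>) * R y)"
        by (simp add: f_def)
      have 2: "(\<Prod>j\<in>UNIV. 1 + \<bar>y $ j - m $ j\<bar>) = (1 + \<bar>y $ i - m $ i\<bar>) * (\<Prod>j\<in>UNIV - {i}. 1 + \<bar>y $ j - m $ j\<bar>)"
        by (rule prod.remove) auto
      show ?thesis unfolding W_def 1 2 by (simp only: mult_ac)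
    qed
    with int show ?thesis by simp
  qed
  have bounded_by: "\<bar>a * R y * g y\<bar> \<le> b * R y * W y" if "\<bar>a\<bar> \<le> b" for a b y
    unfolding abs_mult using that gW[of y] R0[of y] by (intro mult_mono) auto
  have Rm: "R \<in> borel_measurable borel"
  proof -
    have "(\<lambda>y::real^'n. normal_density (m $ j) \<sigma> (y $ j)) \<in> borel_measurable borel" for j
      by (rule measurable_compose[OF _ borel_measurable_normal_density]) (intro borel_measurable_continuous_onI continuous_intros)
    then show ?thesis unfolding R_def[abs_def] by (intro borel_measurable_prod) simp
  qed
  have nm: "(\<lambda>y::real^'n. n (y $ i - s)) \<in> borel_measurable borel" for s
    unfolding n_def by (rule measurable_compose[OF _ borel_measurable_normal_density]) (intro borel_measurable_continuous_onI continuous_intros)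
  define u where "u = (\<lambda>k y. real (Suc k) * (n (y $ i - h k) - n (y $ i)) * R y * g y)"
  have um: "u k \<in> borel_measurable lborel" for k
    unfolding u_def using nm[of "h k"] nm[of 0] Rm gm by (simp del: of_nat_Suc)
  have \<psi>int: "integrable lborel (\<lambda>y. \<psi> (y $ i) * R y * W y)"
  proof (rule major)
    have "integrable lborel (\<lambda>t. C / \<sigma>\<^sup>2 * ((1 + \<bar>t - m $ i\<bar>) ^ 2 * N t))"
      unfolding N_def using \<sigma> by (intro integrable_mult_right integrable_normal_abs_power) simp
    moreover have "C / \<sigma>\<^sup>2 * ((1 + \<bar>t - m $ i\<bar>) ^ 2 * N t) = (1 + \<bar>t - m $ i\<bar>) * \<psi> t" for t
      unfolding \<psi>_def by (simp add: power2_eq_square)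
    ultimately show "integrable lborel (\<lambda>t. (1 + \<bar>t - m $ i\<bar>) * \<psi> t)" by simp
    show "0 \<le> \<psi> t" for t unfolding \<psi>_def using C N0[of t] by simp
  qed
  have u_bound: "norm (u k y) \<le> \<psi> (y $ i) * R y * W y" for k y
    unfolding u_def real_norm_def by (rule bounded_by[OF dq])
  have uint: "integrable lborel (u k)" for k
    by (rule Bochner_Integration.integrable_bound[OF \<psi>int um]) (use u_bound in \<open>auto intro!: AE_I2 intro: order_trans[OF _ abs_ge_self]\<close>)
  have nint: "integrable lborel (\<lambda>y. n (y $ i) * R y * W y)"
    using integrable_normal_abs_power[OF \<sigma>, of "m $ i" 1] n0 by (intro major) (simp_all add: n_def)
  have gint: "integrable lborel (\<lambda>y. gauss m \<sigma> y * g y)"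
  proof (rule Bochner_Integration.integrable_bound[OF nint])
    show "(\<lambda>y. gauss m \<sigma> y * g y) \<in> borel_measurable lborel" using \<rho>m gm by simp
    show "AE y in lborel. norm (gauss m \<sigma> y * g y) \<le> norm (n (y $ i) * R y * W y)"
      unfolding \<rho> real_norm_def
      by (intro AE_I2 order_trans[OF bounded_by abs_ge_self]) (use n0 in simp)
  qed
  define q where "q = (\<lambda>k y. real (Suc k) * (g (y + h k *\<^sub>R e) - g y))"
  have qK: "\<bar>q k y\<bar> \<le> K" for k y
    unfolding q_def h_def by (rule difference_quotient_bound[OF g]) (simp add: e_def)
  have "continuous_on UNIV (q k)" for k
    unfolding q_def by (intro continuous_intros cont continuous_on_compose2[OF cont]) auto
  then have qm: "q k \<in> borel_measurable borel" for k by (rule borel_measurable_continuous_onI)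
  have \<rho>int: "integrable lborel (gauss m \<sigma>)"
    unfolding gauss_def[abs_def] using \<sigma> by (intro integrable_prod_coordinates) auto
  have bint: "integrable lborel (\<lambda>y. gauss m \<sigma> y * b y)" if "b \<in> borel_measurable borel" "\<And>y. \<bar>b y\<bar> \<le> K" for b
  proof (rule Bochner_Integration.integrable_bound)
    show "integrable lborel (\<lambda>y. K * gauss m \<sigma> y)" using \<rho>int by (rule integrable_mult_right)
    show "(\<lambda>y. gauss m \<sigma> y * b y) \<in> borel_measurable lborel" using \<rho>m that by simp
    show "AE y in lborel. norm (gauss m \<sigma> y * b y) \<le> norm (K * gauss m \<sigma> y)"
      using that(2) K gauss_nonneg[of m \<sigma>] by (intro AE_I2) (simp add: abs_mult mult.commute[of K] mult_left_mono)
  qed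
  show dint: "integrable lborel (\<lambda>y. gauss m \<sigma> y * d y)" by (rule bint[OF d])
  \<comment> \<open>the difference quotient moves from \<open>g\<close> to the density\<close>
  have shift: "(LINT y|lborel. gauss m \<sigma> y * q k y) = (LINT y|lborel. u k y)" for k
  proof -
    define F where "F = (\<lambda>y. gauss m \<sigma> (y - h k *\<^sub>R e) * g y)"
    have Suc_h: "real (Suc k) * h k = 1" unfolding h_def by simp
    have Fu: "F y = gauss m \<sigma> y * g y + h k * u k y" for y
    proof -
      have a: "h k * u k y = (real (Suc k) * h k) * ((n (y $ i - h k) - n (y $ i)) * R y * g y)" unfolding u_def by (simp only: mult_ac)
      have b: "F y = n (y $ i - h k) * R y * g y" unfolding F_def \<rho>s ..
      have c: "gauss m \<sigma> y * g y = n (y $ i) * R y * g y" unfolding \<rho> ..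
      show ?thesis unfolding a b c Suc_h by (simp add: algebra_simps)
    qed
    have Fint: "(LINT y|lborel. F y) = (LINT y|lborel. gauss m \<sigma> y * g y) + h k * (LINT y|lborel. u k y)"
      unfolding Fu using gint uint[of k] by simp
    have Fm: "F \<in> borel_measurable borel"
      unfolding Fu[abs_def] using \<rho>m gm um by simp
    have "(LINT y|lborel. F (y + h k *\<^sub>R e)) = (LINT y|lborel. F y)" by (rule lborel_integral_translate[OF Fm])
    moreover have "F (y + h k *\<^sub>R e) = gauss m \<sigma> y * g y + h k * (gauss m \<sigma> y * q k y)" for y
    proof -
      have "h k * (gauss m \<sigma> y * q k y) = (real (Suc k) * h k) * (gauss m \<sigma> y * (g (y + h k *\<^sub>R e) - g y))"
        unfolding q_def by (simp only: mult_ac)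
      then show ?thesis unfolding F_def Suc_h by (simp add: algebra_simps)
    qed
    ultimately have "(LINT y|lborel. gauss m \<sigma> y * g y + h k * (gauss m \<sigma> y * q k y)) = (LINT y|lborel. gauss m \<sigma> y * g y) + h k * (LINT y|lborel. u k y)"
      unfolding Fint by simp
    moreover have "(LINT y|lborel. gauss m \<sigma> y * g y + h k * (gauss m \<sigma> y * q k y)) = (LINT y|lborel. gauss m \<sigma> y * g y) + h k * (LINT y|lborel. gauss m \<sigma> y * q k y)"
      using gint bint[OF qm qK, of k] by simp
    ultimately show ?thesis using h(1)[of k] by simp
  qed
  have ulim: "(\<lambda>k. u k y) \<longlonglongrightarrow> gauss m \<sigma> y * ((y $ i - m $ i) * g y) / \<sigma>\<^sup>2" for y
  proof -
    have "(\<lambda>k. real (Suc k) * (n (y $ i + inverse (real (Suc k)) *\<^sub>R (-1)) - n (y $ i))) \<longlonglongrightarrow> (- (y $ i - m $ i) / \<sigma>\<^sup>2 * n (y $ i)) * (-1)"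
      using dn[of "y $ i"] unfolding has_field_derivative_def by (rule difference_quotient_limit)
    moreover have "(- (y $ i - m $ i) / \<sigma>\<^sup>2 * n (y $ i)) * (-1) = (y $ i - m $ i) / \<sigma>\<^sup>2 * n (y $ i)"
      by (simp only: minus_divide_left[symmetric] mult_minus_left mult_minus_right mult_1_right minus_minus)
    moreover have "y $ i + inverse (real (Suc k)) *\<^sub>R (-1) = y $ i - h k" for k unfolding h_def by simp
    ultimately have "(\<lambda>k. real (Suc k) * (n (y $ i - h k) - n (y $ i))) \<longlonglongrightarrow> (y $ i - m $ i) / \<sigma>\<^sup>2 * n (y $ i)"
      by (simp only:)
    then have "(\<lambda>k. u k y) \<longlonglongrightarrow> (y $ i - m $ i) / \<sigma>\<^sup>2 * n (y $ i) * R y * g y"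
      unfolding u_def by (rule tendsto_mult[OF tendsto_mult[OF _ tendsto_const] tendsto_const])
    then show ?thesis unfolding \<rho> by (simp add: mult_ac)
  qed
  have lm: "(\<lambda>y. gauss m \<sigma> y * ((y $ i - m $ i) * g y) / \<sigma>\<^sup>2) \<in> borel_measurable lborel"
    using \<rho>m gm by (intro borel_measurable_divide borel_measurable_times borel_measurable_diff) (auto intro!: borel_measurable_continuous_onI continuous_intros)
  have AEb: "AE y in lborel. norm (u k y) \<le> \<psi> (y $ i) * R y * W y" for k by (rule AE_I2) (rule u_bound)
  have AEl: "AE y in lborel. (\<lambda>k. u k y) \<longlonglongrightarrow> gauss m \<sigma> y * ((y $ i - m $ i) * g y) / \<sigma>\<^sup>2"
    by (rule AE_I2) (rule ulim)
  have Lint: "integrable lborel (\<lambda>y. gauss m \<sigma> y * ((y $ i - m $ i) * g y) / \<sigma>\<^sup>2)"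
    by (rule integrable_dominated_convergence[OF lm um \<psi>int AEl AEb])
  have L1: "(\<lambda>k. LINT y|lborel. u k y) \<longlonglongrightarrow> (LINT y|lborel. gauss m \<sigma> y * ((y $ i - m $ i) * g y) / \<sigma>\<^sup>2)"
    by (rule integral_dominated_convergence[OF lm um \<psi>int AEl AEb])
  have "integrable lborel (\<lambda>y. \<sigma>\<^sup>2 * (gauss m \<sigma> y * ((y $ i - m $ i) * g y) / \<sigma>\<^sup>2))" using Lint by (rule integrable_mult_right)
  then show "integrable lborel (\<lambda>y. gauss m \<sigma> y * ((y $ i - m $ i) * g y))" using \<sigma> by simp
  have L2: "(\<lambda>k. LINT y|lborel. gauss m \<sigma> y * q k y) \<longlonglongrightarrow> (LINT y|lborel. gauss m \<sigma> y * d y)"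
  proof (rule integral_dominated_convergence)
    show "integrable lborel (\<lambda>y. K * gauss m \<sigma> y)" using \<rho>int by (rule integrable_mult_right)
    show "(\<lambda>y. gauss m \<sigma> y * d y) \<in> borel_measurable lborel" using \<rho>m d by simp
    show "(\<lambda>y. gauss m \<sigma> y * q k y) \<in> borel_measurable lborel" for k using \<rho>m qm by simp
    show "AE y in lborel. (\<lambda>k. gauss m \<sigma> y * q k y) \<longlonglongrightarrow> gauss m \<sigma> y * d y"
      using lim unfolding q_def h_def e_def by eventually_elim (intro tendsto_intros)
    show "AE y in lborel. norm (gauss m \<sigma> y * q k y) \<le> K * gauss m \<sigma> y" for k
      using qK gauss_nonneg[of m \<sigma>] by (intro AE_I2) (simp add: abs_mult mult.commute[of K] mult_left_mono)
  qed
  have "(LINT y|lborel. gauss m \<sigma> y * d y) = (LINT y|lborel. gauss m \<sigma> y * ((y $ i - m $ i) * g y) / \<sigma>\<^sup>2)"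
    using LIMSEQ_unique[OF L2[unfolded shift] L1] .
  then show "(LINT y|lborel. gauss m \<sigma> y * ((y $ i - m $ i) * g y)) = \<sigma>\<^sup>2 * (LINT y|lborel. gauss m \<sigma> y * d y)"
    using \<sigma> by simp
qed

section \<open>Unbiased risk estimation\<close>

text \<open>The second moment is Stein's identity for a coordinate function.\<close>

lemma integrable_gauss_sq:
  fixes m :: "real^'n"
  assumes \<sigma>: "\<sigma> > 0"
  shows "integrable lborel (gauss m \<sigma>)" and "(LINT y|lborel. gauss m \<sigma> y) = 1"
    and "integrable lborel (\<lambda>y. gauss m \<sigma> y * (y $ i - m $ i)\<^sup>2)"
    and "(LINT y|lborel. gauss m \<sigma> y * (y $ i - m $ i)\<^sup>2) = \<sigma>\<^sup>2"
proof -
  show 1: "integrable lborel (gauss m \<sigma>)"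
    unfolding gauss_def[abs_def] using \<sigma> by (intro integrable_prod_coordinates(1)) auto
  have "(LINT y|lborel. (\<Prod>i\<in>UNIV. normal_density (m $ i) \<sigma> (y $ i))) = (\<Prod>i\<in>UNIV. LINT t|lborel. normal_density (m $ i) \<sigma> t)"
    using \<sigma> by (intro integrable_prod_coordinates(2)) auto
  then show 2: "(LINT y|lborel. gauss m \<sigma> y) = 1" unfolding gauss_def using \<sigma> by simp
  have lip: "1-lipschitz_on UNIV (\<lambda>y::real^'n. y $ i - m $ i)"
  proof (rule lipschitz_onI)
    fix x y :: "real^'n"
    show "dist (x $ i - m $ i) (y $ i - m $ i) \<le> 1 * dist x y"
      using component_le_norm_cart[of "x - y" i] by (simp add: dist_norm)
  qed simp
  have q: "AE y in lborel. (\<lambda>k. real (Suc k) * (((y + inverse (real (Suc k)) *\<^sub>R axis i 1) $ i - m $ i) - ((y::real^'n) $ i - m $ i))) \<longlonglongrightarrow> (1::real)"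
    by (simp del: of_nat_Suc)
  note S = stein_component[OF \<sigma> lip borel_measurable_const _ q]
  show "integrable lborel (\<lambda>y. gauss m \<sigma> y * (y $ i - m $ i)\<^sup>2)" using S(1) by (simp add: power2_eq_square)
  show "(LINT y|lborel. gauss m \<sigma> y * (y $ i - m $ i)\<^sup>2) = \<sigma>\<^sup>2" using S(3) 2 by (simp add: power2_eq_square)
qed

lemma norm_sq_sum: "(norm v)\<^sup>2 = (\<Sum>i\<in>UNIV. (v $ i)\<^sup>2)" for v :: "real^'n"
  unfolding norm_vec_def L2_set_def by (simp add: sum_nonneg)

text \<open>Expand \<open>|y - g|\<^sup>2 = |(y - m) - (g - m)|\<^sup>2\<close> and apply Stein's identity to the mixed term, coordinate by coordinate. The Borel
  function \<open>T\<close> stands in for the divergence, since the given derivative is only known almost everywhere and need not be measurable.\<close>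

theorem stein_risk_identity:
  fixes g :: "real^'n \<Rightarrow> real^'n" and m :: "real^'n"
  assumes \<sigma>: "\<sigma> > 0" and g: "K-lipschitz_on UNIV g"
    and D: "AE y in lborel. (g has_derivative (\<lambda>v. D y *v v)) (at y)"
  shows "\<exists>T. T \<in> borel_measurable borel \<and> (AE y in lborel. trace (D y) = T y) \<and>
     integrable lborel (\<lambda>y. gauss m \<sigma> y * T y) \<and>
     integrable lborel (\<lambda>y. gauss m \<sigma> y * (norm (g y - m))\<^sup>2) \<and>
     integrable lborel (\<lambda>y. gauss m \<sigma> y * ((norm (y - g y))\<^sup>2 + 2 * \<sigma>\<^sup>2 * T y - real CARD('n) * \<sigma>\<^sup>2)) \<and>
     (LINT y|lborel. gauss m \<sigma> y * ((norm (y - g y))\<^sup>2 + 2 * \<sigma>\<^sup>2 * T y - real CARD('n) * \<sigma>\<^sup>2))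
       = (LINT y|lborel. gauss m \<sigma> y * (norm (g y - m))\<^sup>2)"
proof -
  define c where "c i y = g y $ i - m $ i" for i y
  define q where "q i k y = real (Suc k) * (c i (y + inverse (real (Suc k)) *\<^sub>R axis i 1) - c i y)" for i k y
  have cl: "K-lipschitz_on UNIV (c i)" for i
  proof (rule lipschitz_onI)
    show "dist (c i x) (c i y) \<le> K * dist x y" for x y
      using lipschitz_onD[OF lipschitz_component[OF g, of i], of x y] unfolding c_def by (simp add: dist_norm)
  qed (rule lipschitz_on_nonneg[OF g])
  note cc = lipschitz_on_continuous_on[OF cl]
  have cm: "c i \<in> borel_measurable borel" for i by (rule borel_measurable_continuous_onI[OF cc])
  have qm: "q i k \<in> borel_measurable borel" for i k
  proof (rule borel_measurable_continuous_onI)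
    show "continuous_on UNIV (q i k)"
      unfolding q_def by (intro continuous_intros cc continuous_on_compose2[OF cc]) auto
  qed
  have qK: "\<bar>q i k y\<bar> \<le> K" for i k y unfolding q_def by (rule difference_quotient_bound[OF cl]) simp
  have qD: "AE y in lborel. (\<lambda>k. q i k y) \<longlonglongrightarrow> D y $ i $ i" for i
    using D
  proof eventually_elim
    case (elim y)
    have "((\<lambda>y. g y $ i) has_derivative (\<lambda>v. (D y *v v) $ i)) (at y)"
      by (rule bounded_linear.has_derivative[OF bounded_linear_vec_nth elim])
    then have "(c i has_derivative (\<lambda>v. (D y *v v) $ i)) (at y)"
      unfolding c_def[abs_def] using has_derivative_diff[OF _ has_derivative_const[of "m $ i"]] by fastforce
    from difference_quotient_limit[OF this, of "axis i 1"]
    show ?case unfolding q_def by (simp add: matrix_vector_mult_basis column_def)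
  qed
  have "\<exists>d\<in>borel_measurable borel. (\<forall>y. \<bar>d y\<bar> \<le> K) \<and> (AE y in lborel. d y = D y $ i $ i)" for i
    by (rule bounded_borel_limit[OF qm qK qD])
  then have "\<forall>i. \<exists>d. d \<in> borel_measurable borel \<and> (\<forall>y. \<bar>d y\<bar> \<le> K) \<and> (AE y in lborel. d y = D y $ i $ i)" by blast
  then have "\<exists>d. \<forall>i. d i \<in> borel_measurable borel \<and> (\<forall>y. \<bar>d i y\<bar> \<le> K) \<and> (AE y in lborel. d i y = D y $ i $ i)"
    by (rule choice)
  then obtain d where "\<forall>i. d i \<in> borel_measurable borel \<and> (\<forall>y. \<bar>d i y\<bar> \<le> K) \<and> (AE y in lborel. d i y = D y $ i $ i)" ..
  then have d: "\<And>i. d i \<in> borel_measurable borel" "\<And>i y. \<bar>d i y\<bar> \<le> K" "\<And>i. AE y in lborel. d i y = D y $ i $ i" by blast+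
  have lim: "AE y in lborel. (\<lambda>k. real (Suc k) * (c i (y + inverse (real (Suc k)) *\<^sub>R axis i 1) - c i y)) \<longlonglongrightarrow> d i y" for i
    using qD[of i] d(3)[of i] unfolding q_def by eventually_elim simp
  note S = stein_component[OF \<sigma> cl d(1) d(2) lim]
  define p where "p = gauss m \<sigma>"
  have p0: "0 \<le> p y" for y unfolding p_def by (rule gauss_nonneg)
  have pm: "p \<in> borel_measurable borel" unfolding p_def by (rule gauss_measurable)
  define T where "T y = (\<Sum>i\<in>UNIV. d i y)" for y
  have Tm: "T \<in> borel_measurable borel" unfolding T_def[abs_def] by (intro borel_measurable_sum d(1))
  have AET: "AE y in lborel. trace (D y) = T y"
  proof -
    have "AE y in lborel. \<forall>i\<in>UNIV. d i y = D y $ i $ i" by (rule AE_finite_allI) (simp_all add: d(3))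
    then show ?thesis by eventually_elim (simp add: trace_def T_def)
  qed
  have dint: "integrable lborel (\<lambda>y. p y * d i y)" for i unfolding p_def by (rule S(2))
  have Tint: "integrable lborel (\<lambda>y. p y * T y)"
    unfolding T_def sum_distrib_left by (intro Bochner_Integration.integrable_sum dint)
  note sq = integrable_gauss_sq[OF \<sigma>, of m, folded p_def]
  define x where "x i y = y $ i - m $ i" for i and y :: "real^'n"
  have sqx: "integrable lborel (\<lambda>y. p y * (x i y)\<^sup>2)" "(LINT y|lborel. p y * (x i y)\<^sup>2) = \<sigma>\<^sup>2" for i
    unfolding x_def by (rule sq)+
  have xc: "integrable lborel (\<lambda>y. p y * (x i y * c i y))" "(LINT y|lborel. p y * (x i y * c i y)) = \<sigma>\<^sup>2 * (LINT y|lborel. p y * d i y)" for i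
    unfolding x_def p_def by (rule S(1), rule S(3))
  have ccint: "integrable lborel (\<lambda>y. p y * (c i y)\<^sup>2)" for i
  proof (rule Bochner_Integration.integrable_bound)
    show "integrable lborel (\<lambda>y. p y * (2 * (c i m)\<^sup>2) + (\<Sum>j\<in>UNIV. (2 * K\<^sup>2) * (p y * (x j y)\<^sup>2)))"
      by (intro Bochner_Integration.integrable_add Bochner_Integration.integrable_sum integrable_mult_right integrable_mult_left sq(1) sqx(1))
    show "(\<lambda>y. p y * (c i y)\<^sup>2) \<in> borel_measurable lborel" using pm cm[of i] by simp
    show "AE y in lborel. norm (p y * (c i y)\<^sup>2) \<le> norm (p y * (2 * (c i m)\<^sup>2) + (\<Sum>j\<in>UNIV. (2 * K\<^sup>2) * (p y * (x j y)\<^sup>2)))"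
    proof (rule AE_I2)
      fix y :: "real^'n"
      \<comment> \<open>square integrability from the linear growth of \<open>c i\<close>\<close>
      have "\<bar>c i y - c i m\<bar> \<le> K * norm (y - m)" using lipschitz_onD[OF cl, of y m i] by (simp add: dist_norm)
      then have "(c i y - c i m)\<^sup>2 \<le> (K * norm (y - m))\<^sup>2" by (metis abs_ge_zero power2_abs power_mono)
      moreover have "(c i y)\<^sup>2 \<le> 2 * (c i m)\<^sup>2 + 2 * (c i y - c i m)\<^sup>2"
        using zero_le_power2[of "c i y - 2 * c i m"] by (simp add: power2_eq_square algebra_simps)
      ultimately have "(c i y)\<^sup>2 \<le> 2 * (c i m)\<^sup>2 + 2 * K\<^sup>2 * (\<Sum>j\<in>UNIV. (x j y)\<^sup>2)"
        unfolding power_mult_distrib norm_sq_sum x_def by simp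
      then have "p y * (c i y)\<^sup>2 \<le> p y * (2 * (c i m)\<^sup>2 + 2 * K\<^sup>2 * (\<Sum>j\<in>UNIV. (x j y)\<^sup>2))" using p0 by (rule mult_left_mono)
      also have "\<dots> = p y * (2 * (c i m)\<^sup>2) + (\<Sum>j\<in>UNIV. (2 * K\<^sup>2) * (p y * (x j y)\<^sup>2))"
        by (simp add: distrib_left sum_distrib_left mult_ac)
      finally show "norm (p y * (c i y)\<^sup>2) \<le> norm (p y * (2 * (c i m)\<^sup>2) + (\<Sum>j\<in>UNIV. (2 * K\<^sup>2) * (p y * (x j y)\<^sup>2)))"
        using p0[of y] by (simp add: abs_mult)
    qed
  qed
  have risk: "p y * (norm (g y - m))\<^sup>2 = (\<Sum>i\<in>UNIV. p y * (c i y)\<^sup>2)" for y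
    unfolding norm_sq_sum c_def by (simp add: sum_distrib_left)
  have riskint: "integrable lborel (\<lambda>y. p y * (norm (g y - m))\<^sup>2)"
    unfolding risk by (intro Bochner_Integration.integrable_sum ccint)
  define s where "s i y = p y * (x i y)\<^sup>2 - 2 * (p y * (x i y * c i y)) + p y * (c i y)\<^sup>2 + 2 * \<sigma>\<^sup>2 * (p y * d i y) - \<sigma>\<^sup>2 * p y" for i y
  have sure: "p y * ((norm (y - g y))\<^sup>2 + 2 * \<sigma>\<^sup>2 * T y - real CARD('n) * \<sigma>\<^sup>2) = (\<Sum>i\<in>UNIV. s i y)" for y
  proof -
    have 1: "y - g y = (\<chi> i. x i y - c i y)" by (simp add: vec_eq_iff x_def c_def)
    have "(norm (y - g y))\<^sup>2 + 2 * \<sigma>\<^sup>2 * T y - real CARD('n) * \<sigma>\<^sup>2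
        = (\<Sum>i\<in>UNIV. (x i y - c i y)\<^sup>2 + 2 * \<sigma>\<^sup>2 * d i y - \<sigma>\<^sup>2)"
      unfolding 1 norm_sq_sum T_def by (simp add: sum.distrib sum_subtractf sum_distrib_left)
    then show ?thesis unfolding s_def by (simp add: sum_distrib_left power2_eq_square algebra_simps)
  qed
  have sint: "integrable lborel (s i)" for i
    unfolding s_def[abs_def]
    by (intro Bochner_Integration.integrable_diff Bochner_Integration.integrable_add integrable_mult_right sq(1) sqx(1) xc(1) ccint dint)
  have "(LINT y|lborel. s i y) = (LINT y|lborel. p y * (c i y)\<^sup>2)" for i
    unfolding s_def using sq(1,2) sqx[of i] xc[of i] ccint[of i] dint[of i] by simp
  then have "(LINT y|lborel. (\<Sum>i\<in>UNIV. s i y)) = (LINT y|lborel. (\<Sum>i\<in>UNIV. p y * (c i y)\<^sup>2))"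
    by (simp add: Bochner_Integration.integral_sum sint ccint)
  moreover have "integrable lborel (\<lambda>y. \<Sum>i\<in>UNIV. s i y)" by (intro Bochner_Integration.integrable_sum sint)
  ultimately show ?thesis
    using Tm AET Tint riskint unfolding p_def[symmetric] sure[symmetric] risk[symmetric] by blast
qed

text \<open>An estimator that agrees Lebesgue-a.e. with a Borel function of the data has the same expectation, as the law of the data is
  absolutely continuous. Completing the probability space makes such an estimator measurable.\<close>

lemma gaussian_expectation:
  fixes Y :: "'w \<Rightarrow> real^'n"
  assumes Y: "distributed P lborel Y (gaussian_density m \<sigma>)"
    and f: "f \<in> borel_measurable borel" "integrable lborel (\<lambda>y. gauss m \<sigma> y * f y)"
    and Z: "AE y in lborel. Z y = f y"
  shows "integrable (completion P) (\<lambda>\<omega>. Z (Y \<omega>))"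
    and "(LINT \<omega>|completion P. Z (Y \<omega>)) = (LINT y|lborel. gauss m \<sigma> y * f y)"
proof -
  have dens: "gaussian_density m \<sigma> = (\<lambda>y. ennreal (gauss m \<sigma> y))"
    unfolding gaussian_density_def gauss_def by (rule ext) (rule refl)
  note Y' = Y[unfolded dens]
  have Ym: "Y \<in> measurable P lborel" by (rule distributed_measurable[OF Y])
  have fY: "(\<lambda>\<omega>. f (Y \<omega>)) \<in> borel_measurable P" by (rule measurable_compose[OF Ym]) (use f(1) in simp)
  have fm: "f \<in> borel_measurable lborel" using f(1) by simp
  have int: "integrable P (\<lambda>\<omega>. f (Y \<omega>))"
    using distributed_integrable[OF Y' fm gauss_nonneg] f(2) by blast
  have eq: "(LINT \<omega>|P. f (Y \<omega>)) = (LINT y|lborel. gauss m \<sigma> y * f y)"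
    using distributed_integral[OF Y' fm gauss_nonneg] by simp
  have "AE y in distr P lborel Y. Z y = f y"
    unfolding distributed_distr_eq_density[OF Y]
    by (subst AE_density[OF distributed_borel_measurable[OF Y]]) (use Z in eventually_elim, simp)
  then have "AE \<omega> in P. Z (Y \<omega>) = f (Y \<omega>)" by (rule AE_distrD[OF Ym])
  then have ae: "AE \<omega> in completion P. Z (Y \<omega>) = f (Y \<omega>)" by (rule AE_completion)
  have fc: "(\<lambda>\<omega>. f (Y \<omega>)) \<in> borel_measurable (completion P)" by (rule measurable_completion[OF fY])
  have Zc: "(\<lambda>\<omega>. Z (Y \<omega>)) \<in> borel_measurable (completion P)"
  proof (rule measurableI)
    fix S :: "real set" assume S: "S \<in> sets borel"
    show "(\<lambda>\<omega>. Z (Y \<omega>)) -` S \<inter> space (completion P) \<in> sets (completion P)"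
    proof (rule completion.in_sets_AE)
      show "(\<lambda>\<omega>. f (Y \<omega>)) -` S \<inter> space (completion P) \<in> sets (completion P)" by (rule measurable_sets[OF fc S])
      show "AE \<omega> in completion P. (\<omega> \<in> (\<lambda>\<omega>. f (Y \<omega>)) -` S \<inter> space (completion P)) = (\<omega> \<in> (\<lambda>\<omega>. Z (Y \<omega>)) -` S \<inter> space (completion P))"
        using ae by eventually_elim simp
    qed simp
  qed simp
  have "integrable (completion P) (\<lambda>\<omega>. f (Y \<omega>))" using int integrable_completion[OF fY] by blast
  then show "integrable (completion P) (\<lambda>\<omega>. Z (Y \<omega>))" using integrable_cong_AE[OF Zc fc ae] by blast
  show "(LINT \<omega>|completion P. Z (Y \<omega>)) = (LINT y|lborel. gauss m \<sigma> y * f y)"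
    using integral_cong_AE[OF Zc fc ae] integral_completion[OF fY] eq by simp
qed

lemma Ck1_has_derivative:
  fixes h :: "real^'n \<Rightarrow> real^'m"
  assumes "Ck_on 1 UNIV h" shows "(h has_derivative (\<lambda>v. jacobian h x *v v)) (at x)"
proof -
  have "h differentiable (at x)" using assms unfolding One_nat_def by simp
  then have 1: "(h has_derivative frechet_derivative h (at x)) (at x)" unfolding frechet_derivative_works .
  then show ?thesis unfolding jacobian_def by (simp add: matrix_works_real[OF has_derivative_linear[OF 1]])
qed

section \<open>The degrees of freedom and the risk of the estimator\<close>

theorem theorem3:
  fixes X :: "real^'p^'n"
    and \<beta>0 :: "real^'p"
    and \<sigma> :: real
    and h :: "real^'n \<Rightarrow> real^'n"
    and F0 :: "real^'n \<Rightarrow> real^'n \<Rightarrow> real"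
    and J :: "real^'p \<Rightarrow> ereal"
    and Mf :: "real^'p \<Rightarrow> (real^'p) set"
    and bhat :: "real^'n \<Rightarrow> real^'p"
    and muhat :: "real^'n \<Rightarrow> real^'n"
    and \<mu>0 :: "real^'n"
    and P :: "'w measure"
    and Y :: "'w \<Rightarrow> real^'n"
  assumes mu0: "\<mu>0 = X *v \<beta>0"
    and sigma: "\<sigma> > 0"
    and h_smooth: "Ck_on 1 UNIV h"
    and h_lipschitz: "\<exists>K. K-lipschitz_on UNIV h"
    and P: "prob_space P"
    and Y: "distributed P lborel Y (gaussian_density (h \<mu>0) \<sigma>)"
    and J_proper: "proper_ext J"
    and J_lsc: "lsc_ext J"
    and J_convex: "convex_ext J"
    and J_partly_smooth: "\<And>\<beta>. subdiff J \<beta> \<noteq> {} \<Longrightarrow> partly_smooth J \<beta> (Mf \<beta>)"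
    and finite_manifolds: "finite (manifolds J Mf)"
    and F0_convex: "\<And>y. convex_on UNIV (\<lambda>m. F0 m y)"
    and bhat: "\<And>y. bhat y \<in> solutions X F0 J y"
    and muhat: "\<And>y. muhat y = X *v bhat y"
  shows
    "(cond_O X F0 J Mf \<longrightarrow> transition_space X F0 J Mf \<in> null_sets lebesgue)
     \<and>
     (cond_sconv F0 \<and> cond_L F0 \<longrightarrow>
        (\<exists>K. K-lipschitz_on UNIV (h \<circ> muhat)) \<and>
        (\<exists>G. weak_jacobian (h \<circ> muhat) G \<and> (\<exists>C. AE y in lebesgue. norm (G y) \<le> C)))
     \<and>
     (cond_O X F0 J Mf \<and> cond_sconv F0 \<and> cond_F X F0 \<and> cond_L F0 \<and>
      non_injectivity_set X F0 J Mf \<in> null_sets lebesgue \<longrightarrow>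
        (\<forall>bstar.
           (\<forall>y. y \<notin> transition_space X F0 J Mf \<union> non_injectivity_set X F0 J Mf \<longrightarrow>
                bstar y \<in> solutions X F0 J y \<and> cond_C X F0 J Mf (bstar y) y) \<longrightarrow>
           (let df_hat = (\<lambda>y. trace (jacobian h (muhat y) **
                                      Delta X F0 J Mf (muhat y) (bstar y) y));
                SURE = (\<lambda>y. (norm (y - h (muhat y)))\<^sup>2 + 2 * \<sigma>\<^sup>2 * df_hat y
                             - real CARD('n) * \<sigma>\<^sup>2)
            in (\<forall>G. weak_jacobian (h \<circ> muhat) G \<longrightarrow>
                  integrable (completion P) (\<lambda>\<omega>. trace (G (Y \<omega>))) \<and>
                  unbiased_estimate P (\<lambda>\<omega>. df_hat (Y \<omega>))
                    (LINT \<omega>|completion P. trace (G (Y \<omega>))))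
               \<and>
               integrable (completion P) (\<lambda>\<omega>. (norm (h (muhat (Y \<omega>)) - h \<mu>0))\<^sup>2) \<and>
               unbiased_estimate P (\<lambda>\<omega>. SURE (Y \<omega>))
                 (LINT \<omega>|completion P. (norm (h (muhat (Y \<omega>)) - h \<mu>0))\<^sup>2))))"
proof -
  obtain Kh where Kh: "Kh-lipschitz_on UNIV h" using h_lipschitz ..
  have crit: "- grad (\<lambda>b. loss X F0 b y) b \<in> subdiff J b" if "cond_L F0" "b \<in> solutions X F0 J y" for b y
  proof -
    have gd: "GDERIV (\<lambda>b. loss X F0 b y) b :> transpose X *v grad (\<lambda>m. F0 m y) (X *v b)"
      by (rule gderiv_loss, rule gderiv_differentiable) (use that(1) in \<open>simp add: cond_L_def\<close>)
    show ?thesis using solution_subgradient[OF J_proper J_convex gd] that(2) unfolding solutions_def grad_eq[OF gd] by simp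
  qed
  have part1: "transition_space X F0 J Mf \<in> null_sets lebesgue" if "cond_O X F0 J Mf"
    by (rule null_sets_completionI[OF transition_space_null[OF that J_proper finite_manifolds]])
  have part2a: "\<exists>K. K-lipschitz_on UNIV (h \<circ> muhat)" if A: "cond_sconv F0 \<and> cond_L F0"
  proof -
    obtain \<tau> where \<tau>: "\<tau> > 0" "\<And>y. strongly_convex \<tau> (\<lambda>m. F0 m y)" using A unfolding cond_sconv_def by blast
    have fd: "(\<lambda>m. F0 m y) differentiable (at \<mu>)" and gd: "(\<lambda>y'. grad (\<lambda>m. F0 m y') \<mu>) differentiable (at y)" for \<mu> y
      using A unfolding cond_L_def by blast+
    obtain L where L: "L > 0" "\<And>\<mu> y. onorm ((*v) (D_grad F0 \<mu> y)) \<le> L" using A unfolding cond_L_def by blast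
    have c: "- grad (\<lambda>b. loss X F0 b y) (bhat y) \<in> subdiff J (bhat y)" for y using crit[OF _ bhat] A by blast
    have "(L / \<tau>)-lipschitz_on UNIV muhat"
    proof (rule lipschitz_onI)
      show "dist (muhat y1) (muhat y2) \<le> L / \<tau> * dist y1 y2" for y1 y2
        unfolding muhat dist_norm
        by (rule critical_image_lipschitz[OF J_proper \<tau> fd grad_lipschitz_in_data[OF gd L(2)] c c])
    qed (use \<tau>(1) L(1) in simp)
    from lipschitz_on_compose[OF this lipschitz_on_subset[OF Kh subset_UNIV]] show ?thesis by blast
  qed
  have part2b: "\<exists>G. weak_jacobian (h \<circ> muhat) G \<and> (\<exists>C. AE y in lebesgue. norm (G y) \<le> C)" if A: "cond_sconv F0 \<and> cond_L F0"
  proof -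
    obtain K where "K-lipschitz_on UNIV (h \<circ> muhat)" using part2a[OF A] ..
    from lipschitz_weak_jacobian[OF this] obtain G C where "weak_jacobian (h \<circ> muhat) G" "\<And>y. norm (G y) \<le> C" by blast
    then show ?thesis by (intro exI[of _ G] conjI exI[of _ C] AE_I2)
  qed
  have main: "weak_jacobian (h \<circ> muhat) G \<Longrightarrow> integrable (completion P) (\<lambda>\<omega>. trace (G (Y \<omega>)))"
    "integrable (completion P) (\<lambda>\<omega>. trace (jacobian h (muhat (Y \<omega>)) ** Delta X F0 J Mf (muhat (Y \<omega>)) (bstar (Y \<omega>)) (Y \<omega>)))"
    "weak_jacobian (h \<circ> muhat) G \<Longrightarrow>
      (LINT \<omega>|completion P. trace (jacobian h (muhat (Y \<omega>)) ** Delta X F0 J Mf (muhat (Y \<omega>)) (bstar (Y \<omega>)) (Y \<omega>)))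
       = (LINT \<omega>|completion P. trace (G (Y \<omega>)))"
    "integrable (completion P) (\<lambda>\<omega>. (norm (h (muhat (Y \<omega>)) - h \<mu>0))\<^sup>2)"
    "integrable (completion P) (\<lambda>\<omega>. (norm (Y \<omega> - h (muhat (Y \<omega>))))\<^sup>2
       + 2 * \<sigma>\<^sup>2 * trace (jacobian h (muhat (Y \<omega>)) ** Delta X F0 J Mf (muhat (Y \<omega>)) (bstar (Y \<omega>)) (Y \<omega>))
       - real CARD('n) * \<sigma>\<^sup>2)"
    "(LINT \<omega>|completion P. (norm (Y \<omega> - h (muhat (Y \<omega>))))\<^sup>2
       + 2 * \<sigma>\<^sup>2 * trace (jacobian h (muhat (Y \<omega>)) ** Delta X F0 J Mf (muhat (Y \<omega>)) (bstar (Y \<omega>)) (Y \<omega>))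
       - real CARD('n) * \<sigma>\<^sup>2) = (LINT \<omega>|completion P. (norm (h (muhat (Y \<omega>)) - h \<mu>0))\<^sup>2)"
    if A: "cond_O X F0 J Mf \<and> cond_sconv F0 \<and> cond_F X F0 \<and> cond_L F0 \<and> non_injectivity_set X F0 J Mf \<in> null_sets lebesgue"
      and bstar: "\<forall>y. y \<notin> transition_space X F0 J Mf \<union> non_injectivity_set X F0 J Mf \<longrightarrow>
                bstar y \<in> solutions X F0 J y \<and> cond_C X F0 J Mf (bstar y) y" for bstar G
  proof -
    obtain \<O> where O: "o_minimal \<O>" "definable_loss \<O> (loss X F0)" "definable_ext \<O> J"
      "\<And>M. M \<in> manifolds J Mf \<Longrightarrow> definable_set \<O> (tilde_manifold J Mf M)"
      using A unfolding cond_O_def by blast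
    obtain \<tau> where \<tau>: "\<tau> > 0" "\<And>y. strongly_convex \<tau> (\<lambda>m. F0 m y)" using A unfolding cond_sconv_def by blast
    have cL: "cond_L F0" using A by blast
    obtain L where L: "\<And>\<mu> y. onorm ((*v) (D_grad F0 \<mu> y)) \<le> L" using cL unfolding cond_L_def by blast
    interpret tame_problem \<O> X F0 J Mf bhat \<tau> L
    proof (unfold_locales)
      show "(\<lambda>m. F0 m y) differentiable (at \<mu>)" and "(\<lambda>y'. grad (\<lambda>m. F0 m y') \<mu>) differentiable (at y)" for \<mu> y
        using cL unfolding cond_L_def by blast+
      show "Ck_on 2 UNIV (\<lambda>\<beta>. loss X F0 \<beta> y)" for y using A unfolding cond_F_def by blast
      show "- grad (\<lambda>b. loss X F0 b y) (bhat y) \<in> subdiff J (bhat y)" for y by (rule crit[OF cL bhat])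
    qed (fact O \<tau> L J_partly_smooth finite_manifolds J_proper)+
    define \<Delta> where "\<Delta> y = Delta X F0 J Mf (muhat y) (bstar y) y" for y
    define D where "D y = jacobian h (muhat y) ** \<Delta> y" for y
    define g where "g = (\<lambda>y. h (muhat y))"
    have g: "h \<circ> muhat = g" unfolding g_def comp_def ..
    obtain K where K: "K-lipschitz_on UNIV g" using part2a A unfolding g by blast
    have "AE y in lebesgue. y \<notin> transition_space X F0 J Mf" by (rule AE_not_in[OF part1]) (use A in blast)
    then have nH: "AE y in lborel. y \<notin> transition_space X F0 J Mf" unfolding AE_completion_iff .
    have "AE y in lebesgue. y \<notin> non_injectivity_set X F0 J Mf" by (rule AE_not_in) (use A in blast)
    then have nG: "AE y in lborel. y \<notin> non_injectivity_set X F0 J Mf" unfolding AE_completion_iff .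
    have mu: "muhat = (\<lambda>y. X *v bhat y)" by (rule ext) (rule muhat)
    have AED: "AE y in lborel. (g has_derivative (\<lambda>v. D y *v v)) (at y)"
      using image_derivative_AE nH nG
    proof eventually_elim
      case (elim y)
      then have b: "bstar y \<in> solutions X F0 J y" "cond_C X F0 J Mf (bstar y) y" using bstar by blast+
      note c = crit[OF cL b(1)]
      have "X *v bstar y = muhat y" unfolding muhat by (rule critical_image[OF c])
      then have "(muhat has_derivative (\<lambda>v. \<Delta> y *v v)) (at y)"
        using elim(1) c b(2) unfolding \<Delta>_def mu[symmetric] by metis
      from has_derivative_compose[OF this Ck1_has_derivative[OF h_smooth]]
      show ?case unfolding g_def D_def by (simp only: matrix_vector_mul_assoc)
    qed
    obtain T where T: "T \<in> borel_measurable borel" "AE y in lborel. trace (D y) = T y"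
      "integrable lborel (\<lambda>y. gauss (h \<mu>0) \<sigma> y * T y)"
      "integrable lborel (\<lambda>y. gauss (h \<mu>0) \<sigma> y * (norm (g y - h \<mu>0))\<^sup>2)"
      "integrable lborel (\<lambda>y. gauss (h \<mu>0) \<sigma> y * ((norm (y - g y))\<^sup>2 + 2 * \<sigma>\<^sup>2 * T y - real CARD('n) * \<sigma>\<^sup>2))"
      "(LINT y|lborel. gauss (h \<mu>0) \<sigma> y * ((norm (y - g y))\<^sup>2 + 2 * \<sigma>\<^sup>2 * T y - real CARD('n) * \<sigma>\<^sup>2))
       = (LINT y|lborel. gauss (h \<mu>0) \<sigma> y * (norm (g y - h \<mu>0))\<^sup>2)"
      using stein_risk_identity[OF sigma K AED, of "h \<mu>0"] by (elim exE conjE)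
    have gc: "continuous_on UNIV g" by (rule lipschitz_on_continuous_on[OF K])
    have rm: "(\<lambda>y. (norm (g y - h \<mu>0))\<^sup>2) \<in> borel_measurable borel"
      and nm: "(\<lambda>y. (norm (y - g y))\<^sup>2) \<in> borel_measurable borel"
      by (intro borel_measurable_continuous_onI continuous_intros gc)+
    have sm: "(\<lambda>y. (norm (y - g y))\<^sup>2 + 2 * \<sigma>\<^sup>2 * T y - real CARD('n) * \<sigma>\<^sup>2) \<in> borel_measurable borel"
      using nm T(1) by (intro borel_measurable_diff borel_measurable_add borel_measurable_times borel_measurable_const)
    note df = gaussian_expectation[OF Y T(1) T(3) T(2)]
    note risk = gaussian_expectation[OF Y rm T(4) AE_I2[OF refl]]
    have "AE y in lborel. (norm (y - g y))\<^sup>2 + 2 * \<sigma>\<^sup>2 * trace (D y) - real CARD('n) * \<sigma>\<^sup>2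
        = (norm (y - g y))\<^sup>2 + 2 * \<sigma>\<^sup>2 * T y - real CARD('n) * \<sigma>\<^sup>2"
      using T(2) by eventually_elim simp
    note sure = gaussian_expectation[OF Y sm T(5) this]
    have div: "integrable (completion P) (\<lambda>\<omega>. trace (G (Y \<omega>)))"
      "(LINT \<omega>|completion P. trace (G (Y \<omega>))) = (LINT y|lborel. gauss (h \<mu>0) \<sigma> y * T y)"
      if G: "weak_jacobian (h \<circ> muhat) G"
    proof -
      have "AE y in lborel. G y = D y"
        using weak_jacobian_eq_derivative[OF K G[unfolded g] AED] unfolding AE_completion_iff .
      with T(2) have "AE y in lborel. trace (G y) = T y" by eventually_elim simp
      from gaussian_expectation[OF Y T(1) T(3) this]
      show "integrable (completion P) (\<lambda>\<omega>. trace (G (Y \<omega>)))"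
        "(LINT \<omega>|completion P. trace (G (Y \<omega>))) = (LINT y|lborel. gauss (h \<mu>0) \<sigma> y * T y)" .
    qed
    note unf = D_def \<Delta>_def g_def
    show "weak_jacobian (h \<circ> muhat) G \<Longrightarrow> integrable (completion P) (\<lambda>\<omega>. trace (G (Y \<omega>)))" by (rule div(1))
    show "integrable (completion P) (\<lambda>\<omega>. trace (jacobian h (muhat (Y \<omega>)) ** Delta X F0 J Mf (muhat (Y \<omega>)) (bstar (Y \<omega>)) (Y \<omega>)))"
      using df(1) unfolding unf .
    show "weak_jacobian (h \<circ> muhat) G \<Longrightarrow>
      (LINT \<omega>|completion P. trace (jacobian h (muhat (Y \<omega>)) ** Delta X F0 J Mf (muhat (Y \<omega>)) (bstar (Y \<omega>)) (Y \<omega>)))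
       = (LINT \<omega>|completion P. trace (G (Y \<omega>)))"
      using df(2)[unfolded unf] div(2) by (simp only:)
    show "integrable (completion P) (\<lambda>\<omega>. (norm (h (muhat (Y \<omega>)) - h \<mu>0))\<^sup>2)"
      using risk(1) unfolding unf .
    show "integrable (completion P) (\<lambda>\<omega>. (norm (Y \<omega> - h (muhat (Y \<omega>))))\<^sup>2
       + 2 * \<sigma>\<^sup>2 * trace (jacobian h (muhat (Y \<omega>)) ** Delta X F0 J Mf (muhat (Y \<omega>)) (bstar (Y \<omega>)) (Y \<omega>))
       - real CARD('n) * \<sigma>\<^sup>2)"
      using sure(1) unfolding unf .
    show "(LINT \<omega>|completion P. (norm (Y \<omega> - h (muhat (Y \<omega>))))\<^sup>2
       + 2 * \<sigma>\<^sup>2 * trace (jacobian h (muhat (Y \<omega>)) ** Delta X F0 J Mf (muhat (Y \<omega>)) (bstar (Y \<omega>)) (Y \<omega>))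
       - real CARD('n) * \<sigma>\<^sup>2) = (LINT \<omega>|completion P. (norm (h (muhat (Y \<omega>)) - h \<mu>0))\<^sup>2)"
      using trans[OF trans[OF sure(2) T(6)] risk(2)[symmetric]] unfolding unf .
  qed
  show ?thesis
    unfolding Let_def unbiased_estimate_def
    by (intro conjI impI allI; (rule part1 part2a part2b main; assumption))
qed

end
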